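(* Let $\alpha\in[0,1]$ and $(u_0,\mu_0,\nu_0)\in\mathcal{D}_0$. For $t\in[0,\infty)$ and $\Delta x>0$ let $(u,\mu,\nu)(t)=T_t((u_0,\mu_0,\nu_0))$ and $(u_{\Delta x},\mu_{\Delta x},\nu_{\Delta x})(t)=T_t\circ P_{\Delta x}((u_0,\mu_0,\nu_0))$, with primitives $F(t,x)=\mu(t)((-\infty,x))$, $G(t,x)=\nu(t)((-\infty,x))$, $F_{\Delta x}(t,x)=\mu_{\Delta x}(t)((-\infty,x))$, $G_{\Delta x}(t,x)=\nu_{\Delta x}(t)((-\infty,x))$, and let $X(t)=(y,U,V,H)(t)=S_t\circ L((u_0,\mu_0,\nu_0))$ and $X_{\Delta x}(t)=(y_{\Delta x},U_{\Delta x},V_{\Delta x},H_{\Delta x})(t)=S_t\circ L\circ P_{\Delta x}((u_0,\mu_0,\nu_0))$. Then, for every $t\in[0,\infty)$, as $\Delta x\to 0$, \begin{align*} u_{\Delta x}(t)&\to u(t)\ \text{ in } L^\infty(\mathbb{R}),\\ u_{\Delta x,x}(t)&\rightharpoonup u_x(t)\ \text{ weakly in } L^2(\mathbb{R}),\\ G_{\Delta x}(t)&\to G(t)\ \text{ in } L^1(\mathbb{R}),\\ \nu_{\Delta x}(t)&\Longrightarrow \nu(t),\\ (y_{\Delta x}(t))_{\#}\big(g(X_{\Delta x}(t))\,d\xi\big)&\Longrightarrow (y(t))_{\#}\big(g(X(t))\,d\xi\big). \end{align*} Furthermore, there exist a sequence $\{\Delta x_m\}_{m\in\mathbb{N}}$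 of positive numbers with $\Delta x_m\to0$ as $m\to\infty$ and a Lebesgue null set $N\subset[0,\infty)$ such that for all $t\in N^c=[0,\infty)\setminus N$, as $m\to\infty$, \begin{align*} F_{\Delta x_m}(t,x)&\to F(t,x)\ \text{ for every } x \text{ at which } F(t,\cdot) \text{ is continuous},\\ F_{\Delta x_m,\infty}(t)&\to F_\infty(t), \end{align*} where $F_\infty(t)=\lim_{x\to\infty}F(t,x)$ and $F_{\Delta x,\infty}(t)=\lim_{x\to\infty}F_{\Delta x}(t,x)$.
   Context: Fix $\alpha\in[0,1]$. "$f_{\Delta x}\to f$ in $L^p$" means $\|f_{\Delta x}-f\|_{p}\to0$ (the individual functions need not lie in $L^p$). For finite positive measures, $\eta_{\Delta x}\Longrightarrow\eta$ means $\int\phi\,d\eta_{\Delta x}\to\int\phi\,d\eta$ for all bounded continuous $\phi:\mathbb{R}\to\mathbb{R}$. $f_{\#}\lambda$ denotes the pushforward, $(f_{\#}\lambda)(A)=\lambda(f^{-1}(A))$. Subscripts $x,\xi,t$ denote (weak) derivatives. Spaces. Let $\chi^+,\chi^-\in C^\infty(\mathbb{R})$ with $\chi^++\chi^-=1$, $0\le\chi^\pm\le1$, $\mathrm{supp}\,\chi^+\subset(-1,\infty)$, $\mathrm{supp}\,\chi^-\subset(-\infty,1)$. Put $E_1=\{\bar f+a\chi^+:\bar f\in H^1(\mathbb{R}),a\in\mathbb{R}\}$, $E_2=\{\bar f+a\chi^++b\chi^-:\bar f\in H^1(\mathbb{R}),a,b\in\mathbb{R}\}$, $E_1^0=\{\bar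 f+a\chi^+:\bar f\in L^2(\mathbb{R}),a\in\mathbb{R}\}$. $\mathcal{M}^+(\mathbb{R})$ is the set of positive finite Radon measures on $\mathbb{R}$; subscripts ac and sing denote absolutely continuous and singular parts with respect to Lebesgue measure. Eulerian set. $\mathcal{D}$ is the set of triplets $(u,\mu,\nu)$ with $u\in E_2$; $\mu\le\nu\in\mathcal{M}^+(\mathbb{R})$; $\mu_{\mathrm{ac}}\le\nu_{\mathrm{ac}}$; $d\mu_{\mathrm{ac}}=u_x^2dx$; $\mu((-\infty,\cdot)),\nu((-\infty,\cdot))\in E_1^0$; if $\alpha=1$, then $d\nu_{\mathrm{ac}}=d\mu=u_x^2dx$; if $\alpha\in[0,1)$, then $\frac{d\mu}{d\nu}(x)\in\{1-\alpha,1\}$ and $\frac{d\mu_{\mathrm{ac}}}{d\nu_{\mathrm{ac}}}(x)=1$ if $u_x(x)<0$. $\mathcal{D}_0=\{(u,\mu,\nu)\in\mathcal{D}:\mu=\nu\}$. Write $F(x)=\mu((-\infty,x))$, $G(x)=\nu((-\infty,x))$, $F_{\mathrm{ac}}(x)=\mu_{\mathrm{ac}}((-\infty,x))$, $F_{\mathrm{sing}}(x)=\mu_{\mathrm{sing}}((-\infty,x))$; $(u,F,G)$ and $(u,\mu,\nu)$ are identified. Projection. For $\Delta x>0$ let $x_j=j\Delta x$, $j\in\mathbb{Z}$. For $(u,F,G)\in\mathcal{D}_0$ let $Du_{2j}=\frac{u(x_{2j+2})-u(x_{2j})}{2\Delta x}$, $DF_{\mathrm{ac},2j}=\frac{F_{\mathrm{ac}}(x_{2j+2})-F_{\mathrm{ac}}(x_{2j})}{2\Delta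 x}$, $q_{2j}=\sqrt{DF_{\mathrm{ac},2j}-(Du_{2j})^2}$ (the radicand is nonnegative). $P_{\Delta x}:\mathcal{D}_0\to\mathcal{D}_0$, $P_{\Delta x}((u,F,G))=(u_{\Delta x},F_{\Delta x},G_{\Delta x})$ is given by $u_{\Delta x}(x)=u(x_{2j})+(Du_{2j}\mp q_{2j})(x-x_{2j})$ for $x_{2j}<x\le x_{2j+1}$, $u_{\Delta x}(x)=u(x_{2j+2})+(Du_{2j}\pm q_{2j})(x-x_{2j+2})$ for $x_{2j+1}<x\le x_{2j+2}$; $G_{\Delta x}=F_{\Delta x}=F_{\Delta x,\mathrm{ac}}+F_{\Delta x,\mathrm{sing}}$, where $F_{\Delta x,\mathrm{ac}}(x)=F_{\mathrm{ac}}(x_{2j})+(Du_{2j}\mp q_{2j})^2(x-x_{2j})$ for $x_{2j}<x\le x_{2j+1}$, $F_{\Delta x,\mathrm{ac}}(x)=\frac{F_{\mathrm{ac}}(x_{2j+2})+F_{\mathrm{ac}}(x_{2j})}{2}\mp2q_{2j}Du_{2j}\Delta x+(Du_{2j}\pm q_{2j})^2(x-x_{2j+1})$ for $x_{2j+1}<x\le x_{2j+2}$, and $F_{\Delta x,\mathrm{sing}}(x)=F_{\mathrm{sing}}(x_{2j+2})$ for $x_{2j}<x\le x_{2j+2}$. For each $j$ (and $\Delta x$) either all upper or all lower signs are used; the choice is arbitrary but fixed. Lagrangian set. $\mathcal{F}$ is the set of $X=(y,U,V,H)$ with $(y-\mathrm{id},U,V,H)\in E_2\times E_2\times E_1\times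 E_1$ and $(y-\mathrm{id},U,V,H)\in[W^{1,\infty}(\mathbb{R})]^4$; $y_\xi,H_\xi\ge0$ and $y_\xi+H_\xi\ge c$ a.e. for some $c>0$; $y_\xi V_\xi=U_\xi^2$ a.e.; $0\le V_\xi\le H_\xi$ a.e.; if $\alpha=1$, then a.e. $y_\xi(\xi)=0$ implies $V_\xi(\xi)=0$ and $y_\xi(\xi)>0$ implies $V_\xi(\xi)=H_\xi(\xi)$; if $\alpha\in[0,1)$, there is $\kappa:\mathbb{R}\to\{1-\alpha,1\}$ with $V_\xi=\kappa H_\xi$ a.e. and $\kappa(\xi)=1$ whenever $U_\xi(\xi)<0$. Maps. $L:\mathcal{D}\to\mathcal{F}$, $L((u,\mu,\nu))=(y,U,V,H)$ with $y(\xi)=\sup\{x\in\mathbb{R}:x+\nu((-\infty,x))<\xi\}$, $U(\xi)=u(y(\xi))$, $H(\xi)=\xi-y(\xi)$, $V(\xi)=\int_{-\infty}^\xi\frac{d\mu}{d\nu}(y(\eta))H_\xi(\eta)\,d\eta$. $M:\mathcal{F}\to\mathcal{D}$, $M((y,U,V,H))=(u,\mu,\nu)$ with $u(x)=U(\xi)$ for any $\xi$ with $x=y(\xi)$, $\mu=y_{\#}(V_\xi d\xi)$, $\nu=y_{\#}(H_\xi d\xi)$. Evolution. For $X_0=(y_0,U_0,V_0,H_0)\in\mathcal{F}$ let $\tau(\xi)=-\frac{2y_{0,\xi}(\xi)}{U_{0,\xi}(\xi)}$ if $U_{0,\xi}(\xi)<0$, $\tau(\xi)=0$ if $y_{0,\xi}(\xi)=U_{0,\xi}(\xi)=0$,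 and $\tau(\xi)=\infty$ otherwise. $S_t(X_0)=X(t)=(y,U,V,H)(t)$ is the unique solution with $X(0)=X_0$ of $y_t=U$, $U_t=\frac12V-\frac14V_\infty(t)$, $V(t,\xi)=\int_{-\infty}^\xi V_{0,\xi}(\eta)\big(1-\alpha\chi_{\{t\ge\tau(\eta)>0\}}(\eta)\big)d\eta$, $H_t=0$, where $V_\infty(t)=\lim_{\xi\to\infty}V(t,\xi)$. The $\alpha$-dissipative solution operator (for the Hunter–Saxton equation $u_t+uu_x=\frac14\int_{-\infty}^xu_x^2dz-\frac14\int_x^\infty u_x^2dz$) is $T_t=M\circ S_t\circ L$. Stability function. For $X\in\mathcal{F}$, $g(X)(\xi)=(1-\alpha)V_\xi(\xi)$ if $U_\xi(\xi)<0$ and $g(X)(\xi)=V_\xi(\xi)$ if $U_\xi(\xi)\ge0$. *)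

theory Defs
  imports "HOL-Probability.Probability"
begin

section \<open>Function spaces on the real line\<close>

definition smooth :: "(real \<Rightarrow> real) \<Rightarrow> bool" where
  "smooth f \<longleftrightarrow> (\<forall>n x. ((deriv ^^ n) f) differentiable (at x))"

definition test_function :: "(real \<Rightarrow> real) \<Rightarrow> bool" where
  "test_function \<phi> \<longleftrightarrow> smooth \<phi> \<and> compact (closure {x. \<phi> x \<noteq> 0})"

definition locally_integrable :: "(real \<Rightarrow> real) \<Rightarrow> bool" where
  "locally_integrable f \<longleftrightarrow> (\<forall>a b. set_integrable lborel {a..b} f)"

definition has_weak_deriv :: "(real \<Rightarrow> real) \<Rightarrow> (real \<Rightarrow> real) \<Rightarrow> bool" where
  "has_weak_deriv f g \<longleftrightarrow>
     locally_integrable f \<and> locally_integrable g \<and>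
     (\<forall>\<phi>. test_function \<phi> \<longrightarrow>
        (\<integral>x. f x * deriv \<phi> x \<partial>lborel) = - (\<integral>x. g x * \<phi> x \<partial>lborel))"

definition weakly_differentiable :: "(real \<Rightarrow> real) \<Rightarrow> bool" where
  "weakly_differentiable f \<longleftrightarrow> (\<exists>g. has_weak_deriv f g)"

text \<open>A weak derivative is unique up to Lebesgue null sets only; \<open>wderiv\<close> picks one
  representative. Every use below is insensitive to changes on null sets.\<close>

definition wderiv :: "(real \<Rightarrow> real) \<Rightarrow> real \<Rightarrow> real" where
  "wderiv f = (SOME g. has_weak_deriv f g)"

definition L2_space :: "(real \<Rightarrow> real) set" where
  "L2_space = {f. f \<in> borel_measurable lborel \<and> integrable lborel (\<lambda>x. (f x)\<^sup>2)}"

text \<open>Elements of \<open>H\<^sup>1\<close> are identified with their continuous representatives, since they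
  are evaluated pointwise.\<close>

definition H1_space :: "(real \<Rightarrow> real) set" where
  "H1_space = {f. continuous_on UNIV f \<and> f \<in> L2_space \<and> (\<exists>g \<in> L2_space. has_weak_deriv f g)}"

definition cutoff_pair :: "(real \<Rightarrow> real) \<Rightarrow> (real \<Rightarrow> real) \<Rightarrow> bool" where
  "cutoff_pair \<chi>p \<chi>m \<longleftrightarrow>
     smooth \<chi>p \<and> smooth \<chi>m \<and>
     (\<forall>x. \<chi>p x + \<chi>m x = 1 \<and> 0 \<le> \<chi>p x \<and> \<chi>p x \<le> 1 \<and> 0 \<le> \<chi>m x \<and> \<chi>m x \<le> 1) \<and>
     closure {x. \<chi>p x \<noteq> 0} \<subseteq> {-1<..} \<and> closure {x. \<chi>m x \<noteq> 0} \<subseteq> {..<1}"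

definition E2_space :: "(real \<Rightarrow> real) \<Rightarrow> (real \<Rightarrow> real) \<Rightarrow> (real \<Rightarrow> real) set" where
  "E2_space \<chi>p \<chi>m = {f. \<exists>h \<in> H1_space. \<exists>a b. f = (\<lambda>x. h x + a * \<chi>p x + b * \<chi>m x)}"

definition E10_space :: "(real \<Rightarrow> real) \<Rightarrow> (real \<Rightarrow> real) set" where
  "E10_space \<chi>p = {f. \<exists>h \<in> L2_space. \<exists>a. f = (\<lambda>x. h x + a * \<chi>p x)}"


section \<open>Measures on the real line\<close>

text \<open>The class of finite positive Radon measures on the line is \<open>finite_borel_measure\<close>;
  \<open>\<le>\<close> on measures with equal sigma-algebras is the setwise order.\<close>

definition lprim :: "real measure \<Rightarrow> real \<Rightarrow> real" where
  "lprim \<mu> x = measure \<mu> {..<x}"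

definition measure_of_lprim :: "(real \<Rightarrow> real) \<Rightarrow> real measure" where
  "measure_of_lprim F = (THE \<mu>. finite_borel_measure \<mu> \<and> lprim \<mu> = F)"

definition lebesgue_decomposition :: "real measure \<Rightarrow> real measure \<Rightarrow> real measure \<Rightarrow> bool" where
  "lebesgue_decomposition \<mu> a s \<longleftrightarrow>
     finite_borel_measure a \<and> finite_borel_measure s \<and>
     absolutely_continuous lborel a \<and>
     (\<exists>N \<in> null_sets lborel. emeasure s (- N) = 0) \<and>
     (\<forall>A \<in> sets borel. emeasure \<mu> A = emeasure a A + emeasure s A)"

definition ac_part :: "real measure \<Rightarrow> real measure" where
  "ac_part \<mu> = (THE a. \<exists>s. lebesgue_decomposition \<mu> a s)"

definition sing_part :: "real measure \<Rightarrow> real measure" where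
  "sing_part \<mu> = (THE s. \<exists>a. lebesgue_decomposition \<mu> a s)"

text \<open>The pushforward \<open>y\<^sub>#(w d\<xi>)\<close>.\<close>

definition push_density :: "(real \<Rightarrow> real) \<Rightarrow> (real \<Rightarrow> real) \<Rightarrow> real measure" where
  "push_density y w = distr (density lborel (\<lambda>\<xi>. ennreal (w \<xi>))) borel y"


section \<open>Eulerian set and projection\<close>

type_synonym eulerian = "(real \<Rightarrow> real) \<times> real measure \<times> real measure"

text \<open>\<open>RN_deriv \<nu> \<mu>\<close> is \<open>d\<mu>/d\<nu>\<close>; it is determined only \<open>\<nu>\<close>-almost everywhere, so
  pointwise conditions on it are required \<open>\<nu>\<close>-almost everywhere.\<close>

definition eulerian_set ::
    "real \<Rightarrow> (real \<Rightarrow> real) \<Rightarrow> (real \<Rightarrow> real) \<Rightarrow> eulerian set" where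
  "eulerian_set \<alpha> \<chi>p \<chi>m = {(u, \<mu>, \<nu>).
     u \<in> E2_space \<chi>p \<chi>m \<and>
     finite_borel_measure \<mu> \<and> finite_borel_measure \<nu> \<and> \<mu> \<le> \<nu> \<and>
     ac_part \<mu> \<le> ac_part \<nu> \<and>
     ac_part \<mu> = density lborel (\<lambda>x. ennreal ((wderiv u x)\<^sup>2)) \<and>
     lprim \<mu> \<in> E10_space \<chi>p \<and> lprim \<nu> \<in> E10_space \<chi>p \<and>
     (\<alpha> = 1 \<longrightarrow>
        ac_part \<nu> = \<mu> \<and> \<mu> = density lborel (\<lambda>x. ennreal ((wderiv u x)\<^sup>2))) \<and>
     (0 \<le> \<alpha> \<and> \<alpha> < 1 \<longrightarrow>
        (AE x in \<nu>. RN_deriv \<nu> \<mu> x \<in> {ennreal (1 - \<alpha>), 1}) \<and>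
        (AE x in ac_part \<nu>. wderiv u x < 0 \<longrightarrow> RN_deriv (ac_part \<nu>) (ac_part \<mu>) x = 1))}"

definition eulerian_set0 ::
    "real \<Rightarrow> (real \<Rightarrow> real) \<Rightarrow> (real \<Rightarrow> real) \<Rightarrow> eulerian set" where
  "eulerian_set0 \<alpha> \<chi>p \<chi>m = {(u, \<mu>, \<nu>). (u, \<mu>, \<nu>) \<in> eulerian_set \<alpha> \<chi>p \<chi>m \<and> \<mu> = \<nu>}"

definition cell_slope :: "real \<Rightarrow> (real \<Rightarrow> real) \<Rightarrow> int \<Rightarrow> real" where
  "cell_slope d f j = (f (of_int (2*j+2) * d) - f (of_int (2*j) * d)) / (2 * d)"

definition cell_q :: "real \<Rightarrow> (real \<Rightarrow> real) \<Rightarrow> (real \<Rightarrow> real) \<Rightarrow> int \<Rightarrow> real" where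
  "cell_q d u Fac j = sqrt (cell_slope d Fac j - (cell_slope d u j)\<^sup>2)"

text \<open>The \<open>j\<close> with \<open>x\<^bsub>2j\<^esub> < x \<le> x\<^bsub>2j+2\<^esub>\<close>, where \<open>x\<^bsub>i\<^esub> = i d\<close>.\<close>

definition cell_index :: "real \<Rightarrow> real \<Rightarrow> int" where
  "cell_index d x = \<lceil>x / (2 * d)\<rceil> - 1"

text \<open>\<open>up j\<close> selects the upper signs on the \<open>j\<close>-th cell, that is, \<open>\<minusplus> = - cell_sign up j\<close>
  and \<open>\<plusminus> = + cell_sign up j\<close>.\<close>

definition cell_sign :: "(int \<Rightarrow> bool) \<Rightarrow> int \<Rightarrow> real" where
  "cell_sign up j = (if up j then 1 else -1)"

definition proj_u ::
    "(int \<Rightarrow> bool) \<Rightarrow> real \<Rightarrow> (real \<Rightarrow> real) \<Rightarrow> (real \<Rightarrow> real) \<Rightarrow> real \<Rightarrow> real" where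
  "proj_u up d u Fac x =
     (let j = cell_index d x; Du = cell_slope d u j; q = cell_q d u Fac j; s = cell_sign up j;
          x0 = of_int (2*j) * d; x1 = of_int (2*j+1) * d; x2 = of_int (2*j+2) * d
      in if x \<le> x1 then u x0 + (Du - s * q) * (x - x0)
         else u x2 + (Du + s * q) * (x - x2))"

definition proj_Fac ::
    "(int \<Rightarrow> bool) \<Rightarrow> real \<Rightarrow> (real \<Rightarrow> real) \<Rightarrow> (real \<Rightarrow> real) \<Rightarrow> real \<Rightarrow> real" where
  "proj_Fac up d u Fac x =
     (let j = cell_index d x; Du = cell_slope d u j; q = cell_q d u Fac j; s = cell_sign up j;
          x0 = of_int (2*j) * d; x1 = of_int (2*j+1) * d; x2 = of_int (2*j+2) * d
      in if x \<le> x1 then Fac x0 + (Du - s * q)\<^sup>2 * (x - x0)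
         else (Fac x2 + Fac x0) / 2 - s * 2 * q * Du * d + (Du + s * q)\<^sup>2 * (x - x1))"

definition proj_Fsing :: "real \<Rightarrow> (real \<Rightarrow> real) \<Rightarrow> real \<Rightarrow> real" where
  "proj_Fsing d Fsing x = Fsing (of_int (2 * cell_index d x + 2) * d)"

definition projection :: "(int \<Rightarrow> bool) \<Rightarrow> real \<Rightarrow> eulerian \<Rightarrow> eulerian" where
  "projection up d = (\<lambda>(u, \<mu>, \<nu>).
     let Fac = lprim (ac_part \<mu>); Fsing = lprim (sing_part \<mu>);
         \<mu>d = measure_of_lprim (\<lambda>x. proj_Fac up d u Fac x + proj_Fsing d Fsing x)
     in (proj_u up d u Fac, \<mu>d, \<mu>d))"


section \<open>Lagrangian coordinates and the solution operator\<close>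

text \<open>A Lagrangian state is a quadruple \<open>(y, U, V, H)\<close>.\<close>

type_synonym lagrangian =
  "(real \<Rightarrow> real) \<times> (real \<Rightarrow> real) \<times> (real \<Rightarrow> real) \<times> (real \<Rightarrow> real)"

definition L_map :: "eulerian \<Rightarrow> lagrangian" where
  "L_map = (\<lambda>(u, \<mu>, \<nu>).
     let y = (\<lambda>\<xi>. Sup {x. x + measure \<nu> {..<x} < \<xi>});
         H = (\<lambda>\<xi>. \<xi> - y \<xi>)
     in (y, \<lambda>\<xi>. u (y \<xi>),
         \<lambda>\<xi>. (LINT \<eta>:{..\<xi>}|lborel. enn2real (RN_deriv \<nu> \<mu> (y \<eta>)) * wderiv H \<eta>),
         H))"

definition M_map :: "lagrangian \<Rightarrow> eulerian" where
  "M_map = (\<lambda>(y, U, V, H).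
     (\<lambda>x. U (SOME \<xi>. y \<xi> = x), push_density y (wderiv V), push_density y (wderiv H)))"

definition breaking_time :: "lagrangian \<Rightarrow> real \<Rightarrow> ereal" where
  "breaking_time = (\<lambda>(y, U, V, H) \<xi>.
     if wderiv U \<xi> < 0 then ereal (- (2 * wderiv y \<xi> / wderiv U \<xi>))
     else if wderiv y \<xi> = 0 \<and> wderiv U \<xi> = 0 then 0
     else \<infinity>)"

text \<open>\<open>V\<close> may jump in time, so the equation for \<open>U\<close> is understood in integrated form; \<open>U\<close> is
  then continuous in time and \<open>y\<^sub>t = U\<close> holds classically (one-sided at \<open>t = 0\<close>).\<close>

definition lagr_solution ::
    "real \<Rightarrow> lagrangian \<Rightarrow> (real \<Rightarrow> real \<Rightarrow> real) \<Rightarrow> (real \<Rightarrow> real \<Rightarrow> real) \<Rightarrow>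
      (real \<Rightarrow> real \<Rightarrow> real) \<Rightarrow> (real \<Rightarrow> real \<Rightarrow> real) \<Rightarrow> bool" where
  "lagr_solution \<alpha> X0 y U V H \<longleftrightarrow>
     (y 0, U 0, V 0, H 0) = X0 \<and>
     (\<forall>t \<ge> 0. \<forall>\<xi>.
        ((\<lambda>s. y s \<xi>) has_real_derivative U t \<xi>) (at t within {0..}) \<and>
        ((\<lambda>s. 1/2 * V s \<xi> - 1/4 * Lim at_top (V s)) has_integral (U t \<xi> - U 0 \<xi>)) {0..t} \<and>
        V t \<xi> = (LINT \<eta>:{..\<xi>}|lborel.
          wderiv (V 0) \<eta> *
          (1 - \<alpha> * of_bool (breaking_time X0 \<eta> \<le> ereal t \<and> 0 < breaking_time X0 \<eta>))) \<and>
        H t \<xi> = H 0 \<xi>)"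

definition S_flow :: "real \<Rightarrow> real \<Rightarrow> lagrangian \<Rightarrow> lagrangian" where
  "S_flow \<alpha> t X0 =
     (THE X. \<exists>y U V H. lagr_solution \<alpha> X0 y U V H \<and> X = (y t, U t, V t, H t))"

definition T_flow :: "real \<Rightarrow> real \<Rightarrow> eulerian \<Rightarrow> eulerian" where
  "T_flow \<alpha> t = M_map \<circ> S_flow \<alpha> t \<circ> L_map"

definition stab_fun :: "real \<Rightarrow> lagrangian \<Rightarrow> real \<Rightarrow> real" where
  "stab_fun \<alpha> = (\<lambda>(y, U, V, H) \<xi>.
     if wderiv U \<xi> < 0 then (1 - \<alpha>) * wderiv V \<xi> else wderiv V \<xi>)"


section \<open>Modes of convergence\<close>

definition conv_Linf :: "('i \<Rightarrow> real \<Rightarrow> real) \<Rightarrow> (real \<Rightarrow> real) \<Rightarrow> 'i filter \<Rightarrow> bool" where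
  "conv_Linf f f0 \<F> \<longleftrightarrow> ((\<lambda>i. esssup lborel (\<lambda>x. ennreal \<bar>f i x - f0 x\<bar>)) \<longlongrightarrow> 0) \<F>"

definition conv_L1 :: "('i \<Rightarrow> real \<Rightarrow> real) \<Rightarrow> (real \<Rightarrow> real) \<Rightarrow> 'i filter \<Rightarrow> bool" where
  "conv_L1 f f0 \<F> \<longleftrightarrow> ((\<lambda>i. \<integral>\<^sup>+ x. ennreal \<bar>f i x - f0 x\<bar> \<partial>lborel) \<longlongrightarrow> 0) \<F>"

definition weak_conv_L2 :: "('i \<Rightarrow> real \<Rightarrow> real) \<Rightarrow> (real \<Rightarrow> real) \<Rightarrow> 'i filter \<Rightarrow> bool" where
  "weak_conv_L2 f f0 \<F> \<longleftrightarrow>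
     (\<forall>\<^sub>F i in \<F>. f i \<in> L2_space) \<and> f0 \<in> L2_space \<and>
     (\<forall>\<phi> \<in> L2_space.
        ((\<lambda>i. \<integral>x. f i x * \<phi> x \<partial>lborel) \<longlongrightarrow> (\<integral>x. f0 x * \<phi> x \<partial>lborel)) \<F>)"

definition weak_conv_measure :: "('i \<Rightarrow> real measure) \<Rightarrow> real measure \<Rightarrow> 'i filter \<Rightarrow> bool" where
  "weak_conv_measure \<eta> \<eta>0 \<F> \<longleftrightarrow>
     (\<forall>\<^sub>F i in \<F>. finite_borel_measure (\<eta> i)) \<and> finite_borel_measure \<eta>0 \<and>
     (\<forall>\<phi>::real \<Rightarrow> real. continuous_on UNIV \<phi> \<and> bounded (range \<phi>) \<longrightarrow>
        ((\<lambda>i. \<integral>x. \<phi> x \<partial>(\<eta> i)) \<longlongrightarrow> (\<integral>x. \<phi> x \<partial>\<eta>0)) \<F>)"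

end

theory Submission
  imports Defs
begin

text \<open>
  In Lagrangian coordinates the initial derivatives satisfy \<open>y\<^sub>\<xi> + H\<^sub>\<xi> = 1\<close> and \<open>U\<^sub>\<xi>\<^sup>2 = y\<^sub>\<xi> H\<^sub>\<xi>\<close>, so
  \<open>U\<^sub>\<xi>\<^sup>2 + H\<^sub>\<xi>\<^sup>2 = H\<^sub>\<xi>\<close> integrates to the total energy. The projection preserves \<open>u\<close> and the cumulative
  energy at the nodes, hence \<open>y\<close> and \<open>U\<close> converge uniformly while the \<open>L\<^sup>2\<close> norm of \<open>(U\<^sub>\<xi>, H\<^sub>\<xi>)\<close> stays
  fixed, and weak convergence of the derivatives upgrades to strong convergence. It also preserves the
  singular mass \<open>|{y\<^sub>\<xi> = 0}|\<close>, which excludes spurious wave breaking created by oscillating slopes on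
  the singular part. Breaking times therefore converge wherever they carry energy. The flow is explicit:
  its Lagrangian variables are integrals of the initial energy against functions of the breaking time
  that are continuous for \<open>y\<close> and \<open>U\<close>, so these converge at all times; for \<open>V\<close> the function jumps, and
  the countably many times at which a positive amount of energy breaks must be excluded. Finally
  \<open>y(t)\<close> transports \<open>y\<^sub>\<xi> d\<xi>\<close> to Lebesgue measure, so that \<open>u\<^sub>x = U\<^sub>\<xi> / y\<^sub>\<xi>\<close> along the generalised inverse
  of \<open>y(t)\<close>.
\<close>

section \<open>Primitives of locally integrable functions\<close>

text \<open>By \<open>distr_y\<close>, the map \<open>y\<close> carries Lebesgue measure to
  \<open>lborel\<close> plus \<mu>. Hence \<open>y\<^sub>\<xi>\<close> and
  \<open>H\<^sub>\<xi>\<close> are the densities \<open>p\<close> and \<open>h\<close> of the two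
  summands with respect to their sum, evaluated at \<open>y \<xi>\<close>. Fixing these densities as
  functions makes \<open>p + h = 1\<close> and \<open>q\<^sup>2 = p * h\<close> hold at every point,
  so the motion of one particle is the algebra of a quadratic in time with a double root. Weak
  derivatives are replaced by the relation \<open>primitive\<close> (increments and a density);
  \<open>wderiv\<close> is confined to the interface with the given definitions. The obstacle is
  that derivatives converge only in \<open>L\<^sup>2\<close>, whereas breaking times depend on them
  discontinuously. They are treated pointwise along subsequences, and full limits are recovered from
  subsubsequences. Two devices recur. Bounded energy makes \<open>u\<close> Hoelder continuous with
  exponent 1/2, which absorbs evaluation at different points. The \<open>L\<^sup>1\<close> distance
  of two monotone functions equals that of their inverses, by Fubini; this gives the estimates for
  \<open>y\<close> and for \<open>G\<close>.\<close>

lemma measure_eqI_Ioc: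
  fixes M N :: "real measure"
  assumes "sets M = sets borel" "sets N = sets borel"
    and eq: "\<And>a b. a \<le> b \<Longrightarrow> emeasure M {a<..b} = emeasure N {a<..b}"
    and fin: "\<And>a b. a \<le> b \<Longrightarrow> emeasure M {a<..b} < \<infinity>"
  shows "M = N"
proof (rule measure_eqI_generator_eq[where E = "range (\<lambda>(a, b). {a<..b})" and \<Omega> = UNIV
      and A = "\<lambda>n::nat. {- real n<..real n}"])
  show "Int_stable (range (\<lambda>(a::real, b). {a<..b}))"
    by (auto simp: Int_stable_def)
  show "sets M = sigma_sets UNIV (range (\<lambda>(a, b). {a<..b}))"
    "sets N = sigma_sets UNIV (range (\<lambda>(a, b). {a<..b}))"
    unfolding assms(1,2) borel_sigma_sets_Ioc by (simp_all add: sets_measure_of)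
  show "emeasure M X = emeasure N X" if "X \<in> range (\<lambda>(a, b). {a<..b})" for X
  proof -
    obtain a b where X: "X = {a<..b}" using \<open>X \<in> _\<close> by auto
    show ?thesis by (cases "a \<le> b") (simp_all add: eq X)
  qed
  show "(\<Union>i. {- real i<..real i}) = UNIV"
  proof -
    have "\<exists>n. - real n < x \<and> x \<le> real n" for x
      using reals_Archimedean2[of "\<bar>x\<bar>"] by (meson abs_less_iff minus_less_iff order_less_imp_le)
    then show ?thesis by auto
  qed
  show "emeasure M {- real i<..real i} \<noteq> \<infinity>" for i
    using fin[of "- real i" "real i"] by auto
  show "range (\<lambda>n. {- real n<..real n}) \<subseteq> range (\<lambda>(a, b). {a<..b})"
  proof
    fix S assume "S \<in> range (\<lambda>n. {- real n<..real n})"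
    then obtain n where "S = {- real n<..real n}" by blast
    then show "S \<in> range (\<lambda>(a, b). {a<..b})"
      by (intro range_eqI[where x = "(- real n, real n)"]) simp
  qed
  show "range (\<lambda>(a::real, b). {a<..b}) \<subseteq> Pow UNIV" by (simp only: Pow_UNIV subset_UNIV)
qed

text \<open>\<open>lprim\<close> measures open half lines \<open>{..<x}\<close>, whose differences
  have the form \<open>{a..<b}\<close>; the variant with \<open>{a<..b}\<close> serves interval
  integrals and \<open>distr_yinv\<close>.\<close>

lemma measure_eqI_Ico:
  fixes M N :: "real measure"
  assumes "sets M = sets borel" "sets N = sets borel"
    and eq: "\<And>a b. a \<le> b \<Longrightarrow> emeasure M {a..<b} = emeasure N {a..<b}"
    and fin: "\<And>a b. a \<le> b \<Longrightarrow> emeasure M {a..<b} < \<infinity>"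
  shows "M = N"
proof (rule measure_eqI_generator_eq[where E = "range (\<lambda>(a, b). {a..<b})" and \<Omega> = UNIV
      and A = "\<lambda>n::nat. {- real n..<real n}"])
  show "Int_stable (range (\<lambda>(a::real, b). {a..<b}))"
    by (auto simp: Int_stable_def)
  show "sets M = sigma_sets UNIV (range (\<lambda>(a, b). {a..<b}))"
    "sets N = sigma_sets UNIV (range (\<lambda>(a, b). {a..<b}))"
    unfolding assms(1,2) borel_eq_atLeastLessThan by (simp_all add: sets_measure_of)
  show "emeasure M X = emeasure N X" if "X \<in> range (\<lambda>(a, b). {a..<b})" for X
  proof -
    obtain a b where X: "X = {a..<b}" using \<open>X \<in> _\<close> by auto
    show ?thesis by (cases "a \<le> b") (simp_all add: eq X)
  qed
  show "(\<Union>i. {- real i..<real i}) = UNIV"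
  proof -
    have "\<exists>n. - real n \<le> x \<and> x < real n" for x
      using reals_Archimedean2[of "\<bar>x\<bar>"] by (meson abs_less_iff minus_less_iff order_less_imp_le)
    then show ?thesis by auto
  qed
  show "emeasure M {- real i..<real i} \<noteq> \<infinity>" for i
    using fin[of "- real i" "real i"] by auto
  show "range (\<lambda>n. {- real n..<real n}) \<subseteq> range (\<lambda>(a, b). {a..<b})"
  proof
    fix S assume "S \<in> range (\<lambda>n. {- real n..<real n})"
    then obtain n where "S = {- real n..<real n}" by blast
    then show "S \<in> range (\<lambda>(a, b). {a..<b})"
      by (intro range_eqI[where x = "(- real n, real n)"]) simp
  qed
  show "range (\<lambda>(a::real, b). {a..<b}) \<subseteq> Pow UNIV" by (simp only: Pow_UNIV subset_UNIV)
qed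

lemma locally_integrable_measurable:
  assumes "locally_integrable g"
  shows "g \<in> borel_measurable borel"
proof (rule borel_measurable_LIMSEQ_real)
  show "(\<lambda>x. indicator {- real n..real n} x *\<^sub>R g x) \<in> borel_measurable borel" for n
  proof -
    have "integrable lborel (\<lambda>x. indicator {- real n..real n} x *\<^sub>R g x)"
      using assms unfolding locally_integrable_def set_integrable_def by blast
    from borel_measurable_integrable[OF this] show ?thesis by simp
  qed
  show "(\<lambda>n. indicator {- real n..real n} x *\<^sub>R g x) \<longlonglongrightarrow> g x" for x
  proof (rule tendsto_eventually)
    obtain N :: nat where N: "\<bar>x\<bar> \<le> real N" using real_arch_simple by blast
    show "\<forall>\<^sub>F n in sequentially. indicator {- real n..real n} x *\<^sub>R g x = g x"
      using eventually_ge_at_top[of N]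
    proof eventually_elim
      case (elim n)
      then have "x \<in> {- real n..real n}" using N by (auto simp: abs_le_iff)
      then show ?case by simp
    qed
  qed
qed

lemma set_integrable_mono_real:
  fixes f g :: "real \<Rightarrow> real"
  assumes "set_integrable lborel A f" "g \<in> borel_measurable borel" "A \<in> sets borel"
    and "\<And>x. x \<in> A \<Longrightarrow> \<bar>g x\<bar> \<le> f x"
  shows "set_integrable lborel A g"
  unfolding set_integrable_def
proof (rule Bochner_Integration.integrable_bound)
  show "integrable lborel (\<lambda>x. indicator A x *\<^sub>R f x)"
    using assms(1) by (simp add: set_integrable_def)
  show "(\<lambda>x. indicat_real A x *\<^sub>R g x) \<in> borel_measurable lborel"
    using assms(2,3) by simp
  show "AE x in lborel. norm (indicat_real A x *\<^sub>R g x) \<le> norm (indicat_real A x *\<^sub>R f x)"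
    using assms(4) by (intro AE_I2) (auto simp: indicator_def intro: order_trans[OF _ abs_ge_self])
qed

lemma locally_integrable_mono:
  assumes "locally_integrable f" "g \<in> borel_measurable borel" "\<And>x. \<bar>g x\<bar> \<le> f x"
  shows "locally_integrable g"
  unfolding locally_integrable_def
proof (intro allI)
  show "set_integrable lborel {a..b} g" for a b
    by (rule set_integrable_mono_real[OF assms(1)[unfolded locally_integrable_def, rule_format] assms(2)])
       (simp_all add: assms(3))
qed

lemma integrable_imp_locally_integrable:
  assumes "integrable lborel f"
  shows "locally_integrable f"
  unfolding locally_integrable_def set_integrable_def
proof (intro allI)
  show "integrable lborel (\<lambda>x. indicat_real {a..b} x *\<^sub>R f x)" for a b
    using integrable_mult_indicator[of "{a..b}" lborel f] assms by simp
qed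

lemma locally_integrable_continuous:
  assumes "continuous_on UNIV f"
  shows "locally_integrable f"
  unfolding locally_integrable_def
  using borel_integrable_atLeastAtMost' continuous_on_subset[OF assms] by blast

lemma locally_integrable_const [simp]: "locally_integrable (\<lambda>x. c)"
  by (rule locally_integrable_continuous) (rule continuous_on_const)

lemma locally_integrable_add:
  "locally_integrable f \<Longrightarrow> locally_integrable g \<Longrightarrow> locally_integrable (\<lambda>x. f x + g x)"
  unfolding locally_integrable_def by (blast intro: set_integral_add(1))

lemma locally_integrable_diff:
  "locally_integrable f \<Longrightarrow> locally_integrable g \<Longrightarrow> locally_integrable (\<lambda>x. f x - g x)"
  unfolding locally_integrable_def by (blast intro: set_integral_diff(1))

lemma locally_integrable_cmult:
  "locally_integrable f \<Longrightarrow> locally_integrable (\<lambda>x. c * f x)"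
  unfolding locally_integrable_def by (blast intro: set_integrable_mult_right)

lemma locally_integrable_square:
  assumes "g \<in> borel_measurable borel" "integrable lborel (\<lambda>x. (g x)\<^sup>2)"
  shows "locally_integrable g"
proof (rule locally_integrable_mono)
  show "locally_integrable (\<lambda>x. 1 + (g x)\<^sup>2)"
    by (rule locally_integrable_add[OF locally_integrable_const integrable_imp_locally_integrable[OF assms(2)]])
  show "\<bar>g x\<bar> \<le> 1 + (g x)\<^sup>2" for x
    using sum_power2_ge_zero[of "\<bar>g x\<bar> - 1/2" 0] by (simp add: power2_eq_square algebra_simps)
qed fact

lemma set_integral_Ioc:
  fixes g :: "real \<Rightarrow> real"
  assumes "g \<in> borel_measurable borel"
  shows "(LBINT x:{a<..b}. g x) = (LBINT x:{a..b}. g x)"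
  unfolding set_lebesgue_integral_def
proof (rule integral_cong_AE)
  show "AE x in lborel. indicat_real {a<..b} x *\<^sub>R g x = indicat_real {a..b} x *\<^sub>R g x"
    using AE_lborel_singleton[of a] by eventually_elim (auto simp: indicator_def)
qed (use assms in auto)

lemma set_integral_Icc_split:
  fixes g :: "real \<Rightarrow> real"
  assumes g: "set_integrable lborel {a..c} g" "g \<in> borel_measurable borel" and "a \<le> b" "b \<le> c"
  shows "(LBINT x:{a..c}. g x) = (LBINT x:{a..b}. g x) + (LBINT x:{b..c}. g x)"
proof -
  have *: "{a..c} = {a..b} \<union> {b<..c}" using assms by auto
  have "(LBINT x:{a..c}. g x) = (LBINT x:{a..b}. g x) + (LBINT x:{b<..c}. g x)"
    unfolding *
    by (rule set_integral_Un) (use assms in \<open>auto intro: set_integrable_subset\<close>)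
  then show ?thesis using set_integral_Ioc[OF g(2)] by simp
qed

text \<open>The positive and the negative part of \<open>g\<close> are densities of two measures
  that agree on all half-open intervals, hence coincide; uniqueness of densities then equates the
  two parts. The sign \<open>c\<close> in the auxiliary facts treats both parts at once.\<close>

lemma AE_eq_0_if_interval_integrals_0:
  fixes g :: "real \<Rightarrow> real"
  assumes g: "locally_integrable g" and z: "\<And>a b. a \<le> b \<Longrightarrow> (LBINT x:{a..b}. g x) = 0"
  shows "AE x in lborel. g x = 0"
proof -
  have m[measurable]: "g \<in> borel_measurable borel" using g by (rule locally_integrable_measurable)
  define P where "P = density lborel (\<lambda>x. ennreal (max 0 (g x)))"
  define Q where "Q = density lborel (\<lambda>x. ennreal (max 0 (- g x)))"
  have i: "set_integrable lborel {a<..b} (\<lambda>x. max 0 (c * g x))" if "\<bar>c\<bar> = 1" for a b c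
  proof (rule set_integrable_mono_real)
    have "set_integrable lborel {a<..b} g"
      by (rule set_integrable_subset[OF g[unfolded locally_integrable_def, rule_format, of a b]]) auto
    then show "set_integrable lborel {a<..b} (\<lambda>x. \<bar>g x\<bar>)" by (rule set_integrable_abs)
    fix x
    have "\<bar>c * g x\<bar> = \<bar>g x\<bar>" using that by (simp add: abs_mult)
    then show "\<bar>max 0 (c * g x)\<bar> \<le> \<bar>g x\<bar>" by linarith
  qed simp_all
  have e: "emeasure (density lborel (\<lambda>x. ennreal (max 0 (c * g x)))) {a<..b}
      = ennreal (LBINT x:{a<..b}. max 0 (c * g x))" if "\<bar>c\<bar> = 1" for a b c
  proof -
    have "emeasure (density lborel (\<lambda>x. ennreal (max 0 (c * g x)))) {a<..b}
      = (\<integral>\<^sup>+x. ennreal (indicator {a<..b} x * max 0 (c * g x)) \<partial>lborel)"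
      by (subst emeasure_density) (auto intro!: nn_integral_cong simp: indicator_def)
    also have "\<dots> = ennreal (LBINT x:{a<..b}. max 0 (c * g x))"
      unfolding set_lebesgue_integral_def
      using i[OF that, of a b] by (subst nn_integral_eq_integral) (auto simp: set_integrable_def)
    finally show ?thesis .
  qed
  have "P = Q"
  proof (rule measure_eqI_Ioc)
    fix a b :: real assume ab: "a \<le> b"
    have "(LBINT x:{a<..b}. max 0 (1 * g x)) - (LBINT x:{a<..b}. max 0 (-1 * g x))
      = (LBINT x:{a<..b}. max 0 (1 * g x) - max 0 (-1 * g x))"
      by (rule set_integral_diff(2)[symmetric]) (rule i, simp)+
    also have "\<dots> = (LBINT x:{a<..b}. g x)"
      by (rule set_lebesgue_integral_cong) (auto simp: max_def)
    also have "\<dots> = 0" using z[OF ab] set_integral_Ioc[OF m] by simp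
    finally show "emeasure P {a<..b} = emeasure Q {a<..b}"
      unfolding P_def Q_def using e[of 1] e[of "-1"] by simp
    show "emeasure P {a<..b} < \<infinity>"
      unfolding P_def using e[of 1] by simp
  qed (auto simp: P_def Q_def)
  then have "AE x in lborel. ennreal (max 0 (g x)) = ennreal (max 0 (- g x))"
    unfolding P_def Q_def by (subst (asm) sigma_finite_measure.density_unique_iff[OF lborel.sigma_finite_measure_axioms]) auto
  then show ?thesis
    by (rule AE_mp) (auto simp: max_def split: if_splits intro!: AE_I2)
qed

text \<open>Local absolute continuity with a named density. It stands in for the weak derivative
  because it speaks about point values of \<open>f\<close>, forces \<open>f\<close> to be continuous
  and composes well with monotone changes of variables.\<close>

definition primitive :: "(real \<Rightarrow> real) \<Rightarrow> (real \<Rightarrow> real) \<Rightarrow> bool" where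
  "primitive f g \<longleftrightarrow> locally_integrable g \<and>
     (\<forall>a b. a \<le> b \<longrightarrow> f b - f a = (LBINT x:{a..b}. g x))"

lemma primitiveD:
  assumes "primitive f g"
  shows "locally_integrable g" "g \<in> borel_measurable borel"
    "a \<le> b \<Longrightarrow> f b - f a = (LBINT x:{a..b}. g x)" "set_integrable lborel {a..b} g"
  using assms locally_integrable_measurable unfolding primitive_def locally_integrable_def by auto

lemma primitive_unique:
  assumes "primitive f g" "primitive f g'"
  shows "AE x in lborel. g x = g' x"
proof -
  have "AE x in lborel. g x - g' x = 0"
  proof (rule AE_eq_0_if_interval_integrals_0)
    show "locally_integrable (\<lambda>x. g x - g' x)"
      using assms by (auto simp: primitive_def intro: locally_integrable_diff)
    show "(LBINT x:{a..b}. g x - g' x) = 0" if "a \<le> b" for a b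
      using primitiveD(3)[OF assms(1) that] primitiveD(3)[OF assms(2) that]
        primitiveD(4)[OF assms(1)] primitiveD(4)[OF assms(2)]
      by (subst set_integral_diff(2)) auto
  qed
  then show ?thesis by simp
qed

lemma primitive_add:
  assumes "primitive f g" "primitive f' g'"
  shows "primitive (\<lambda>x. f x + f' x) (\<lambda>x. g x + g' x)"
  unfolding primitive_def
proof (intro conjI allI impI)
  fix a b :: real assume ab: "a \<le> b"
  show "f b + f' b - (f a + f' a) = (LBINT x:{a..b}. g x + g' x)"
    using primitiveD(3)[OF assms(1) ab] primitiveD(3)[OF assms(2) ab]
    by (simp add: set_integral_add(2)[OF primitiveD(4)[OF assms(1)] primitiveD(4)[OF assms(2)]])
qed (rule locally_integrable_add[OF primitiveD(1)[OF assms(1)] primitiveD(1)[OF assms(2)]])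

lemma primitive_cmult:
  assumes "primitive f g"
  shows "primitive (\<lambda>x. c * f x) (\<lambda>x. c * g x)"
  using assms unfolding primitive_def
  by (auto intro: locally_integrable_cmult simp flip: right_diff_distrib)

lemma primitive_id: "primitive (\<lambda>x. x) (\<lambda>x. 1)"
  unfolding primitive_def by (auto simp: set_integral_const)

lemma primitive_integral_atMost:
  assumes "integrable lborel g"
  shows "primitive (\<lambda>x. c + (LBINT y:{..x}. g y)) g"
  unfolding primitive_def
proof (intro conjI allI impI)
  fix a b :: real assume ab: "a \<le> b"
  have i: "set_integrable lborel A g" if "A \<in> sets borel" for A
    unfolding set_integrable_def using integrable_mult_indicator[of A lborel g] assms that by simp
  have [measurable]: "g \<in> borel_measurable borel" using assms by auto
  have "{..b} = {..a} \<union> {a<..b}" using ab by auto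
  then have "(LBINT y:{..b}. g y) = (LBINT y:{..a}. g y) + (LBINT y:{a<..b}. g y)"
    by (simp only:) (rule set_integral_Un, auto intro!: i)
  then show "c + (LBINT y:{..b}. g y) - (c + (LBINT y:{..a}. g y)) = (LBINT x:{a..b}. g x)"
    using set_integral_Ioc[of g a b] by simp
qed (use assms in \<open>rule integrable_imp_locally_integrable\<close>)

section \<open>Weak derivatives\<close>

lemma smooth_iff: "smooth f \<longleftrightarrow> (\<forall>x. f differentiable at x) \<and> smooth (deriv f)"
proof -
  have "smooth f \<longleftrightarrow> (\<forall>x. ((deriv ^^ 0) f) differentiable at x) \<and> (\<forall>n x. ((deriv ^^ Suc n) f) differentiable at x)"
    unfolding smooth_def by (metis old.nat.exhaust)
  then show ?thesis
    unfolding smooth_def by (simp add: funpow_swap1)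
qed

lemma smooth_has_deriv: "smooth f \<Longrightarrow> (f has_real_derivative deriv f x) (at x)"
  using smooth_iff[of f] by (simp add: DERIV_deriv_iff_real_differentiable)

lemma smooth_deriv: "smooth f \<Longrightarrow> smooth (deriv f)"
  using smooth_iff[of f] by simp

lemma smooth_continuous: "smooth f \<Longrightarrow> continuous_on A f"
  by (meson DERIV_isCont continuous_at_imp_continuous_on smooth_has_deriv)

text \<open>\<open>smooth\<close> speaks about \<open>deriv ^^ n\<close>, so showing that rescaled
  cut-offs are smooth needs all derivatives in closed form. The induction peels off the innermost
  derivative, which turns \<open>f\<close> into \<open>deriv f\<close> and \<open>a\<close> into
  \<open>a * c\<close>; hence both are generalised.\<close>

lemma deriv_pow_affine:
  fixes f :: "real \<Rightarrow> real"
  assumes "smooth f"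
  shows "(deriv ^^ n) (\<lambda>x. a * f (c * x + d)) = (\<lambda>x. a * c ^ n * (deriv ^^ n) f (c * x + d))"
  using assms
proof (induction n arbitrary: f a)
  case (Suc n)
  have "deriv (\<lambda>x. a * f (c * x + d)) = (\<lambda>x. (a * c) * deriv f (c * x + d))"
  proof
    fix x
    have "((\<lambda>x. a * f (c * x + d)) has_real_derivative (a * c) * deriv f (c * x + d)) (at x)"
      by (rule derivative_eq_intros DERIV_chain2[OF smooth_has_deriv[OF Suc.prems]] refl | simp)+
    then show "deriv (\<lambda>x. a * f (c * x + d)) x = (a * c) * deriv f (c * x + d)"
      by (rule DERIV_imp_deriv)
  qed
  then have "(deriv ^^ Suc n) (\<lambda>x. a * f (c * x + d)) = (deriv ^^ n) (\<lambda>x. (a * c) * deriv f (c * x + d))"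
    by (simp only: funpow_Suc_right o_apply)
  also have "\<dots> = (\<lambda>x. a * c * c ^ n * (deriv ^^ n) (deriv f) (c * x + d))"
    by (rule Suc.IH[OF smooth_deriv[OF Suc.prems]])
  finally show ?case by (simp only: funpow_Suc_right o_apply power_Suc mult.assoc)
qed simp

lemma deriv_pow_add:
  fixes f g :: "real \<Rightarrow> real"
  assumes "smooth f" "smooth g"
  shows "(deriv ^^ n) (\<lambda>x. f x + g x) = (\<lambda>x. (deriv ^^ n) f x + (deriv ^^ n) g x)"
  using assms
proof (induction n arbitrary: f g)
  case (Suc n)
  have "deriv (\<lambda>x. f x + g x) = (\<lambda>x. deriv f x + deriv g x)"
    using Suc.prems by (intro ext DERIV_imp_deriv DERIV_add smooth_has_deriv)
  then have "(deriv ^^ Suc n) (\<lambda>x. f x + g x) = (deriv ^^ n) (\<lambda>x. deriv f x + deriv g x)"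
    by (simp only: funpow_Suc_right o_apply)
  also have "\<dots> = (\<lambda>x. (deriv ^^ n) (deriv f) x + (deriv ^^ n) (deriv g) x)"
    by (rule Suc.IH[OF smooth_deriv[OF Suc.prems(1)] smooth_deriv[OF Suc.prems(2)]])
  finally show ?case by (simp only: funpow_Suc_right o_apply)
qed simp

lemma smooth_affine:
  fixes f :: "real \<Rightarrow> real"
  assumes "smooth f"
  shows "smooth (\<lambda>x. a * f (c * x + d))"
  unfolding smooth_def
proof (intro allI)
  fix n x
  have "(deriv ^^ n) f differentiable at y" for y
    using assms by (simp add: smooth_def)
  then have D: "((deriv ^^ n) f has_real_derivative deriv ((deriv ^^ n) f) y) (at y)" for y
    by (simp add: DERIV_deriv_iff_real_differentiable)
  have "((\<lambda>x. a * c ^ n * (deriv ^^ n) f (c * x + d)) has_real_derivative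
      a * c ^ n * (deriv ((deriv ^^ n) f) (c * x + d) * c)) (at x)"
    by (rule derivative_eq_intros DERIV_chain2[OF D] refl | simp)+
  then show "(deriv ^^ n) (\<lambda>x. a * f (c * x + d)) differentiable at x"
    unfolding deriv_pow_affine[OF assms] by (meson real_differentiable_def)
qed

lemma smooth_add:
  fixes f g :: "real \<Rightarrow> real"
  assumes "smooth f" "smooth g"
  shows "smooth (\<lambda>x. f x + g x)"
  using assms unfolding smooth_def deriv_pow_add[OF assms] by (simp add: differentiable_add)

lemma integrable_continuous_support:
  fixes F :: "real \<Rightarrow> real"
  assumes "continuous_on UNIV F" "\<And>x. x \<notin> {l..u} \<Longrightarrow> F x = 0"
  shows "integrable lborel F"
proof -
  have "set_integrable lborel {l..u} F"
    by (rule borel_integrable_atLeastAtMost') (rule continuous_on_subset[OF assms(1)], simp)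
  moreover have "(\<lambda>x. indicat_real {l..u} x *\<^sub>R F x) = F"
    using assms(2) by (auto simp: indicator_def fun_eq_iff)
  ultimately show ?thesis by (simp add: set_integrable_def)
qed

lemma set_integral_deriv:
  assumes "smooth \<phi>" "a \<le> b"
  shows "(LBINT x:{a..b}. deriv \<phi> x) = \<phi> b - \<phi> a"
proof -
  have "(LBINT x. deriv \<phi> x * indicat_real {a..b} x) = \<phi> b - \<phi> a"
  proof (rule integral_FTC_Icc_real[OF assms(2)])
    show "(\<phi> has_real_derivative deriv \<phi> x) (at x)" for x by (rule smooth_has_deriv[OF assms(1)])
    show "isCont (deriv \<phi>) x" for x
      by (rule DERIV_isCont[OF smooth_has_deriv[OF smooth_deriv[OF assms(1)]]])
  qed
  then show ?thesis by (simp add: set_lebesgue_integral_def mult.commute)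
qed

lemma primitive_smooth:
  assumes "smooth f"
  shows "primitive f (deriv f)"
  unfolding primitive_def
  using locally_integrable_continuous[OF smooth_continuous[OF smooth_deriv[OF assms]]]
    set_integral_deriv[OF assms] by simp

lemma primitive_continuous:
  assumes "primitive f g"
  shows "continuous_on A f"
proof -
  have "isCont f x" for x
  proof -
    have "set_integrable lborel {x - 1..x + 1} g" by (rule primitiveD(4)[OF assms])
    then have "g integrable_on {x - 1..x + 1}" by (rule set_borel_integral_eq_integral)
    then have "continuous_on {x - 1..x + 1} (\<lambda>y. integral {x - 1..y} g)"
      by (rule indefinite_integral_continuous_1)
    then have "continuous_on {x - 1..x + 1} (\<lambda>y. f (x - 1) + integral {x - 1..y} g)"
      by (intro continuous_intros)
    then have "continuous_on {x - 1..x + 1} f"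
    proof (rule continuous_on_eq)
      fix y assume "y \<in> {x - 1..x + 1}"
      then show "f (x - 1) + integral {x - 1..y} g = f y"
        using primitiveD(3)[OF assms, of "x - 1" y]
          set_borel_integral_eq_integral(2)[OF primitiveD(4)[OF assms, of "x - 1" y]] by simp
    qed
    then show ?thesis
      by (rule continuous_on_interior) simp
  qed
  then show ?thesis by (simp add: continuous_at_imp_continuous_on)
qed

section \<open>Equivalence of weak derivatives and primitives\<close>

lemma test_function_support:
  assumes "test_function \<phi>"
  obtains R where "0 < R" "\<And>x. R \<le> \<bar>x\<bar> \<Longrightarrow> \<phi> x = 0" "\<And>x. R \<le> \<bar>x\<bar> \<Longrightarrow> deriv \<phi> x = 0"
proof -
  have "bounded {x. \<phi> x \<noteq> 0}" using assms by (simp add: test_function_def)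
  then obtain B where B: "\<And>x. \<phi> x \<noteq> 0 \<Longrightarrow> \<bar>x\<bar> \<le> B" unfolding bounded_iff by auto
  define R where "R = \<bar>B\<bar> + 1"
  have z: "\<phi> x = 0" if "\<bar>B\<bar> < \<bar>x\<bar>" for x using B[of x] that by fastforce
  have "deriv \<phi> x = 0" if "R \<le> \<bar>x\<bar>" for x
  proof (rule DERIV_imp_deriv)
    have "\<forall>\<^sub>F y in nhds x. y \<in> {y. \<bar>B\<bar> < \<bar>y\<bar>}"
      by (rule eventually_nhds_in_open) (use that in \<open>auto simp: R_def intro!: open_Collect_less continuous_intros\<close>)
    then have ev: "\<forall>\<^sub>F y in nhds x. \<phi> y = 0" by eventually_elim (simp add: z)
    show "(\<phi> has_real_derivative 0) (at x)"
      by (subst DERIV_cong_ev[OF refl ev refl]) simp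
  qed
  then show thesis by (intro that[of R]) (auto simp: R_def z)
qed

text \<open>Integration by parts by Fubini on a triangle: integrating
  \<open>g s * deriv \<phi> x\<close> first over \<open>s\<close> gives an increment of
  \<open>f\<close>, first over \<open>x\<close> it gives \<open>- g s * \<phi> s\<close>, because
  \<phi> vanishes at \<open>R\<close>. No pointwise derivative of \<open>f\<close> occurs.\<close>

lemma primitive_has_weak_deriv:
  assumes fg: "primitive f g"
  shows "has_weak_deriv f g"
  unfolding has_weak_deriv_def
proof (intro conjI allI impI)
  have cf: "continuous_on UNIV f" using primitive_continuous[OF fg] .
  show "locally_integrable f" by (rule locally_integrable_continuous[OF cf])
  show "locally_integrable g" by (rule primitiveD(1)[OF fg])
  have [measurable]: "g \<in> borel_measurable borel" by (rule primitiveD(2)[OF fg])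
  fix \<phi> assume t: "test_function \<phi>"
  have s: "smooth \<phi>" using t by (simp add: test_function_def)
  obtain R where R: "0 < R" "\<And>x. R \<le> \<bar>x\<bar> \<Longrightarrow> \<phi> x = 0" "\<And>x. R \<le> \<bar>x\<bar> \<Longrightarrow> deriv \<phi> x = 0"
    using test_function_support[OF t] by blast
  have cd: "continuous_on UNIV (deriv \<phi>)" by (rule smooth_continuous[OF smooth_deriv[OF s]])
  have [measurable]: "deriv \<phi> \<in> borel_measurable borel" by (rule borel_measurable_continuous_onI[OF cd])
  have "bounded (deriv \<phi> ` {-R..R})"
    by (intro compact_imp_bounded compact_continuous_image continuous_on_subset[OF cd]) auto
  then obtain C where "\<forall>x\<in>{-R..R}. \<bar>deriv \<phi> x\<bar> \<le> C" unfolding bounded_iff by auto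
  then have C: "\<And>x. x \<in> {-R..R} \<Longrightarrow> \<bar>deriv \<phi> x\<bar> \<le> C" by blast
  have C': "\<bar>deriv \<phi> x\<bar> \<le> \<bar>C\<bar>" for x
    by (cases "\<bar>x\<bar> \<le> R") (use C[of x] R(3)[of x] in \<open>auto simp: abs_le_iff\<close>)
  have gC: "\<bar>g s\<bar> * \<bar>deriv \<phi> x\<bar> \<le> \<bar>C\<bar> * \<bar>g s\<bar>" for s x
    using mult_right_mono[OF C'[of x], of "\<bar>g s\<bar>"] by (simp add: mult.commute)
  \<comment> \<open>The triangle \<open>- R \<le> s \<le> x \<le> R\<close>, with \<open>R\<close>
    beyond the support of \<phi>.\<close>
  define k where "k = (\<lambda>x s. if - R \<le> x \<and> x \<le> R \<and> - R \<le> s \<and> s \<le> x then g s * deriv \<phi> x else 0)"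
  have gi: "integrable lborel (\<lambda>s. indicat_real {-R..R} s * g s)"
    using primitiveD(4)[OF fg, of "-R" R] by (simp add: set_integrable_def)
  have ki: "integrable lborel (k x)" for x
  proof (rule Bochner_Integration.integrable_bound)
    show "integrable lborel (\<lambda>s. \<bar>C\<bar> * (indicat_real {-R..R} s * g s))" using gi by simp
    show "k x \<in> borel_measurable lborel" unfolding k_def by simp
    show "AE s in lborel. norm (k x s) \<le> norm (\<bar>C\<bar> * (indicat_real {- R..R} s * g s))"
      using gC unfolding k_def by (intro AE_I2) (auto simp: indicator_def abs_mult)
  qed
  have kx: "(LBINT s. k x s) = indicat_real {-R..R} x * ((f x - f (-R)) * deriv \<phi> x)" for x
  proof (cases "x \<in> {-R..R}")
    case True
    then have "(LBINT s. k x s) = (LBINT s. deriv \<phi> x * (indicat_real {-R..x} s * g s))"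
      unfolding k_def by (intro Bochner_Integration.integral_cong) (auto simp: indicator_def)
    also have "\<dots> = deriv \<phi> x * (f x - f (-R))"
      using True primitiveD(3)[OF fg, of "-R" x] by (simp add: set_lebesgue_integral_def)
    finally show ?thesis using True by simp
  qed (auto simp: k_def)
  have ks: "(LBINT x. k x s) = - (g s * \<phi> s)" for s
  proof (cases "s \<in> {-R..R}")
    case True
    then have "(LBINT x. k x s) = (LBINT x. g s * (indicat_real {s..R} x * deriv \<phi> x))"
      unfolding k_def by (intro Bochner_Integration.integral_cong) (auto simp: indicator_def)
    also have "\<dots> = g s * (\<phi> R - \<phi> s)"
      using set_integral_deriv[OF s, of s R] True by (simp add: set_lebesgue_integral_def)
    finally show ?thesis using R by simp
  next
    case False
    then have "k x s = 0" for x by (auto simp: k_def)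
    moreover have "\<phi> s = 0" using False by (intro R(2)) auto
    ultimately show ?thesis by simp
  qed
  have m: "(\<lambda>(x, s). k x s) \<in> borel_measurable (lborel \<Otimes>\<^sub>M lborel)"
    unfolding k_def by measurable
  have "integrable (lborel \<Otimes>\<^sub>M lborel) (\<lambda>(x, s). k x s)"
  proof (rule lborel_pair.Fubini_integrable[OF m])
    show "AE x in lborel. integrable lborel (\<lambda>s. case (x, s) of (x, s) \<Rightarrow> k x s)"
      using ki by simp
    let ?I = "LBINT s. \<bar>C\<bar> * \<bar>indicat_real {-R..R} s * g s\<bar>"
    show "integrable lborel (\<lambda>x. LBINT s. norm (case (x, s) of (x, s) \<Rightarrow> k x s))"
    proof (rule Bochner_Integration.integrable_bound)
      show "integrable lborel (\<lambda>x. indicat_real {-R..R} x * ?I)"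
        by (intro integrable_mult_left integrable_real_indicator) (auto simp: emeasure_lborel_Icc_eq)
      show "(\<lambda>x. LBINT s. norm (case (x, s) of (x, s) \<Rightarrow> k x s)) \<in> borel_measurable lborel"
        using m by (intro lborel.borel_measurable_lebesgue_integral) (simp add: split_beta')
      show "AE x in lborel. norm (LBINT s. norm (case (x, s) of (x, s) \<Rightarrow> k x s)) \<le> norm (indicat_real {-R..R} x * ?I)"
      proof (intro AE_I2)
        fix x
        have "(LBINT s. \<bar>k x s\<bar>) \<le> indicat_real {-R..R} x * ?I"
        proof (cases "x \<in> {-R..R}")
          case True
          have "(LBINT s. \<bar>k x s\<bar>) \<le> ?I"
          proof (rule integral_mono)
            show "integrable lborel (\<lambda>s. \<bar>k x s\<bar>)" using ki[of x] by simp
            show "integrable lborel (\<lambda>s. \<bar>C\<bar> * \<bar>indicat_real {-R..R} s * g s\<bar>)" using gi by simp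
            show "\<bar>k x s\<bar> \<le> \<bar>C\<bar> * \<bar>indicat_real {-R..R} s * g s\<bar>" for s
              using gC unfolding k_def by (auto simp: indicator_def abs_mult)
          qed
          then show ?thesis using True by simp
        qed (auto simp: k_def)
        moreover have "0 \<le> (LBINT s. \<bar>k x s\<bar>)" by simp
        ultimately show "norm (LBINT s. norm (case (x, s) of (x, s) \<Rightarrow> k x s)) \<le> norm (indicat_real {-R..R} x * ?I)"
          by simp
      qed
    qed
  qed
  from lborel_pair.Fubini_integral[OF this]
  have sw: "(LBINT s. - (g s * \<phi> s)) = (LBINT x. indicat_real {-R..R} x * ((f x - f (-R)) * deriv \<phi> x))"
    by (simp only: kx ks)
  have ind: "indicat_real {-R..R} x * (c * deriv \<phi> x) = c * deriv \<phi> x" for x c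
    by (cases "R \<le> \<bar>x\<bar>") (use R(3)[of x] in \<open>auto simp: indicator_def\<close>)
  have i1: "integrable lborel (\<lambda>x. f x * deriv \<phi> x)"
    by (rule integrable_continuous_support[where l = "-R" and u = R])
       (use R(3) in \<open>auto intro!: continuous_intros cf cd\<close>)
  have i2: "integrable lborel (\<lambda>x. f (-R) * deriv \<phi> x)"
    by (rule integrable_continuous_support[where l = "-R" and u = R])
       (use R(3) in \<open>auto intro!: continuous_intros cd\<close>)
  \<comment> \<open>The base value \<open>f (-R)\<close> in the increment drops out, since
    \<open>deriv \<phi>\<close> has integral zero.\<close>
  have "(LBINT x. f (-R) * deriv \<phi> x) = f (-R) * (LBINT x:{-R..R}. deriv \<phi> x)"
  proof -
    have "(\<lambda>x. indicat_real {-R..R} x * deriv \<phi> x) = deriv \<phi>"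
      using ind[of _ 1] by (simp add: fun_eq_iff)
    then show ?thesis by (simp add: set_lebesgue_integral_def)
  qed
  also have "\<dots> = 0" using set_integral_deriv[OF s, of "-R" R] R by simp
  finally have z: "(LBINT x. f (-R) * deriv \<phi> x) = 0" .
  have "(LBINT x. f x * deriv \<phi> x) = (LBINT x. (f x - f (-R)) * deriv \<phi> x)"
    using Bochner_Integration.integral_diff[OF i1 i2] z by (simp add: left_diff_distrib)
  then show "(LBINT x. f x * deriv \<phi> x) = - (LBINT x. g x * \<phi> x)"
    using sw by (simp add: ind)
qed

lemma cutoff_pair_values:
  assumes "cutoff_pair \<chi>p \<chi>m"
  shows "smooth \<chi>p" "smooth \<chi>m" "0 \<le> \<chi>p x" "\<chi>p x \<le> 1" "x \<le> -1 \<Longrightarrow> \<chi>p x = 0" "1 \<le> x \<Longrightarrow> \<chi>p x = 1"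
proof -
  show "smooth \<chi>p" "smooth \<chi>m" "0 \<le> \<chi>p x" "\<chi>p x \<le> 1" using assms by (auto simp: cutoff_pair_def)
  have "{x. \<chi>p x \<noteq> 0} \<subseteq> {-1<..}" "{x. \<chi>m x \<noteq> 0} \<subseteq> {..<1}"
    using assms closure_subset[of "{x. \<chi>p x \<noteq> 0}"] closure_subset[of "{x. \<chi>m x \<noteq> 0}"]
    by (auto simp: cutoff_pair_def)
  moreover have "\<chi>p x + \<chi>m x = 1" using assms by (auto simp: cutoff_pair_def)
  moreover have "\<not> 1 \<le> x" if "\<chi>m x \<noteq> 0" using calculation(2) that by force
  ultimately show "x \<le> -1 \<Longrightarrow> \<chi>p x = 0" "1 \<le> x \<Longrightarrow> \<chi>p x = 1" by force+
qed

lemma cutoff_deriv_zero: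
  assumes "cutoff_pair \<chi>p \<chi>m" "1 < \<bar>x\<bar>"
  shows "deriv \<chi>p x = 0"
proof (rule DERIV_imp_deriv)
  show "(\<chi>p has_real_derivative 0) (at x)"
  proof (cases "x < 0")
    case True
    have "\<forall>\<^sub>F y in nhds x. y \<in> {..<-1}"
      by (rule eventually_nhds_in_open) (use assms(2) True in auto)
    then have ev: "\<forall>\<^sub>F y in nhds x. \<chi>p y = 0"
      by eventually_elim (simp add: cutoff_pair_values(5)[OF assms(1)])
    show ?thesis by (subst DERIV_cong_ev[OF refl ev refl]) simp
  next
    case False
    have "\<forall>\<^sub>F y in nhds x. y \<in> {1<..}"
      by (rule eventually_nhds_in_open) (use assms(2) False in auto)
    then have ev: "\<forall>\<^sub>F y in nhds x. \<chi>p y = 1"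
      by eventually_elim (simp add: cutoff_pair_values(6)[OF assms(1)])
    show ?thesis by (subst DERIV_cong_ev[OF refl ev refl]) simp
  qed
qed

text \<open>The cut-off rises from 0 to 1 inside \<open>{-1..1}\<close>, so its derivative has
  integral one and compact support; its rescalings form an approximate identity. It may change sign,
  but it is bounded, which is enough for dominated convergence after the substitution
  \<open>x = a + z / real (Suc n)\<close>. This spares the construction of a bump function.\<close>

lemma cutoff_mollifier:
  assumes \<chi>: "cutoff_pair \<chi>p \<chi>m" and f: "continuous_on UNIV f"
  shows "(\<lambda>n. \<integral>x. f x * (real (Suc n) * deriv \<chi>p (real (Suc n) * (x - a))) \<partial>lborel) \<longlonglongrightarrow> f a"
proof -
  let ?c = "deriv \<chi>p"
  have s: "smooth \<chi>p" using cutoff_pair_values(1)[OF \<chi>] .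
  have cc: "continuous_on UNIV ?c" by (rule smooth_continuous[OF smooth_deriv[OF s]])
  have [measurable]: "?c \<in> borel_measurable borel" by (rule borel_measurable_continuous_onI[OF cc])
  have [measurable]: "f \<in> borel_measurable borel" by (rule borel_measurable_continuous_onI[OF f])
  have c0: "?c z = 0" if "z \<notin> {-1..1}" for z
    by (rule cutoff_deriv_zero[OF \<chi>]) (use that in auto)
  have "bounded (?c ` {-1..1})"
    by (intro compact_imp_bounded compact_continuous_image continuous_on_subset[OF cc]) auto
  then obtain C where "\<forall>x\<in>{-1..1}. \<bar>?c x\<bar> \<le> C" unfolding bounded_iff by auto
  then have C: "\<bar>?c z\<bar> \<le> C" if "z \<in> {-1..1}" for z using that by blast
  have "bounded (f ` {a-1..a+1})"
    by (intro compact_imp_bounded compact_continuous_image continuous_on_subset[OF f]) auto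
  then obtain B where "\<forall>x\<in>{a-1..a+1}. \<bar>f x\<bar> \<le> B" unfolding bounded_iff by auto
  then have B: "\<bar>f x\<bar> \<le> B" if "x \<in> {a-1..a+1}" for x using that by blast
  have tr: "(LBINT x. f x * (real (Suc n) * ?c (real (Suc n) * (x - a))))
     = (LBINT z. f (a + z / real (Suc n)) * ?c z)" for n
  proof -
    have "(LBINT x. f x * (real (Suc n) * ?c (real (Suc n) * (x - a))))
      = \<bar>1 / real (Suc n)\<bar> *\<^sub>R (LBINT z. f (a + (1 / real (Suc n)) * z) * (real (Suc n) * ?c (real (Suc n) * ((a + (1 / real (Suc n)) * z) - a))))"
      by (rule lborel_integral_real_affine) simp
    also have "(LBINT z. f (a + (1 / real (Suc n)) * z) * (real (Suc n) * ?c (real (Suc n) * ((a + (1 / real (Suc n)) * z) - a))))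
      = (LBINT z. real (Suc n) * (f (a + z / real (Suc n)) * ?c z))"
      by (intro Bochner_Integration.integral_cong refl) (simp del: of_nat_Suc)
    also have "\<dots> = real (Suc n) * (LBINT z. f (a + z / real (Suc n)) * ?c z)"
      by (rule integral_mult_right_zero)
    also have "\<bar>1 / real (Suc n)\<bar> *\<^sub>R (real (Suc n) * (LBINT z. f (a + z / real (Suc n)) * ?c z))
        = (LBINT z. f (a + z / real (Suc n)) * ?c z)"
      by (simp del: of_nat_Suc)
    finally show ?thesis .
  qed
  have "(\<lambda>n. \<integral>z. f (a + z / real (Suc n)) * ?c z \<partial>lborel) \<longlonglongrightarrow> (LBINT z. f a * ?c z)"
  proof (rule integral_dominated_convergence[where w = "\<lambda>z. indicat_real {-1..1} z * (B * C)"])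
    show "AE z in lborel. (\<lambda>n. f (a + z / real (Suc n)) * ?c z) \<longlonglongrightarrow> f a * ?c z"
    proof (intro AE_I2 tendsto_mult tendsto_const)
      fix z
      have "(\<lambda>n. a + z / real (Suc n)) \<longlonglongrightarrow> a + 0"
        by (intro tendsto_add tendsto_const real_tendsto_divide_at_top[OF tendsto_const]
            filterlim_compose[OF filterlim_real_sequentially filterlim_Suc])
      moreover have "isCont f a" using f by (simp add: continuous_on_eq_continuous_at)
      ultimately show "(\<lambda>n. f (a + z / real (Suc n))) \<longlonglongrightarrow> f a"
        using isCont_tendsto_compose by fastforce
    qed
    show "AE z in lborel. norm (f (a + z / real (Suc n)) * ?c z) \<le> indicat_real {-1..1} z * (B * C)" for n
    proof (intro AE_I2)
      fix z
      show "norm (f (a + z / real (Suc n)) * ?c z) \<le> indicat_real {-1..1} z * (B * C)"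
      proof (cases "z \<in> {-1..1}")
        case True
        have "\<bar>z / real (Suc n)\<bar> \<le> 1"
          using True by (auto simp: divide_simps abs_if)
        then have "a + z / real (Suc n) \<in> {a-1..a+1}"
          by (simp only: abs_le_iff atLeastAtMost_iff) linarith
        then have "\<bar>f (a + z / real (Suc n))\<bar> * \<bar>?c z\<bar> \<le> B * C"
          by (intro mult_mono B C True) (use B[of a] in auto)
        then show ?thesis using True by (simp add: abs_mult)
      qed (simp add: c0)
    qed
  qed auto
  also have "(LBINT z. f a * ?c z) = f a * (LBINT z:{-2..2}. ?c z)"
  proof -
    have "(LBINT z:{-2..2}. ?c z) = (LBINT z. ?c z)"
      unfolding set_lebesgue_integral_def
      by (intro Bochner_Integration.integral_cong) (use c0 in \<open>force simp: indicator_def\<close>)+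
    then show ?thesis by simp
  qed
  also have "\<dots> = f a"
    using set_integral_deriv[OF s, of "-2" 2] cutoff_pair_values(5,6)[OF \<chi>] by simp
  finally show ?thesis unfolding tr .
qed

text \<open>The test function is the difference of two steeper and steeper cut-offs placed at
  \<open>a\<close> and \<open>b\<close>, a smooth approximation of the indicator of
  \<open>{a..b}\<close>. Its derivative is a difference of two approximate identities and so
  recovers \<open>f a - f b\<close>.\<close>

lemma has_weak_deriv_imp_primitive:
  assumes \<chi>: "cutoff_pair \<chi>p \<chi>m" and w: "has_weak_deriv f g" and f: "continuous_on UNIV f"
  shows "primitive f g"
  unfolding primitive_def
proof (intro conjI allI impI)
  let ?c = "deriv \<chi>p"
  show lg: "locally_integrable g" using w by (simp add: has_weak_deriv_def)
  then have [measurable]: "g \<in> borel_measurable borel" by (rule locally_integrable_measurable)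
  have s: "smooth \<chi>p" using cutoff_pair_values(1)[OF \<chi>] .
  have [measurable]: "\<chi>p \<in> borel_measurable borel"
    by (rule borel_measurable_continuous_onI[OF smooth_continuous[OF s]])
  have cc: "continuous_on UNIV ?c" by (rule smooth_continuous[OF smooth_deriv[OF s]])
  fix a b :: real assume ab: "a \<le> b"
  show "f b - f a = (LBINT x:{a..b}. g x)"
  proof (cases "a = b")
    case True
    then show ?thesis
      using set_integral_Ioc[of g b b] by (simp add: set_lebesgue_integral_def)
  next
    case False
    then have ab: "a < b" using ab by simp
    define \<phi> where "\<phi> = (\<lambda>n x. \<chi>p (real (Suc n) * (x - a)) - \<chi>p (real (Suc n) * (x - b)))"
    have \<phi>_eq: "\<phi> n = (\<lambda>x. 1 * \<chi>p (real (Suc n) * x + (- real (Suc n) * a)) + (-1) * \<chi>p (real (Suc n) * x + (- real (Suc n) * b)))" for n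
      by (auto simp: \<phi>_def algebra_simps fun_eq_iff)
    have s\<phi>: "smooth (\<phi> n)" for n
      unfolding \<phi>_eq by (intro smooth_add smooth_affine s)
    have sup: "\<phi> n x = 0" if "x \<notin> {a-1..b+1}" for n x
    proof (cases "x < a - 1")
      case True
      then have "real (Suc n) * (x - a) \<le> real (Suc n) * (-1)" "real (Suc n) * (x - b) \<le> real (Suc n) * (-1)"
        using ab by (intro mult_left_mono; simp)+
      then show ?thesis unfolding \<phi>_def using cutoff_pair_values(5)[OF \<chi>] by simp
    next
      case False
      then have "1 \<le> real (Suc n) * (x - e)" if "e \<in> {a, b}" for e
        using mult_mono[of 1 "real (Suc n)" 1 "x - e"] that ab \<open>x \<notin> {a - 1..b + 1}\<close> by auto
      then show ?thesis unfolding \<phi>_def using cutoff_pair_values(6)[OF \<chi>] by simp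
    qed
    have t\<phi>: "test_function (\<phi> n)" for n
    proof -
      have "{x. \<phi> n x \<noteq> 0} \<subseteq> {a-1..b+1}" using sup[of _ n] by blast
      then have "bounded {x. \<phi> n x \<noteq> 0}" by (rule bounded_subset[OF bounded_closed_interval])
      then show ?thesis using s\<phi> by (simp add: test_function_def)
    qed
    have d\<phi>: "deriv (\<phi> n) x = real (Suc n) * ?c (real (Suc n) * (x - a)) - real (Suc n) * ?c (real (Suc n) * (x - b))" for n x
      unfolding \<phi>_def
      by (rule DERIV_imp_deriv) (rule derivative_eq_intros DERIV_chain2[OF smooth_has_deriv[OF s]] refl | simp)+
    have ci: "integrable lborel (\<lambda>x. f x * (real (Suc n) * ?c (real (Suc n) * (x - e))))" for n e
    proof (rule integrable_continuous_support[where l = "e - 1" and u = "e + 1"])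
      show "continuous_on UNIV (\<lambda>x. f x * (real (Suc n) * ?c (real (Suc n) * (x - e))))"
        by (intro continuous_intros f continuous_on_compose2[OF cc]) auto
      fix x assume x: "x \<notin> {e - 1..e + 1}"
      then have "1 < \<bar>x - e\<bar>" by auto
      also have "\<dots> \<le> real (Suc n) * \<bar>x - e\<bar>" by (simp add: mult_le_cancel_right1)
      also have "\<dots> = \<bar>real (Suc n) * (x - e)\<bar>" by (simp add: abs_mult)
      finally have "?c (real (Suc n) * (x - e)) = 0" by (rule cutoff_deriv_zero[OF \<chi>])
      then show "f x * (real (Suc n) * ?c (real (Suc n) * (x - e))) = 0" by simp
    qed
    have "(\<lambda>n. (LBINT x. f x * (real (Suc n) * ?c (real (Suc n) * (x - a))))
       - (LBINT x. f x * (real (Suc n) * ?c (real (Suc n) * (x - b))))) \<longlonglongrightarrow> f a - f b"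
      by (intro tendsto_diff cutoff_mollifier[OF \<chi> f])
    moreover have "(LBINT x. f x * (real (Suc n) * ?c (real (Suc n) * (x - a))))
       - (LBINT x. f x * (real (Suc n) * ?c (real (Suc n) * (x - b)))) = - (LBINT x. g x * \<phi> n x)" for n
    proof -
      have "(LBINT x. f x * (real (Suc n) * ?c (real (Suc n) * (x - a))))
       - (LBINT x. f x * (real (Suc n) * ?c (real (Suc n) * (x - b)))) = (LBINT x. f x * deriv (\<phi> n) x)"
        unfolding d\<phi> right_diff_distrib[of "f x" for x] by (rule Bochner_Integration.integral_diff[OF ci ci, symmetric])
      also have "\<dots> = - (LBINT x. g x * \<phi> n x)"
        using w t\<phi>[of n] by (simp add: has_weak_deriv_def)
      finally show ?thesis .
    qed
    ultimately have 1: "(\<lambda>n. - (LBINT x. g x * \<phi> n x)) \<longlonglongrightarrow> f a - f b" by simp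
    have "(\<lambda>n. \<integral>x. g x * \<phi> n x \<partial>lborel) \<longlonglongrightarrow> (LBINT x. indicat_real {a..b} x * g x)"
    proof (rule integral_dominated_convergence[where w = "\<lambda>x. \<bar>indicat_real {a-1..b+1} x * g x\<bar>"])
      show "integrable lborel (\<lambda>x. \<bar>indicat_real {a-1..b+1} x * g x\<bar>)"
        using lg unfolding locally_integrable_def set_integrable_def by simp
      show "(\<lambda>x. g x * \<phi> n x) \<in> borel_measurable lborel" for n unfolding \<phi>_def by simp
      have "\<bar>\<phi> n x\<bar> \<le> 1" for n x
        unfolding \<phi>_def using cutoff_pair_values(3,4)[OF \<chi>, of "real (Suc n) * (x - a)"]
          cutoff_pair_values(3,4)[OF \<chi>, of "real (Suc n) * (x - b)"] by linarith
      then have "\<bar>g x * \<phi> n x\<bar> \<le> \<bar>g x\<bar>" for n x by (simp add: abs_mult mult_left_le)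
      then show "AE x in lborel. norm (g x * \<phi> n x) \<le> \<bar>indicat_real {a-1..b+1} x * g x\<bar>" for n
        using sup[of _ n] by (intro AE_I2) (auto simp: indicator_def)
      \<comment> \<open>At the end points the cut-off stays at the unknown value
        \<open>\<chi>p 0\<close>; these two points are discarded.\<close>
      show "AE x in lborel. (\<lambda>n. g x * \<phi> n x) \<longlonglongrightarrow> indicat_real {a..b} x * g x"
        using AE_lborel_singleton[of a] AE_lborel_singleton[of b]
      proof eventually_elim
        fix x assume x: "x \<noteq> a" "x \<noteq> b"
        have lo: "(\<lambda>n. \<chi>p (real (Suc n) * (x - e))) \<longlonglongrightarrow> (if x < e then 0 else 1)" if "x \<noteq> e" for e
        proof (rule tendsto_eventually)
          obtain N :: nat where N: "1 / \<bar>x - e\<bar> \<le> real N" using real_arch_simple by blast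
          show "\<forall>\<^sub>F n in sequentially. \<chi>p (real (Suc n) * (x - e)) = (if x < e then 0 else 1)"
            using eventually_ge_at_top[of N]
          proof eventually_elim
            case (elim n)
            then have "1 / \<bar>x - e\<bar> \<le> real (Suc n)" using N by linarith
            then have "1 \<le> real (Suc n) * \<bar>x - e\<bar>" using that by (simp add: divide_simps)
            then show ?case
              using cutoff_pair_values(5,6)[OF \<chi>, of "real (Suc n) * (x - e)"] that
              by (cases "x < e") (simp_all del: of_nat_Suc add: abs_if algebra_simps)
          qed
        qed
        have "(\<lambda>n. g x * \<phi> n x) \<longlonglongrightarrow> g x * ((if x < a then 0 else 1) - (if x < b then 0 else 1))"
          unfolding \<phi>_def by (intro tendsto_mult tendsto_const tendsto_diff lo x)
        also have "g x * ((if x < a then 0 else 1) - (if x < b then 0 else 1)) = indicat_real {a..b} x * g x"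
          using x ab by (auto simp: indicator_def)
        finally show "(\<lambda>n. g x * \<phi> n x) \<longlonglongrightarrow> indicat_real {a..b} x * g x" .
      qed
    qed simp
    then have "(\<lambda>n. - (LBINT x. g x * \<phi> n x)) \<longlonglongrightarrow> - (LBINT x:{a..b}. g x)"
      unfolding set_lebesgue_integral_def by (auto intro: tendsto_minus)
    with 1 have "f a - f b = - (LBINT x:{a..b}. g x)" by (rule LIMSEQ_unique)
    then show ?thesis by simp
  qed
qed

text \<open>The choice operator may return any weak derivative. Whichever it is, it is again a
  density of the same primitive, so it can be exchanged for the explicit one almost
  everywhere.\<close>

lemma primitive_wderiv:
  assumes \<chi>: "cutoff_pair \<chi>p \<chi>m" and fg: "primitive f g"
  shows "weakly_differentiable f" "primitive f (wderiv f)" "AE x in lborel. wderiv f x = g x"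
    "wderiv f \<in> borel_measurable borel"
proof -
  have w: "has_weak_deriv f g" by (rule primitive_has_weak_deriv[OF fg])
  then show "weakly_differentiable f" by (auto simp: weakly_differentiable_def)
  have "has_weak_deriv f (wderiv f)" unfolding wderiv_def using w by (rule someI[where P = "has_weak_deriv f"])
  then show p: "primitive f (wderiv f)"
    by (rule has_weak_deriv_imp_primitive[OF \<chi> _ primitive_continuous[OF fg]])
  show "AE x in lborel. wderiv f x = g x" by (rule primitive_unique[OF p fg])
  show "wderiv f \<in> borel_measurable borel" by (rule primitiveD(2)[OF p])
qed

section \<open>Weak convergence of square integrable functions\<close>

lemma integrable_mult_L2:
  fixes f g :: "real \<Rightarrow> real"
  assumes [measurable]: "f \<in> borel_measurable M" "g \<in> borel_measurable M"
    and "integrable M (\<lambda>x. (f x)\<^sup>2)" "integrable M (\<lambda>x. (g x)\<^sup>2)"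
  shows "integrable M (\<lambda>x. f x * g x)"
proof (rule Bochner_Integration.integrable_bound)
  show "integrable M (\<lambda>x. (f x)\<^sup>2 + (g x)\<^sup>2)" using assms by simp
  show "AE x in M. norm (f x * g x) \<le> norm ((f x)\<^sup>2 + (g x)\<^sup>2)"
  proof (intro AE_I2)
    fix x
    have "2 * (\<bar>f x\<bar> * \<bar>g x\<bar>) \<le> (f x)\<^sup>2 + (g x)\<^sup>2"
      using sum_squares_bound[of "\<bar>f x\<bar>" "\<bar>g x\<bar>"] by (simp add: mult.assoc)
    moreover have "0 \<le> \<bar>f x\<bar> * \<bar>g x\<bar>" by simp
    ultimately have "\<bar>f x\<bar> * \<bar>g x\<bar> \<le> (f x)\<^sup>2 + (g x)\<^sup>2" by linarith
    then show "norm (f x * g x) \<le> norm ((f x)\<^sup>2 + (g x)\<^sup>2)" by (simp add: abs_mult)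
  qed
qed simp

lemma integrable_power2_diff:
  fixes f g :: "real \<Rightarrow> real"
  assumes [measurable]: "f \<in> borel_measurable M" "g \<in> borel_measurable M"
    and "integrable M (\<lambda>x. (f x)\<^sup>2)" "integrable M (\<lambda>x. (g x)\<^sup>2)"
  shows "integrable M (\<lambda>x. (f x - g x)\<^sup>2)"
    and "(\<integral>x. (f x - g x)\<^sup>2 \<partial>M) = (\<integral>x. (f x)\<^sup>2 \<partial>M) - 2 * (\<integral>x. f x * g x \<partial>M) + (\<integral>x. (g x)\<^sup>2 \<partial>M)"
proof -
  have i: "integrable M (\<lambda>x. f x * g x)" by (rule integrable_mult_L2) (use assms in auto)
  have e: "(f x - g x)\<^sup>2 = ((f x)\<^sup>2 - 2 * (f x * g x)) + (g x)\<^sup>2" for x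
    by (simp add: power2_diff algebra_simps)
  show "integrable M (\<lambda>x. (f x - g x)\<^sup>2)" unfolding e using i assms by simp
  show "(\<integral>x. (f x - g x)\<^sup>2 \<partial>M) = (\<integral>x. (f x)\<^sup>2 \<partial>M) - 2 * (\<integral>x. f x * g x \<partial>M) + (\<integral>x. (g x)\<^sup>2 \<partial>M)"
    unfolding e using i assms by simp
qed

text \<open>The squared norm of \<open>f - t * g\<close> is a nonnegative quadratic polynomial in
  \<open>t\<close>.\<close>

lemma Cauchy_Schwarz_L2:
  fixes f g :: "real \<Rightarrow> real"
  assumes f[measurable]: "f \<in> borel_measurable M" and g[measurable]: "g \<in> borel_measurable M"
    and fi: "integrable M (\<lambda>x. (f x)\<^sup>2)" and gi: "integrable M (\<lambda>x. (g x)\<^sup>2)"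
  shows "(\<integral>x. f x * g x \<partial>M)\<^sup>2 \<le> (\<integral>x. (f x)\<^sup>2 \<partial>M) * (\<integral>x. (g x)\<^sup>2 \<partial>M)"
proof -
  define P where "P = (\<integral>x. f x * g x \<partial>M)"
  define A where "A = (\<integral>x. (f x)\<^sup>2 \<partial>M)"
  define C where "C = (\<integral>x. (g x)\<^sup>2 \<partial>M)"
  have q: "0 \<le> A - 2 * t * P + t\<^sup>2 * C" for t
  proof -
    have "0 \<le> (\<integral>x. (f x - t * g x)\<^sup>2 \<partial>M)" by (rule Bochner_Integration.integral_nonneg) simp
    also have "\<dots> = (\<integral>x. (f x)\<^sup>2 \<partial>M) - 2 * (\<integral>x. f x * (t * g x) \<partial>M) + (\<integral>x. (t * g x)\<^sup>2 \<partial>M)"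
      by (rule integrable_power2_diff(2)) (use fi gi in \<open>auto simp: power_mult_distrib\<close>)
    also have "(\<integral>x. f x * (t * g x) \<partial>M) = (\<integral>x. t * (f x * g x) \<partial>M)"
      by (intro Bochner_Integration.integral_cong) auto
    also have "\<dots> = t * P" by (simp add: P_def)
    also have "(\<integral>x. (t * g x)\<^sup>2 \<partial>M) = t\<^sup>2 * C" by (simp add: power_mult_distrib C_def)
    finally show ?thesis by (simp add: A_def)
  qed
  have "0 \<le> C" unfolding C_def by (rule Bochner_Integration.integral_nonneg) simp
  show "P\<^sup>2 \<le> A * C"
  proof (cases "C = 0")
    case True
    \<comment> \<open>For \<open>C = 0\<close> the polynomial is affine in \<open>t\<close> and
      would equal -1 at the value of \<open>t\<close> chosen here; for \<open>C\<close> nonzero the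
      minimiser \<open>P / C\<close> is inserted below.\<close>
    have "P = 0"
    proof (rule ccontr)
      assume "P \<noteq> 0"
      then show False using q[of "(A + 1) / (2 * P)"] True by (simp add: field_simps)
    qed
    then show ?thesis using True by simp
  next
    case False
    then show ?thesis using q[of "P / C"] \<open>0 \<le> C\<close>
      by (simp add: field_simps power2_eq_square)
  qed
qed

text \<open>Closure of the admissible test functions under dominated limits: by Cauchy-Schwarz,
  replacing \<phi> by \<open>\<psi> k\<close> costs at most the square root of \<open>B\<close>
  times the norm of the difference, uniformly in \<open>n\<close>.\<close>

lemma weak_L2_null_dominated:
  fixes D :: "nat \<Rightarrow> real \<Rightarrow> real"
  assumes D[measurable]: "\<And>n. D n \<in> borel_measurable borel"
    and D2: "\<And>n. integrable lborel (\<lambda>x. (D n x)\<^sup>2)" and B: "\<And>n. (LBINT x. (D n x)\<^sup>2) \<le> B"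
    and \<phi>[measurable]: "\<phi> \<in> borel_measurable borel" and \<phi>2: "integrable lborel (\<lambda>x. (\<phi> x)\<^sup>2)"
    and \<psi>[measurable]: "\<And>k. \<psi> k \<in> borel_measurable borel"
    and le: "\<And>k x. \<bar>\<psi> k x\<bar> \<le> \<bar>\<phi> x\<bar>"
    and lim: "\<And>x. (\<lambda>k. \<psi> k x) \<longlonglongrightarrow> \<phi> x"
    and Z: "\<And>k. (\<lambda>n. \<integral>x. D n x * \<psi> k x \<partial>lborel) \<longlonglongrightarrow> 0"
  shows "(\<lambda>n. \<integral>x. D n x * \<phi> x \<partial>lborel) \<longlonglongrightarrow> 0"
proof (rule LIMSEQ_I)
  have \<psi>2: "integrable lborel (\<lambda>x. (\<psi> k x)\<^sup>2)" for k
    by (rule Bochner_Integration.integrable_bound[OF \<phi>2]) (use le in \<open>auto simp: abs_le_square_iff intro!: AE_I2\<close>)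
  have "(\<lambda>k. \<integral>x. (\<phi> x - \<psi> k x)\<^sup>2 \<partial>lborel) \<longlonglongrightarrow> (\<integral>x. 0 \<partial>(lborel :: real measure))"
  proof (rule integral_dominated_convergence[where w = "\<lambda>x. 4 * (\<phi> x)\<^sup>2"])
    show "integrable lborel (\<lambda>x. 4 * (\<phi> x)\<^sup>2)" using \<phi>2 by simp
    show "AE x in lborel. (\<lambda>k. (\<phi> x - \<psi> k x)\<^sup>2) \<longlonglongrightarrow> 0"
    proof (intro AE_I2)
      fix x
      have "(\<lambda>k. (\<phi> x - \<psi> k x)\<^sup>2) \<longlonglongrightarrow> (\<phi> x - \<phi> x)\<^sup>2"
        by (intro tendsto_power tendsto_diff tendsto_const lim)
      then show "(\<lambda>k. (\<phi> x - \<psi> k x)\<^sup>2) \<longlonglongrightarrow> 0" by simp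
    qed
    show "AE x in lborel. norm ((\<phi> x - \<psi> k x)\<^sup>2) \<le> 4 * (\<phi> x)\<^sup>2" for k
    proof (intro AE_I2)
      fix x
      have "\<bar>\<phi> x - \<psi> k x\<bar> \<le> \<bar>2 * \<phi> x\<bar>" using le[of k x] by linarith
      then have "(\<phi> x - \<psi> k x)\<^sup>2 \<le> (2 * \<phi> x)\<^sup>2" by (simp only: abs_le_square_iff)
      then show "norm ((\<phi> x - \<psi> k x)\<^sup>2) \<le> 4 * (\<phi> x)\<^sup>2" by (simp add: power_mult_distrib)
    qed
  qed auto
  then have L: "(\<lambda>k. \<integral>x. (\<phi> x - \<psi> k x)\<^sup>2 \<partial>lborel) \<longlonglongrightarrow> 0" by simp
  have B0: "0 \<le> B" by (rule order_trans[OF Bochner_Integration.integral_nonneg B[of 0]]) simp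
  fix r :: real assume r: "0 < r"
  \<comment> \<open>The threshold is chosen so that Cauchy-Schwarz yields an error below
    \<open>r/2\<close>; \<open>B + 1\<close> avoids division by zero.\<close>
  have "\<forall>\<^sub>F k in sequentially. (LBINT x. (\<phi> x - \<psi> k x)\<^sup>2) < (r/2)\<^sup>2 / (B + 1)"
    by (rule order_tendstoD(2)[OF L]) (use r B0 in auto)
  then obtain k where k: "(LBINT x. (\<phi> x - \<psi> k x)\<^sup>2) < (r/2)\<^sup>2 / (B + 1)"
    by (auto simp: eventually_sequentially)
  obtain N where N: "\<And>n. n \<ge> N \<Longrightarrow> norm ((LBINT x. D n x * \<psi> k x) - 0) < r/2"
    using LIMSEQ_D[OF Z[of k], of "r/2"] r by auto
  show "\<exists>N. \<forall>n\<ge>N. norm ((LBINT x. D n x * \<phi> x) - 0) < r"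
  proof (intro exI allI impI)
    fix n assume n: "n \<ge> N"
    let ?d = "LBINT x. D n x * (\<phi> x - \<psi> k x)"
    have i1: "integrable lborel (\<lambda>x. D n x * \<phi> x)"
      by (rule integrable_mult_L2) (use D2 \<phi>2 in auto)
    have i2: "integrable lborel (\<lambda>x. D n x * \<psi> k x)"
      by (rule integrable_mult_L2) (use D2 \<psi>2 in auto)
    have "?d\<^sup>2 \<le> (LBINT x. (D n x)\<^sup>2) * (LBINT x. (\<phi> x - \<psi> k x)\<^sup>2)"
      by (rule Cauchy_Schwarz_L2) (use D2 \<phi>2 \<psi>2 in \<open>auto intro!: integrable_power2_diff(1)\<close>)
    also have "\<dots> \<le> (B + 1) * (LBINT x. (\<phi> x - \<psi> k x)\<^sup>2)"
      using B[of n] by (intro mult_right_mono Bochner_Integration.integral_nonneg) auto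
    also have "\<dots> < (r/2)\<^sup>2" using k B0 by (simp add: field_simps)
    finally have "\<bar>?d\<bar> < r/2"
      using power2_less_imp_less[of "\<bar>?d\<bar>" "r/2"] r by simp
    moreover have "?d = (LBINT x. D n x * \<phi> x) - (LBINT x. D n x * \<psi> k x)"
      unfolding right_diff_distrib by (rule Bochner_Integration.integral_diff[OF i1 i2])
    ultimately show "norm ((LBINT x. D n x * \<phi> x) - 0) < r"
      using N[OF n] unfolding real_norm_def by linarith
  qed
qed

text \<open>The class \<open>Z\<close> of admissible test functions is closed under sums, multiples
  and dominated limits. Starting from intervals, it is extended to Borel subsets of a bounded
  interval by the induction for disjoint unions and complements, then to sets of finite measure, to
  nonnegative functions by monotone approximation, and finally to differences.\<close>

lemma weak_L2_null:
  fixes D :: "nat \<Rightarrow> real \<Rightarrow> real"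
  assumes D[measurable]: "\<And>n. D n \<in> borel_measurable borel"
    and D2: "\<And>n. integrable lborel (\<lambda>x. (D n x)\<^sup>2)" and B: "\<And>n. (LBINT x. (D n x)\<^sup>2) \<le> B"
    and ivl: "\<And>a b. a \<le> b \<Longrightarrow> (\<lambda>n. LBINT x:{a..b}. D n x) \<longlonglongrightarrow> 0"
    and \<phi>: "\<phi> \<in> borel_measurable borel" and \<phi>2: "integrable lborel (\<lambda>x. (\<phi> x)\<^sup>2)"
  shows "(\<lambda>n. \<integral>x. D n x * \<phi> x \<partial>lborel) \<longlonglongrightarrow> 0"
proof -
  define Z where "Z = (\<lambda>\<psi>. (\<lambda>n. \<integral>x. D n x * \<psi> x \<partial>lborel) \<longlonglongrightarrow> 0)"
  have dom: "Z \<phi>" if "\<phi> \<in> borel_measurable borel" "integrable lborel (\<lambda>x. (\<phi> x)\<^sup>2)"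
      "\<And>k. \<psi> k \<in> borel_measurable borel" "\<And>k x. \<bar>\<psi> k x\<bar> \<le> \<bar>\<phi> x\<bar>"
      "\<And>x. (\<lambda>k. \<psi> k x) \<longlonglongrightarrow> \<phi> x" "\<And>k. Z (\<psi> k)" for \<phi> and \<psi> :: "nat \<Rightarrow> real \<Rightarrow> real"
    unfolding Z_def
    by (rule weak_L2_null_dominated[OF D D2 B that(1-5) that(6)[unfolded Z_def]])
  have i: "integrable lborel (\<lambda>x. D n x * \<psi> x)"
    if [measurable]: "\<psi> \<in> borel_measurable borel" and "integrable lborel (\<lambda>x. (\<psi> x)\<^sup>2)" for n \<psi>
    by (rule integrable_mult_L2) (use D2 that in auto)
  have add: "Z (\<lambda>x. \<psi> x + \<psi>' x)" if "\<psi> \<in> borel_measurable borel" "integrable lborel (\<lambda>x. (\<psi> x)\<^sup>2)"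
    "\<psi>' \<in> borel_measurable borel" "integrable lborel (\<lambda>x. (\<psi>' x)\<^sup>2)" "Z \<psi>" "Z \<psi>'" for \<psi> \<psi>'
    using tendsto_add[OF that(5,6)[unfolded Z_def]] i[OF that(1,2)] i[OF that(3,4)]
    unfolding Z_def by (simp add: distrib_left)
  have mult: "Z (\<lambda>x. c * \<psi> x)" if "Z \<psi>" for \<psi> and c :: real
  proof -
    have "(LBINT x. D n x * (c * \<psi> x)) = c * (LBINT x. D n x * \<psi> x)" for n
    proof -
      have "(\<lambda>x. D n x * (c * \<psi> x)) = (\<lambda>x. c * (D n x * \<psi> x))" by (auto simp: fun_eq_iff)
      then show ?thesis by simp
    qed
    then show ?thesis using tendsto_mult_right_zero[OF that[unfolded Z_def], of c] unfolding Z_def by simp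
  qed
  have ind2: "(\<lambda>x. (indicat_real A x)\<^sup>2) = indicat_real A" for A :: "real set"
    by (auto simp: indicator_def fun_eq_iff)
  \<comment> \<open>The intersection with a bounded interval keeps complements square integrable;
    without it the induction over sigma sets would leave \<open>L\<^sup>2\<close>.\<close>
  have Zbdd: "Z (indicat_real (A \<inter> {- r<..r}))" if "A \<in> sets borel" for A r
  proof -
    define J where "J = {- r<..r}"
    have iJ: "integrable lborel (\<lambda>x. (indicat_real (A \<inter> J) x)\<^sup>2)" if "A \<in> sets borel" for A
    proof -
      have "emeasure lborel (A \<inter> J) \<le> emeasure lborel J" using that by (intro emeasure_mono) (auto simp: J_def)
      also have "\<dots> < \<infinity>" by (cases "-r \<le> r") (auto simp: J_def)
      finally have "emeasure lborel (A \<inter> J) < \<infinity>" .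
      then show ?thesis unfolding ind2 using that
        by (intro integrable_real_indicator) (auto simp: J_def)
    qed
    have \<sigma>: "A \<in> sigma_sets UNIV (range (\<lambda>(a, b). {a<..b}))"
    proof -
      have "sets (borel :: real measure) = sigma_sets UNIV (range (\<lambda>(a, b). {a<..b}))"
        unfolding borel_sigma_sets_Ioc by (simp add: sets_measure_of)
      then show ?thesis using that by (simp only:)
    qed
    have "Int_stable (range (\<lambda>(a::real, b). {a<..b}))" by (auto simp: Int_stable_def)
    moreover have "range (\<lambda>(a::real, b). {a<..b}) \<subseteq> Pow UNIV" by (simp only: Pow_UNIV subset_UNIV)
    moreover note \<sigma>
    ultimately have "A \<in> sets borel \<and> Z (indicat_real (A \<inter> J))"
    proof (induction rule: sigma_sets_induct_disjoint)
      case (basic A)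
      then obtain a b where A: "A = {a<..b}" by auto
      show ?case
      proof (cases "max a (-r) \<le> min b r")
        case True
        have "A \<inter> J = {max a (-r)<..min b r}" by (auto simp: A J_def)
        then have "(LBINT x. D n x * indicat_real (A \<inter> J) x) = (LBINT x:{max a (-r)..min b r}. D n x)" for n
          using set_integral_Ioc[OF D[of n], of "max a (-r)" "min b r"]
          by (simp add: set_lebesgue_integral_def mult.commute)
        then show ?thesis using ivl[OF True] A unfolding Z_def by simp
      next
        case False
        then have "A \<inter> J = {}" by (auto simp: A J_def)
        then show ?thesis using A by (simp add: Z_def)
      qed
    next
      case empty
      then show ?case by (simp add: Z_def)
    next
      case (compl A)
      have 1: "Z (indicat_real (UNIV \<inter> J))"
      proof (cases "-r \<le> r")
        case True
        then have "(LBINT x. D n x * indicat_real (UNIV \<inter> J) x) = (LBINT x:{-r..r}. D n x)" for n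
          using set_integral_Ioc[OF D[of n], of "-r" r]
          by (simp add: set_lebesgue_integral_def mult.commute J_def)
        then show ?thesis using ivl[OF True] unfolding Z_def by simp
      qed (auto simp: Z_def J_def)
      have A: "A \<in> sets borel" "Z (indicat_real (A \<inter> J))" using compl by auto
      have [measurable]: "J \<in> sets borel" by (simp add: J_def)
      have "Z (\<lambda>x. indicat_real (UNIV \<inter> J) x + (-1) * indicat_real (A \<inter> J) x)"
      proof (rule add[OF _ _ _ _ 1 mult[OF A(2)]])
        show "integrable lborel (\<lambda>x. (indicat_real (UNIV \<inter> J) x)\<^sup>2)" by (rule iJ) simp
        show "integrable lborel (\<lambda>x. (-1 * indicat_real (A \<inter> J) x)\<^sup>2)" using iJ[OF A(1)] by simp
      qed (use A in auto)
      also have "(\<lambda>x. indicat_real (UNIV \<inter> J) x + (-1) * indicat_real (A \<inter> J) x) = indicat_real ((UNIV - A) \<inter> J)"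
        by (auto simp: indicator_def fun_eq_iff)
      finally show ?case using A by simp
    next
      case (union A)
      have As: "A i \<in> sets borel" for i using union by auto
      have [measurable]: "J \<in> sets borel" by (simp add: J_def)
      have "Z (indicat_real (\<Union> (range A) \<inter> J))"
      proof (rule dom)
        show "indicat_real (\<Union> (range A) \<inter> J) \<in> borel_measurable borel" using As by simp
        show "integrable lborel (\<lambda>x. (indicat_real (\<Union> (range A) \<inter> J) x)\<^sup>2)" using As by (intro iJ) auto
        show "indicat_real ((\<Union>i<k. A i) \<inter> J) \<in> borel_measurable borel" for k using As by simp
        show "\<bar>indicat_real ((\<Union>i<k. A i) \<inter> J) x\<bar> \<le> \<bar>indicat_real (\<Union> (range A) \<inter> J) x\<bar>" for k x
          by (auto simp: indicator_def)
        show "(\<lambda>k. indicat_real ((\<Union>i<k. A i) \<inter> J) x) \<longlonglongrightarrow> indicat_real (\<Union> (range A) \<inter> J) x" for x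
        proof (cases "x \<in> \<Union> (range A) \<inter> J")
          case True
          then obtain i where i: "x \<in> A i" "x \<in> J" by auto
          show ?thesis
          proof (rule tendsto_eventually)
            show "\<forall>\<^sub>F k in sequentially. indicat_real ((\<Union>i<k. A i) \<inter> J) x = indicat_real (\<Union> (range A) \<inter> J) x"
              using eventually_gt_at_top[of i] by eventually_elim (use i in \<open>auto simp: indicator_def\<close>)
          qed
        next
          case False
          then show ?thesis by (intro tendsto_eventually always_eventually) (auto simp: indicator_def)
        qed
        show "Z (indicat_real ((\<Union>i<k. A i) \<inter> J))" for k
        proof (induction k)
          case 0
          show ?case by (simp add: Z_def)
        next
          case (Suc k)
          have "Z (\<lambda>x. indicat_real ((\<Union>i<k. A i) \<inter> J) x + indicat_real (A k \<inter> J) x)"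
          proof (rule add[OF _ _ _ _ Suc.IH])
            show "Z (indicat_real (A k \<inter> J))" using union by auto
            show "integrable lborel (\<lambda>x. (indicat_real ((\<Union>i<k. A i) \<inter> J) x)\<^sup>2)" using As by (intro iJ) auto
            show "integrable lborel (\<lambda>x. (indicat_real (A k \<inter> J) x)\<^sup>2)" using As by (intro iJ) auto
          qed (use As in auto)
          also have "(\<lambda>x. indicat_real ((\<Union>i<k. A i) \<inter> J) x + indicat_real (A k \<inter> J) x) = indicat_real ((\<Union>i<Suc k. A i) \<inter> J)"
          proof
            fix x
            have "x \<notin> A i" if "x \<in> A k" "i < k" for i
              using union(1) that unfolding disjoint_family_on_def by (metis IntI UNIV_I empty_iff less_irrefl)
            then show "indicat_real ((\<Union>i<k. A i) \<inter> J) x + indicat_real (A k \<inter> J) x = indicat_real ((\<Union>i<Suc k. A i) \<inter> J) x"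
              by (auto simp: indicator_def less_Suc_eq)
          qed
          finally show ?case .
        qed
      qed
      then show ?case using As by auto
    qed
    then show ?thesis by (simp add: J_def)
  qed
  have Zfin: "Z (indicat_real A)" if A: "A \<in> sets borel" and fin: "integrable lborel (\<lambda>x. (indicat_real A x)\<^sup>2)" for A
  proof (rule dom[OF _ fin])
    show "indicat_real (A \<inter> {- real k<..real k}) \<in> borel_measurable borel" for k using A by simp
    show "\<bar>indicat_real (A \<inter> {- real k<..real k}) x\<bar> \<le> \<bar>indicat_real A x\<bar>" for k x by (auto simp: indicator_def)
    show "Z (indicat_real (A \<inter> {- real k<..real k}))" for k by (rule Zbdd[OF A])
    show "(\<lambda>k. indicat_real (A \<inter> {- real k<..real k}) x) \<longlonglongrightarrow> indicat_real A x" for x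
    proof (rule tendsto_eventually)
      obtain N :: nat where N: "\<bar>x\<bar> < real N" using reals_Archimedean2 by blast
      show "\<forall>\<^sub>F k in sequentially. indicat_real (A \<inter> {- real k<..real k}) x = indicat_real A x"
        using eventually_ge_at_top[of N] by eventually_elim (use N in \<open>auto simp: indicator_def\<close>)
    qed
  qed (use A in simp)
  \<comment> \<open>Square integrability is carried as an implication because the induction rule
    provides only measurability; the pieces inherit it from the function that dominates
    them.\<close>
  have nn: "integrable lborel (\<lambda>x. (\<phi> x)\<^sup>2) \<longrightarrow> Z \<phi>" if "\<phi> \<in> borel_measurable borel" "\<And>x. 0 \<le> \<phi> x" for \<phi>
    using that
  proof (induction rule: borel_measurable_induct_real)
    case (set A)
    then show ?case using Zfin by auto
  next
    case (mult u c)
    show ?case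
    proof (cases "c = 0")
      case False
      then show ?thesis using mult assms by (auto simp: power_mult_distrib intro: \<open>\<And>\<psi> c. Z \<psi> \<Longrightarrow> Z (\<lambda>x. c * \<psi> x)\<close>)
    qed (simp add: Z_def)
  next
    case (add u v)
    show ?case
    proof
      assume I: "integrable lborel (\<lambda>x. (v x + u x)\<^sup>2)"
      have "integrable lborel (\<lambda>x. (u x)\<^sup>2)" "integrable lborel (\<lambda>x. (v x)\<^sup>2)"
        by (rule Bochner_Integration.integrable_bound[OF I];
            use add in \<open>auto intro!: AE_I2 power_mono\<close>)+
      then show "Z (\<lambda>x. v x + u x)"
        using add \<open>\<And>\<psi> \<psi>'. \<lbrakk>\<psi> \<in> borel_measurable borel; integrable lborel (\<lambda>x. (\<psi> x)\<^sup>2);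
           \<psi>' \<in> borel_measurable borel; integrable lborel (\<lambda>x. (\<psi>' x)\<^sup>2); Z \<psi>; Z \<psi>'\<rbrakk> \<Longrightarrow> Z (\<lambda>x. \<psi> x + \<psi>' x)\<close>[of v u] by blast
    qed
  next
    case (seq U)
    have le: "U k x \<le> \<phi> x" for k x
      using seq incseq_le[of "\<lambda>k. U k x"] by (auto simp: incseq_def le_fun_def)
    show ?case
    proof
      assume I: "integrable lborel (\<lambda>x. (\<phi> x)\<^sup>2)"
      show "Z \<phi>"
      proof (rule dom[OF _ I])
        show "\<phi> \<in> borel_measurable borel" by fact
        show "\<bar>U k x\<bar> \<le> \<bar>\<phi> x\<bar>" for k x using le[of k x] seq(2)[of k x] by simp
        have "integrable lborel (\<lambda>x. (U k x)\<^sup>2)" for k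
          by (rule Bochner_Integration.integrable_bound[OF I])
             (use seq le in \<open>auto intro!: AE_I2 power_mono\<close>)
        then show "Z (U k)" for k using seq by blast
      qed (use seq in auto)
    qed
  qed
  have p: "Z (\<lambda>x. max 0 (c * \<phi> x))" if "\<bar>c\<bar> = 1" for c
  proof -
    have "integrable lborel (\<lambda>x. (max 0 (c * \<phi> x))\<^sup>2)"
    proof (rule Bochner_Integration.integrable_bound[OF \<phi>2])
      show "AE x in lborel. norm ((max 0 (c * \<phi> x))\<^sup>2) \<le> norm ((\<phi> x)\<^sup>2)"
      proof (intro AE_I2)
        fix x
        have "\<bar>c * \<phi> x\<bar> = \<bar>\<phi> x\<bar>" using that by (simp add: abs_mult)
        then have "\<bar>max 0 (c * \<phi> x)\<bar> \<le> \<bar>\<phi> x\<bar>" by linarith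
        then show "norm ((max 0 (c * \<phi> x))\<^sup>2) \<le> norm ((\<phi> x)\<^sup>2)" by (simp only: abs_le_square_iff norm_power) (simp add: power_mono)
      qed
    qed (use \<phi> in simp)
    then show ?thesis using nn[of "\<lambda>x. max 0 (c * \<phi> x)"] \<phi> by simp
  qed
  have i2: "integrable lborel (\<lambda>x. (max 0 (c * \<phi> x))\<^sup>2)" if "\<bar>c\<bar> = 1" for c
    by (rule Bochner_Integration.integrable_bound[OF \<phi>2])
      (use that \<phi> in \<open>auto intro!: AE_I2 simp: max_def abs_if power2_eq_square split: if_splits\<close>)
  have "Z (\<lambda>x. max 0 (1 * \<phi> x) + (-1) * max 0 (-1 * \<phi> x))"
    by (rule add[OF _ _ _ _ p mult[OF p]]) (use i2[of 1] i2[of "-1"] \<phi> in auto)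
  moreover have "(\<lambda>x. max 0 (1 * \<phi> x) + (-1) * max 0 (-1 * \<phi> x)) = \<phi>"
    by (auto simp: max_def fun_eq_iff)
  ultimately have "Z \<phi>" by (simp only:)
  then show ?thesis by (simp add: Z_def)
qed

section \<open>Measures on the line\<close>

lemma finite_borel_measureD:
  assumes "finite_borel_measure \<mu>"
  shows "finite_measure \<mu>" "sets \<mu> = sets borel" "space \<mu> = UNIV"
proof -
  show "finite_measure \<mu>" "sets \<mu> = sets borel"
    using assms by (auto simp: finite_borel_measure_def finite_borel_measure_axioms_def)
  then show "space \<mu> = UNIV" using sets_eq_imp_space_eq by fastforce
qed

lemma finite_borel_measureI:
  assumes "sets \<mu> = sets borel" "emeasure \<mu> UNIV < \<infinity>"
  shows "finite_borel_measure \<mu>"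
proof -
  have "space \<mu> = UNIV" using sets_eq_imp_space_eq[OF assms(1)] by simp
  then show ?thesis using assms
    unfolding finite_borel_measure_def finite_borel_measure_axioms_def
    by (auto intro!: finite_measureI)
qed

lemma emeasure_Ico_lprim:
  assumes "finite_borel_measure \<mu>" "a \<le> b"
  shows "emeasure \<mu> {a..<b} = ennreal (lprim \<mu> b - lprim \<mu> a)" "lprim \<mu> a \<le> lprim \<mu> b"
    "measure \<mu> {a..<b} = lprim \<mu> b - lprim \<mu> a"
proof -
  interpret finite_measure \<mu> by (rule finite_borel_measureD(1)[OF assms(1)])
  note [simp] = finite_borel_measureD(2,3)[OF assms(1)]
  have e: "{a..<b} = {..<b} - {..<a}" using assms(2) by auto
  show m: "measure \<mu> {a..<b} = lprim \<mu> b - lprim \<mu> a"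
    unfolding e lprim_def by (rule finite_measure_Diff) (use assms(2) in auto)
  show "emeasure \<mu> {a..<b} = ennreal (lprim \<mu> b - lprim \<mu> a)"
    by (simp add: emeasure_eq_measure m)
  show "lprim \<mu> a \<le> lprim \<mu> b"
    using m measure_nonneg[of \<mu> "{a..<b}"] by simp
qed

lemma lprim_inject:
  assumes "finite_borel_measure \<mu>" "finite_borel_measure \<nu>" "lprim \<mu> = lprim \<nu>"
  shows "\<mu> = \<nu>"
  by (rule measure_eqI_Ico)
     (simp_all add: finite_borel_measureD(2)[OF assms(1)] finite_borel_measureD(2)[OF assms(2)]
       emeasure_Ico_lprim[OF assms(1)] emeasure_Ico_lprim[OF assms(2)] assms(3))

lemma measure_of_lprim_eq:
  assumes "finite_borel_measure \<mu>" "lprim \<mu> = F"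
  shows "measure_of_lprim F = \<mu>"
  unfolding measure_of_lprim_def
proof (rule the_equality)
  show "finite_borel_measure \<mu> \<and> lprim \<mu> = F" using assms by simp
  show "\<nu> = \<mu>" if "finite_borel_measure \<nu> \<and> lprim \<nu> = F" for \<nu>
    by (rule lprim_inject) (use assms that in auto)
qed

text \<open>The case of interest is \<open>msum lborel \<mu>\<close>, whose increments are those of
  \<open>x + lprim \<mu> x\<close>; \<open>y\<close> is the generalised inverse of that
  function.\<close>

definition msum :: "real measure \<Rightarrow> real measure \<Rightarrow> real measure" where
  "msum M N = measure_of UNIV (sets borel) (\<lambda>A. emeasure M A + emeasure N A)"

lemma sets_msum [simp, measurable_cong]: "sets (msum M N) = sets borel"
  unfolding msum_def by (simp add: sets_measure_of sets.sigma_sets_eq[of "borel :: real measure", simplified])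

lemma space_msum [simp]: "space (msum M N) = UNIV"
  unfolding msum_def by (simp add: space_measure_of_conv)

lemma emeasure_msum:
  assumes "sets M = sets borel" "sets N = sets borel" "A \<in> sets borel"
  shows "emeasure (msum M N) A = emeasure M A + emeasure N A"
  unfolding msum_def
proof (rule emeasure_measure_of_sigma)
  show "sigma_algebra (UNIV :: real set) (sets borel)"
    using sets.sigma_algebra_axioms[of "borel :: real measure"] by simp
  show "positive (sets borel) (\<lambda>A. emeasure M A + emeasure N A)"
    by (simp add: positive_def)
  show "countably_additive (sets borel) (\<lambda>A. emeasure M A + emeasure N A)"
  proof (rule countably_additiveI)
    fix A :: "nat \<Rightarrow> real set"
    assume A: "range A \<subseteq> sets borel" "disjoint_family A" "\<Union> (range A) \<in> sets borel"
    have "(\<Sum>i. emeasure M (A i) + emeasure N (A i)) = (\<Sum>i. emeasure M (A i)) + (\<Sum>i. emeasure N (A i))"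
      by (rule suminf_add[symmetric]) auto
    also have "(\<Sum>i. emeasure M (A i)) = emeasure M (\<Union> (range A))"
      by (rule suminf_emeasure) (use A assms in auto)
    also have "(\<Sum>i. emeasure N (A i)) = emeasure N (\<Union> (range A))"
      by (rule suminf_emeasure) (use A assms in auto)
    finally show "(\<Sum>i. emeasure M (A i) + emeasure N (A i)) = emeasure M (\<Union> (range A)) + emeasure N (\<Union> (range A))" .
  qed
qed fact

lemma nn_integral_msum:
  assumes s: "sets M = sets borel" "sets N = sets borel" and f: "f \<in> borel_measurable borel"
  shows "(\<integral>\<^sup>+x. f x \<partial>msum M N) = (\<integral>\<^sup>+x. f x \<partial>M) + (\<integral>\<^sup>+x. f x \<partial>N)"
  using f
proof (induction rule: borel_measurable_induct)
  case (cong f g)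
  then show ?case by simp
next
  case (set A)
  then show ?case using emeasure_msum[OF s] s by simp
next
  case (mult u c)
  have "u \<in> borel_measurable M" "u \<in> borel_measurable N" "u \<in> borel_measurable (msum M N)"
    using mult(2) by (simp_all add: measurable_cong_sets[OF s(1) refl] measurable_cong_sets[OF s(2) refl] measurable_cong_sets[OF sets_msum refl])
  then show ?case using mult by (simp add: nn_integral_cmult distrib_left)
next
  case (add u v)
  have "u \<in> borel_measurable M" "u \<in> borel_measurable N" "u \<in> borel_measurable (msum M N)"
    "v \<in> borel_measurable M" "v \<in> borel_measurable N" "v \<in> borel_measurable (msum M N)"
    using add by (simp_all add: measurable_cong_sets[OF s(1) refl] measurable_cong_sets[OF s(2) refl] measurable_cong_sets[OF sets_msum refl])
  then show ?case using add by (simp add: nn_integral_add ac_simps)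
next
  case (seq U)
  have m: "U i \<in> borel_measurable M" "U i \<in> borel_measurable N" "U i \<in> borel_measurable (msum M N)" for i
    using seq(1)[of i] by (simp_all add: measurable_cong_sets[OF s(1) refl] measurable_cong_sets[OF s(2) refl] measurable_cong_sets[OF sets_msum refl])
  have inc: "incseq (\<lambda>i. \<integral>\<^sup>+x. U i x \<partial>M)" "incseq (\<lambda>i. \<integral>\<^sup>+x. U i x \<partial>N)"
    using \<open>incseq U\<close> by (auto simp: incseq_def le_fun_def intro!: nn_integral_mono)
  have *: "(\<integral>\<^sup>+x. (\<Squnion> (range U)) x \<partial>L) = (\<Squnion>i. \<integral>\<^sup>+x. U i x \<partial>L)" if "\<And>i. U i \<in> borel_measurable L" for L
    using nn_integral_monotone_convergence_SUP[OF \<open>incseq U\<close> that] by (simp add: image_comp SUP_apply)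
  show ?case
    unfolding *[OF m(1)] *[OF m(2)] *[OF m(3)] using ennreal_SUP_add[OF inc] seq by simp
qed

section \<open>Existence and uniqueness of the Lebesgue decomposition\<close>

lemma lebesgue_decompositionD:
  assumes "lebesgue_decomposition \<mu> a s"
  shows "finite_borel_measure a" "finite_borel_measure s" "absolutely_continuous lborel a"
    "\<exists>N \<in> null_sets lborel. emeasure s (- N) = 0"
    "A \<in> sets borel \<Longrightarrow> emeasure \<mu> A = emeasure a A + emeasure s A"
  using assms by (auto simp: lebesgue_decomposition_def)

text \<open>Off a carrier of the singular part only the absolutely continuous part is seen. The
  extra null set \<open>N'\<close> leaves room for the carrier of a second decomposition, so that
  both can be compared on the same set.\<close>

lemma lebesgue_decomposition_ac_eq:
  assumes D: "lebesgue_decomposition \<mu> a s" and N: "N \<in> null_sets lborel" "emeasure s (- N) = 0"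
    and A: "A \<in> sets borel" and N': "N' \<in> null_sets lborel"
  shows "emeasure a A = emeasure \<mu> (A - (N \<union> N'))"
proof -
  have b: "N \<in> sets borel" "N' \<in> sets borel" using N N' by auto
  note [simp] = finite_borel_measureD(2)[OF lebesgue_decompositionD(1)[OF D]]
     finite_borel_measureD(2)[OF lebesgue_decompositionD(2)[OF D]]
  have "N \<union> N' \<in> null_sets a"
    using lebesgue_decompositionD(3)[OF D] N N' unfolding absolutely_continuous_def by blast
  then have "emeasure a A = emeasure a (A - (N \<union> N'))"
    by (simp add: emeasure_Diff_null_set A)
  moreover have "emeasure s (A - (N \<union> N')) \<le> emeasure s (- N)"
    using b by (intro emeasure_mono) auto
  ultimately show ?thesis
    using lebesgue_decompositionD(5)[OF D, of "A - (N \<union> N')"] N A b by simp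
qed

lemma lebesgue_decomposition_unique:
  assumes D: "lebesgue_decomposition \<mu> a s" and D': "lebesgue_decomposition \<mu> a' s'"
  shows "a = a'" "s = s'"
proof -
  note [simp] = finite_borel_measureD(2)[OF lebesgue_decompositionD(1)[OF D]]
     finite_borel_measureD(2)[OF lebesgue_decompositionD(2)[OF D]]
     finite_borel_measureD(2)[OF lebesgue_decompositionD(1)[OF D']]
     finite_borel_measureD(2)[OF lebesgue_decompositionD(2)[OF D']]
  obtain N where N: "N \<in> null_sets lborel" "emeasure s (- N) = 0" using lebesgue_decompositionD(4)[OF D] by auto
  obtain N' where N': "N' \<in> null_sets lborel" "emeasure s' (- N') = 0" using lebesgue_decompositionD(4)[OF D'] by auto
  have a: "emeasure a A = emeasure a' A" if "A \<in> sets borel" for A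
    using lebesgue_decomposition_ac_eq[OF D N that N'(1)] lebesgue_decomposition_ac_eq[OF D' N' that N(1)]
    by (simp add: Un_commute)
  then show "a = a'" by (intro measure_eqI) auto
  show "s = s'"
  proof (rule measure_eqI)
    fix A assume "A \<in> sets s"
    then have A: "A \<in> sets borel" by simp
    have fin: "emeasure a A \<noteq> \<infinity>"
      using finite_measure.emeasure_finite[OF finite_borel_measureD(1)[OF lebesgue_decompositionD(1)[OF D]]] by simp
    show "emeasure s A = emeasure s' A"
      using lebesgue_decompositionD(5)[OF D A] lebesgue_decompositionD(5)[OF D' A] a[OF A] fin
      by (simp add: ennreal_add_left_cancel)
  qed simp
qed

text \<open>Let \<open>g\<close> be the density of Lebesgue measure with respect to
  \<open>m = msum lborel \<mu>\<close>. Its zero set \<open>K\<close> is Lebesgue null, so \<mu>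
  restricted to \<open>K\<close> is singular. Outside \<open>K\<close> the density is positive, so
  Lebesgue null sets are null for \<open>m\<close> and hence for \<mu>.\<close>

lemma lebesgue_decomposition_exists:
  assumes \<mu>: "finite_borel_measure \<mu>"
  shows "\<exists>a s. lebesgue_decomposition \<mu> a s"
proof -
  interpret finite_measure \<mu> by (rule finite_borel_measureD(1)[OF \<mu>])
  note [simp] = finite_borel_measureD(2,3)[OF \<mu>]
  have [measurable_cong]: "sets \<mu> = sets borel" by simp
  define m where "m = msum lborel \<mu>"
  have em: "emeasure m A = emeasure lborel A + emeasure \<mu> A" if "A \<in> sets borel" for A
    unfolding m_def by (rule emeasure_msum) (use that in auto)
  have [simp]: "sets m = sets borel" by (simp add: m_def)
  have "space m = UNIV" by (simp add: m_def)
  interpret m: sigma_finite_measure m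
  proof
    have "emeasure m {- real n..real n} \<noteq> \<infinity>" for n
      by (simp add: em)
    moreover have "(\<Union>n. {- real n..real n}) = UNIV"
    proof -
      have "\<exists>n. - real n \<le> x \<and> x \<le> real n" for x
        using real_arch_simple[of "\<bar>x\<bar>"] by (auto simp: abs_le_iff minus_le_iff)
      then show ?thesis by auto
    qed
    ultimately show "\<exists>A. countable A \<and> A \<subseteq> sets m \<and> \<Union> A = space m \<and> (\<forall>a\<in>A. emeasure m a \<noteq> \<infinity>)"
      using \<open>space m = UNIV\<close> by (intro exI[of _ "range (\<lambda>n. {- real n..real n})"]) auto
  qed
  have "absolutely_continuous m lborel"
    unfolding absolutely_continuous_def by (auto simp: null_sets_def em)
  then have d: "density m (RN_deriv m lborel) = lborel"
    by (rule m.density_RN_deriv) simp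
  define g where "g = RN_deriv m lborel"
  have g[measurable]: "g \<in> borel_measurable borel"
    using borel_measurable_RN_deriv[of m lborel] unfolding g_def
    by (simp add: measurable_cong_sets[OF \<open>sets m = sets borel\<close> refl])
  define K where "K = {x. g x = 0}"
  have K[measurable]: "K \<in> sets borel" unfolding K_def by simp
  have gl: "(\<integral>\<^sup>+x. g x * indicator A x \<partial>m) = emeasure lborel A" if "A \<in> sets borel" for A
    using that by (subst d[symmetric], subst emeasure_density) (auto simp: g_def[symmetric] measurable_cong_sets[OF \<open>sets m = sets borel\<close> refl])
  have K0: "K \<in> null_sets lborel"
  proof -
    have "(\<integral>\<^sup>+x. g x * indicator K x \<partial>m) = (\<integral>\<^sup>+x. 0 \<partial>m)"
      by (intro nn_integral_cong) (auto simp: K_def indicator_def)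
    then show ?thesis using gl[OF K] K by (simp add: null_sets_def)
  qed
  have ea: "emeasure (density \<mu> (indicator B)) A = emeasure \<mu> (A \<inter> B)" if "A \<in> sets borel" "B \<in> sets borel" for A B
    using that by (subst emeasure_density) (auto simp: indicator_inter_arith[symmetric] Int_commute)
  have fin: "finite_borel_measure (density \<mu> (indicator B))" if "B \<in> sets borel" for B
  proof (rule finite_borel_measureI)
    show "emeasure (density \<mu> (indicator B)) UNIV < \<infinity>"
      using ea[of UNIV B] that emeasure_finite[of B] unfolding infinity_ennreal_def less_top by simp
  qed simp
  have "lebesgue_decomposition \<mu> (density \<mu> (indicator (- K))) (density \<mu> (indicator K))"
    unfolding lebesgue_decomposition_def
  proof (intro conjI ballI)
    show "finite_borel_measure (density \<mu> (indicator (- K)))" "finite_borel_measure (density \<mu> (indicator K))"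
      by (auto intro!: fin)
    show "\<exists>N\<in>null_sets lborel. emeasure (density \<mu> (indicator K)) (- N) = 0"
      using K0 by (intro bexI[of _ K]) (auto simp: ea)
    show "absolutely_continuous lborel (density \<mu> (indicator (- K)))"
      unfolding absolutely_continuous_def
    proof
      fix N assume N: "N \<in> null_sets (lborel :: real measure)"
      then have Nb[measurable]: "N \<in> sets borel" by auto
      have "(\<integral>\<^sup>+x. g x * indicator N x \<partial>m) = 0" using gl[OF Nb] N by auto
      then have "AE x in m. g x * indicator N x = 0"
        by (subst (asm) nn_integral_0_iff_AE) (auto simp: measurable_cong_sets[OF \<open>sets m = sets borel\<close> refl])
      then have "AE x in m. x \<notin> N - K" by eventually_elim (auto simp: K_def indicator_def split: if_splits)
      then have "N - K \<in> null_sets m"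
        by (subst (asm) AE_iff_null_sets[symmetric]) auto
      then have "emeasure \<mu> (N - K) = 0" using em[of "N - K"] by (auto simp: null_sets_def)
      then show "N \<in> null_sets (density \<mu> (indicator (- K)))"
        using ea[of N "- K"] by (simp add: null_sets_def Diff_eq)
    qed
    fix A :: "real set" assume A: "A \<in> sets borel"
    have "emeasure \<mu> A = emeasure \<mu> (A \<inter> - K) + emeasure \<mu> (A \<inter> K)"
      using A by (subst plus_emeasure) (auto intro!: arg_cong[where f = "emeasure \<mu>"])
    then show "emeasure \<mu> A = emeasure (density \<mu> (indicator (- K))) A + emeasure (density \<mu> (indicator K)) A"
      using A by (simp add: ea)
  qed
  then show ?thesis by blast
qed

lemma lebesgue_decomposition_parts:
  assumes "lebesgue_decomposition \<mu> a s"
  shows "ac_part \<mu> = a" "sing_part \<mu> = s"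
  unfolding ac_part_def sing_part_def
  using lebesgue_decomposition_unique[OF assms] assms by (blast intro!: the_equality)+

section \<open>Lagrangian coordinates of an Eulerian state\<close>

text \<open>A state whose two measures coincide, with an explicit representative \<open>v\<close> of
  \<open>u\<^sub>x\<close> and an explicit carrier \<open>K\<close> of the singular part, so that
  densities can be defined pointwise. Both the initial datum and its projection are
  instances.\<close>

locale eulerian_data =
  fixes u v :: "real \<Rightarrow> real" and \<mu> \<mu>s :: "real measure" and K :: "real set"
  assumes primitive_u: "primitive u v"
    and v2: "integrable lborel (\<lambda>x. (v x)\<^sup>2)"
    and fin: "finite_borel_measure \<mu>" "finite_borel_measure \<mu>s"
    and K: "K \<in> null_sets lborel" "emeasure \<mu>s (- K) = 0"
    and dec: "\<And>A. A \<in> sets borel \<Longrightarrow>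
      emeasure \<mu> A = emeasure (density lborel (\<lambda>x. ennreal ((v x)\<^sup>2))) A + emeasure \<mu>s A"
begin

sublocale \<mu>: finite_borel_measure \<mu> by (rule fin)

definition y :: "real \<Rightarrow> real" where "y \<xi> = Sup {x. x + lprim \<mu> x < \<xi>}"

text \<open>The density of Lebesgue measure with respect to \<open>m\<close>: off \<open>K\<close>
  the measure \<open>m\<close> is \<open>1 + v\<^sup>2\<close> times Lebesgue measure, and
  \<open>K\<close> carries no Lebesgue measure. Likewise \<open>h\<close> is the density of \<mu>,
  and \<open>p\<close>, \<open>h\<close>, \<open>q\<close> composed with \<open>y\<close> are the
  derivatives of \<open>y\<close>, \<open>H\<close> and \<open>U\<close>.\<close>

definition p :: "real \<Rightarrow> real" where "p x = indicator (- K) x / (1 + (v x)\<^sup>2)"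

definition h :: "real \<Rightarrow> real" where "h x = 1 - p x"

definition q :: "real \<Rightarrow> real" where "q x = v x * p x"

definition m :: "real measure" where "m = msum lborel \<mu>"

lemma sets_\<mu> [simp, measurable_cong]: "sets \<mu> = sets borel" "sets \<mu>s = sets borel"
  using fin finite_borel_measureD(2) by auto

lemma space_\<mu> [simp]: "space \<mu> = UNIV" "space \<mu>s = UNIV"
  using fin finite_borel_measureD(3) by auto

lemma sets_m [simp, measurable_cong]: "sets m = sets borel" by (simp add: m_def)

lemma space_m [simp]: "space m = UNIV" by (simp add: m_def)

lemma v_measurable [measurable]: "v \<in> borel_measurable borel"
  by (rule primitiveD(2)[OF primitive_u])

lemma K_measurable [measurable]: "K \<in> sets borel" using K by auto

lemma p_measurable [measurable]: "p \<in> borel_measurable borel" unfolding p_def by measurable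

lemma h_measurable [measurable]: "h \<in> borel_measurable borel" unfolding h_def by measurable

lemma q_measurable [measurable]: "q \<in> borel_measurable borel" unfolding q_def by measurable

lemma one_plus_square_pos: "0 < 1 + (v x)\<^sup>2" by (simp add: add_pos_nonneg)

lemma p_bounds: "0 \<le> p x" "p x \<le> 1"
  using one_plus_square_pos[of x] by (auto simp: p_def indicator_def divide_simps)

lemma h_bounds: "0 \<le> h x" "h x \<le> 1"
  using p_bounds[of x] by (auto simp: h_def)

lemma p_plus_h: "p x + h x = 1" by (simp add: h_def)

lemma q_square: "(q x)\<^sup>2 = p x * h x"
proof (cases "x \<in> K")
  case False
  have "h x = (v x)\<^sup>2 * p x"
    using one_plus_square_pos[of x] False by (simp add: h_def p_def divide_simps)
  then show ?thesis by (simp add: q_def power_mult_distrib power2_eq_square)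
qed (simp add: q_def p_def)

lemma lprim_bounds: "0 \<le> lprim \<mu> x" "lprim \<mu> x \<le> measure \<mu> UNIV"
  using \<mu>.bounded_measure[of "{..<x}"] by (auto simp: lprim_def)

lemma lprim_mono: "a \<le> b \<Longrightarrow> lprim \<mu> a \<le> lprim \<mu> b"
  by (rule emeasure_Ico_lprim(2)[OF fin(1)])

section \<open>The generalised inverse \<open>y\<close> and the derivatives of the Lagrangian
  variables\<close>

lemma y_set: "{x. x + lprim \<mu> x < \<xi>} \<noteq> {}" "bdd_above {x. x + lprim \<mu> x < \<xi>}"
proof -
  have "\<xi> - measure \<mu> UNIV - 1 \<in> {x. x + lprim \<mu> x < \<xi>}"
    using lprim_bounds(2)[of "\<xi> - measure \<mu> UNIV - 1"] by simp
  then show "{x. x + lprim \<mu> x < \<xi>} \<noteq> {}" by blast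
  show "bdd_above {x. x + lprim \<mu> x < \<xi>}"
    by (rule bdd_aboveI[of _ \<xi>]) (use lprim_bounds(1) in \<open>smt (verit) mem_Collect_eq\<close>)
qed

lemma y_ge: "x + lprim \<mu> x < \<xi> \<Longrightarrow> x \<le> y \<xi>"
  unfolding y_def by (rule cSup_upper) (use y_set in auto)

lemma y_le: "\<xi> \<le> x + lprim \<mu> x \<Longrightarrow> y \<xi> \<le> x"
  unfolding y_def
proof (rule cSup_least[OF y_set(1)])
  fix z assume "\<xi> \<le> x + lprim \<mu> x" "z \<in> {z. z + lprim \<mu> z < \<xi>}"
  then show "z \<le> x" using lprim_mono[of x z] by (cases "z \<le> x") auto
qed

text \<open>Strictness comes from left continuity of \<open>lprim\<close>: the hypothesis survives
  at some point slightly to the left of \<open>x\<close>, to which \<open>y_le\<close>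
  applies.\<close>

lemma y_less: assumes "\<xi> < x + lprim \<mu> x" shows "y \<xi> < x"
proof -
  have "((\<lambda>z. z + cdf \<mu> z) \<longlongrightarrow> x + measure \<mu> {..<x}) (at_left x)"
    by (intro tendsto_intros \<mu>.cdf_at_left)
  then have "\<forall>\<^sub>F z in at_left x. \<xi> < z + cdf \<mu> z"
    by (rule order_tendstoD(1)) (use assms in \<open>simp add: lprim_def\<close>)
  then obtain b where b: "b < x" "\<And>z. b < z \<Longrightarrow> z < x \<Longrightarrow> \<xi> < z + cdf \<mu> z"
    by (auto simp: eventually_at_left_field)
  obtain z where z: "b < z" "z < x" using dense[OF b(1)] by auto
  obtain z' where z': "z < z'" "z' < x" using dense[OF z(2)] by auto
  have "cdf \<mu> z \<le> lprim \<mu> z'"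
    unfolding cdf_def lprim_def using z' by (intro \<mu>.finite_measure_mono) auto
  then have "y \<xi> \<le> z'" using b(2)[OF z] z' by (intro y_le) simp
  then show ?thesis using z' by simp
qed

lemma y_mono: "mono y"
proof (rule monoI)
  fix a b :: real assume "a \<le> b"
  then show "y a \<le> y b" unfolding y_def
    by (intro cSup_subset_mono y_set) auto
qed

lemma y_measurable [measurable]: "y \<in> borel_measurable borel"
  by (rule borel_measurable_mono[OF y_mono])

lemma y_upper: "y \<xi> \<le> \<xi>" by (rule y_le) (simp add: lprim_bounds)

lemma y_lower: "y \<xi> < x \<Longrightarrow> \<xi> - x \<le> lprim \<mu> x"
  using y_ge[of x \<xi>] by linarith

lemma emeasure_m: "A \<in> sets borel \<Longrightarrow> emeasure m A = emeasure lborel A + emeasure \<mu> A"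
  unfolding m_def by (rule emeasure_msum) auto

text \<open>The quantile transform. The preimage of \<open>{a..<b}\<close> lies between the open and
  the closed interval with end points \<open>a + lprim \<mu> a\<close> and
  \<open>b + lprim \<mu> b\<close>, which have equal length.\<close>

lemma distr_y: "distr lborel borel y = m"
proof (rule measure_eqI_Ico)
  fix a b :: real assume ab: "a \<le> b"
  have m: "emeasure m {a..<b} = ennreal ((b + lprim \<mu> b) - (a + lprim \<mu> a))"
    using ab emeasure_Ico_lprim[OF fin(1) ab] by (simp add: emeasure_m algebra_simps flip: ennreal_plus)
  have le: "a + lprim \<mu> a \<le> b + lprim \<mu> b" using lprim_mono[OF ab] ab by simp
  have d: "emeasure (distr lborel borel y) {a..<b} = emeasure lborel (y -` {a..<b})"
    by (subst emeasure_distr) auto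
  have Sm[measurable]: "y -` {a..<b} \<in> sets borel"
    using measurable_sets[OF y_measurable, of "{a..<b}"] by simp
  have "emeasure lborel {a + lprim \<mu> a<..<b + lprim \<mu> b} \<le> emeasure lborel (y -` {a..<b})"
    using y_ge y_less by (intro emeasure_mono) auto
  moreover have "emeasure lborel (y -` {a..<b}) \<le> emeasure lborel {a + lprim \<mu> a..b + lprim \<mu> b}"
  proof (rule emeasure_mono)
    show "y -` {a..<b} \<subseteq> {a + lprim \<mu> a..b + lprim \<mu> b}"
      using y_less[of _ a] y_ge[of b] by (force simp: not_less not_le)
  qed auto
  ultimately show "emeasure (distr lborel borel y) {a..<b} = emeasure m {a..<b}"
    using le unfolding d m by (simp add: order_antisym)
  then show "emeasure (distr lborel borel y) {a..<b} < \<infinity>" unfolding m by simp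
qed auto

lemma nn_integral_m:
  assumes [measurable]: "f \<in> borel_measurable borel"
  shows "(\<integral>\<^sup>+x. f x \<partial>m) = (\<integral>\<^sup>+x. f x \<partial>lborel) + (\<integral>\<^sup>+x. f x \<partial>\<mu>)"
  unfolding m_def by (rule nn_integral_msum) auto

lemma \<mu>_eq_msum: "\<mu> = msum (density lborel (\<lambda>x. ennreal ((v x)\<^sup>2))) \<mu>s"
  by (rule measure_eqI) (simp_all add: dec emeasure_msum)

lemma nn_integral_\<mu>:
  assumes [measurable]: "f \<in> borel_measurable borel"
  shows "(\<integral>\<^sup>+x. f x \<partial>\<mu>) = (\<integral>\<^sup>+x. ennreal ((v x)\<^sup>2) * f x \<partial>lborel) + (\<integral>\<^sup>+x. f x \<partial>\<mu>s)"
  by (subst \<mu>_eq_msum, subst nn_integral_msum) (auto simp: nn_integral_density)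

lemma AE_lborel_K: "AE x in lborel. x \<notin> K" by (rule AE_not_in[OF K(1)])

lemma AE_\<mu>s_K: "AE x in \<mu>s. x \<in> K"
  by (rule AE_I[where N = "- K"]) (use K(2) in auto)

text \<open>Split \<open>m\<close> into Lebesgue measure, \<open>v\<^sup>2\<close> times Lebesgue
  measure and \<open>\<mu>s\<close>. The factor \<open>p\<close> vanishes on \<open>K\<close>, which
  carries \<open>\<mu>s\<close>, and \<open>p * (1 + v\<^sup>2) = 1\<close> off
  \<open>K\<close>.\<close>

lemma density_m_p: "density m (\<lambda>x. ennreal (p x)) = lborel"
proof (rule measure_eqI)
  fix A assume "A \<in> sets (density m (\<lambda>x. ennreal (p x)))"
  then have [measurable]: "A \<in> sets borel" by simp
  have "emeasure (density m (\<lambda>x. ennreal (p x))) A = (\<integral>\<^sup>+x. ennreal (p x) * indicator A x \<partial>m)"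
    by (subst emeasure_density) auto
  also have "\<dots> = (\<integral>\<^sup>+x. ennreal (p x) * indicator A x \<partial>lborel)
     + ((\<integral>\<^sup>+x. ennreal ((v x)\<^sup>2) * (ennreal (p x) * indicator A x) \<partial>lborel)
      + (\<integral>\<^sup>+x. ennreal (p x) * indicator A x \<partial>\<mu>s))"
    by (simp add: nn_integral_m nn_integral_\<mu>)
  also have "(\<integral>\<^sup>+x. ennreal (p x) * indicator A x \<partial>\<mu>s) = (\<integral>\<^sup>+x. 0 \<partial>\<mu>s)"
    by (rule nn_integral_cong_AE) (use AE_\<mu>s_K in eventually_elim, simp add: p_def)
  also have "(\<integral>\<^sup>+x. ennreal (p x) * indicator A x \<partial>lborel)
     + ((\<integral>\<^sup>+x. ennreal ((v x)\<^sup>2) * (ennreal (p x) * indicator A x) \<partial>lborel) + (\<integral>\<^sup>+x. 0 \<partial>\<mu>s))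
     = (\<integral>\<^sup>+x. ennreal (p x) * indicator A x + ennreal ((v x)\<^sup>2) * (ennreal (p x) * indicator A x) \<partial>lborel)"
    by (subst nn_integral_add) auto
  also have "\<dots> = (\<integral>\<^sup>+x. indicator A x \<partial>lborel)"
  proof (rule nn_integral_cong_AE, use AE_lborel_K in eventually_elim)
    fix x assume x: "x \<notin> K"
    have "p x + (v x)\<^sup>2 * p x = 1" using x one_plus_square_pos[of x] by (simp add: p_def divide_simps)
    then have "ennreal (p x) + ennreal ((v x)\<^sup>2) * ennreal (p x) = 1"
      using p_bounds[of x] by (simp flip: ennreal_plus ennreal_mult)
    then show "ennreal (p x) * indicator A x + ennreal ((v x)\<^sup>2) * (ennreal (p x) * indicator A x) = indicator A x"
      by (simp add: indicator_def)
  qed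
  finally show "emeasure (density m (\<lambda>x. ennreal (p x))) A = emeasure lborel A" by simp
qed simp

text \<open>The same splitting, now with \<open>h = 1\<close> on \<open>K\<close> and
  \<open>h * (1 + v\<^sup>2) = v\<^sup>2\<close> off \<open>K\<close>.\<close>

lemma density_m_h: "density m (\<lambda>x. ennreal (h x)) = \<mu>"
proof (rule measure_eqI)
  fix A assume "A \<in> sets (density m (\<lambda>x. ennreal (h x)))"
  then have [measurable]: "A \<in> sets borel" by simp
  have "emeasure (density m (\<lambda>x. ennreal (h x))) A = (\<integral>\<^sup>+x. ennreal (h x) * indicator A x \<partial>m)"
    by (subst emeasure_density) auto
  also have "\<dots> = (\<integral>\<^sup>+x. ennreal (h x) * indicator A x \<partial>lborel)
     + ((\<integral>\<^sup>+x. ennreal ((v x)\<^sup>2) * (ennreal (h x) * indicator A x) \<partial>lborel)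
      + (\<integral>\<^sup>+x. ennreal (h x) * indicator A x \<partial>\<mu>s))"
    by (simp add: nn_integral_m nn_integral_\<mu>)
  also have "\<dots> = ((\<integral>\<^sup>+x. ennreal (h x) * indicator A x \<partial>lborel)
     + (\<integral>\<^sup>+x. ennreal ((v x)\<^sup>2) * (ennreal (h x) * indicator A x) \<partial>lborel))
      + (\<integral>\<^sup>+x. ennreal (h x) * indicator A x \<partial>\<mu>s)"
    by (simp only: add.assoc)
  also have "(\<integral>\<^sup>+x. ennreal (h x) * indicator A x \<partial>\<mu>s) = (\<integral>\<^sup>+x. indicator A x \<partial>\<mu>s)"
    by (rule nn_integral_cong_AE) (use AE_\<mu>s_K in eventually_elim, simp add: p_def h_def)
  also have "(\<integral>\<^sup>+x. ennreal (h x) * indicator A x \<partial>lborel)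
     + (\<integral>\<^sup>+x. ennreal ((v x)\<^sup>2) * (ennreal (h x) * indicator A x) \<partial>lborel)
     = (\<integral>\<^sup>+x. ennreal (h x) * indicator A x + ennreal ((v x)\<^sup>2) * (ennreal (h x) * indicator A x) \<partial>lborel)"
    by (subst nn_integral_add) auto
  also have "\<dots> = (\<integral>\<^sup>+x. ennreal ((v x)\<^sup>2) * indicator A x \<partial>lborel)"
  proof (rule nn_integral_cong_AE, use AE_lborel_K in eventually_elim)
    fix x assume x: "x \<notin> K"
    have "h x + (v x)\<^sup>2 * h x = (v x)\<^sup>2"
      using x one_plus_square_pos[of x] by (simp add: p_def h_def divide_simps) (simp add: algebra_simps)
    then have "ennreal (h x) + ennreal ((v x)\<^sup>2) * ennreal (h x) = ennreal ((v x)\<^sup>2)"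
      using h_bounds[of x] by (simp flip: ennreal_plus ennreal_mult)
    then show "ennreal (h x) * indicator A x + ennreal ((v x)\<^sup>2) * (ennreal (h x) * indicator A x) = ennreal ((v x)\<^sup>2) * indicator A x"
      by (simp add: indicator_def)
  qed
  also have "\<dots> + (\<integral>\<^sup>+x. indicator A x \<partial>\<mu>s) = emeasure \<mu> A"
    by (simp add: dec emeasure_density)
  finally show "emeasure (density m (\<lambda>x. ennreal (h x))) A = emeasure \<mu> A" .
qed simp

lemma push_h:
  assumes [measurable]: "f \<in> borel_measurable borel"
  shows "(\<integral>\<^sup>+\<xi>. ennreal (h (y \<xi>)) * f (y \<xi>) \<partial>lborel) = (\<integral>\<^sup>+x. f x \<partial>\<mu>)"
proof -
  have "(\<integral>\<^sup>+x. f x \<partial>\<mu>) = (\<integral>\<^sup>+x. ennreal (h x) * f x \<partial>m)"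
    by (subst density_m_h[symmetric], subst nn_integral_density) auto
  also have "\<dots> = (\<integral>\<^sup>+\<xi>. ennreal (h (y \<xi>)) * f (y \<xi>) \<partial>lborel)"
    by (subst distr_y[symmetric], subst nn_integral_distr) auto
  finally show ?thesis by simp
qed

lemma h_y_integrable: "integrable lborel (\<lambda>\<xi>. h (y \<xi>))"
  and integral_h_y: "(LBINT \<xi>. h (y \<xi>)) = measure \<mu> UNIV"
proof -
  have "(\<integral>\<^sup>+\<xi>. ennreal (h (y \<xi>)) \<partial>lborel) = ennreal (measure \<mu> UNIV)"
    using push_h[of "\<lambda>_. 1"] by (simp add: \<mu>.emeasure_eq_measure)
  then have "has_bochner_integral lborel (\<lambda>\<xi>. h (y \<xi>)) (measure \<mu> UNIV)"
    using h_bounds by (intro has_bochner_integral_nn_integral) auto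
  then show "integrable lborel (\<lambda>\<xi>. h (y \<xi>))" "(LBINT \<xi>. h (y \<xi>)) = measure \<mu> UNIV"
    by (auto simp: has_bochner_integral_iff)
qed

text \<open>\<open>y\<close> may be constant on an interval, namely over an atom of \<mu>. Since
  Lebesgue measure has no atoms, \<open>p\<close> vanishes almost everywhere on each such level set,
  so ambiguities at the ends of an interval cost nothing.\<close>

lemma AE_plateau: "AE \<xi> in lborel. p (y \<xi>) = 0 \<or> y \<xi> \<noteq> c"
proof -
  have "(\<integral>\<^sup>+\<xi>. ennreal (p (y \<xi>)) * indicator {c} (y \<xi>) \<partial>lborel) = (\<integral>\<^sup>+x. ennreal (p x) * indicator {c} x \<partial>m)"
    by (subst distr_y[symmetric], subst nn_integral_distr) auto
  also have "\<dots> = emeasure (density m (\<lambda>x. ennreal (p x))) {c}"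
    by (subst emeasure_density) auto
  also have "\<dots> = 0" by (simp add: density_m_p)
  finally have "AE \<xi> in lborel. ennreal (p (y \<xi>)) * indicator {c} (y \<xi>) = 0"
    by (subst (asm) nn_integral_0_iff_AE) auto
  then show ?thesis
    by eventually_elim (use p_bounds in \<open>auto simp: indicator_def order_antisym split: if_splits\<close>)
qed

text \<open>A chain rule without differentiating \<open>y\<close>: the increment of \<open>W\<close>
  between \<open>y \<xi>1\<close> and \<open>y \<xi>2\<close> is an integral against Lebesgue
  measure, rewritten as density \<open>p\<close> on \<open>m\<close> and pulled back by
  \<open>y\<close>. Off the two plateaus, \<open>y \<xi>\<close> lies between the end values exactly
  when \<xi> lies between \<open>\<xi>1\<close> and \<open>\<xi>2\<close>.\<close>

lemma primitive_comp_y: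
  assumes W: "primitive W w"
  shows "primitive (\<lambda>\<xi>. W (y \<xi>)) (\<lambda>\<xi>. w (y \<xi>) * p (y \<xi>))"
proof -
  have [measurable]: "w \<in> borel_measurable borel" by (rule primitiveD(2)[OF W])
  have main: "set_integrable lborel {\<xi>1..\<xi>2} (\<lambda>\<xi>. w (y \<xi>) * p (y \<xi>)) \<and>
      W (y \<xi>2) - W (y \<xi>1) = (LBINT \<xi>:{\<xi>1..\<xi>2}. w (y \<xi>) * p (y \<xi>))" if le: "\<xi>1 \<le> \<xi>2" for \<xi>1 \<xi>2
  proof -
    define a b where "a = y \<xi>1" and "b = y \<xi>2"
    have ab: "a \<le> b" using y_mono le by (auto simp: a_def b_def mono_def)
    let ?f = "\<lambda>x. indicat_real {a<..b} x * w x"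
    have fm: "?f \<in> borel_measurable borel" by measurable
    have "integrable lborel (\<lambda>x. indicat_real {a..b} x * w x)"
      using primitiveD(4)[OF W, of a b] by (simp add: set_integrable_def)
    then have fi: "integrable lborel ?f"
      by (rule Bochner_Integration.integrable_bound) (auto simp: indicator_def)
    have "integrable (density m (\<lambda>x. ennreal (p x))) ?f" using fi by (simp add: density_m_p)
    then have "integrable m (\<lambda>x. p x *\<^sub>R ?f x)"
      by (subst (asm) integrable_density) (use p_bounds in auto)
    then have i: "integrable lborel (\<lambda>\<xi>. p (y \<xi>) *\<^sub>R ?f (y \<xi>))"
      unfolding distr_y[symmetric] by (subst (asm) integrable_distr_eq) auto
    have "W b - W a = (LBINT x. ?f x)"
      using primitiveD(3)[OF W ab] set_integral_Ioc[of w a b] by (simp add: set_lebesgue_integral_def)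
    also have "\<dots> = (\<integral>x. ?f x \<partial>density m (\<lambda>x. ennreal (p x)))" by (simp add: density_m_p)
    also have "\<dots> = (\<integral>x. p x *\<^sub>R ?f x \<partial>m)"
      by (rule integral_density) (use p_bounds in auto)
    also have "\<dots> = (LBINT \<xi>. p (y \<xi>) *\<^sub>R ?f (y \<xi>))"
      unfolding distr_y[symmetric] by (subst integral_distr) auto
    finally have e: "W b - W a = (LBINT \<xi>. p (y \<xi>) *\<^sub>R ?f (y \<xi>))" .
    have ae: "AE \<xi> in lborel. p (y \<xi>) *\<^sub>R ?f (y \<xi>) = indicat_real {\<xi>1..\<xi>2} \<xi> *\<^sub>R (w (y \<xi>) * p (y \<xi>))"
      using AE_plateau[of a] AE_plateau[of b]
    proof eventually_elim
      case (elim \<xi>)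
      show ?case
      proof (cases "p (y \<xi>) = 0")
        case False
        then have ne: "y \<xi> \<noteq> a" "y \<xi> \<noteq> b" using elim by auto
        have "y \<xi> \<in> {a<..b} \<longleftrightarrow> \<xi> \<in> {\<xi>1..\<xi>2}"
          using ne y_mono[THEN monoD, of \<xi> \<xi>1] y_mono[THEN monoD, of \<xi>1 \<xi>]
            y_mono[THEN monoD, of \<xi> \<xi>2] y_mono[THEN monoD, of \<xi>2 \<xi>]
          unfolding a_def b_def by (simp only: greaterThanAtMost_iff atLeastAtMost_iff) linarith
        then show ?thesis by (auto simp: indicator_def)
      qed simp
    qed
    have "integrable lborel (\<lambda>\<xi>. indicat_real {\<xi>1..\<xi>2} \<xi> *\<^sub>R (w (y \<xi>) * p (y \<xi>)))"
      using i by (subst (asm) integrable_cong_AE[OF _ _ ae]) auto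
    moreover have "(LBINT \<xi>. p (y \<xi>) *\<^sub>R ?f (y \<xi>)) = (LBINT \<xi>. indicat_real {\<xi>1..\<xi>2} \<xi> *\<^sub>R (w (y \<xi>) * p (y \<xi>)))"
      by (rule integral_cong_AE[OF _ _ ae]) auto
    ultimately show ?thesis
      using e by (simp add: set_integrable_def set_lebesgue_integral_def a_def b_def)
  qed
  show ?thesis unfolding primitive_def locally_integrable_def
  proof (intro conjI allI impI)
    fix a b
    show "set_integrable lborel {a..b} (\<lambda>\<xi>. w (y \<xi>) * p (y \<xi>))"
      using main[of a b] by (cases "a \<le> b") (auto simp: set_integrable_def)
  qed (use main in auto)
qed

lemma primitive_y: "primitive y (\<lambda>\<xi>. p (y \<xi>))"
  using primitive_comp_y[OF primitive_id] by simp

lemma primitive_U: "primitive (\<lambda>\<xi>. u (y \<xi>)) (\<lambda>\<xi>. q (y \<xi>))"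
  using primitive_comp_y[OF primitive_u] by (simp add: q_def)

lemma primitive_H: "primitive (\<lambda>\<xi>. \<xi> - y \<xi>) (\<lambda>\<xi>. h (y \<xi>))"
proof -
  have "primitive (\<lambda>\<xi>. \<xi> + (-1) * y \<xi>) (\<lambda>\<xi>. 1 + (-1) * p (y \<xi>))"
    by (intro primitive_add primitive_id primitive_cmult primitive_y)
  then show ?thesis by (simp add: h_def)
qed

text \<open>Fixes the constant of integration in \<open>H_eq\<close>. A sequence of points is enough
  there, because the difference to the integral is constant.\<close>

lemma H_tendsto_0: "(\<lambda>n. - real n - y (- real n)) \<longlonglongrightarrow> 0"
proof (rule LIMSEQ_I)
  fix r :: real assume r: "0 < r"
  have "\<forall>\<^sub>F x in at_bot. cdf \<mu> x < r" by (rule order_tendstoD(2)[OF \<mu>.cdf_lim_at_bot r])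
  then obtain x0 where x0: "cdf \<mu> x0 < r" by (auto simp: eventually_at_bot_linorder)
  have G: "lprim \<mu> x0 \<le> cdf \<mu> x0"
    unfolding cdf_def lprim_def by (intro \<mu>.finite_measure_mono) auto
  obtain N :: nat where N: "- x0 < real N" using reals_Archimedean2 by blast
  show "\<exists>N. \<forall>n\<ge>N. norm (- real n - y (- real n) - 0) < r"
  proof (intro exI allI impI)
    fix n assume "n \<ge> N"
    then have n: "- real n < x0" using N by linarith
    let ?\<xi> = "- real n"
    have y0: "y ?\<xi> < x0" using y_upper[of ?\<xi>] n by linarith
    \<comment> \<open>\<open>y_lower\<close> requires a point strictly above \<open>y\<close>; the
      bound is shown for all such \<open>w\<close> and passes to the limit.\<close>
    have "?\<xi> - lprim \<mu> x0 \<le> y ?\<xi>"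
    proof (rule dense_ge_bounded[OF y0])
      fix w assume w: "y ?\<xi> < w" "w < x0"
      then show "?\<xi> - lprim \<mu> x0 \<le> w" using y_lower[OF w(1)] lprim_mono[of w x0] by linarith
    qed
    then show "norm (- real n - y (- real n) - 0) < r" using y_upper[of ?\<xi>] G x0 by simp
  qed
qed

lemma H_eq: "\<xi> - y \<xi> = (LBINT \<eta>:{..\<xi>}. h (y \<eta>))"
proof -
  define I where "I = (\<lambda>\<xi>. LBINT \<eta>:{..\<xi>}. h (y \<eta>))"
  have "primitive (\<lambda>\<xi>. 0 + I \<xi>) (\<lambda>\<xi>. h (y \<xi>))"
    unfolding I_def by (rule primitive_integral_atMost[OF h_y_integrable])
  then have I: "primitive I (\<lambda>\<xi>. h (y \<xi>))" by simp
  have c: "\<xi> - y \<xi> - I \<xi> = \<eta> - y \<eta> - I \<eta>" if "\<eta> \<le> \<xi>" for \<xi> \<eta>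
    using primitiveD(3)[OF I that] primitiveD(3)[OF primitive_H that] by simp
  have "(\<lambda>n. I (- real n)) \<longlonglongrightarrow> (\<integral>\<eta>. 0 \<partial>(lborel :: real measure))"
    unfolding I_def set_lebesgue_integral_def
  proof (rule integral_dominated_convergence[where w = "\<lambda>\<eta>. h (y \<eta>)"])
    show "AE \<eta> in lborel. (\<lambda>n. indicat_real {..- real n} \<eta> *\<^sub>R h (y \<eta>)) \<longlonglongrightarrow> 0"
    proof (intro AE_I2 tendsto_eventually)
      fix \<eta> :: real
      obtain N :: nat where N: "- \<eta> < real N" using reals_Archimedean2 by blast
      show "\<forall>\<^sub>F n in sequentially. indicat_real {..- real n} \<eta> *\<^sub>R h (y \<eta>) = 0"
        using eventually_ge_at_top[of N] by eventually_elim (use N in \<open>auto simp: indicator_def\<close>)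
    qed
    show "AE \<eta> in lborel. norm (indicat_real {..- real n} \<eta> *\<^sub>R h (y \<eta>)) \<le> h (y \<eta>)" for n
      using h_bounds by (intro AE_I2) (auto simp: indicator_def)
  qed (use h_y_integrable in auto)
  then have "(\<lambda>n. - real n - y (- real n) - I (- real n)) \<longlonglongrightarrow> 0 - 0"
    by (intro tendsto_diff H_tendsto_0) simp
  moreover have "\<forall>\<^sub>F n in sequentially. - real n - y (- real n) - I (- real n) = \<xi> - y \<xi> - I \<xi>"
  proof -
    obtain N :: nat where N: "- \<xi> < real N" using reals_Archimedean2 by blast
    show ?thesis
      using eventually_ge_at_top[of N] by eventually_elim (use N in \<open>auto intro!: c[symmetric]\<close>)
  qed
  ultimately have "\<xi> - y \<xi> - I \<xi> = 0"
    using LIMSEQ_unique[OF tendsto_eventually] by fastforce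
  then show ?thesis by (simp add: I_def)
qed

text \<open>The zeros of \<open>p\<close> are the points of \<open>K\<close>, \<open>y\<close>
  carries Lebesgue measure to \<open>m\<close>, and on the null set \<open>K\<close> only
  \<open>\<mu>s\<close> contributes. This makes the singular mass a property of the Lagrangian
  variables alone.\<close>

lemma emeasure_p_zero: "emeasure lborel {\<xi>. p (y \<xi>) = 0} = emeasure \<mu>s UNIV"
proof -
  have "{\<xi>. p (y \<xi>) = 0} = y -` K"
    using one_plus_square_pos by (auto simp: p_def indicator_def less_le)
  also have "emeasure lborel (y -` K) = emeasure (distr lborel borel y) K"
    by (subst emeasure_distr) auto
  also have "\<dots> = emeasure \<mu> K" using K(1) by (simp add: distr_y emeasure_m null_sets_def)
  also have "\<dots> = emeasure \<mu>s K"
  proof -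
    have "emeasure (density lborel (\<lambda>x. ennreal ((v x)\<^sup>2))) K = 0"
      by (subst emeasure_density, simp, simp, subst nn_integral_0_iff_AE, simp)
         (use AE_lborel_K in eventually_elim, simp)
    then show ?thesis by (simp add: dec)
  qed
  also have "\<dots> = emeasure \<mu>s UNIV"
    by (rule emeasure_eq_AE) (use AE_\<mu>s_K in auto)
  finally show ?thesis .
qed

end

section \<open>The explicit flow\<close>

text \<open>Fubini, phrased with \<open>has_integral\<close> in time. It lifts identities for the
  energy fraction of a single particle to the integrals over particles in \<open>Vt\<close>,
  \<open>Ut\<close> and \<open>yt\<close>.\<close>

lemma integral_parametric:
  fixes w :: "real \<Rightarrow> real \<Rightarrow> real"
  assumes h: "integrable lborel h"
    and w[measurable]: "(\<lambda>(s, \<eta>). w s \<eta>) \<in> borel_measurable (borel \<Otimes>\<^sub>M borel)"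
    and B: "\<And>s \<eta>. s \<in> {0..t} \<Longrightarrow> \<bar>w s \<eta>\<bar> \<le> B"
    and W: "\<And>\<eta>. ((\<lambda>s. w s \<eta>) has_integral W \<eta>) {0..t}"
  shows "((\<lambda>s. \<integral>\<eta>. h \<eta> * w s \<eta> \<partial>lborel) has_integral (LBINT \<eta>. h \<eta> * W \<eta>)) {0..t}"
proof -
  have [measurable]: "h \<in> borel_measurable borel" using h by simp
  define k where "k = (\<lambda>s \<eta>. indicat_real {0..t} s * (h \<eta> * w s \<eta>))"
  have bound: "\<bar>k s \<eta>\<bar> \<le> indicat_real {0..t} s * (\<bar>B\<bar> * \<bar>h \<eta>\<bar>)" for s \<eta>
  proof (cases "s \<in> {0..t}")
    case True
    have "\<bar>w s \<eta>\<bar> \<le> \<bar>B\<bar>" using B[OF True, of \<eta>] by linarith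
    then show ?thesis using True mult_right_mono[of "\<bar>w s \<eta>\<bar>" "\<bar>B\<bar>" "\<bar>h \<eta>\<bar>"]
      by (simp add: k_def abs_mult mult.commute)
  qed (simp add: k_def)
  have km: "(\<lambda>(s, \<eta>). k s \<eta>) \<in> borel_measurable (lborel \<Otimes>\<^sub>M lborel)"
  proof -
    have s: "sets (lborel \<Otimes>\<^sub>M lborel :: (real \<times> real) measure) = sets (borel \<Otimes>\<^sub>M borel)"
      by (intro sets_pair_measure_cong) auto
    have "(\<lambda>(s, \<eta>). k s \<eta>) \<in> borel_measurable (borel \<Otimes>\<^sub>M borel)"
      unfolding k_def by measurable
    then show ?thesis unfolding measurable_cong_sets[OF s refl] .
  qed
  have ki: "integrable lborel (k s)" for s
  proof (rule Bochner_Integration.integrable_bound)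
    show "integrable lborel (\<lambda>\<eta>. indicat_real {0..t} s * (\<bar>B\<bar> * \<bar>h \<eta>\<bar>))" using h by simp
    show "k s \<in> borel_measurable lborel"
      using measurable_compose[OF measurable_Pair1'[of s lborel lborel] km] by simp
  qed (use bound[of s] in \<open>auto intro!: AE_I2 intro: order_trans[OF _ abs_ge_self]\<close>)
  have int: "integrable (lborel \<Otimes>\<^sub>M lborel) (\<lambda>(s, \<eta>). k s \<eta>)"
  proof (rule lborel_pair.Fubini_integrable[OF km])
    show "AE s in lborel. integrable lborel (\<lambda>\<eta>. case (s, \<eta>) of (s, \<eta>) \<Rightarrow> k s \<eta>)" using ki by simp
    show "integrable lborel (\<lambda>s. LBINT \<eta>. norm (case (s, \<eta>) of (s, \<eta>) \<Rightarrow> k s \<eta>))"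
    proof (rule Bochner_Integration.integrable_bound)
      show "integrable lborel (\<lambda>s. indicat_real {0..t} s * (LBINT \<eta>. \<bar>B\<bar> * \<bar>h \<eta>\<bar>))"
        by (intro integrable_mult_left integrable_real_indicator) (auto simp: emeasure_lborel_Icc_eq)
      show "(\<lambda>s. LBINT \<eta>. norm (case (s, \<eta>) of (s, \<eta>) \<Rightarrow> k s \<eta>)) \<in> borel_measurable lborel"
        using km by (intro lborel.borel_measurable_lebesgue_integral) (simp add: split_beta')
      show "AE s in lborel. norm (LBINT \<eta>. norm (case (s, \<eta>) of (s, \<eta>) \<Rightarrow> k s \<eta>))
          \<le> norm (indicat_real {0..t} s * (LBINT \<eta>. \<bar>B\<bar> * \<bar>h \<eta>\<bar>))"
      proof (intro AE_I2)
        fix s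
        have "(LBINT \<eta>. \<bar>k s \<eta>\<bar>) \<le> (LBINT \<eta>. indicat_real {0..t} s * (\<bar>B\<bar> * \<bar>h \<eta>\<bar>))"
          by (rule integral_mono) (use ki[of s] h bound in auto)
        also have "\<dots> = indicat_real {0..t} s * (LBINT \<eta>. \<bar>B\<bar> * \<bar>h \<eta>\<bar>)"
          by (rule integral_mult_right_zero)
        finally have "(LBINT \<eta>. \<bar>k s \<eta>\<bar>) \<le> indicat_real {0..t} s * (LBINT \<eta>. \<bar>B\<bar> * \<bar>h \<eta>\<bar>)" .
        moreover have "0 \<le> (LBINT \<eta>. \<bar>k s \<eta>\<bar>)" by simp
        ultimately show "norm (LBINT \<eta>. norm (case (s, \<eta>) of (s, \<eta>) \<Rightarrow> k s \<eta>))
          \<le> norm (indicat_real {0..t} s * (LBINT \<eta>. \<bar>B\<bar> * \<bar>h \<eta>\<bar>))" by simp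
      qed
    qed
  qed
  have sections: "(LBINT s. k s \<eta>) = h \<eta> * W \<eta>" for \<eta>
  proof -
    have [measurable]: "(\<lambda>s. w s \<eta>) \<in> borel_measurable borel"
      using measurable_compose[OF measurable_Pair2'[of \<eta> borel borel] w] by simp
    have "set_integrable lborel {0..t} (\<lambda>s. w s \<eta>)"
    proof (rule set_integrable_mono_real[where f = "\<lambda>_. B"])
      show "set_integrable lborel {0..t} (\<lambda>_. B)"
        using locally_integrable_const[of B] unfolding locally_integrable_def by blast
    qed (use B in auto)
    then have "(LBINT s:{0..t}. w s \<eta>) = W \<eta>"
      using set_borel_integral_eq_integral(2) integral_unique[OF W[of \<eta>]] by metis
    moreover have "(\<lambda>s. k s \<eta>) = (\<lambda>s. h \<eta> * (indicat_real {0..t} s *\<^sub>R w s \<eta>))"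
      by (auto simp: k_def fun_eq_iff)
    ultimately show ?thesis by (simp add: set_lebesgue_integral_def)
  qed
  have e: "(LBINT \<eta>. k s \<eta>) = indicat_real {0..t} s *\<^sub>R (LBINT \<eta>. h \<eta> * w s \<eta>)" for s
    unfolding k_def by simp
  have eq: "(LBINT \<eta>. h \<eta> * W \<eta>) = (LBINT s:{0..t}. \<integral>\<eta>. h \<eta> * w s \<eta> \<partial>lborel)"
    using lborel_pair.Fubini_integral[OF int] by (simp add: sections e set_lebesgue_integral_def)
  have si: "set_integrable lborel {0..t} (\<lambda>s. \<integral>\<eta>. h \<eta> * w s \<eta> \<partial>lborel)"
    using lborel_pair.integrable_fst'[OF int] by (simp add: set_integrable_def e)
  show ?thesis unfolding eq set_borel_integral_eq_integral(2)[OF si]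
    using set_borel_integral_eq_integral(1)[OF si] by (rule integrable_integral)
qed

lemma tendsto_set_integral_atMost:
  fixes g :: "real \<Rightarrow> real"
  assumes "integrable lborel g"
  shows "((\<lambda>\<xi>. LBINT \<eta>:{..\<xi>}. g \<eta>) \<longlongrightarrow> (LBINT \<eta>. g \<eta>)) at_top"
  unfolding set_lebesgue_integral_def
  by (rule tendsto_integral_at_top) (use assms in auto)

text \<open>What the flow uses of an image under \<open>L_map\<close>. \<open>V\<close> and
  \<open>H\<close> agree initially because the two measures do, so a single density \<open>h\<close>
  describes both.\<close>

locale lagrangian_data =
  fixes \<alpha> :: real and y U p q h :: "real \<Rightarrow> real"
  assumes \<alpha>: "0 \<le> \<alpha>" "\<alpha> \<le> 1"
    and primitive_y: "primitive y p" and primitive_U: "primitive U q"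
    and p_nonneg: "\<And>\<xi>. 0 \<le> p \<xi>" and h_nonneg: "\<And>\<xi>. 0 \<le> h \<xi>"
    and p_plus_h: "\<And>\<xi>. p \<xi> + h \<xi> = 1" and q_square: "\<And>\<xi>. (q \<xi>)\<^sup>2 = p \<xi> * h \<xi>"
    and h_integrable: "integrable lborel h"
    and H_eq: "\<And>\<xi>. \<xi> - y \<xi> = (LBINT \<eta>:{..\<xi>}. h \<eta>)"
begin

text \<open>The breaking time of a particle with \<open>q \<xi> < 0\<close>; otherwise a junk value.\<close>

definition brk :: "real \<Rightarrow> real" where "brk \<xi> = 2 * p \<xi> / (- q \<xi>)"

text \<open>\<open>\<phi>\<^sub>1\<close> and \<open>\<phi>\<^sub>2\<close> are the first and second time integrals of the surviving energy fraction \<open>\<phi>\<^sub>0\<close>.\<close>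

definition \<phi>\<^sub>0 :: "real \<Rightarrow> real \<Rightarrow> real" where
  "\<phi>\<^sub>0 t \<xi> = 1 - \<alpha> * of_bool (q \<xi> < 0 \<and> brk \<xi> \<le> t)"

definition \<phi>\<^sub>1 :: "real \<Rightarrow> real \<Rightarrow> real" where
  "\<phi>\<^sub>1 t \<xi> = t - \<alpha> * (of_bool (q \<xi> < 0) * max 0 (t - brk \<xi>))"

definition \<phi>\<^sub>2 :: "real \<Rightarrow> real \<Rightarrow> real" where
  "\<phi>\<^sub>2 t \<xi> = t\<^sup>2 / 2 - \<alpha> * (of_bool (q \<xi> < 0) * ((max 0 (t - brk \<xi>))\<^sup>2 / 2))"

definition V\<^sub>\<xi> :: "real \<Rightarrow> real \<Rightarrow> real" where "V\<^sub>\<xi> t \<xi> = h \<xi> * \<phi>\<^sub>0 t \<xi>"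
definition U\<^sub>\<xi> :: "real \<Rightarrow> real \<Rightarrow> real" where "U\<^sub>\<xi> t \<xi> = q \<xi> + h \<xi> * \<phi>\<^sub>1 t \<xi> / 2"
definition y\<^sub>\<xi> :: "real \<Rightarrow> real \<Rightarrow> real" where "y\<^sub>\<xi> t \<xi> = p \<xi> + t * q \<xi> + h \<xi> * \<phi>\<^sub>2 t \<xi> / 2"

text \<open>Candidates for the solution: the equation for \<open>U\<close> is integrated once and
  twice in time, and the time integral is moved inside the integral over particles. Their spatial
  densities are the three preceding functions.\<close>

definition Vt :: "real \<Rightarrow> real \<Rightarrow> real" where
  "Vt t \<xi> = (LBINT \<eta>:{..\<xi>}. V\<^sub>\<xi> t \<eta>)"
definition Ut :: "real \<Rightarrow> real \<Rightarrow> real" where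
  "Ut t \<xi> = U \<xi> + 1/2 * (LBINT \<eta>:{..\<xi>}. h \<eta> * \<phi>\<^sub>1 t \<eta>) - 1/4 * (LBINT \<eta>. h \<eta> * \<phi>\<^sub>1 t \<eta>)"
definition yt :: "real \<Rightarrow> real \<Rightarrow> real" where
  "yt t \<xi> = y \<xi> + t * U \<xi> + 1/2 * (LBINT \<eta>:{..\<xi>}. h \<eta> * \<phi>\<^sub>2 t \<eta>) - 1/4 * (LBINT \<eta>. h \<eta> * \<phi>\<^sub>2 t \<eta>)"
definition H :: "real \<Rightarrow> real" where "H \<xi> = \<xi> - y \<xi>"

lemma measurable_data [measurable]:
  "p \<in> borel_measurable borel" "q \<in> borel_measurable borel" "h \<in> borel_measurable borel"
  using primitiveD(2)[OF primitive_y] primitiveD(2)[OF primitive_U] h_integrable by auto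

lemma brk_measurable [measurable]: "brk \<in> borel_measurable borel"
  unfolding brk_def by measurable

lemma \<phi>_measurable_pair [measurable]:
  "(\<lambda>(s, \<eta>). \<phi>\<^sub>0 s \<eta>) \<in> borel_measurable (borel \<Otimes>\<^sub>M borel)"
  "(\<lambda>(s, \<eta>). \<phi>\<^sub>1 s \<eta>) \<in> borel_measurable (borel \<Otimes>\<^sub>M borel)"
  unfolding \<phi>\<^sub>0_def \<phi>\<^sub>1_def of_bool_def by measurable

lemma \<phi>_measurable [measurable]:
  "\<phi>\<^sub>0 t \<in> borel_measurable borel" "\<phi>\<^sub>1 t \<in> borel_measurable borel" "\<phi>\<^sub>2 t \<in> borel_measurable borel"
  unfolding \<phi>\<^sub>0_def \<phi>\<^sub>1_def \<phi>\<^sub>2_def of_bool_def by measurable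

lemma deriv_measurable [measurable]:
  "V\<^sub>\<xi> t \<in> borel_measurable borel" "U\<^sub>\<xi> t \<in> borel_measurable borel" "y\<^sub>\<xi> t \<in> borel_measurable borel"
  unfolding V\<^sub>\<xi>_def U\<^sub>\<xi>_def y\<^sub>\<xi>_def by measurable

lemma h_le_1: "h \<xi> \<le> 1" and p_le_1: "p \<xi> \<le> 1"
  using p_nonneg[of \<xi>] h_nonneg[of \<xi>] p_plus_h[of \<xi>] by linarith+

lemma q_le_1: "\<bar>q \<xi>\<bar> \<le> 1"
proof -
  have "(q \<xi>)\<^sup>2 \<le> 1"
    unfolding q_square using mult_mono[OF p_le_1 h_le_1, of \<xi> \<xi>] h_nonneg by simp
  then show ?thesis using abs_le_square_iff[of "q \<xi>" 1] by simp
qed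

lemma q_neg_pos: "q \<xi> < 0 \<Longrightarrow> 0 < p \<xi>" "q \<xi> < 0 \<Longrightarrow> 0 < h \<xi>"
proof -
  assume "q \<xi> < 0"
  then have "0 < p \<xi> * h \<xi>" using q_square[of \<xi>] by (metis less_irrefl zero_less_power2)
  then show "0 < p \<xi>" "0 < h \<xi>"
    using p_nonneg[of \<xi>] h_nonneg[of \<xi>] by (auto simp: zero_less_mult_iff)
qed

lemma brk_pos: "q \<xi> < 0 \<Longrightarrow> 0 < brk \<xi>"
  using q_neg_pos[of \<xi>] by (auto simp: brk_def divide_simps)

text \<open>Before breaking, \<open>y\<^sub>\<xi>\<close> is the quadratic
  \<open>p + t * q + h * t\<^sup>2 / 4\<close>. Its discriminant \<open>q\<^sup>2 - p * h\<close>
  vanishes, so it equals \<open>h * (t - brk)\<^sup>2 / 4\<close>; the two identities compare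
  coefficients.\<close>

lemma brk_eqs: "q \<xi> < 0 \<Longrightarrow> q \<xi> = - (h \<xi> * brk \<xi> / 2)" "q \<xi> < 0 \<Longrightarrow> p \<xi> = h \<xi> * (brk \<xi>)\<^sup>2 / 4"
proof -
  assume q: "q \<xi> < 0"
  have "q \<xi> * brk \<xi> = - 2 * p \<xi>" using q by (simp add: brk_def)
  then have "h \<xi> * (q \<xi> * brk \<xi>) = - 2 * (q \<xi>)\<^sup>2" by (simp add: q_square)
  then have "q \<xi> * (h \<xi> * brk \<xi> + 2 * q \<xi>) = 0" by (simp add: power2_eq_square algebra_simps)
  then show 1: "q \<xi> = - (h \<xi> * brk \<xi> / 2)" using q by simp
  have "p \<xi> = - (q \<xi> * brk \<xi>) / 2" using q by (simp add: brk_def)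
  then show "p \<xi> = h \<xi> * (brk \<xi>)\<^sup>2 / 4" by (simp add: power2_eq_square) (simp add: 1)
qed

lemma \<phi>\<^sub>0_bounds: "0 \<le> \<phi>\<^sub>0 t \<xi>" "\<phi>\<^sub>0 t \<xi> \<le> 1"
  using \<alpha> by (auto simp: \<phi>\<^sub>0_def of_bool_def)

lemma \<phi>\<^sub>1_bounds: "0 \<le> t \<Longrightarrow> 0 \<le> \<phi>\<^sub>1 t \<xi>" "\<phi>\<^sub>1 t \<xi> \<le> t"
proof -
  assume t: "0 \<le> t"
  have "\<alpha> * (of_bool (q \<xi> < 0) * max 0 (t - brk \<xi>)) \<le> 1 * t"
    using \<alpha> t brk_pos[of \<xi>] by (intro mult_mono) (auto simp: of_bool_def)
  then show "0 \<le> \<phi>\<^sub>1 t \<xi>" by (simp add: \<phi>\<^sub>1_def)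
qed (use \<alpha> in \<open>auto simp: \<phi>\<^sub>1_def of_bool_def\<close>)

lemma \<phi>\<^sub>2_bounds: "0 \<le> t \<Longrightarrow> 0 \<le> \<phi>\<^sub>2 t \<xi>" "\<phi>\<^sub>2 t \<xi> \<le> t\<^sup>2 / 2"
proof -
  assume t: "0 \<le> t"
  have "\<alpha> * (of_bool (q \<xi> < 0) * ((max 0 (t - brk \<xi>))\<^sup>2 / 2)) \<le> 1 * (t\<^sup>2 / 2)"
    using \<alpha> t brk_pos[of \<xi>] by (intro mult_mono) (auto simp: of_bool_def intro!: power_mono)
  then show "0 \<le> \<phi>\<^sub>2 t \<xi>" by (simp add: \<phi>\<^sub>2_def)
qed (use \<alpha> in \<open>auto simp: \<phi>\<^sub>2_def of_bool_def\<close>)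

lemma integrable_h_mult:
  assumes [measurable]: "w \<in> borel_measurable borel" and "\<And>\<xi>. \<bar>w \<xi>\<bar> \<le> B"
  shows "integrable lborel (\<lambda>\<xi>. h \<xi> * w \<xi>)"
proof (rule Bochner_Integration.integrable_bound)
  show "integrable lborel (\<lambda>\<xi>. h \<xi> * B)" using h_integrable by simp
  show "AE \<xi> in lborel. norm (h \<xi> * w \<xi>) \<le> norm (h \<xi> * B)"
  proof (intro AE_I2)
    fix \<xi>
    have "\<bar>h \<xi>\<bar> * \<bar>w \<xi>\<bar> \<le> \<bar>h \<xi>\<bar> * \<bar>B\<bar>"
      using assms(2)[of \<xi>] by (intro mult_left_mono) auto
    then show "norm (h \<xi> * w \<xi>) \<le> norm (h \<xi> * B)" by (simp add: abs_mult)
  qed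
qed simp

lemma integrable_h\<phi>:
  shows "integrable lborel (V\<^sub>\<xi> t)"
    and "0 \<le> t \<Longrightarrow> integrable lborel (\<lambda>\<xi>. h \<xi> * \<phi>\<^sub>1 t \<xi>)"
    and "0 \<le> t \<Longrightarrow> integrable lborel (\<lambda>\<xi>. h \<xi> * \<phi>\<^sub>2 t \<xi>)"
  using integrable_h_mult[of "\<phi>\<^sub>0 t" 1] integrable_h_mult[of "\<phi>\<^sub>1 t" t] integrable_h_mult[of "\<phi>\<^sub>2 t" "t\<^sup>2 / 2"]
    \<phi>\<^sub>0_bounds \<phi>\<^sub>1_bounds \<phi>\<^sub>2_bounds by (auto simp: V\<^sub>\<xi>_def[abs_def])

lemma primitive_Vt: "primitive (Vt t) (V\<^sub>\<xi> t)"
  using primitive_integral_atMost[OF integrable_h\<phi>(1), of 0 t] by (simp add: Vt_def[abs_def])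

lemma primitive_H: "primitive H h"
  using primitive_integral_atMost[OF h_integrable, of 0] by (simp add: H_def[abs_def] H_eq)

lemma primitive_Ut:
  assumes t: "0 \<le> t"
  shows "primitive (Ut t) (U\<^sub>\<xi> t)"
proof -
  have "primitive (\<lambda>\<xi>. U \<xi> + 1/2 * (- 1/2 * (LBINT \<eta>. h \<eta> * \<phi>\<^sub>1 t \<eta>) + (LBINT \<eta>:{..\<xi>}. h \<eta> * \<phi>\<^sub>1 t \<eta>)))
     (\<lambda>\<xi>. q \<xi> + 1/2 * (h \<xi> * \<phi>\<^sub>1 t \<xi>))"
    by (intro primitive_add primitive_cmult primitive_U primitive_integral_atMost integrable_h\<phi> t)
  moreover have "(\<lambda>\<xi>. U \<xi> + 1/2 * (- 1/2 * (LBINT \<eta>. h \<eta> * \<phi>\<^sub>1 t \<eta>) + (LBINT \<eta>:{..\<xi>}. h \<eta> * \<phi>\<^sub>1 t \<eta>))) = Ut t"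
    by (auto simp: Ut_def fun_eq_iff algebra_simps)
  moreover have "(\<lambda>\<xi>. q \<xi> + 1/2 * (h \<xi> * \<phi>\<^sub>1 t \<xi>)) = U\<^sub>\<xi> t" by (auto simp: U\<^sub>\<xi>_def fun_eq_iff)
  ultimately show ?thesis by (simp only:)
qed

lemma primitive_yt:
  assumes t: "0 \<le> t"
  shows "primitive (yt t) (y\<^sub>\<xi> t)"
proof -
  have "primitive (\<lambda>\<xi>. (y \<xi> + t * U \<xi>) + 1/2 * (- 1/2 * (LBINT \<eta>. h \<eta> * \<phi>\<^sub>2 t \<eta>) + (LBINT \<eta>:{..\<xi>}. h \<eta> * \<phi>\<^sub>2 t \<eta>)))
     (\<lambda>\<xi>. (p \<xi> + t * q \<xi>) + 1/2 * (h \<xi> * \<phi>\<^sub>2 t \<xi>))"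
    by (intro primitive_add primitive_cmult primitive_U primitive_y primitive_integral_atMost integrable_h\<phi> t)
  moreover have "(\<lambda>\<xi>. (y \<xi> + t * U \<xi>) + 1/2 * (- 1/2 * (LBINT \<eta>. h \<eta> * \<phi>\<^sub>2 t \<eta>) + (LBINT \<eta>:{..\<xi>}. h \<eta> * \<phi>\<^sub>2 t \<eta>))) = yt t"
    by (auto simp: yt_def fun_eq_iff algebra_simps)
  moreover have "(\<lambda>\<xi>. (p \<xi> + t * q \<xi>) + 1/2 * (h \<xi> * \<phi>\<^sub>2 t \<xi>)) = y\<^sub>\<xi> t" by (auto simp: y\<^sub>\<xi>_def fun_eq_iff)
  ultimately show ?thesis by (simp only:)
qed

lemma flow_before:
  assumes "\<not> (q \<xi> < 0 \<and> brk \<xi> \<le> t)"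
  shows "V\<^sub>\<xi> t \<xi> = h \<xi>" "U\<^sub>\<xi> t \<xi> = q \<xi> + h \<xi> * t / 2" "y\<^sub>\<xi> t \<xi> = p \<xi> + t * q \<xi> + h \<xi> * t\<^sup>2 / 4"
  using assms by (auto simp: V\<^sub>\<xi>_def U\<^sub>\<xi>_def y\<^sub>\<xi>_def \<phi>\<^sub>0_def \<phi>\<^sub>1_def \<phi>\<^sub>2_def of_bool_def max_def)

text \<open>At time \<open>brk\<close> both \<open>y\<^sub>\<xi>\<close> and
  \<open>U\<^sub>\<xi>\<close> are zero, and the remaining energy \<open>(1 - \<alpha>) * h\<close>
  drives the particle from there.\<close>

lemma flow_after:
  assumes "q \<xi> < 0" "brk \<xi> \<le> t"
  shows "V\<^sub>\<xi> t \<xi> = (1 - \<alpha>) * h \<xi>" "U\<^sub>\<xi> t \<xi> = (1 - \<alpha>) * h \<xi> * (t - brk \<xi>) / 2"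
    "y\<^sub>\<xi> t \<xi> = (1 - \<alpha>) * h \<xi> * (t - brk \<xi>)\<^sup>2 / 4"
proof -
  show "V\<^sub>\<xi> t \<xi> = (1 - \<alpha>) * h \<xi>" using assms by (simp add: V\<^sub>\<xi>_def \<phi>\<^sub>0_def)
  have "U\<^sub>\<xi> t \<xi> = q \<xi> + h \<xi> * (t - \<alpha> * (t - brk \<xi>)) / 2" using assms by (simp add: U\<^sub>\<xi>_def \<phi>\<^sub>1_def)
  then show "U\<^sub>\<xi> t \<xi> = (1 - \<alpha>) * h \<xi> * (t - brk \<xi>) / 2"
    by (subst (asm) brk_eqs(1)[OF assms(1)]) (simp add: algebra_simps diff_divide_distrib add_divide_distrib)
  have "y\<^sub>\<xi> t \<xi> = p \<xi> + t * q \<xi> + h \<xi> * (t\<^sup>2 / 2 - \<alpha> * ((t - brk \<xi>)\<^sup>2 / 2)) / 2"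
    using assms by (simp add: y\<^sub>\<xi>_def \<phi>\<^sub>2_def)
  also have "\<dots> = h \<xi> * (brk \<xi>)\<^sup>2 / 4 + t * (- (h \<xi> * brk \<xi> / 2)) + h \<xi> * (t\<^sup>2 / 2 - \<alpha> * ((t - brk \<xi>)\<^sup>2 / 2)) / 2"
    by (simp only: brk_eqs(1)[OF assms(1), symmetric] brk_eqs(2)[OF assms(1), symmetric])
  also have "\<dots> = (1 - \<alpha>) * h \<xi> * (t - brk \<xi>)\<^sup>2 / 4"
    by (simp add: power2_eq_square field_simps)
  finally show "y\<^sub>\<xi> t \<xi> = (1 - \<alpha>) * h \<xi> * (t - brk \<xi>)\<^sup>2 / 4" .
qed

text \<open>\<open>q_square\<close> is propagated by the flow at every point: before breaking by
  expanding, afterwards because both sides are the same square.\<close>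

lemma U\<^sub>\<xi>_square: "(U\<^sub>\<xi> t \<xi>)\<^sup>2 = y\<^sub>\<xi> t \<xi> * V\<^sub>\<xi> t \<xi>"
proof (cases "q \<xi> < 0 \<and> brk \<xi> \<le> t")
  case True
  then have "q \<xi> < 0" "brk \<xi> \<le> t" by auto
  show ?thesis unfolding flow_after[OF \<open>q \<xi> < 0\<close> \<open>brk \<xi> \<le> t\<close>]
    by (simp add: power2_eq_square)
next
  case False
  have "(q \<xi> + h \<xi> * t / 2)\<^sup>2 = (q \<xi>)\<^sup>2 + (t * q \<xi> + h \<xi> * t\<^sup>2 / 4) * h \<xi>"
    by (simp add: power2_eq_square field_simps)
  then show ?thesis using flow_before[OF False] by (simp add: q_square distrib_right)
qed

lemma V\<^sub>\<xi>_bounds: "0 \<le> V\<^sub>\<xi> t \<xi>" "V\<^sub>\<xi> t \<xi> \<le> h \<xi>"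
  using \<phi>\<^sub>0_bounds[of t \<xi>] h_nonneg[of \<xi>] by (auto simp: V\<^sub>\<xi>_def mult_left_le)

text \<open>Before breaking, a particle with energy gets the sign from
  \<open>U\<^sub>\<xi>_square\<close>, as \<open>V\<^sub>\<xi>\<close> is positive; a particle
  without energy has \<open>q = 0\<close> and keeps \<open>y\<^sub>\<xi> = p\<close>.\<close>

lemma y\<^sub>\<xi>_nonneg: "0 \<le> y\<^sub>\<xi> t \<xi>"
proof (cases "q \<xi> < 0 \<and> brk \<xi> \<le> t")
  case True
  then have "q \<xi> < 0" "brk \<xi> \<le> t" by auto
  show ?thesis unfolding flow_after(3)[OF \<open>q \<xi> < 0\<close> \<open>brk \<xi> \<le> t\<close>]
    using \<alpha> h_nonneg by simp
next
  case False
  show ?thesis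
  proof (cases "h \<xi> = 0")
    case True
    then have "q \<xi> = 0" using q_square[of \<xi>] by simp
    then show ?thesis using True flow_before(3)[OF False] p_nonneg by simp
  next
    case h: False
    then have "0 < V\<^sub>\<xi> t \<xi>" using flow_before(1)[OF False] h_nonneg[of \<xi>] by simp
    moreover have "0 \<le> y\<^sub>\<xi> t \<xi> * V\<^sub>\<xi> t \<xi>" by (simp flip: U\<^sub>\<xi>_square)
    ultimately show ?thesis by (simp add: zero_le_mult_iff)
  qed
qed

text \<open>A bound for the Jacobian of \<open>yt t\<close> that does not depend on the data; it
  converts an \<open>L\<^sup>1\<close> estimate over particles into one over space.\<close>

lemma y\<^sub>\<xi>_le: "0 \<le> t \<Longrightarrow> y\<^sub>\<xi> t \<xi> \<le> 1 + t + t\<^sup>2"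
proof -
  assume t: "0 \<le> t"
  have "t * q \<xi> \<le> t * 1" using q_le_1[of \<xi>] t by (intro mult_left_mono) auto
  moreover have "h \<xi> * \<phi>\<^sub>2 t \<xi> \<le> 1 * (t\<^sup>2 / 2)"
    using \<phi>\<^sub>2_bounds[of t \<xi>] t h_le_1 by (intro mult_mono) auto
  moreover have "0 \<le> t\<^sup>2" by simp
  ultimately show ?thesis unfolding y\<^sub>\<xi>_def using p_le_1[of \<xi>] by linarith
qed

text \<open>A breaking particle loses its energy exactly when \<open>U\<^sub>\<xi>\<close> stops being negative, so the
  stability function is constant in time.\<close>

lemma stab_eq:
  "(if U\<^sub>\<xi> t \<xi> < 0 then (1 - \<alpha>) * V\<^sub>\<xi> t \<xi> else V\<^sub>\<xi> t \<xi>) = h \<xi> * (1 - \<alpha> * of_bool (q \<xi> < 0))" if "0 \<le> t"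
proof (cases "q \<xi> < 0")
  case True
  show ?thesis
  proof (cases "brk \<xi> \<le> t")
    case after: True
    have "0 \<le> U\<^sub>\<xi> t \<xi>" unfolding flow_after(2)[OF True after] using \<alpha> h_nonneg after by simp
    then show ?thesis using flow_after(1)[OF True after] True by simp
  next
    case False
    have "h \<xi> * t < h \<xi> * brk \<xi>" using q_neg_pos[OF True] False by simp
    then have "U\<^sub>\<xi> t \<xi> < 0"
      using flow_before(2)[of \<xi> t] False brk_eqs(1)[OF True] by simp
    then show ?thesis using flow_before(1)[of \<xi> t] False True by simp
  qed
next
  case False
  then have "0 \<le> U\<^sub>\<xi> t \<xi>" using flow_before(2)[of \<xi> t] h_nonneg[of \<xi>] that by simp
  then show ?thesis using flow_before(1)[of \<xi> t] False by simp
qed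

end

section \<open>The explicit formulas are the unique solution of the Lagrangian system\<close>

context lagrangian_data
begin

lemma \<phi>\<^sub>1_eq_integral:
  assumes t: "0 \<le> t"
  shows "((\<lambda>s. \<phi>\<^sub>0 s \<xi>) has_integral \<phi>\<^sub>1 t \<xi>) {0..t}"
proof -
  have "((\<lambda>s. \<phi>\<^sub>0 s \<xi>) has_integral \<phi>\<^sub>1 t \<xi> - \<phi>\<^sub>1 0 \<xi>) {0..t}"
  \<comment> \<open>The kink of the ramp at \<open>brk \<xi>\<close> is the only point where
    differentiability may fail.\<close>
  proof (rule fundamental_theorem_of_calculus_strong[of "{brk \<xi>}"])
    show "continuous_on {0..t} (\<lambda>s. \<phi>\<^sub>1 s \<xi>)"
      unfolding \<phi>\<^sub>1_def by (intro continuous_intros)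
    fix s assume "s \<in> {0..t} - {brk \<xi>}"
    then have ne: "s \<noteq> brk \<xi>" by simp
    have "((\<lambda>s. max 0 (s - brk \<xi>)) has_real_derivative of_bool (brk \<xi> \<le> s)) (at s)"
    proof (cases "s < brk \<xi>")
      case True
      have "\<forall>\<^sub>F x in nhds s. x \<in> {..<brk \<xi>}" by (rule eventually_nhds_in_open) (use True in auto)
      then have ev: "\<forall>\<^sub>F x in nhds s. max 0 (x - brk \<xi>) = 0" by eventually_elim auto
      show ?thesis using True by (subst DERIV_cong_ev[OF refl ev refl]) simp
    next
      case False
      have "\<forall>\<^sub>F x in nhds s. x \<in> {brk \<xi><..}" by (rule eventually_nhds_in_open) (use False ne in auto)
      then have ev: "\<forall>\<^sub>F x in nhds s. max 0 (x - brk \<xi>) = x - brk \<xi>" by eventually_elim auto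
      show ?thesis using False
        by (subst DERIV_cong_ev[OF refl ev refl]) (auto intro!: derivative_eq_intros)
    qed
    then have "((\<lambda>s. \<phi>\<^sub>1 s \<xi>) has_real_derivative 1 - \<alpha> * (of_bool (q \<xi> < 0) * of_bool (brk \<xi> \<le> s))) (at s)"
      unfolding \<phi>\<^sub>1_def by (intro DERIV_diff DERIV_ident DERIV_cmult)
    then show "((\<lambda>s. \<phi>\<^sub>1 s \<xi>) has_vector_derivative \<phi>\<^sub>0 s \<xi>) (at s)"
      by (simp add: has_real_derivative_iff_has_vector_derivative \<phi>\<^sub>0_def of_bool_conj)
  qed (use t in auto)
  moreover have "\<phi>\<^sub>1 0 \<xi> = 0" using brk_pos[of \<xi>] by (auto simp: \<phi>\<^sub>1_def of_bool_def)
  ultimately show ?thesis by simp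
qed

lemma \<phi>\<^sub>2_eq_integral:
  assumes t: "0 \<le> t"
  shows "((\<lambda>s. \<phi>\<^sub>1 s \<xi>) has_integral \<phi>\<^sub>2 t \<xi>) {0..t}"
proof -
  have "((\<lambda>s. \<phi>\<^sub>1 s \<xi>) has_integral \<phi>\<^sub>2 t \<xi> - \<phi>\<^sub>2 0 \<xi>) {0..t}"
  proof (rule fundamental_theorem_of_calculus_strong[of "{brk \<xi>}"])
    show "continuous_on {0..t} (\<lambda>s. \<phi>\<^sub>2 s \<xi>)"
      unfolding \<phi>\<^sub>2_def by (intro continuous_intros) auto
    fix s assume "s \<in> {0..t} - {brk \<xi>}"
    then have ne: "s \<noteq> brk \<xi>" by simp
    have "((\<lambda>s. (max 0 (s - brk \<xi>))\<^sup>2 / 2) has_real_derivative max 0 (s - brk \<xi>)) (at s)"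
    proof (cases "s < brk \<xi>")
      case True
      have "\<forall>\<^sub>F x in nhds s. x \<in> {..<brk \<xi>}" by (rule eventually_nhds_in_open) (use True in auto)
      then have ev: "\<forall>\<^sub>F x in nhds s. (max 0 (x - brk \<xi>))\<^sup>2 / 2 = 0" by eventually_elim auto
      show ?thesis using True by (subst DERIV_cong_ev[OF refl ev refl]) simp
    next
      case False
      have "\<forall>\<^sub>F x in nhds s. x \<in> {brk \<xi><..}" by (rule eventually_nhds_in_open) (use False ne in auto)
      then have ev: "\<forall>\<^sub>F x in nhds s. (max 0 (x - brk \<xi>))\<^sup>2 / 2 = (x - brk \<xi>)\<^sup>2 / 2" by eventually_elim auto
      show ?thesis using False
        by (subst DERIV_cong_ev[OF refl ev refl]) (auto intro!: derivative_eq_intros)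
    qed
    moreover have "((\<lambda>s. s\<^sup>2 / 2) has_real_derivative s) (at s)"
      by (auto intro!: derivative_eq_intros)
    ultimately have "((\<lambda>s. \<phi>\<^sub>2 s \<xi>) has_real_derivative s - \<alpha> * (of_bool (q \<xi> < 0) * max 0 (s - brk \<xi>))) (at s)"
      unfolding \<phi>\<^sub>2_def by (intro DERIV_diff DERIV_cmult)
    then show "((\<lambda>s. \<phi>\<^sub>2 s \<xi>) has_vector_derivative \<phi>\<^sub>1 s \<xi>) (at s)"
      by (simp add: has_real_derivative_iff_has_vector_derivative \<phi>\<^sub>1_def)
  qed (use t in auto)
  moreover have "\<phi>\<^sub>2 0 \<xi> = 0" using brk_pos[of \<xi>] by (auto simp: \<phi>\<^sub>2_def of_bool_def)
  ultimately show ?thesis by simp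
qed

lemma integrable_indicator_h: "A \<in> sets borel \<Longrightarrow> integrable lborel (\<lambda>\<eta>. indicat_real A \<eta> * h \<eta>)"
  using integrable_mult_indicator[OF _ h_integrable, of A] by simp

lemma set_integral_h:
  "(LBINT \<eta>:A. h \<eta> * w \<eta>) = (LBINT \<eta>. (indicat_real A \<eta> * h \<eta>) * w \<eta>)"
  by (simp add: set_lebesgue_integral_def mult.assoc)

lemma energy_integral:
  assumes t: "0 \<le> t" and A: "A \<in> sets borel"
  shows "((\<lambda>s. LBINT \<eta>:A. V\<^sub>\<xi> s \<eta>) has_integral (LBINT \<eta>:A. h \<eta> * \<phi>\<^sub>1 t \<eta>)) {0..t}"
    and "((\<lambda>s. LBINT \<eta>:A. h \<eta> * \<phi>\<^sub>1 s \<eta>) has_integral (LBINT \<eta>:A. h \<eta> * \<phi>\<^sub>2 t \<eta>)) {0..t}"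
proof -
  show "((\<lambda>s. LBINT \<eta>:A. V\<^sub>\<xi> s \<eta>) has_integral (LBINT \<eta>:A. h \<eta> * \<phi>\<^sub>1 t \<eta>)) {0..t}"
    unfolding set_integral_h V\<^sub>\<xi>_def
    by (rule integral_parametric[where B = 1])
       (use \<phi>\<^sub>0_bounds \<phi>\<^sub>1_eq_integral[OF t] integrable_indicator_h[OF A] in auto)
  show "((\<lambda>s. LBINT \<eta>:A. h \<eta> * \<phi>\<^sub>1 s \<eta>) has_integral (LBINT \<eta>:A. h \<eta> * \<phi>\<^sub>2 t \<eta>)) {0..t}"
    unfolding set_integral_h
  proof (rule integral_parametric[where B = t])
    show "\<bar>\<phi>\<^sub>1 s \<eta>\<bar> \<le> t" if "s \<in> {0..t}" for s \<eta>
      using \<phi>\<^sub>1_bounds[of s \<eta>] that by auto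
  qed (use \<phi>\<^sub>2_eq_integral[OF t] integrable_indicator_h[OF A] in auto)
qed

lemma Lim_Vt: "Lim at_top (Vt s) = (LBINT \<eta>. V\<^sub>\<xi> s \<eta>)"
  unfolding Vt_def[abs_def]
  by (rule tendsto_Lim) (auto intro: tendsto_set_integral_atMost integrable_h\<phi>)

lemma set_integral_UNIV: "(LBINT \<eta>:UNIV. f \<eta>) = (LBINT \<eta>. f \<eta>)" for f :: "real \<Rightarrow> real"
  by (simp add: set_lebesgue_integral_def)

lemma U_0: "Ut 0 \<xi> = U \<xi>" and y_0: "yt 0 \<xi> = y \<xi>" and V_0: "Vt 0 \<xi> = H \<xi>"
proof -
  have "\<phi>\<^sub>1 0 \<eta> = 0" "\<phi>\<^sub>2 0 \<eta> = 0" "\<phi>\<^sub>0 0 \<eta> = 1" for \<eta>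
    using brk_pos[of \<eta>] by (auto simp: \<phi>\<^sub>1_def \<phi>\<^sub>2_def \<phi>\<^sub>0_def of_bool_def)
  then show "Ut 0 \<xi> = U \<xi>" "yt 0 \<xi> = y \<xi>" "Vt 0 \<xi> = H \<xi>"
    by (simp_all add: Ut_def yt_def Vt_def V\<^sub>\<xi>_def H_def H_eq)
qed

lemma Ut_integral:
  assumes t: "0 \<le> t"
  shows "((\<lambda>s. 1/2 * Vt s \<xi> - 1/4 * Lim at_top (Vt s)) has_integral (Ut t \<xi> - U \<xi>)) {0..t}"
proof -
  have "((\<lambda>s. 1/2 * Vt s \<xi> - 1/4 * (LBINT \<eta>:UNIV. V\<^sub>\<xi> s \<eta>)) has_integral
     1/2 * (LBINT \<eta>:{..\<xi>}. h \<eta> * \<phi>\<^sub>1 t \<eta>) - 1/4 * (LBINT \<eta>:UNIV. h \<eta> * \<phi>\<^sub>1 t \<eta>)) {0..t}"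
    unfolding Vt_def
    by (intro has_integral_diff has_integral_mult_right energy_integral(1)[OF t]) auto
  then show ?thesis by (simp add: Lim_Vt set_integral_UNIV Ut_def)
qed

lemma yt_integral:
  assumes t: "0 \<le> t"
  shows "((\<lambda>s. Ut s \<xi>) has_integral (yt t \<xi> - y \<xi>)) {0..t}"
proof -
  have "((\<lambda>s. U \<xi> + 1/2 * (LBINT \<eta>:{..\<xi>}. h \<eta> * \<phi>\<^sub>1 s \<eta>) - 1/4 * (LBINT \<eta>:UNIV. h \<eta> * \<phi>\<^sub>1 s \<eta>)) has_integral
     t * U \<xi> + 1/2 * (LBINT \<eta>:{..\<xi>}. h \<eta> * \<phi>\<^sub>2 t \<eta>) - 1/4 * (LBINT \<eta>:UNIV. h \<eta> * \<phi>\<^sub>2 t \<eta>)) {0..t}"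
  proof (intro has_integral_diff has_integral_add has_integral_mult_right energy_integral(2)[OF t])
    show "((\<lambda>s. U \<xi>) has_integral t * U \<xi>) {0..t}"
      using has_integral_const_real[of "U \<xi>" 0 t] t by simp
  qed auto
  then show ?thesis by (simp add: Ut_def yt_def set_integral_UNIV add_diff_eq)
qed

text \<open>\<open>Vt\<close> jumps in time, but \<open>Ut\<close> is a time integral of it.
  Continuity is what turns the integral formula for \<open>yt\<close> into a classical
  derivative.\<close>

lemma Ut_continuous: "continuous_on {0..b} (\<lambda>s. Ut s \<xi>)"
proof (cases "0 \<le> b")
  case True
  let ?g = "\<lambda>s. 1/2 * Vt s \<xi> - 1/4 * Lim at_top (Vt s)"
  have "?g integrable_on {0..b}" using Ut_integral[OF True, of \<xi>] by blast
  then have "continuous_on {0..b} (\<lambda>s. U \<xi> + integral {0..s} ?g)"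
    by (intro continuous_intros indefinite_integral_continuous_1)
  then show ?thesis
  proof (rule continuous_on_eq)
    show "U \<xi> + integral {0..s} ?g = Ut s \<xi>" if "s \<in> {0..b}" for s
      using integral_unique[OF Ut_integral[of s \<xi>]] that by simp
  qed
qed simp

lemma yt_deriv:
  assumes t: "0 \<le> t"
  shows "((\<lambda>s. yt s \<xi>) has_real_derivative Ut t \<xi>) (at t within {0..})"
proof -
  have "((\<lambda>x. integral {0..x} (\<lambda>s. Ut s \<xi>)) has_real_derivative Ut t \<xi>) (at t within {0..t+1})"
    by (rule integral_has_real_derivative[OF Ut_continuous]) (use t in auto)
  then have "((\<lambda>x. y \<xi> + integral {0..x} (\<lambda>s. Ut s \<xi>)) has_real_derivative 0 + Ut t \<xi>) (at t within {0..t+1})"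
    by (intro DERIV_add DERIV_const)
  then have "((\<lambda>x. y \<xi> + integral {0..x} (\<lambda>s. Ut s \<xi>)) has_real_derivative Ut t \<xi>) (at t within {0..t+1})"
    by simp
  then have "((\<lambda>s. yt s \<xi>) has_real_derivative Ut t \<xi>) (at t within {0..t+1})"
  proof (rule has_field_derivative_transform_within[where d = 1])
    show "y \<xi> + integral {0..s} (\<lambda>s. Ut s \<xi>) = yt s \<xi>" if "s \<in> {0..t+1}" "dist s t < 1" for s
      using integral_unique[OF yt_integral[of s \<xi>]] that by simp
  qed (use t in auto)
  \<comment> \<open>The differentiation theorem lives on a compact interval; cutting at
    \<open>t + 1\<close> does not affect the filter at \<open>t\<close>.\<close>
  moreover have "at t within {0..t+1} = at t within {0..}"
    by (rule at_within_nhd[of t "{..<t+1}"]) auto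
  ultimately show ?thesis by simp
qed

text \<open>\<open>breaking_time\<close> is built from the representatives picked by
  \<open>wderiv\<close>, so it matches \<open>brk\<close> almost everywhere only. Its special value
  0 is excluded by strict positivity and its value infinity by the bound
  \<open>ereal t\<close>.\<close>

lemma Vt_breaking_time:
  assumes \<chi>: "cutoff_pair \<chi>p \<chi>m"
  shows "Vt t \<xi> = (LBINT \<eta>:{..\<xi>}. wderiv H \<eta> *
    (1 - \<alpha> * of_bool (breaking_time (y, U, H, H) \<eta> \<le> ereal t \<and> 0 < breaking_time (y, U, H, H) \<eta>)))"
proof -
  note wy = primitive_wderiv[OF \<chi> primitive_y] and wU = primitive_wderiv[OF \<chi> primitive_U]
    and wH = primitive_wderiv[OF \<chi> primitive_H]
  note [measurable] = wy(4) wU(4) wH(4)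
  show ?thesis
    unfolding Vt_def set_lebesgue_integral_def
  proof (rule integral_cong_AE)
    show "(\<lambda>\<eta>. indicat_real {..\<xi>} \<eta> *\<^sub>R (wderiv H \<eta> *
      (1 - \<alpha> * of_bool (breaking_time (y, U, H, H) \<eta> \<le> ereal t \<and> 0 < breaking_time (y, U, H, H) \<eta>)))) \<in> borel_measurable lborel"
      unfolding breaking_time_def of_bool_def by simp measurable
    show "AE \<eta> in lborel. indicat_real {..\<xi>} \<eta> *\<^sub>R V\<^sub>\<xi> t \<eta> = indicat_real {..\<xi>} \<eta> *\<^sub>R (wderiv H \<eta> *
      (1 - \<alpha> * of_bool (breaking_time (y, U, H, H) \<eta> \<le> ereal t \<and> 0 < breaking_time (y, U, H, H) \<eta>)))"
      using wy(3) wU(3) wH(3)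
    proof eventually_elim
      case (elim \<eta>)
      have "(breaking_time (y, U, H, H) \<eta> \<le> ereal t \<and> 0 < breaking_time (y, U, H, H) \<eta>) \<longleftrightarrow> (q \<eta> < 0 \<and> brk \<eta> \<le> t)"
        using elim q_neg_pos[of \<eta>] brk_pos[of \<eta>]
        by (auto simp: breaking_time_def brk_def divide_simps)
      then show ?case using elim by (simp add: V\<^sub>\<xi>_def \<phi>\<^sub>0_def)
    qed
  qed simp
qed

text \<open>Uniqueness takes no fixed point argument: the initial data determine \<open>V\<close> at
  all times, then the integrated equation determines \<open>U\<close>, and finally the derivative in
  time determines \<open>y\<close>.\<close>

lemma S_flow_eq:
  assumes \<chi>: "cutoff_pair \<chi>p \<chi>m" and t: "0 \<le> t"
  shows "S_flow \<alpha> t (y, U, H, H) = (yt t, Ut t, Vt t, H)"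
  unfolding S_flow_def
proof (rule the_equality)
  have V0: "Vt 0 = H" "Ut 0 = U" "yt 0 = y" using V_0 U_0 y_0 by auto
  have "lagr_solution \<alpha> (y, U, H, H) yt Ut Vt (\<lambda>_. H)"
    unfolding lagr_solution_def V0
    using yt_deriv Ut_integral Vt_breaking_time[OF \<chi>] by auto
  then show "\<exists>y' U' V' H'. lagr_solution \<alpha> (y, U, H, H) y' U' V' H' \<and> (yt t, Ut t, Vt t, H) = (y' t, U' t, V' t, H' t)"
    by blast
next
  fix X assume "\<exists>y' U' V' H'. lagr_solution \<alpha> (y, U, H, H) y' U' V' H' \<and> X = (y' t, U' t, V' t, H' t)"
  then obtain y' U' V' H' where s: "lagr_solution \<alpha> (y, U, H, H) y' U' V' H'" and X: "X = (y' t, U' t, V' t, H' t)"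
    by blast
  have i: "y' 0 = y" "U' 0 = U" "V' 0 = H" "H' 0 = H"
    using s by (auto simp: lagr_solution_def)
  have V: "V' s = Vt s" if "0 \<le> s" for s
    using s that unfolding lagr_solution_def i Vt_breaking_time[OF \<chi>] by (auto simp: fun_eq_iff)
  have U: "U' s \<xi> = Ut s \<xi>" if s0: "0 \<le> s" for s \<xi>
  proof -
    have "((\<lambda>r. 1/2 * V' r \<xi> - 1/4 * Lim at_top (V' r)) has_integral (U' s \<xi> - U \<xi>)) {0..s}"
      using s s0 unfolding lagr_solution_def i by blast
    then have "((\<lambda>r. 1/2 * Vt r \<xi> - 1/4 * Lim at_top (Vt r)) has_integral (U' s \<xi> - U \<xi>)) {0..s}"
      by (rule has_integral_eq[rotated]) (simp add: V)
    from has_integral_unique[OF this Ut_integral[OF s0]] show ?thesis by simp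
  qed
  have Y: "y' s \<xi> = yt s \<xi>" if s0: "0 \<le> s" for s \<xi>
  proof -
    have "((\<lambda>s. y' s \<xi> - yt s \<xi>) has_real_derivative 0) (at r within {0..})" if r: "r \<in> {0..}" for r
    proof -
      have r0: "0 \<le> r" using r by simp
      have "((\<lambda>s. y' s \<xi>) has_real_derivative U' r \<xi>) (at r within {0..})"
        using s r0 unfolding lagr_solution_def by blast
      then have "((\<lambda>s. y' s \<xi>) has_real_derivative Ut r \<xi>) (at r within {0..})"
        by (simp only: U[OF r0])
      from DERIV_diff[OF this yt_deriv[of r \<xi>]] r show ?thesis by simp
    qed
    then obtain c where c: "\<And>r. r \<in> {0..} \<Longrightarrow> y' r \<xi> - yt r \<xi> = c"
      using has_field_derivative_zero_constant[of "{0..}" "\<lambda>s. y' s \<xi> - yt s \<xi>"] by auto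
    show ?thesis using c[of s] c[of 0] s0 by (simp add: i y_0)
  qed
  have "H' t = H" using s t unfolding lagr_solution_def i by auto
  then show "X = (yt t, Ut t, Vt t, H)" using V[OF t] U[OF t] Y[OF t] X by auto
qed

end

section \<open>Back to Eulerian coordinates\<close>

context eulerian_data
begin

definition H :: "real \<Rightarrow> real" where "H \<xi> = \<xi> - y \<xi>"

text \<open>The density of \<mu> with respect to itself is 1 only almost everywhere for \<mu>. Along
  \<open>y\<close> this means almost everywhere outside the zeros of \<open>h (y \<xi>)\<close>,
  which suffices since the density is multiplied by \<open>H\<^sub>\<xi>\<close> in
  \<open>L_map\<close>.\<close>

lemma RN_deriv_self: "AE \<xi> in lborel. h (y \<xi>) = 0 \<or> RN_deriv \<mu> \<mu> (y \<xi>) = 1"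
proof -
  have d: "density \<mu> (\<lambda>x. 1) = \<mu>"
    by (rule measure_eqI) (simp_all add: emeasure_density)
  have [measurable]: "RN_deriv \<mu> \<mu> \<in> borel_measurable borel"
    using borel_measurable_RN_deriv[of \<mu> \<mu>] unfolding measurable_cong_sets[OF sets_\<mu>(1) refl] .
  have "AE x in \<mu>. 1 = RN_deriv \<mu> \<mu> x"
    by (rule \<mu>.RN_deriv_unique[OF _ d]) simp
  then have "(\<integral>\<^sup>+x. indicator {x. RN_deriv \<mu> \<mu> x \<noteq> 1} x \<partial>\<mu>) = 0"
    by (subst nn_integral_0_iff_AE) (auto elim!: eventually_mono)
  then have "(\<integral>\<^sup>+\<xi>. ennreal (h (y \<xi>)) * indicator {x. RN_deriv \<mu> \<mu> x \<noteq> 1} (y \<xi>) \<partial>lborel) = 0"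
    by (subst push_h) auto
  then have "AE \<xi> in lborel. ennreal (h (y \<xi>)) * indicator {x. RN_deriv \<mu> \<mu> x \<noteq> 1} (y \<xi>) = 0"
    by (subst (asm) nn_integral_0_iff_AE) auto
  then show ?thesis
    by eventually_elim (use h_bounds in \<open>auto simp: indicator_def order_antisym split: if_splits\<close>)
qed

lemma L_map_eq:
  assumes \<chi>: "cutoff_pair \<chi>p \<chi>m"
  shows "L_map (u, \<mu>, \<mu>) = (y, \<lambda>\<xi>. u (y \<xi>), H, H)"
proof -
  have y: "Sup {x. x + measure \<mu> {..<x} < \<xi>} = y \<xi>" for \<xi>
    by (simp add: y_def lprim_def)
  have H: "\<xi> - y \<xi> = H \<xi>" for \<xi> by (simp add: H_def)
  have pH: "primitive H (\<lambda>\<xi>. h (y \<xi>))" using primitive_H by (simp add: H)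
  note [measurable] = primitive_wderiv(4)[OF \<chi> pH]
  have [measurable]: "RN_deriv \<mu> \<mu> \<in> borel_measurable borel"
    using borel_measurable_RN_deriv[of \<mu> \<mu>] unfolding measurable_cong_sets[OF sets_\<mu>(1) refl] .
  have "(LBINT \<eta>:{..\<xi>}. enn2real (RN_deriv \<mu> \<mu> (y \<eta>)) * wderiv H \<eta>) = H \<xi>" for \<xi>
  proof -
    have "(LBINT \<eta>:{..\<xi>}. enn2real (RN_deriv \<mu> \<mu> (y \<eta>)) * wderiv H \<eta>) = (LBINT \<eta>:{..\<xi>}. h (y \<eta>))"
      unfolding set_lebesgue_integral_def
    proof (rule integral_cong_AE)
      show "AE \<eta> in lborel. indicat_real {..\<xi>} \<eta> *\<^sub>R (enn2real (RN_deriv \<mu> \<mu> (y \<eta>)) * wderiv H \<eta>) = indicat_real {..\<xi>} \<eta> *\<^sub>R h (y \<eta>)"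
        using RN_deriv_self primitive_wderiv(3)[OF \<chi> pH] by eventually_elim auto
    qed auto
    then show ?thesis by (simp add: H_def H_eq)
  qed
  then show ?thesis by (simp add: L_map_def y H Let_def)
qed

lemma lagrangian_data:
  assumes "0 \<le> \<alpha>" "\<alpha> \<le> 1"
  shows "lagrangian_data \<alpha> y (\<lambda>\<xi>. u (y \<xi>)) (\<lambda>\<xi>. p (y \<xi>)) (\<lambda>\<xi>. q (y \<xi>)) (\<lambda>\<xi>. h (y \<xi>))"
  by unfold_locales
     (use assms primitive_y primitive_U p_bounds h_bounds p_plus_h q_square h_y_integrable H_eq in auto)

end

lemma push_density_cong:
  assumes "w \<in> borel_measurable borel" "w' \<in> borel_measurable borel" "AE \<xi> in lborel. w \<xi> = w' \<xi>"
  shows "push_density y w = push_density y w'"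
proof -
  have "density lborel (\<lambda>\<xi>. ennreal (w \<xi>)) = density lborel (\<lambda>\<xi>. ennreal (w' \<xi>))"
    by (rule density_cong) (use assms in auto)
  then show ?thesis by (simp add: push_density_def)
qed

lemma push_density_integral:
  assumes [measurable]: "y \<in> borel_measurable borel" and w: "integrable lborel w" "\<And>\<xi>. 0 \<le> w \<xi>"
  shows "finite_borel_measure (push_density y w)"
    and "\<phi> \<in> borel_measurable borel \<Longrightarrow> (\<integral>x. \<phi> x \<partial>push_density y w) = (LBINT \<xi>. w \<xi> * \<phi> (y \<xi>))"
    and "A \<in> sets borel \<Longrightarrow> measure (push_density y w) A = (LBINT \<xi>. w \<xi> * indicator A (y \<xi>))"
proof -
  have [measurable]: "w \<in> borel_measurable borel" using w(1) by auto
  show fin: "finite_borel_measure (push_density y w)"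
  proof (rule finite_borel_measureI)
    have "emeasure (push_density y w) UNIV = (\<integral>\<^sup>+\<xi>. ennreal (w \<xi>) \<partial>lborel)"
      by (simp add: push_density_def emeasure_distr emeasure_density)
    also have "\<dots> = ennreal (LBINT \<xi>. w \<xi>)" by (rule nn_integral_eq_integral) (use w in auto)
    finally show "emeasure (push_density y w) UNIV < \<infinity>" by simp
  qed (simp add: push_density_def)
  show *: "(\<integral>x. \<phi> x \<partial>push_density y w) = (LBINT \<xi>. w \<xi> * \<phi> (y \<xi>))"
    if [measurable]: "\<phi> \<in> borel_measurable borel" for \<phi>
    unfolding push_density_def
    by (subst integral_distr) (auto simp: integral_density w(2))
  show "measure (push_density y w) A = (LBINT \<xi>. w \<xi> * indicator A (y \<xi>))"
    if [measurable]: "A \<in> sets borel"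
    using *[of "indicator A"] that finite_borel_measureD[OF fin] by simp
qed

section \<open>Inverting the characteristics and the Eulerian solution\<close>

context lagrangian_data
begin

lemma yt_measurable [measurable]: "0 \<le> t \<Longrightarrow> yt t \<in> borel_measurable borel"
  by (rule borel_measurable_continuous_onI[OF primitive_continuous[OF primitive_yt]])

lemma yt_mono: "0 \<le> t \<Longrightarrow> a \<le> b \<Longrightarrow> yt t a \<le> yt t b"
proof -
  assume t: "0 \<le> t" "a \<le> b"
  have "0 \<le> (LBINT \<xi>:{a..b}. y\<^sub>\<xi> t \<xi>)"
    unfolding set_lebesgue_integral_def
    by (rule Bochner_Integration.integral_nonneg) (simp add: y\<^sub>\<xi>_nonneg)
  then show ?thesis using primitiveD(3)[OF primitive_yt[OF t(1)] t(2)] by simp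
qed

text \<open>Young's inequality gives \<open>y\<^sub>\<xi> \<ge> 1/2 - (1 + t\<^sup>2) h / 2\<close>, so \<open>yt t\<close> is onto although \<open>U\<close> need
  not be bounded here.\<close>

lemma yt_growth:
  assumes t: "0 \<le> t" and ab: "a \<le> b"
  shows "(b - a) / 2 - (1 + t\<^sup>2) / 2 * (LBINT \<xi>. h \<xi>) \<le> yt t b - yt t a"
proof -
  have lower: "1/2 - (1 + t\<^sup>2) / 2 * h \<xi> \<le> y\<^sub>\<xi> t \<xi>" for \<xi>
  proof -
    have "(t * \<bar>q \<xi>\<bar>)\<^sup>2 = p \<xi> * (t\<^sup>2 * h \<xi>)"
      by (simp add: power_mult_distrib q_square)
    also have "\<dots> \<le> ((p \<xi> + t\<^sup>2 * h \<xi>) / 2)\<^sup>2"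
      using zero_le_power2[of "p \<xi> - t\<^sup>2 * h \<xi>"] by (simp add: power2_eq_square field_simps)
    finally have "t * \<bar>q \<xi>\<bar> \<le> (p \<xi> + t\<^sup>2 * h \<xi>) / 2"
      by (rule power2_le_imp_le) (use p_nonneg h_nonneg in simp)
    moreover have "- (t * q \<xi>) \<le> t * \<bar>q \<xi>\<bar>"
      using mult_left_mono[OF abs_ge_minus_self t, of "q \<xi>"] by simp
    moreover have "0 \<le> h \<xi> * \<phi>\<^sub>2 t \<xi>" using h_nonneg \<phi>\<^sub>2_bounds(1)[OF t] by simp
    moreover have "p \<xi> = 1 - h \<xi>" using p_plus_h[of \<xi>] by simp
    ultimately show ?thesis unfolding y\<^sub>\<xi>_def by (simp add: field_simps)
  qed
  have si: "set_integrable lborel {a..b} (\<lambda>\<xi>. 1/2 - (1 + t\<^sup>2) / 2 * h \<xi>)"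
    and si': "set_integrable lborel {a..b} (\<lambda>\<xi>. (1 + t\<^sup>2) / 2 * h \<xi>)"
    and si1: "set_integrable lborel {a..b} (\<lambda>\<xi>. 1/2 :: real)"
  proof -
    show 1: "set_integrable lborel {a..b} (\<lambda>\<xi>. 1/2 :: real)"
      using locally_integrable_const unfolding locally_integrable_def by blast
    show 2: "set_integrable lborel {a..b} (\<lambda>\<xi>. (1 + t\<^sup>2) / 2 * h \<xi>)"
      using locally_integrable_cmult[OF integrable_imp_locally_integrable[OF h_integrable]]
      unfolding locally_integrable_def by blast
    show "set_integrable lborel {a..b} (\<lambda>\<xi>. 1/2 - (1 + t\<^sup>2) / 2 * h \<xi>)"
      by (rule set_integral_diff(1)[OF 1 2])
  qed
  have "(LBINT \<xi>:{a..b}. h \<xi>) \<le> (LBINT \<xi>. h \<xi>)"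
    unfolding set_lebesgue_integral_def
    by (rule integral_mono) (use integrable_indicator_h[of "{a..b}"] h_integrable h_nonneg in \<open>auto simp: indicator_def\<close>)
  then have "(1 + t\<^sup>2) / 2 * (LBINT \<xi>:{a..b}. h \<xi>) \<le> (1 + t\<^sup>2) / 2 * (LBINT \<xi>. h \<xi>)"
    by (intro mult_left_mono) (auto simp: add_nonneg_nonneg)
  moreover have "(LBINT \<xi>:{a..b}. 1/2 - (1 + t\<^sup>2) / 2 * h \<xi>) = (b - a) / 2 - (1 + t\<^sup>2) / 2 * (LBINT \<xi>:{a..b}. h \<xi>)"
    using ab by (subst set_integral_diff(2)[OF si1 si']) (simp add: set_integral_const)
  moreover have "(LBINT \<xi>:{a..b}. 1/2 - (1 + t\<^sup>2) / 2 * h \<xi>) \<le> (LBINT \<xi>:{a..b}. y\<^sub>\<xi> t \<xi>)"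
    by (rule set_integral_mono[OF si primitiveD(4)[OF primitive_yt[OF t]]]) (rule lower)
  ultimately show ?thesis using primitiveD(3)[OF primitive_yt[OF t] ab] by linarith
qed

definition yinv :: "real \<Rightarrow> real \<Rightarrow> real" where "yinv t x = Sup {\<xi>. yt t \<xi> < x}"

text \<open>Everything about \<open>yinv\<close> follows from this equivalence. One direction is
  monotonicity of \<open>yt t\<close>, the other its continuity, which allows moving slightly to the
  right of \<open>a\<close>; \<open>yt_growth\<close> ensures that the supremum is taken over a
  nonempty set bounded above.\<close>

lemma less_yinv:
  assumes t: "0 \<le> t"
  shows "a < yinv t x \<longleftrightarrow> yt t a < x"
proof -
  define C where "C = (1 + t\<^sup>2) / 2 * (LBINT \<xi>. h \<xi>)"
  have C: "0 \<le> C" using h_nonneg by (simp add: C_def add_nonneg_nonneg)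
  note growth = yt_growth[OF t, folded C_def]
  have ne: "{\<xi>. yt t \<xi> < x} \<noteq> {}"
  proof -
    \<comment> \<open>So far to the left that \<open>yt_growth\<close> between \<open>a\<close> and
      0 forces \<open>yt t a\<close> below \<open>x\<close>.\<close>
    define a where "a = - 2 * (\<bar>yt t 0\<bar> + \<bar>x\<bar> + C + 1)"
    have "a \<le> 0" using C by (simp add: a_def)
    from growth[OF this] have "yt t a \<le> yt t 0 + a / 2 + C" by (simp add: algebra_simps)
    moreover have "a / 2 = - (\<bar>yt t 0\<bar> + \<bar>x\<bar> + C + 1)" by (simp add: a_def)
    ultimately have "yt t a < x" by linarith
    then show ?thesis by blast
  qed
  have bd: "bdd_above {\<xi>. yt t \<xi> < x}"
  proof (rule bdd_aboveI)
    fix \<xi> assume "\<xi> \<in> {\<xi>. yt t \<xi> < x}"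
    then have x: "yt t \<xi> < x" by simp
    show "\<xi> \<le> 2 * (\<bar>x\<bar> + \<bar>yt t 0\<bar> + C)"
    proof (cases "0 \<le> \<xi>")
      case True
      from growth[OF this] have "\<xi> / 2 \<le> yt t \<xi> - yt t 0 + C" by (simp add: algebra_simps)
      then show ?thesis using x abs_ge_self[of x] abs_ge_minus_self[of "yt t 0"]
        unfolding distrib_left by linarith
    next
      case False
      moreover have "0 \<le> 2 * (\<bar>x\<bar> + \<bar>yt t 0\<bar> + C)" using C by simp
      ultimately show ?thesis by linarith
    qed
  qed
  show ?thesis
  proof
    assume a: "a < yinv t x"
    show "yt t a < x"
    proof (rule ccontr)
      assume "\<not> yt t a < x"
      then have "\<xi> \<le> a" if "yt t \<xi> < x" for \<xi>
        using yt_mono[OF t, of a \<xi>] that by (cases "\<xi> \<le> a") auto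
      then have "yinv t x \<le> a" unfolding yinv_def by (intro cSup_least[OF ne]) auto
      then show False using a by simp
    qed
  next
    assume a: "yt t a < x"
    have "isCont (yt t) a"
      using primitive_continuous[OF primitive_yt[OF t], of UNIV] by (simp add: continuous_on_eq_continuous_at)
    then have "(yt t \<longlongrightarrow> yt t a) (at_right a)" by (simp add: isCont_def filterlim_at_split)
    then have "\<forall>\<^sub>F b in at_right a. yt t b < x" by (rule order_tendstoD(2)) (rule a)
    then obtain b where b: "a < b" "\<And>c. a < c \<Longrightarrow> c < b \<Longrightarrow> yt t c < x"
      by (auto simp: eventually_at_right_field)
    obtain c where c: "a < c" "c < b" using dense[OF b(1)] by auto
    then have "c \<le> yinv t x" unfolding yinv_def by (intro cSup_upper bd) (use b in auto)
    then show "a < yinv t x" using c by simp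
  qed
qed

lemma yt_yinv:
  assumes t: "0 \<le> t"
  shows "yt t (yinv t x) = x"
proof (rule antisym)
  show "x \<le> yt t (yinv t x)" using less_yinv[OF t, of "yinv t x" x] by simp
  have "isCont (yt t) (yinv t x)"
    using primitive_continuous[OF primitive_yt[OF t], of UNIV] by (simp add: continuous_on_eq_continuous_at)
  then have l: "(yt t \<longlongrightarrow> yt t (yinv t x)) (at_left (yinv t x))" by (simp add: isCont_def filterlim_at_split)
  have "\<forall>\<^sub>F a in at_left (yinv t x). a < yinv t x" by (auto simp: eventually_at_filter)
  then have "\<forall>\<^sub>F a in at_left (yinv t x). yt t a \<le> x"
    by eventually_elim (simp add: less_yinv[OF t] less_imp_le)
  then show "yt t (yinv t x) \<le> x"
    by (rule tendsto_upperbound[OF l]) (simp add: trivial_limit_at_left_real)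
qed

lemma yinv_less_iff: "0 \<le> t \<Longrightarrow> yinv t a < yinv t b \<longleftrightarrow> a < b"
  using less_yinv[of t "yinv t a" b] yt_yinv[of t a] by simp

lemma yinv_measurable [measurable]: "0 \<le> t \<Longrightarrow> yinv t \<in> borel_measurable borel"
proof (rule borel_measurable_mono, rule monoI)
  fix a b :: real assume "0 \<le> t" "a \<le> b"
  then show "yinv t a \<le> yinv t b" using yinv_less_iff[of t b a] by (auto simp: not_less[symmetric])
qed

text \<open>By \<open>less_yinv\<close> the preimage of \<open>{a<..b}\<close> is
  \<open>{yt t a<..yt t b}\<close>, whose length is the integral of
  \<open>y\<^sub>\<xi> t\<close>.\<close>

lemma distr_yinv:
  assumes t: "0 \<le> t"
  shows "distr lborel borel (yinv t) = density lborel (\<lambda>\<xi>. ennreal (y\<^sub>\<xi> t \<xi>))"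
proof (rule measure_eqI_Ioc)
  note [measurable] = yinv_measurable[OF t]
  fix a b :: real assume ab: "a \<le> b"
  have "yinv t -` {a<..b} = {yt t a<..yt t b}"
    using less_yinv[OF t] by (auto simp: not_less[symmetric])
  then have 1: "emeasure (distr lborel borel (yinv t)) {a<..b} = ennreal (yt t b - yt t a)"
    using yt_mono[OF t ab] by (subst emeasure_distr) auto
  have "emeasure (density lborel (\<lambda>\<xi>. ennreal (y\<^sub>\<xi> t \<xi>))) {a<..b}
      = (\<integral>\<^sup>+\<xi>. ennreal (indicat_real {a<..b} \<xi> * y\<^sub>\<xi> t \<xi>) \<partial>lborel)"
    by (subst emeasure_density) (auto intro!: nn_integral_cong simp: indicator_def)
  also have "\<dots> = ennreal (LBINT \<xi>:{a<..b}. y\<^sub>\<xi> t \<xi>)"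
  proof -
    have "set_integrable lborel {a<..b} (y\<^sub>\<xi> t)"
      by (rule set_integrable_subset[OF primitiveD(4)[OF primitive_yt[OF t], of a b]]) auto
    then show ?thesis unfolding set_lebesgue_integral_def
      by (subst nn_integral_eq_integral) (auto simp: set_integrable_def y\<^sub>\<xi>_nonneg)
  qed
  also have "\<dots> = ennreal (yt t b - yt t a)"
    using primitiveD(3)[OF primitive_yt[OF t] ab] set_integral_Ioc[OF primitiveD(2)[OF primitive_yt[OF t]]] by simp
  finally show "emeasure (distr lborel borel (yinv t)) {a<..b} = emeasure (density lborel (\<lambda>\<xi>. ennreal (y\<^sub>\<xi> t \<xi>))) {a<..b}"
    using 1 by simp
  show "emeasure (distr lborel borel (yinv t)) {a<..b} < \<infinity>" using 1 by simp
qed auto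

lemma nn_integral_yinv:
  assumes t: "0 \<le> t" and [measurable]: "f \<in> borel_measurable borel"
  shows "(\<integral>\<^sup>+x. f (yinv t x) \<partial>lborel) = (\<integral>\<^sup>+\<xi>. ennreal (y\<^sub>\<xi> t \<xi>) * f \<xi> \<partial>lborel)"
proof -
  note [measurable] = yinv_measurable[OF t]
  have "(\<integral>\<^sup>+x. f (yinv t x) \<partial>lborel) = (\<integral>\<^sup>+\<xi>. f \<xi> \<partial>distr lborel borel (yinv t))"
    by (subst nn_integral_distr) auto
  then show ?thesis unfolding distr_yinv[OF t] by (simp add: nn_integral_density)
qed

definition ue :: "real \<Rightarrow> real \<Rightarrow> real" where "ue t x = Ut t (yinv t x)"
text \<open>Where \<open>y\<^sub>\<xi>\<close> is zero the quotient is 0 by convention. By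
  \<open>distr_yinv\<close> this concerns only a null set of \<open>x\<close>, and
  \<open>U\<^sub>\<xi>\<close> vanishes there as well.\<close>

definition ue\<^sub>x :: "real \<Rightarrow> real \<Rightarrow> real" where "ue\<^sub>x t x = U\<^sub>\<xi> t (yinv t x) / y\<^sub>\<xi> t (yinv t x)"

lemma ue\<^sub>x_measurable [measurable]: "0 \<le> t \<Longrightarrow> ue\<^sub>x t \<in> borel_measurable borel"
  unfolding ue\<^sub>x_def by measurable

text \<open>After the change of variables the integrand is at most \<open>V\<^sub>\<xi>\<close>,
  which is at most \<open>h\<close>. The bound is uniform in time and gives the weak compactness and
  the Hoelder estimates below.\<close>

lemma ue\<^sub>x_square:
  assumes t: "0 \<le> t"
  shows "integrable lborel (\<lambda>x. (ue\<^sub>x t x)\<^sup>2)" "(LBINT x. (ue\<^sub>x t x)\<^sup>2) \<le> (LBINT \<xi>. h \<xi>)"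
proof -
  note [measurable] = ue\<^sub>x_measurable[OF t]
  have "(\<integral>\<^sup>+x. ennreal ((ue\<^sub>x t x)\<^sup>2) \<partial>lborel) = (\<integral>\<^sup>+\<xi>. ennreal (y\<^sub>\<xi> t \<xi>) * ennreal ((U\<^sub>\<xi> t \<xi> / y\<^sub>\<xi> t \<xi>)\<^sup>2) \<partial>lborel)"
    unfolding ue\<^sub>x_def by (rule nn_integral_yinv[OF t]) auto
  also have "\<dots> \<le> (\<integral>\<^sup>+\<xi>. ennreal (h \<xi>) \<partial>lborel)"
  proof (rule nn_integral_mono)
    fix \<xi>
    have "y\<^sub>\<xi> t \<xi> * (U\<^sub>\<xi> t \<xi> / y\<^sub>\<xi> t \<xi>)\<^sup>2 \<le> V\<^sub>\<xi> t \<xi>"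
      unfolding power_divide U\<^sub>\<xi>_square using V\<^sub>\<xi>_bounds(1)[of t \<xi>]
      by (cases "y\<^sub>\<xi> t \<xi> = 0") (auto simp: power2_eq_square)
    also have "\<dots> \<le> h \<xi>" by (rule V\<^sub>\<xi>_bounds(2))
    finally have "ennreal (y\<^sub>\<xi> t \<xi> * (U\<^sub>\<xi> t \<xi> / y\<^sub>\<xi> t \<xi>)\<^sup>2) \<le> ennreal (h \<xi>)" by (rule ennreal_leI)
    then show "ennreal (y\<^sub>\<xi> t \<xi>) * ennreal ((U\<^sub>\<xi> t \<xi> / y\<^sub>\<xi> t \<xi>)\<^sup>2) \<le> ennreal (h \<xi>)"
      by (simp add: y\<^sub>\<xi>_nonneg ennreal_mult)
  qed
  also have "\<dots> = ennreal (LBINT \<xi>. h \<xi>)"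
    by (rule nn_integral_eq_integral) (use h_integrable h_nonneg in auto)
  finally have le: "(\<integral>\<^sup>+x. ennreal ((ue\<^sub>x t x)\<^sup>2) \<partial>lborel) \<le> ennreal (LBINT \<xi>. h \<xi>)" .
  show i: "integrable lborel (\<lambda>x. (ue\<^sub>x t x)\<^sup>2)"
    by (rule integrableI_bounded) (use le in \<open>auto simp: le_less_trans[OF _ ennreal_less_top]\<close>)
  show "(LBINT x. (ue\<^sub>x t x)\<^sup>2) \<le> (LBINT \<xi>. h \<xi>)"
    using le nn_integral_eq_integral[OF i] h_nonneg by (simp add: ennreal_le_iff)
qed

lemma U\<^sub>\<xi>_eq: "y\<^sub>\<xi> t \<xi> * (U\<^sub>\<xi> t \<xi> / y\<^sub>\<xi> t \<xi>) = U\<^sub>\<xi> t \<xi>"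
  using U\<^sub>\<xi>_square[of t \<xi>] by (cases "y\<^sub>\<xi> t \<xi> = 0") auto

text \<open>The increment of \<open>Ut t\<close> between \<open>yinv t a\<close> and
  \<open>yinv t b\<close> is transported to space by \<open>distr_yinv\<close>; strict monotonicity
  of \<open>yinv t\<close> matches the two half-open intervals.\<close>

lemma primitive_ue:
  assumes t: "0 \<le> t"
  shows "primitive (ue t) (ue\<^sub>x t)"
  unfolding primitive_def
proof (intro conjI allI impI)
  note [measurable] = ue\<^sub>x_measurable[OF t] yinv_measurable[OF t]
  show "locally_integrable (ue\<^sub>x t)"
    by (rule locally_integrable_square[OF ue\<^sub>x_measurable[OF t] ue\<^sub>x_square(1)[OF t]])
  fix a b :: real assume ab: "a \<le> b"
  have ab': "yinv t a \<le> yinv t b" using yinv_less_iff[OF t, of b a] ab by (simp add: not_less[symmetric])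
  let ?w = "\<lambda>\<xi>. indicat_real {yinv t a<..yinv t b} \<xi> * (U\<^sub>\<xi> t \<xi> / y\<^sub>\<xi> t \<xi>)"
  have "(LBINT x:{a..b}. ue\<^sub>x t x) = (LBINT x:{a<..b}. ue\<^sub>x t x)"
    by (rule set_integral_Ioc[symmetric]) simp
  also have "\<dots> = (LBINT x. ?w (yinv t x))"
    unfolding set_lebesgue_integral_def ue\<^sub>x_def
    by (intro Bochner_Integration.integral_cong refl)
       (auto simp: indicator_def yinv_less_iff[OF t] not_less[symmetric])
  also have "\<dots> = (\<integral>\<xi>. ?w \<xi> \<partial>distr lborel borel (yinv t))"
    by (subst integral_distr) auto
  also have "\<dots> = (LBINT \<xi>. y\<^sub>\<xi> t \<xi> *\<^sub>R ?w \<xi>)"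
    unfolding distr_yinv[OF t] by (subst integral_density) (auto simp: y\<^sub>\<xi>_nonneg)
  also have "\<dots> = (LBINT \<xi>:{yinv t a<..yinv t b}. U\<^sub>\<xi> t \<xi>)"
    unfolding set_lebesgue_integral_def
  proof (intro Bochner_Integration.integral_cong refl)
    fix \<xi>
    have "y\<^sub>\<xi> t \<xi> *\<^sub>R ?w \<xi> = indicat_real {yinv t a<..yinv t b} \<xi> * (y\<^sub>\<xi> t \<xi> * (U\<^sub>\<xi> t \<xi> / y\<^sub>\<xi> t \<xi>))" by simp
    then show "y\<^sub>\<xi> t \<xi> *\<^sub>R ?w \<xi> = indicat_real {yinv t a<..yinv t b} \<xi> *\<^sub>R U\<^sub>\<xi> t \<xi>"
      by (simp only: U\<^sub>\<xi>_eq real_scaleR_def)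
  qed
  also have "\<dots> = ue t b - ue t a"
    using primitiveD(3)[OF primitive_Ut[OF t] ab'] set_integral_Ioc[OF primitiveD(2)[OF primitive_Ut[OF t]]]
    by (simp add: ue_def)
  finally show "ue t b - ue t a = (LBINT x:{a..b}. ue\<^sub>x t x)" by simp
qed

text \<open>On an interval where \<open>yt t\<close> is constant, \<open>y\<^sub>\<xi>\<close> and
  by \<open>U\<^sub>\<xi>_square\<close> also \<open>U\<^sub>\<xi>\<close> vanish almost everywhere.
  Therefore the particle chosen in \<open>M_map\<close> is irrelevant.\<close>

lemma Ut_level:
  assumes t: "0 \<le> t" and le: "a \<le> b" and eq: "yt t a = yt t b"
  shows "Ut t a = Ut t b"
proof -
  have i: "integrable lborel (\<lambda>\<xi>. indicat_real {a..b} \<xi> * y\<^sub>\<xi> t \<xi>)"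
    using primitiveD(4)[OF primitive_yt[OF t], of a b] by (simp add: set_integrable_def)
  have "(LBINT \<xi>. indicat_real {a..b} \<xi> * y\<^sub>\<xi> t \<xi>) = 0"
    using primitiveD(3)[OF primitive_yt[OF t] le] eq by (simp add: set_lebesgue_integral_def)
  then have "AE \<xi> in lborel. indicat_real {a..b} \<xi> * y\<^sub>\<xi> t \<xi> = 0"
    by (subst (asm) integral_nonneg_eq_0_iff_AE[OF i]) (auto simp: y\<^sub>\<xi>_nonneg)
  then have ae: "AE \<xi> in lborel. indicat_real {a..b} \<xi> * U\<^sub>\<xi> t \<xi> = 0"
  proof eventually_elim
    case (elim \<xi>)
    then show ?case using U\<^sub>\<xi>_square[of t \<xi>] by auto
  qed
  have "Ut t b - Ut t a = (LBINT \<xi>. indicat_real {a..b} \<xi> * U\<^sub>\<xi> t \<xi>)"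
    using primitiveD(3)[OF primitive_Ut[OF t] le] by (simp add: set_lebesgue_integral_def)
  also have "\<dots> = 0" by (rule integral_eq_zero_AE[OF ae])
  finally show ?thesis by simp
qed

lemma Ut_eq_if_yt_eq:
  assumes "0 \<le> t" "yt t a = yt t b"
  shows "Ut t a = Ut t b"
proof (cases "a \<le> b")
  case True
  show ?thesis by (rule Ut_level[OF assms(1) True assms(2)])
next
  case False
  then have "b \<le> a" by simp
  show ?thesis by (rule Ut_level[OF assms(1) \<open>b \<le> a\<close> assms(2)[symmetric], symmetric])
qed

lemma ue_yt: "0 \<le> t \<Longrightarrow> ue t (yt t \<xi>) = Ut t \<xi>"
  unfolding ue_def by (rule Ut_eq_if_yt_eq) (simp_all add: yt_yinv)

definition mu :: "real \<Rightarrow> real measure" where "mu t = push_density (yt t) (V\<^sub>\<xi> t)"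
definition nu :: "real \<Rightarrow> real measure" where "nu t = push_density (yt t) h"

lemma M_map_eq:
  assumes \<chi>: "cutoff_pair \<chi>p \<chi>m" and t: "0 \<le> t"
  shows "M_map (yt t, Ut t, Vt t, H) = (ue t, mu t, nu t)"
proof -
  have "Ut t (SOME \<xi>. yt t \<xi> = x) = ue t x" for x
  proof -
    have "yt t (SOME \<xi>. yt t \<xi> = x) = x" by (rule someI[of "\<lambda>\<xi>. yt t \<xi> = x"]) (rule yt_yinv[OF t])
    then show ?thesis using ue_yt[OF t, of "SOME \<xi>. yt t \<xi> = x"] by simp
  qed
  moreover have "push_density (yt t) (wderiv (Vt t)) = mu t"
    unfolding mu_def
    by (rule push_density_cong[OF primitive_wderiv(4)[OF \<chi> primitive_Vt] _ primitive_wderiv(3)[OF \<chi> primitive_Vt]]) simp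
  moreover have "push_density (yt t) (wderiv H) = nu t"
    unfolding nu_def
    by (rule push_density_cong[OF primitive_wderiv(4)[OF \<chi> primitive_H] _ primitive_wderiv(3)[OF \<chi> primitive_H]]) simp
  ultimately show ?thesis by (simp add: M_map_def)
qed

definition stab :: "real \<Rightarrow> real" where "stab \<xi> = h \<xi> * (1 - \<alpha> * of_bool (q \<xi> < 0))"

lemma push_stab_fun:
  assumes \<chi>: "cutoff_pair \<chi>p \<chi>m" and t: "0 \<le> t"
  shows "push_density (yt t) (stab_fun \<alpha> (yt t, Ut t, Vt t, H)) = push_density (yt t) stab"
proof (rule push_density_cong)
  note wU = primitive_wderiv[OF \<chi> primitive_Ut[OF t]] and wV = primitive_wderiv[OF \<chi> primitive_Vt[of t]]
  note [measurable] = wU(4) wV(4)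
  show "stab_fun \<alpha> (yt t, Ut t, Vt t, H) \<in> borel_measurable borel"
    unfolding stab_fun_def by simp
  show "stab \<in> borel_measurable borel" unfolding stab_def of_bool_def by measurable
  show "AE \<xi> in lborel. stab_fun \<alpha> (yt t, Ut t, Vt t, H) \<xi> = stab \<xi>"
    using wU(3) wV(3)
  proof eventually_elim
    case (elim \<xi>)
    then show ?case unfolding stab_def stab_eq[OF t, symmetric] stab_fun_def by simp
  qed
qed

lemma lprim_nu:
  assumes t: "0 \<le> t"
  shows "lprim (nu t) x = H (yinv t x)"
proof -
  note [measurable] = yt_measurable[OF t]
  have "lprim (nu t) x = (LBINT \<xi>. h \<xi> * indicator {..<x} (yt t \<xi>))"
    unfolding lprim_def nu_def
    by (rule push_density_integral(3)) (use h_integrable h_nonneg in auto)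
  also have "\<dots> = (LBINT \<xi>:{..yinv t x}. h \<xi>)"
    unfolding set_lebesgue_integral_def
  proof (rule integral_cong_AE)
    show "AE \<xi> in lborel. h \<xi> * indicat_real {..<x} (yt t \<xi>) = indicat_real {..yinv t x} \<xi> *\<^sub>R h \<xi>"
      using AE_lborel_singleton[of "yinv t x"]
      by eventually_elim (auto simp: indicator_def less_yinv[OF t, symmetric])
  qed auto
  finally show ?thesis by (simp add: H_def H_eq)
qed

end

section \<open>Convergence of Lagrangian data\<close>

text \<open>Convergence in mean gives pointwise convergence only along a subsequence; this principle
  brings the conclusion back to the full sequence. The proof enumerates the indices that stay away
  from the limit.\<close>

lemma LIMSEQ_if_subsubseq:
  fixes X :: "nat \<Rightarrow> real"
  assumes "\<And>r :: nat \<Rightarrow> nat. strict_mono r \<Longrightarrow> \<exists>s :: nat \<Rightarrow> nat. strict_mono s \<and> (\<lambda>n. X (r (s n))) \<longlonglongrightarrow> L"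
  shows "X \<longlonglongrightarrow> L"
proof (rule ccontr)
  assume "\<not> X \<longlonglongrightarrow> L"
  then obtain e where e: "0 < e" "\<And>N. \<exists>n\<ge>N. e \<le> dist (X n) L"
    unfolding lim_sequentially by (auto simp: not_less)
  then have inf: "infinite {n. e \<le> dist (X n) L}"
    by (auto simp: infinite_nat_iff_unbounded_le)
  define r where "r = enumerate {n. e \<le> dist (X n) L}"
  have r: "strict_mono r" "\<And>n. e \<le> dist (X (r n)) L"
    using strict_mono_enumerate[OF inf] enumerate_in_set[OF inf] by (auto simp: r_def)
  obtain s where s: "(\<lambda>n. X (r (s n))) \<longlonglongrightarrow> L" using assms[OF r(1)] by blast
  then obtain n where "dist (X (r (s n))) L < e"
    using e(1) unfolding lim_sequentially by blast
  then show False using r(2)[of "s n"] by simp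
qed

lemma tendsto_L1_imp_tendsto_integral:
  fixes f :: "nat \<Rightarrow> real \<Rightarrow> real"
  assumes "\<And>n. integrable M (f n)" "integrable M g"
    and "(\<lambda>n. \<integral>x. \<bar>f n x - g x\<bar> \<partial>M) \<longlonglongrightarrow> 0"
  shows "(\<lambda>n. \<integral>x. f n x \<partial>M) \<longlonglongrightarrow> (\<integral>x. g x \<partial>M)"
proof (rule LIM_zero_cancel, rule Lim_null_comparison[OF _ assms(3)], intro always_eventually allI)
  fix n
  have "(\<integral>x. f n x \<partial>M) - (\<integral>x. g x \<partial>M) = (\<integral>x. f n x - g x \<partial>M)"
    using assms by simp
  then show "norm ((\<integral>x. f n x \<partial>M) - (\<integral>x. g x \<partial>M)) \<le> (\<integral>x. \<bar>f n x - g x\<bar> \<partial>M)"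
    using integral_abs_bound[of M "\<lambda>x. f n x - g x"] by simp
qed

lemma L1_add:
  fixes f f' :: "nat \<Rightarrow> real \<Rightarrow> real"
  assumes i: "\<And>n. integrable M (f n)" "integrable M g" "\<And>n. integrable M (f' n)" "integrable M g'"
    and f: "(\<lambda>n. \<integral>x. \<bar>f n x - g x\<bar> \<partial>M) \<longlonglongrightarrow> 0" and f': "(\<lambda>n. \<integral>x. \<bar>f' n x - g' x\<bar> \<partial>M) \<longlonglongrightarrow> 0"
  shows "(\<lambda>n. \<integral>x. \<bar>(a * f n x + b * f' n x) - (a * g x + b * g' x)\<bar> \<partial>M) \<longlonglongrightarrow> 0"
proof (rule Lim_null_comparison)
  show "(\<lambda>n. \<bar>a\<bar> * (\<integral>x. \<bar>f n x - g x\<bar> \<partial>M) + \<bar>b\<bar> * (\<integral>x. \<bar>f' n x - g' x\<bar> \<partial>M)) \<longlonglongrightarrow> 0"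
    using tendsto_add[OF tendsto_mult_right_zero[OF f, of "\<bar>a\<bar>"] tendsto_mult_right_zero[OF f', of "\<bar>b\<bar>"]] by simp
  show "\<forall>\<^sub>F n in sequentially. norm (\<integral>x. \<bar>(a * f n x + b * f' n x) - (a * g x + b * g' x)\<bar> \<partial>M)
      \<le> \<bar>a\<bar> * (\<integral>x. \<bar>f n x - g x\<bar> \<partial>M) + \<bar>b\<bar> * (\<integral>x. \<bar>f' n x - g' x\<bar> \<partial>M)"
  proof (intro always_eventually allI)
    fix n
    have "(\<integral>x. \<bar>(a * f n x + b * f' n x) - (a * g x + b * g' x)\<bar> \<partial>M)
      \<le> (\<integral>x. \<bar>a\<bar> * \<bar>f n x - g x\<bar> + \<bar>b\<bar> * \<bar>f' n x - g' x\<bar> \<partial>M)"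
    proof (rule integral_mono)
      fix x
      have "(a * f n x + b * f' n x) - (a * g x + b * g' x) = a * (f n x - g x) + b * (f' n x - g' x)"
        by (simp add: algebra_simps)
      then show "\<bar>(a * f n x + b * f' n x) - (a * g x + b * g' x)\<bar> \<le> \<bar>a\<bar> * \<bar>f n x - g x\<bar> + \<bar>b\<bar> * \<bar>f' n x - g' x\<bar>"
        using abs_triangle_ineq[of "a * (f n x - g x)" "b * (f' n x - g' x)"] by (simp add: abs_mult)
    qed (use i in auto)
    also have "\<dots> = \<bar>a\<bar> * (\<integral>x. \<bar>f n x - g x\<bar> \<partial>M) + \<bar>b\<bar> * (\<integral>x. \<bar>f' n x - g' x\<bar> \<partial>M)"
      using i by simp
    finally show "norm (\<integral>x. \<bar>(a * f n x + b * f' n x) - (a * g x + b * g' x)\<bar> \<partial>M)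
      \<le> \<bar>a\<bar> * (\<integral>x. \<bar>f n x - g x\<bar> \<partial>M) + \<bar>b\<bar> * (\<integral>x. \<bar>f' n x - g' x\<bar> \<partial>M)" by simp
  qed
qed

context lagrangian_data
begin

lemma q2_plus_h2: "(q \<xi>)\<^sup>2 + (h \<xi>)\<^sup>2 = h \<xi>"
  unfolding q_square unfolding power2_eq_square distrib_right[symmetric] p_plus_h by simp

lemma q2_integrable: "integrable lborel (\<lambda>\<xi>. (q \<xi>)\<^sup>2)" and h2_integrable: "integrable lborel (\<lambda>\<xi>. (h \<xi>)\<^sup>2)"
  and q2_h2: "(LBINT \<xi>. (q \<xi>)\<^sup>2) + (LBINT \<xi>. (h \<xi>)\<^sup>2) = (LBINT \<xi>. h \<xi>)"
proof -
  have e: "(\<lambda>\<xi>. (q \<xi>)\<^sup>2) = (\<lambda>\<xi>. h \<xi> * p \<xi>)" "(\<lambda>\<xi>. (h \<xi>)\<^sup>2) = (\<lambda>\<xi>. h \<xi> * h \<xi>)"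
    by (simp_all only: q_square power2_eq_square[of "h _"] mult.commute)
  show i: "integrable lborel (\<lambda>\<xi>. (q \<xi>)\<^sup>2)" "integrable lborel (\<lambda>\<xi>. (h \<xi>)\<^sup>2)"
    unfolding e by (rule integrable_h_mult[where B = 1]; use p_nonneg p_le_1 h_nonneg h_le_1 in simp)+
  have "(LBINT \<xi>. h \<xi>) = (LBINT \<xi>. (q \<xi>)\<^sup>2 + (h \<xi>)\<^sup>2)"
    by (simp only: q2_plus_h2)
  then show "(LBINT \<xi>. (q \<xi>)\<^sup>2) + (LBINT \<xi>. (h \<xi>)\<^sup>2) = (LBINT \<xi>. h \<xi>)"
    using i by simp
qed

lemma p_zero_iff: "p \<xi> = 0 \<longleftrightarrow> h \<xi> = 1"
  using p_plus_h[of \<xi>] by auto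

lemma p_zero_finite: "emeasure lborel {\<xi>. p \<xi> = 0} < \<infinity>"
proof -
  have "emeasure lborel {\<xi>. p \<xi> = 0} = (\<integral>\<^sup>+\<xi>. indicator {\<xi>. p \<xi> = 0} \<xi> \<partial>lborel)" by simp
  also have "\<dots> \<le> (\<integral>\<^sup>+\<xi>. ennreal (h \<xi>) \<partial>lborel)"
    by (intro nn_integral_mono) (auto simp: indicator_def p_zero_iff)
  also have "\<dots> = ennreal (LBINT \<xi>. h \<xi>)"
    by (rule nn_integral_eq_integral) (use h_integrable h_nonneg in auto)
  also have "\<dots> < \<infinity>" by simp
  finally show ?thesis .
qed

end

text \<open>The interface between projection and flow: nothing else about the projection enters the
  limit. \<open>y_L1\<close> is listed separately because uniform closeness on an unbounded line
  says nothing about \<open>L\<^sup>1\<close>.\<close>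

locale lagrangian_convergence =
  L: lagrangian_data \<alpha> y U p q h
  for \<alpha> :: real and y U p q h :: "real \<Rightarrow> real" +
  fixes yn Us pn qn hn :: "nat \<Rightarrow> real \<Rightarrow> real" and \<epsilon> :: "nat \<Rightarrow> real"
  assumes data_n: "\<And>n. lagrangian_data \<alpha> (yn n) (Us n) (pn n) (qn n) (hn n)"
    and \<epsilon>: "\<epsilon> \<longlonglongrightarrow> 0"
    and y_close: "\<And>n \<xi>. \<bar>yn n \<xi> - y \<xi>\<bar> \<le> \<epsilon> n"
    and U_close: "\<And>n \<xi>. \<bar>Us n \<xi> - U \<xi>\<bar> \<le> \<epsilon> n"
    and mass: "\<And>n. (LBINT \<xi>. hn n \<xi>) = (LBINT \<xi>. h \<xi>)"
    and sing: "\<And>n. emeasure lborel {\<xi>. pn n \<xi> = 0} = emeasure lborel {\<xi>. p \<xi> = 0}"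
    and y_L1: "\<And>n. (\<integral>\<^sup>+\<xi>. ennreal \<bar>yn n \<xi> - y \<xi>\<bar> \<partial>lborel) \<le> ennreal (\<epsilon> n)"
begin

sublocale Ln: lagrangian_data \<alpha> "yn n" "Us n" "pn n" "qn n" "hn n" for n
  by (rule data_n)

lemma primitive_interval_tendsto:
  assumes "\<And>n. primitive (fn n) (gn n)" "primitive f g" "\<And>\<xi>. (\<lambda>n. fn n \<xi>) \<longlonglongrightarrow> f \<xi>" "a \<le> b"
  shows "(\<lambda>n. LBINT \<xi>:{a..b}. gn n \<xi> - g \<xi>) \<longlonglongrightarrow> 0"
proof -
  have "(LBINT \<xi>:{a..b}. gn n \<xi> - g \<xi>) = (fn n b - fn n a) - (f b - f a)" for n
    using primitiveD(3)[OF assms(1) assms(4), of n] primitiveD(3)[OF assms(2) assms(4)]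
    by (subst set_integral_diff(2)[OF primitiveD(4)[OF assms(1)] primitiveD(4)[OF assms(2)]]) simp
  moreover have "(\<lambda>n. (fn n b - fn n a) - (f b - f a)) \<longlonglongrightarrow> (f b - f a) - (f b - f a)"
    by (intro tendsto_diff assms tendsto_const)
  ultimately show ?thesis by simp
qed

lemma y_lim: "(\<lambda>n. yn n \<xi>) \<longlonglongrightarrow> y \<xi>" and U_lim: "(\<lambda>n. Us n \<xi>) \<longlonglongrightarrow> U \<xi>"
proof -
  show "(\<lambda>n. yn n \<xi>) \<longlonglongrightarrow> y \<xi>"
    by (rule LIM_zero_cancel, rule Lim_null_comparison[OF _ \<epsilon>]) (simp add: y_close)
  show "(\<lambda>n. Us n \<xi>) \<longlonglongrightarrow> U \<xi>"
    by (rule LIM_zero_cancel, rule Lim_null_comparison[OF _ \<epsilon>]) (simp add: U_close)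
qed

lemma weak_to_limit:
  fixes fn :: "nat \<Rightarrow> real \<Rightarrow> real" and f \<phi> :: "real \<Rightarrow> real"
  assumes m: "\<And>n. fn n \<in> borel_measurable borel" "f \<in> borel_measurable borel"
    and i: "\<And>n. integrable lborel (\<lambda>\<xi>. (fn n \<xi>)\<^sup>2)" "integrable lborel (\<lambda>\<xi>. (f \<xi>)\<^sup>2)"
    and B: "\<And>n. (LBINT \<xi>. (fn n \<xi>)\<^sup>2) \<le> B" "(LBINT \<xi>. (f \<xi>)\<^sup>2) \<le> B"
    and ivl: "\<And>a b. a \<le> b \<Longrightarrow> (\<lambda>n. LBINT \<xi>:{a..b}. fn n \<xi> - f \<xi>) \<longlonglongrightarrow> 0"
    and \<phi>: "\<phi> \<in> borel_measurable borel" "integrable lborel (\<lambda>\<xi>. (\<phi> \<xi>)\<^sup>2)"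
  shows "(\<lambda>n. \<integral>\<xi>. (fn n \<xi> - f \<xi>) * \<phi> \<xi> \<partial>lborel) \<longlonglongrightarrow> 0"
proof (rule weak_L2_null[where D = "\<lambda>n \<xi>. fn n \<xi> - f \<xi>" and B = "4 * B", OF _ _ _ ivl \<phi>])
  fix n
  show "(\<lambda>\<xi>. fn n \<xi> - f \<xi>) \<in> borel_measurable borel" using m by simp
  show d: "integrable lborel (\<lambda>\<xi>. (fn n \<xi> - f \<xi>)\<^sup>2)"
    by (rule integrable_power2_diff(1)) (use m i in auto)
  have "(LBINT \<xi>. (fn n \<xi> - f \<xi>)\<^sup>2) \<le> (LBINT \<xi>. 2 * (fn n \<xi>)\<^sup>2 + 2 * (f \<xi>)\<^sup>2)"
  proof (rule integral_mono[OF d])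
    show "(fn n \<xi> - f \<xi>)\<^sup>2 \<le> 2 * (fn n \<xi>)\<^sup>2 + 2 * (f \<xi>)\<^sup>2" for \<xi>
      using zero_le_power2[of "fn n \<xi> + f \<xi>"] by (simp add: power2_eq_square algebra_simps)
  qed (use i in auto)
  also have "\<dots> = 2 * (LBINT \<xi>. (fn n \<xi>)\<^sup>2) + 2 * (LBINT \<xi>. (f \<xi>)\<^sup>2)" using i by simp
  finally show "(LBINT \<xi>. (fn n \<xi> - f \<xi>)\<^sup>2) \<le> 4 * B" using B(1)[of n] B(2) by linarith
qed

text \<open>\<open>U\<^sub>\<xi>\<^sup>2 + H\<^sub>\<xi>\<^sup>2 = H\<^sub>\<xi>\<close> and the total masses agree, so weak convergence comes with convergence
  of norms and is therefore strong.\<close>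

lemma strong_L2: "(\<lambda>n. \<integral>\<xi>. (qn n \<xi> - q \<xi>)\<^sup>2 \<partial>lborel) \<longlonglongrightarrow> 0" "(\<lambda>n. \<integral>\<xi>. (hn n \<xi> - h \<xi>)\<^sup>2 \<partial>lborel) \<longlonglongrightarrow> 0"
proof -
  let ?M = "LBINT \<xi>. h \<xi>"
  have nn: "0 \<le> (LBINT \<xi>. (f \<xi>)\<^sup>2)" for f :: "real \<Rightarrow> real" by simp
  have b: "(LBINT \<xi>. (q \<xi>)\<^sup>2) \<le> ?M" "(LBINT \<xi>. (h \<xi>)\<^sup>2) \<le> ?M"
    using L.q2_h2 nn[of q] nn[of h] by linarith+
  have bn: "(LBINT \<xi>. (qn n \<xi>)\<^sup>2) \<le> ?M" "(LBINT \<xi>. (hn n \<xi>)\<^sup>2) \<le> ?M" for n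
    using Ln.q2_h2[of n] nn[of "qn n"] nn[of "hn n"] mass[of n] by linarith+
  have wq: "(\<lambda>n. \<integral>\<xi>. (qn n \<xi> - q \<xi>) * q \<xi> \<partial>lborel) \<longlonglongrightarrow> 0"
    by (rule weak_to_limit[OF _ _ Ln.q2_integrable L.q2_integrable bn(1) b(1)])
       (auto intro: primitive_interval_tendsto[OF Ln.primitive_U L.primitive_U U_lim] L.q2_integrable)
  have wh: "(\<lambda>n. \<integral>\<xi>. (hn n \<xi> - h \<xi>) * h \<xi> \<partial>lborel) \<longlonglongrightarrow> 0"
  proof (rule weak_to_limit[OF _ _ Ln.h2_integrable L.h2_integrable bn(2) b(2)])
    have H: "(\<lambda>n. Ln.H n \<xi>) \<longlonglongrightarrow> L.H \<xi>" for \<xi>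
      unfolding L.H_def Ln.H_def by (intro tendsto_diff tendsto_const y_lim)
    show "(\<lambda>n. LBINT \<xi>:{a..b}. hn n \<xi> - h \<xi>) \<longlonglongrightarrow> 0" if "a \<le> b" for a b
      by (rule primitive_interval_tendsto[OF Ln.primitive_H L.primitive_H H that])
  qed (auto intro: L.h2_integrable)
  have e: "(LBINT \<xi>. (fn \<xi> - f \<xi>)\<^sup>2) = (LBINT \<xi>. (fn \<xi>)\<^sup>2) - (LBINT \<xi>. (f \<xi>)\<^sup>2) - 2 * (LBINT \<xi>. (fn \<xi> - f \<xi>) * f \<xi>)"
    if m: "fn \<in> borel_measurable borel" "f \<in> borel_measurable borel"
      "integrable lborel (\<lambda>\<xi>. (fn \<xi>)\<^sup>2)" "integrable lborel (\<lambda>\<xi>. (f \<xi>)\<^sup>2)" for fn f :: "real \<Rightarrow> real"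
  proof -
    have "integrable lborel (\<lambda>\<xi>. fn \<xi> * f \<xi>)" by (rule integrable_mult_L2) (use m in auto)
    then have "(LBINT \<xi>. (fn \<xi> - f \<xi>) * f \<xi>) = (LBINT \<xi>. fn \<xi> * f \<xi>) - (LBINT \<xi>. (f \<xi>)\<^sup>2)"
      using m by (simp add: left_diff_distrib power2_eq_square)
    moreover have "(LBINT \<xi>. (fn \<xi> - f \<xi>)\<^sup>2) = (LBINT \<xi>. (fn \<xi>)\<^sup>2) - 2 * (LBINT \<xi>. fn \<xi> * f \<xi>) + (LBINT \<xi>. (f \<xi>)\<^sup>2)"
      by (rule integrable_power2_diff(2)) (use m in auto)
    ultimately show ?thesis by simp
  qed
  define Q where "Q = (\<lambda>n. \<integral>\<xi>. (qn n \<xi> - q \<xi>)\<^sup>2 \<partial>lborel)"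
  define R where "R = (\<lambda>n. \<integral>\<xi>. (hn n \<xi> - h \<xi>)\<^sup>2 \<partial>lborel)"
  \<comment> \<open>The squared norms add up to the same mass on both sides and cancel; only the
    pairings with the fixed limit functions are left, and these tend to zero by weak
    convergence.\<close>
  have QR: "Q n + R n = - 2 * (LBINT \<xi>. (qn n \<xi> - q \<xi>) * q \<xi>) + (- 2) * (LBINT \<xi>. (hn n \<xi> - h \<xi>) * h \<xi>)" for n
    using e[of "qn n" q] e[of "hn n" h] Ln.q2_h2[of n] L.q2_h2 mass[of n]
      Ln.q2_integrable[of n] Ln.h2_integrable[of n] L.q2_integrable L.h2_integrable
    by (simp add: Q_def R_def)
  have "(\<lambda>n. - 2 * (LBINT \<xi>. (qn n \<xi> - q \<xi>) * q \<xi>) + (- 2) * (LBINT \<xi>. (hn n \<xi> - h \<xi>) * h \<xi>)) \<longlonglongrightarrow> - 2 * 0 + (- 2) * 0"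
    by (intro tendsto_add tendsto_mult tendsto_const wq wh)
  then have s: "(\<lambda>n. Q n + R n) \<longlonglongrightarrow> 0" by (simp add: QR)
  have n: "0 \<le> Q n" "0 \<le> R n" for n by (simp_all add: Q_def R_def)
  show "(\<lambda>n. \<integral>\<xi>. (qn n \<xi> - q \<xi>)\<^sup>2 \<partial>lborel) \<longlonglongrightarrow> 0"
  proof (rule Lim_null_comparison[OF _ s], intro always_eventually allI)
    show "norm (LBINT \<xi>. (qn n \<xi> - q \<xi>)\<^sup>2) \<le> Q n + R n" for n
      using n[of n] by (simp add: Q_def)
  qed
  show "(\<lambda>n. \<integral>\<xi>. (hn n \<xi> - h \<xi>)\<^sup>2 \<partial>lborel) \<longlonglongrightarrow> 0"
  proof (rule Lim_null_comparison[OF _ s], intro always_eventually allI)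
    show "norm (LBINT \<xi>. (hn n \<xi> - h \<xi>)\<^sup>2) \<le> Q n + R n" for n
      using n[of n] by (simp add: R_def)
  qed
qed

text \<open>The difference of squares is the square of the difference plus twice the difference
  times the limit; Cauchy-Schwarz handles the second term.\<close>

lemma square_L1:
  fixes fn :: "nat \<Rightarrow> real \<Rightarrow> real"
  assumes m[measurable]: "\<And>n. fn n \<in> borel_measurable borel" "f \<in> borel_measurable borel"
    and i: "\<And>n. integrable lborel (\<lambda>\<xi>. (fn n \<xi>)\<^sup>2)" "integrable lborel (\<lambda>\<xi>. (f \<xi>)\<^sup>2)"
    and lim: "(\<lambda>n. \<integral>\<xi>. (fn n \<xi> - f \<xi>)\<^sup>2 \<partial>lborel) \<longlonglongrightarrow> 0"
  shows "(\<lambda>n. \<integral>\<xi>. \<bar>(fn n \<xi>)\<^sup>2 - (f \<xi>)\<^sup>2\<bar> \<partial>lborel) \<longlonglongrightarrow> 0"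
proof (rule Lim_null_comparison)
  have d: "integrable lborel (\<lambda>\<xi>. (fn n \<xi> - f \<xi>)\<^sup>2)" for n
    by (rule integrable_power2_diff(1)) (use i in auto)
  have p: "integrable lborel (\<lambda>\<xi>. \<bar>fn n \<xi> - f \<xi>\<bar> * \<bar>f \<xi>\<bar>)" for n
    by (rule integrable_mult_L2) (use d i in auto)
  let ?C = "\<lambda>n. LBINT \<xi>. \<bar>fn n \<xi> - f \<xi>\<bar> * \<bar>f \<xi>\<bar>"
  have "(\<lambda>n. sqrt ((LBINT \<xi>. (fn n \<xi> - f \<xi>)\<^sup>2) * (LBINT \<xi>. (f \<xi>)\<^sup>2))) \<longlonglongrightarrow> sqrt (0 * (LBINT \<xi>. (f \<xi>)\<^sup>2))"
    by (intro tendsto_real_sqrt tendsto_mult tendsto_const lim)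
  then have s: "(\<lambda>n. sqrt ((LBINT \<xi>. (fn n \<xi> - f \<xi>)\<^sup>2) * (LBINT \<xi>. (f \<xi>)\<^sup>2))) \<longlonglongrightarrow> 0" by simp
  have C: "?C \<longlonglongrightarrow> 0"
  proof (rule Lim_null_comparison[OF _ s], intro always_eventually allI)
    fix n
    have "(?C n)\<^sup>2 \<le> (LBINT \<xi>. \<bar>fn n \<xi> - f \<xi>\<bar>\<^sup>2) * (LBINT \<xi>. \<bar>f \<xi>\<bar>\<^sup>2)"
      by (rule Cauchy_Schwarz_L2) (use d i in auto)
    then show "norm (?C n) \<le> sqrt ((LBINT \<xi>. (fn n \<xi> - f \<xi>)\<^sup>2) * (LBINT \<xi>. (f \<xi>)\<^sup>2))"
      by (simp add: real_le_rsqrt)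
  qed
  show "(\<lambda>n. (LBINT \<xi>. (fn n \<xi> - f \<xi>)\<^sup>2) + 2 * ?C n) \<longlonglongrightarrow> 0"
    using tendsto_add[OF lim tendsto_mult_right_zero[OF C, of 2]] by simp
  show "\<forall>\<^sub>F n in sequentially. norm (LBINT \<xi>. \<bar>(fn n \<xi>)\<^sup>2 - (f \<xi>)\<^sup>2\<bar>) \<le> (LBINT \<xi>. (fn n \<xi> - f \<xi>)\<^sup>2) + 2 * ?C n"
  proof (intro always_eventually allI)
    fix n
    have "(LBINT \<xi>. \<bar>(fn n \<xi>)\<^sup>2 - (f \<xi>)\<^sup>2\<bar>) \<le> (LBINT \<xi>. (fn n \<xi> - f \<xi>)\<^sup>2 + 2 * (\<bar>fn n \<xi> - f \<xi>\<bar> * \<bar>f \<xi>\<bar>))"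
    proof (rule integral_mono)
      fix \<xi>
      have e: "(fn n \<xi>)\<^sup>2 - (f \<xi>)\<^sup>2 = (fn n \<xi> - f \<xi>)\<^sup>2 + 2 * ((fn n \<xi> - f \<xi>) * f \<xi>)"
        by (simp add: power2_eq_square algebra_simps)
      show "\<bar>(fn n \<xi>)\<^sup>2 - (f \<xi>)\<^sup>2\<bar> \<le> (fn n \<xi> - f \<xi>)\<^sup>2 + 2 * (\<bar>fn n \<xi> - f \<xi>\<bar> * \<bar>f \<xi>\<bar>)"
        unfolding e using abs_triangle_ineq[of "(fn n \<xi> - f \<xi>)\<^sup>2" "2 * ((fn n \<xi> - f \<xi>) * f \<xi>)"]
        by (simp add: abs_mult)
    qed (use i d p in auto)
    also have "\<dots> = (LBINT \<xi>. (fn n \<xi> - f \<xi>)\<^sup>2) + 2 * ?C n" using d p by simp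
    finally show "norm (LBINT \<xi>. \<bar>(fn n \<xi>)\<^sup>2 - (f \<xi>)\<^sup>2\<bar>) \<le> (LBINT \<xi>. (fn n \<xi> - f \<xi>)\<^sup>2) + 2 * ?C n" by simp
  qed
qed

text \<open>\<open>h\<close> is itself a sum of two squares by \<open>q2_plus_h2\<close>, which is
  how strong \<open>L\<^sup>2\<close> convergence becomes \<open>L\<^sup>1\<close> convergence on
  the whole line.\<close>

lemma h_L1: "(\<lambda>n. \<integral>\<xi>. \<bar>hn n \<xi> - h \<xi>\<bar> \<partial>lborel) \<longlonglongrightarrow> 0"
proof -
  have "(\<lambda>n. \<integral>\<xi>. \<bar>(1 * (qn n \<xi>)\<^sup>2 + 1 * (hn n \<xi>)\<^sup>2) - (1 * (q \<xi>)\<^sup>2 + 1 * (h \<xi>)\<^sup>2)\<bar> \<partial>lborel) \<longlonglongrightarrow> 0"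
  proof (rule L1_add)
    show "(\<lambda>n. \<integral>\<xi>. \<bar>(qn n \<xi>)\<^sup>2 - (q \<xi>)\<^sup>2\<bar> \<partial>lborel) \<longlonglongrightarrow> 0"
      by (rule square_L1) (use Ln.q2_integrable L.q2_integrable strong_L2 in auto)
    show "(\<lambda>n. \<integral>\<xi>. \<bar>(hn n \<xi>)\<^sup>2 - (h \<xi>)\<^sup>2\<bar> \<partial>lborel) \<longlonglongrightarrow> 0"
      by (rule square_L1) (use Ln.h2_integrable L.h2_integrable strong_L2 in auto)
  qed (use Ln.q2_integrable L.q2_integrable Ln.h2_integrable L.h2_integrable in auto)
  then show ?thesis by (simp only: mult_1 L.q2_plus_h2 Ln.q2_plus_h2)
qed

end

section \<open>Convergence at later times\<close>

text \<open>Cauchy-Schwarz against the indicator of the interval. It yields both the Hoelder bound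
  on \<open>u\<close> and the nonnegativity of the radicand in the projection.\<close>

lemma set_integral_square_bound:
  assumes f: "primitive f g" and g: "integrable lborel (\<lambda>x. (g x)\<^sup>2)" and ab: "a \<le> b"
  shows "(f b - f a)\<^sup>2 \<le> (b - a) * (LBINT x:{a..b}. (g x)\<^sup>2)"
proof -
  note [measurable] = primitiveD(2)[OF f]
  have i: "integrable lborel (\<lambda>x. (indicat_real {a..b} x)\<^sup>2)" "(LBINT x. (indicat_real {a..b} x)\<^sup>2) = b - a"
  proof -
    have e: "(\<lambda>x. (indicat_real {a..b} x)\<^sup>2) = indicat_real {a..b}" by (auto simp: indicator_def)
    show "integrable lborel (\<lambda>x. (indicat_real {a..b} x)\<^sup>2)"
      unfolding e by (rule integrable_real_indicator) (auto simp: emeasure_lborel_Icc_eq)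
    show "(LBINT x. (indicat_real {a..b} x)\<^sup>2) = b - a" unfolding e using ab by simp
  qed
  have e: "(\<lambda>x. (indicat_real {a..b} x * g x)\<^sup>2) = (\<lambda>x. indicat_real {a..b} x * (g x)\<^sup>2)"
    by (auto simp: indicator_def)
  have "(f b - f a)\<^sup>2 = (LBINT x. indicat_real {a..b} x * (indicat_real {a..b} x * g x))\<^sup>2"
    using primitiveD(3)[OF f ab] by (simp add: set_lebesgue_integral_def flip: mult.assoc indicator_inter_arith)
  also have "\<dots> \<le> (LBINT x. (indicat_real {a..b} x)\<^sup>2) * (LBINT x. (indicat_real {a..b} x * g x)\<^sup>2)"
  proof (rule Cauchy_Schwarz_L2)
    show "integrable lborel (\<lambda>x. (indicat_real {a..b} x * g x)\<^sup>2)"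
      unfolding e using integrable_mult_indicator[OF _ g, of "{a..b}"] by simp
  qed (use i in auto)
  finally show ?thesis unfolding i e by (simp add: set_lebesgue_integral_def)
qed

lemma primitive_Hoelder:
  assumes f: "primitive f g" and g: "integrable lborel (\<lambda>x. (g x)\<^sup>2)" "(LBINT x. (g x)\<^sup>2) \<le> M"
  shows "\<bar>f b - f a\<bar> \<le> sqrt (\<bar>b - a\<bar> * M)"
proof -
  have *: "\<bar>f b - f a\<bar> \<le> sqrt (\<bar>b - a\<bar> * M)" if ab: "a \<le> b" for a b
  proof -
    have i: "integrable lborel (\<lambda>x. indicat_real {a..b} x * (g x)\<^sup>2)"
      using integrable_mult_indicator[OF _ g(1), of "{a..b}"] by simp
    have "(LBINT x:{a..b}. (g x)\<^sup>2) \<le> (LBINT x. (g x)\<^sup>2)"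
      unfolding set_lebesgue_integral_def
      by (rule integral_mono) (use i g(1) in \<open>auto simp: indicator_def\<close>)
    then have "(b - a) * (LBINT x:{a..b}. (g x)\<^sup>2) \<le> \<bar>b - a\<bar> * M"
      using ab g(2) by (simp add: mult_left_mono)
    then show ?thesis
      using set_integral_square_bound[OF f g(1) ab] by (intro real_le_rsqrt) simp
  qed
  show ?thesis using *[of a b] *[of b a] by (cases "a \<le> b") (auto simp: abs_minus_commute)
qed

lemma half_quarter_integral_diff:
  fixes f g :: "real \<Rightarrow> real"
  assumes i: "integrable lborel f" "integrable lborel g"
  shows "\<bar>(1/2 * (LBINT \<eta>:{..\<xi>}. f \<eta>) - 1/4 * (LBINT \<eta>. f \<eta>))
    - (1/2 * (LBINT \<eta>:{..\<xi>}. g \<eta>) - 1/4 * (LBINT \<eta>. g \<eta>))\<bar> \<le> (LBINT \<eta>. \<bar>f \<eta> - g \<eta>\<bar>)"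
proof -
  have s: "set_integrable lborel {..\<xi>} f" "set_integrable lborel {..\<xi>} g"
    unfolding set_integrable_def by (rule integrable_mult_indicator[OF _ i(1)], simp) (rule integrable_mult_indicator[OF _ i(2)], simp)
  have d: "integrable lborel (\<lambda>\<eta>. f \<eta> - g \<eta>)" using i by simp
  have "\<bar>LBINT \<eta>:{..\<xi>}. f \<eta> - g \<eta>\<bar> \<le> (LBINT \<eta>. \<bar>indicat_real {..\<xi>} \<eta> * (f \<eta> - g \<eta>)\<bar>)"
    using integral_abs_bound[of lborel "\<lambda>\<eta>. indicat_real {..\<xi>} \<eta> * (f \<eta> - g \<eta>)"]
    by (simp add: set_lebesgue_integral_def)
  also have "\<dots> \<le> (LBINT \<eta>. \<bar>f \<eta> - g \<eta>\<bar>)"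
  proof (rule integral_mono)
    show "integrable lborel (\<lambda>\<eta>. \<bar>indicat_real {..\<xi>} \<eta> * (f \<eta> - g \<eta>)\<bar>)"
      using integrable_mult_indicator[OF _ d, of "{..\<xi>}"] by (intro integrable_abs) simp
  qed (use d in \<open>auto simp: indicator_def\<close>)
  finally have 1: "\<bar>(LBINT \<eta>:{..\<xi>}. f \<eta>) - (LBINT \<eta>:{..\<xi>}. g \<eta>)\<bar> \<le> (LBINT \<eta>. \<bar>f \<eta> - g \<eta>\<bar>)"
    by (simp add: set_integral_diff(2)[OF s])
  have 2: "\<bar>(LBINT \<eta>. f \<eta>) - (LBINT \<eta>. g \<eta>)\<bar> \<le> (LBINT \<eta>. \<bar>f \<eta> - g \<eta>\<bar>)"
    using integral_abs_bound[of lborel "\<lambda>\<eta>. f \<eta> - g \<eta>"] i by simp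
  \<comment> \<open>The coefficients 1/2 and 1/4 from the evolution add up to less than 1.\<close>
  show ?thesis using 1 2 by linarith
qed

context lagrangian_convergence
begin

lemma AE_subsequence:
  assumes "strict_mono (r :: nat \<Rightarrow> nat)"
  shows "\<exists>s :: nat \<Rightarrow> nat. strict_mono s \<and>
    (AE \<xi> in lborel. (\<lambda>n. qn (r (s n)) \<xi>) \<longlonglongrightarrow> q \<xi> \<and> (\<lambda>n. hn (r (s n)) \<xi>) \<longlonglongrightarrow> h \<xi>)"
proof -
  \<comment> \<open>The two squares are added so that one subsequence serves both
    components.\<close>
  let ?u = "\<lambda>n \<xi>. (qn (r n) \<xi> - q \<xi>)\<^sup>2 + (hn (r n) \<xi> - h \<xi>)\<^sup>2"
  have i: "integrable lborel (\<lambda>\<xi>. (qn n \<xi> - q \<xi>)\<^sup>2)" "integrable lborel (\<lambda>\<xi>. (hn n \<xi> - h \<xi>)\<^sup>2)" for n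
    by (rule integrable_power2_diff(1);
        use Ln.q2_integrable L.q2_integrable Ln.h2_integrable L.h2_integrable in auto)+
  have "\<exists>s. strict_mono s \<and> (AE \<xi> in lborel. (\<lambda>n. ?u (s n) \<xi>) \<longlonglongrightarrow> 0)"
  proof (rule tendsto_L1_AE_subseq)
    show "integrable lborel (?u n)" for n using i by simp
    have "(\<lambda>n. (LBINT \<xi>. (qn n \<xi> - q \<xi>)\<^sup>2) + (LBINT \<xi>. (hn n \<xi> - h \<xi>)\<^sup>2)) \<longlonglongrightarrow> 0 + 0"
      by (intro tendsto_add strong_L2)
    from LIMSEQ_subseq_LIMSEQ[OF this assms]
    show "(\<lambda>n. LBINT \<xi>. norm (?u n \<xi>)) \<longlonglongrightarrow> 0" using i by (simp add: o_def)
  qed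
  then obtain s where s: "strict_mono s" "AE \<xi> in lborel. (\<lambda>n. ?u (s n) \<xi>) \<longlonglongrightarrow> 0" by blast
  have sq: "X \<longlonglongrightarrow> x" if u: "u \<longlonglongrightarrow> 0" and le: "\<And>n. (X n - x)\<^sup>2 \<le> u n" for X u :: "nat \<Rightarrow> real" and x
  proof (rule LIM_zero_cancel, rule Lim_null_comparison)
    show "\<forall>\<^sub>F n in sequentially. norm (X n - x) \<le> sqrt (u n)"
      using real_sqrt_le_mono[OF le] by simp
    show "(\<lambda>n. sqrt (u n)) \<longlonglongrightarrow> 0" using tendsto_real_sqrt[OF u] by simp
  qed
  have "AE \<xi> in lborel. (\<lambda>n. qn (r (s n)) \<xi>) \<longlonglongrightarrow> q \<xi> \<and> (\<lambda>n. hn (r (s n)) \<xi>) \<longlonglongrightarrow> h \<xi>"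
    using s(2)
  proof eventually_elim
    case (elim \<xi>)
    show ?case by (intro conjI; rule sq[OF elim]) auto
  qed
  then show ?thesis using s(1) by blast
qed

text \<open>On \<open>{p = 0}\<close> the sign of \<open>qn\<close> may oscillate, so breaking times need not converge there. Since
  \<open>{pn = 0}\<close> and \<open>{p = 0}\<close> have the same finite measure, \<open>{p = 0, pn > 0}\<close> is as small as
  \<open>{pn = 0, p > 0}\<close>, which vanishes in the limit by \<open>L\<^sup>1\<close>-convergence.\<close>

lemma singular_set_tendsto:
  assumes hl: "AE \<xi> in lborel. (\<lambda>n. hn (k n) \<xi>) \<longlonglongrightarrow> h \<xi>" and k: "strict_mono (k :: nat \<Rightarrow> nat)"
  shows "(\<lambda>n. measure lborel ({\<xi>. p \<xi> = 0} - {\<xi>. pn (k n) \<xi> = 0})) \<longlonglongrightarrow> 0"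
proof (rule Lim_null_comparison)
  let ?A = "{\<xi>. p \<xi> = 0}" and ?An = "\<lambda>n. {\<xi>. pn (k n) \<xi> = 0}"
  have m[measurable]: "?A \<in> sets borel" "?An n \<in> sets borel" for n by measurable
  have fm: "?A \<in> fmeasurable lborel" "?An n \<in> fmeasurable lborel" for n
    using L.p_zero_finite Ln.p_zero_finite by (auto simp: fmeasurable_def)
  have eq: "measure lborel (?A - ?An n) = measure lborel (?An n - ?A)" for n
  proof -
    have "measure lborel (?A - ?An n) = measure lborel ?A - measure lborel (?A \<inter> ?An n)"
      using measurable_measure_Diff[of ?A lborel "?A \<inter> ?An n"] fm by (simp add: Diff_Int_distrib fmeasurable.Int Diff_Int)
    moreover have "measure lborel (?An n - ?A) = measure lborel (?An n) - measure lborel (?A \<inter> ?An n)"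
      using measurable_measure_Diff[of "?An n" lborel "?A \<inter> ?An n"] fm by (simp add: Diff_Int fmeasurable.Int)
    moreover have "measure lborel (?An n) = measure lborel ?A" using sing[of "k n"] by (simp add: measure_def)
    ultimately show ?thesis by simp
  qed
  \<comment> \<open>On \<open>?An n - ?A\<close> one has \<open>hn = 1\<close>, so 1 is bounded by
    the sum of the distance of \<open>hn\<close> to \<open>h\<close> and of \<open>h\<close>. The
    first term is small in mean; the second, which is \<open>?g\<close>, tends to zero because
    \<open>h < 1\<close> there forces \<open>hn < 1\<close> eventually.\<close>
  let ?g = "\<lambda>n \<xi>. h \<xi> * indicator (?An n - ?A) \<xi>"
  have gi: "integrable lborel (?g n)" for n
    by (rule L.integrable_h_mult[where B = 1]) auto
  have "(\<lambda>n. \<integral>\<xi>. ?g n \<xi> \<partial>lborel) \<longlonglongrightarrow> (\<integral>\<xi>. 0 \<partial>(lborel :: real measure))"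
  proof (rule integral_dominated_convergence[where w = h])
    show "AE \<xi> in lborel. (\<lambda>n. ?g n \<xi>) \<longlonglongrightarrow> 0"
      using hl
    proof eventually_elim
      case (elim \<xi>)
      show ?case
      proof (cases "p \<xi> = 0")
        case False
        then have "h \<xi> < 1" using L.p_zero_iff[of \<xi>] L.h_le_1[of \<xi>] by simp
        then have "\<forall>\<^sub>F n in sequentially. hn (k n) \<xi> < 1" by (rule order_tendstoD(2)[OF elim])
        then have "\<forall>\<^sub>F n in sequentially. ?g n \<xi> = 0"
          by eventually_elim (auto simp: indicator_def Ln.p_zero_iff)
        then show ?thesis by (rule tendsto_eventually)
      qed simp
    qed
    show "AE \<xi> in lborel. norm (?g n \<xi>) \<le> h \<xi>" for n
      by (intro AE_I2) (auto simp: indicator_def L.h_nonneg)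
  qed (use L.h_integrable in auto)
  moreover have "(\<lambda>n. \<integral>\<xi>. \<bar>hn (k n) \<xi> - h \<xi>\<bar> \<partial>lborel) \<longlonglongrightarrow> 0"
    using LIMSEQ_subseq_LIMSEQ[OF h_L1 k] by (simp add: o_def)
  ultimately show "(\<lambda>n. (LBINT \<xi>. \<bar>hn (k n) \<xi> - h \<xi>\<bar>) + (LBINT \<xi>. ?g n \<xi>)) \<longlonglongrightarrow> 0"
    using tendsto_add by fastforce
  show "\<forall>\<^sub>F n in sequentially. norm (measure lborel (?A - ?An n))
      \<le> (LBINT \<xi>. \<bar>hn (k n) \<xi> - h \<xi>\<bar>) + (LBINT \<xi>. ?g n \<xi>)"
  proof (intro always_eventually allI)
    fix n
    have id: "integrable lborel (\<lambda>\<xi>. \<bar>hn (k n) \<xi> - h \<xi>\<bar>)"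
      using Ln.h_integrable L.h_integrable by simp
    have "measure lborel (?An n - ?A) = (LBINT \<xi>. indicator (?An n - ?A) \<xi>)" by simp
    also have "\<dots> \<le> (LBINT \<xi>. \<bar>hn (k n) \<xi> - h \<xi>\<bar> + ?g n \<xi>)"
    proof (rule integral_mono)
      show "integrable lborel (indicat_real (?An n - ?A))"
        using fmeasurable.Diff[OF fm(2) fm(1), of n]
        by (intro integrable_real_indicator) (auto simp: fmeasurable_def)
      show "indicat_real (?An n - ?A) \<xi> \<le> \<bar>hn (k n) \<xi> - h \<xi>\<bar> + ?g n \<xi>" for \<xi>
        by (auto simp: indicator_def Ln.p_zero_iff)
    qed (use id gi in auto)
    also have "\<dots> = (LBINT \<xi>. \<bar>hn (k n) \<xi> - h \<xi>\<bar>) + (LBINT \<xi>. ?g n \<xi>)"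
      using id gi by simp
    finally show "norm (measure lborel (?A - ?An n))
      \<le> (LBINT \<xi>. \<bar>hn (k n) \<xi> - h \<xi>\<bar>) + (LBINT \<xi>. ?g n \<xi>)" by (simp add: eq)
  qed
qed

text \<open>All later limits are instances: \<omega> is a step for \<open>V\<close>, a ramp for
  \<open>U\<close>, half a squared ramp for \<open>y\<close> and the constant 1 for the stability
  function. Where \<open>p\<close> and \<open>h\<close> are positive, \<open>q\<close> is nonzero,
  so the sign of \<open>qn\<close> settles and breaking times converge. Where \<open>h = 0\<close>
  the weight removes the term. Where \<open>p = 0\<close> the limit term vanishes, and the
  approximate one can differ from zero only where \<open>pn\<close> is positive.\<close>

lemma breaking_L1:
  assumes \<omega>[measurable]: "\<omega> \<in> borel_measurable borel" and B: "\<And>c. 0 < c \<Longrightarrow> \<bar>\<omega> c\<bar> \<le> B"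
    and cont: "AE \<xi> in lborel. q \<xi> < 0 \<longrightarrow> isCont \<omega> (L.brk \<xi>)"
  shows "(\<lambda>n. \<integral>\<xi>. \<bar>hn n \<xi> * (of_bool (qn n \<xi> < 0) * \<omega> (Ln.brk n \<xi>))
      - h \<xi> * (of_bool (q \<xi> < 0) * \<omega> (L.brk \<xi>))\<bar> \<partial>lborel) \<longlonglongrightarrow> 0"
proof (rule LIMSEQ_if_subsubseq)
  fix r :: "nat \<Rightarrow> nat" assume r: "strict_mono r"
  obtain s where s: "strict_mono s"
    and ae: "AE \<xi> in lborel. (\<lambda>n. qn (r (s n)) \<xi>) \<longlonglongrightarrow> q \<xi> \<and> (\<lambda>n. hn (r (s n)) \<xi>) \<longlonglongrightarrow> h \<xi>"
    using AE_subsequence[OF r] by blast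
  define k where "k = (\<lambda>n. r (s n))"
  have k: "strict_mono k" using r s unfolding k_def strict_mono_def by blast
  define W where "W = (\<lambda>\<xi>. of_bool (q \<xi> < 0) * \<omega> (L.brk \<xi>))"
  define Wn where "Wn = (\<lambda>n \<xi>. of_bool (qn (k n) \<xi> < 0) * \<omega> (Ln.brk (k n) \<xi>))"
  have [measurable]: "W \<in> borel_measurable borel" "Wn n \<in> borel_measurable borel" for n
    unfolding W_def Wn_def of_bool_def by measurable
  have B0: "0 \<le> B" using B[of 1] by simp
  have WB: "\<bar>W \<xi>\<bar> \<le> B" "\<bar>Wn n \<xi>\<bar> \<le> B" for n \<xi>
    using B[OF L.brk_pos[of \<xi>]] B[OF Ln.brk_pos[of "k n" \<xi>]] B0 by (auto simp: W_def Wn_def of_bool_def)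
  let ?A = "{\<xi>. p \<xi> = 0}" and ?An = "\<lambda>n. {\<xi>. pn (k n) \<xi> = 0}"
  let ?g = "\<lambda>n \<xi>. h \<xi> * (\<bar>Wn n \<xi> - W \<xi>\<bar> * indicator (- ?A) \<xi>)"
  have m[measurable]: "?A \<in> sets borel" "?An n \<in> sets borel" for n by measurable
  have W2: "\<bar>\<bar>Wn n \<xi> - W \<xi>\<bar> * indicator (- ?A) \<xi>\<bar> \<le> 2 * B" for n \<xi>
    using WB(1)[of \<xi>] WB(2)[of n \<xi>] B0 by (auto simp: indicator_def)
  have gi: "integrable lborel (?g n)" for n
    by (rule L.integrable_h_mult[OF _ W2]) measurable
  have g0: "(\<lambda>n. \<integral>\<xi>. ?g n \<xi> \<partial>lborel) \<longlonglongrightarrow> (\<integral>\<xi>. 0 \<partial>(lborel :: real measure))"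
  proof (rule integral_dominated_convergence[where w = "\<lambda>\<xi>. h \<xi> * (2 * B)"])
    show "AE \<xi> in lborel. norm (?g n \<xi>) \<le> h \<xi> * (2 * B)" for n
    proof (intro AE_I2)
      fix \<xi>
      have "\<bar>h \<xi>\<bar> * \<bar>\<bar>Wn n \<xi> - W \<xi>\<bar> * indicator (- ?A) \<xi>\<bar> \<le> h \<xi> * (2 * B)"
        using L.h_nonneg W2 by (intro mult_mono) auto
      then show "norm (?g n \<xi>) \<le> h \<xi> * (2 * B)" by (simp add: abs_mult)
    qed
    show "AE \<xi> in lborel. (\<lambda>n. ?g n \<xi>) \<longlonglongrightarrow> 0"
      using ae cont
    proof eventually_elim
      case (elim \<xi>)
      show ?case
      proof (cases "p \<xi> = 0 \<or> h \<xi> = 0")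
        case True
        then show ?thesis by auto
      next
        case False
        then have "(q \<xi>)\<^sup>2 \<noteq> 0" by (simp add: L.q_square)
        then have q: "q \<xi> \<noteq> 0" by simp
        have ql: "(\<lambda>n. qn (k n) \<xi>) \<longlonglongrightarrow> q \<xi>" using elim by (simp add: k_def)
        have pl: "(\<lambda>n. pn (k n) \<xi>) \<longlonglongrightarrow> p \<xi>"
        proof -
          have "(\<lambda>n. 1 - hn (k n) \<xi>) \<longlonglongrightarrow> 1 - h \<xi>" using elim unfolding k_def by (intro tendsto_intros) auto
          moreover have "1 - hn n \<xi> = pn n \<xi>" "1 - h \<xi> = p \<xi>" for n
            using Ln.p_plus_h[of n \<xi>] L.p_plus_h[of \<xi>] by auto
          ultimately show ?thesis by simp
        qed
        have "(\<lambda>n. Wn n \<xi>) \<longlonglongrightarrow> W \<xi>"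
        proof (cases "q \<xi> < 0")
          case True
          have "(\<lambda>n. Ln.brk (k n) \<xi>) \<longlonglongrightarrow> L.brk \<xi>"
            unfolding L.brk_def Ln.brk_def by (intro tendsto_intros ql pl) (use q in simp)
          then have "(\<lambda>n. \<omega> (Ln.brk (k n) \<xi>)) \<longlonglongrightarrow> \<omega> (L.brk \<xi>)"
            using elim True by (auto intro: isCont_tendsto_compose)
          moreover have "\<forall>\<^sub>F n in sequentially. \<omega> (Ln.brk (k n) \<xi>) = Wn n \<xi>"
            using order_tendstoD(2)[OF ql True] by eventually_elim (simp add: Wn_def)
          ultimately have "(\<lambda>n. Wn n \<xi>) \<longlonglongrightarrow> \<omega> (L.brk \<xi>)" by (rule Lim_transform_eventually)
          then show ?thesis using True by (simp add: W_def)
        next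
          case False
          then have "0 < q \<xi>" using q by simp
          from order_tendstoD(1)[OF ql this] have "\<forall>\<^sub>F n in sequentially. Wn n \<xi> = W \<xi>"
            by eventually_elim (use False in \<open>simp add: Wn_def W_def\<close>)
          then show ?thesis by (rule tendsto_eventually)
        qed
        then have "(\<lambda>n. h \<xi> * (\<bar>Wn n \<xi> - W \<xi>\<bar> * indicator (- ?A) \<xi>)) \<longlonglongrightarrow> h \<xi> * (\<bar>W \<xi> - W \<xi>\<bar> * indicator (- ?A) \<xi>)"
          by (intro tendsto_intros)
        then show ?thesis by simp
      qed
    qed
  qed (use L.h_integrable gi in auto)
  have hk: "(\<lambda>n. \<integral>\<xi>. \<bar>hn (k n) \<xi> - h \<xi>\<bar> \<partial>lborel) \<longlonglongrightarrow> 0"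
    using LIMSEQ_subseq_LIMSEQ[OF h_L1 k] by (simp add: o_def)
  have Ak: "(\<lambda>n. measure lborel (?A - ?An n)) \<longlonglongrightarrow> 0"
    by (rule singular_set_tendsto[OF _ k]) (use ae in \<open>eventually_elim, simp add: k_def\<close>)
  have "(\<lambda>n. \<integral>\<xi>. \<bar>hn (k n) \<xi> * Wn n \<xi> - h \<xi> * W \<xi>\<bar> \<partial>lborel) \<longlonglongrightarrow> 0"
  proof (rule Lim_null_comparison)
    show "(\<lambda>n. B * (LBINT \<xi>. \<bar>hn (k n) \<xi> - h \<xi>\<bar>) + (LBINT \<xi>. ?g n \<xi>) + B * measure lborel (?A - ?An n)) \<longlonglongrightarrow> 0"
      using tendsto_add[OF tendsto_add[OF tendsto_mult_right_zero[OF hk, of B] g0] tendsto_mult_right_zero[OF Ak, of B]] by simp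
    show "\<forall>\<^sub>F n in sequentially. norm (LBINT \<xi>. \<bar>hn (k n) \<xi> * Wn n \<xi> - h \<xi> * W \<xi>\<bar>)
       \<le> B * (LBINT \<xi>. \<bar>hn (k n) \<xi> - h \<xi>\<bar>) + (LBINT \<xi>. ?g n \<xi>) + B * measure lborel (?A - ?An n)"
    proof (intro always_eventually allI)
      fix n
      have iA: "integrable lborel (indicat_real (?A - ?An n))"
      proof (rule integrable_real_indicator)
        have "emeasure lborel (?A - ?An n) \<le> emeasure lborel ?A" by (intro emeasure_mono) auto
        then show "emeasure lborel (?A - ?An n) < \<infinity>" using L.p_zero_finite by (rule le_less_trans)
      qed simp
      have id: "integrable lborel (\<lambda>\<xi>. \<bar>hn (k n) \<xi> - h \<xi>\<bar>)"
        using Ln.h_integrable L.h_integrable by simp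
      have "(LBINT \<xi>. \<bar>hn (k n) \<xi> * Wn n \<xi> - h \<xi> * W \<xi>\<bar>)
         \<le> (LBINT \<xi>. B * \<bar>hn (k n) \<xi> - h \<xi>\<bar> + ?g n \<xi> + B * indicat_real (?A - ?An n) \<xi>)"
      proof (rule integral_mono)
        have "integrable lborel (\<lambda>\<xi>. hn (k n) \<xi> * Wn n \<xi>)" "integrable lborel (\<lambda>\<xi>. h \<xi> * W \<xi>)"
          using Ln.integrable_h_mult[OF _ WB(2)] L.integrable_h_mult[OF _ WB(1)] by auto
        then show "integrable lborel (\<lambda>\<xi>. \<bar>hn (k n) \<xi> * Wn n \<xi> - h \<xi> * W \<xi>\<bar>)" by simp
        show "integrable lborel (\<lambda>\<xi>. B * \<bar>hn (k n) \<xi> - h \<xi>\<bar> + ?g n \<xi> + B * indicat_real (?A - ?An n) \<xi>)"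
          using id gi[of n] iA by simp
        fix \<xi>
        have e: "hn (k n) \<xi> * Wn n \<xi> - h \<xi> * W \<xi> = (hn (k n) \<xi> - h \<xi>) * Wn n \<xi> + h \<xi> * (Wn n \<xi> - W \<xi>)"
          by (simp add: algebra_simps)
        have 1: "\<bar>(hn (k n) \<xi> - h \<xi>) * Wn n \<xi>\<bar> \<le> B * \<bar>hn (k n) \<xi> - h \<xi>\<bar>"
          using mult_left_mono[OF WB(2)[of n \<xi>], of "\<bar>hn (k n) \<xi> - h \<xi>\<bar>"] by (simp add: abs_mult mult.commute)
        have 2: "\<bar>h \<xi> * (Wn n \<xi> - W \<xi>)\<bar> \<le> ?g n \<xi> + B * indicat_real (?A - ?An n) \<xi>"
        proof (cases "p \<xi> = 0")
          case True
          then have h1: "h \<xi> = 1" by (simp add: L.p_zero_iff)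
          have "q \<xi> = 0" using L.q_square[of \<xi>] True by simp
          then have "W \<xi> = 0" by (simp add: W_def)
          moreover have "Wn n \<xi> = 0" if "pn (k n) \<xi> = 0"
            using Ln.q_square[of "k n" \<xi>] that by (simp add: Wn_def)
          ultimately show ?thesis using True h1 WB(2)[of n \<xi>] by (auto simp: indicator_def)
        qed (auto simp: abs_mult L.h_nonneg)
        show "\<bar>hn (k n) \<xi> * Wn n \<xi> - h \<xi> * W \<xi>\<bar> \<le> B * \<bar>hn (k n) \<xi> - h \<xi>\<bar> + ?g n \<xi> + B * indicat_real (?A - ?An n) \<xi>"
          unfolding e using 1 2 abs_triangle_ineq[of "(hn (k n) \<xi> - h \<xi>) * Wn n \<xi>" "h \<xi> * (Wn n \<xi> - W \<xi>)"] by linarith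
      qed
      also have "\<dots> = B * (LBINT \<xi>. \<bar>hn (k n) \<xi> - h \<xi>\<bar>) + (LBINT \<xi>. ?g n \<xi>) + B * measure lborel (?A - ?An n)"
        using id gi[of n] iA by simp
      finally show "norm (LBINT \<xi>. \<bar>hn (k n) \<xi> * Wn n \<xi> - h \<xi> * W \<xi>\<bar>)
       \<le> B * (LBINT \<xi>. \<bar>hn (k n) \<xi> - h \<xi>\<bar>) + (LBINT \<xi>. ?g n \<xi>) + B * measure lborel (?A - ?An n)" by simp
    qed
  qed
  then show "\<exists>s :: nat \<Rightarrow> nat. strict_mono s \<and> (\<lambda>n. \<integral>\<xi>. \<bar>hn (r (s n)) \<xi> * (of_bool (qn (r (s n)) \<xi> < 0) * \<omega> (Ln.brk (r (s n)) \<xi>))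
      - h \<xi> * (of_bool (q \<xi> < 0) * \<omega> (L.brk \<xi>))\<bar> \<partial>lborel) \<longlonglongrightarrow> 0"
    using s unfolding k_def W_def Wn_def by blast
qed

lemma breaking_L1_affine:
  assumes \<omega>: "\<omega> \<in> borel_measurable borel" and B: "\<And>c. 0 < c \<Longrightarrow> \<bar>\<omega> c\<bar> \<le> B"
    and cont: "AE \<xi> in lborel. q \<xi> < 0 \<longrightarrow> isCont \<omega> (L.brk \<xi>)"
    and fn: "\<And>n \<xi>. fn n \<xi> = hn n \<xi> * (c - \<alpha> * (of_bool (qn n \<xi> < 0) * \<omega> (Ln.brk n \<xi>)))"
    and f: "\<And>\<xi>. f \<xi> = h \<xi> * (c - \<alpha> * (of_bool (q \<xi> < 0) * \<omega> (L.brk \<xi>)))"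
  shows "(\<lambda>n. \<integral>\<xi>. \<bar>fn n \<xi> - f \<xi>\<bar> \<partial>lborel) \<longlonglongrightarrow> 0"
proof -
  note [measurable] = \<omega>
  have B0: "0 \<le> B" using B[of 1] by simp
  have i: "integrable lborel (\<lambda>\<xi>. h \<xi> * (of_bool (q \<xi> < 0) * \<omega> (L.brk \<xi>)))"
    by (rule L.integrable_h_mult[where B = B])
       (use B[OF L.brk_pos] B0 in \<open>auto simp: of_bool_def\<close>)
  have im: "integrable lborel (\<lambda>\<xi>. hn n \<xi> * (of_bool (qn n \<xi> < 0) * \<omega> (Ln.brk n \<xi>)))" for n
    by (rule Ln.integrable_h_mult[where B = B])
       (use B[OF Ln.brk_pos] B0 in \<open>auto simp: of_bool_def\<close>)
  have "(\<lambda>n. \<integral>\<xi>. \<bar>(c * hn n \<xi> + (- \<alpha>) * (hn n \<xi> * (of_bool (qn n \<xi> < 0) * \<omega> (Ln.brk n \<xi>))))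
      - (c * h \<xi> + (- \<alpha>) * (h \<xi> * (of_bool (q \<xi> < 0) * \<omega> (L.brk \<xi>))))\<bar> \<partial>lborel) \<longlonglongrightarrow> 0"
    by (rule L1_add[OF Ln.h_integrable L.h_integrable im i h_L1 breaking_L1[OF \<omega> B cont]])
  moreover have "c * hn n \<xi> + (- \<alpha>) * (hn n \<xi> * (of_bool (qn n \<xi> < 0) * \<omega> (Ln.brk n \<xi>))) = fn n \<xi>"
    "c * h \<xi> + (- \<alpha>) * (h \<xi> * (of_bool (q \<xi> < 0) * \<omega> (L.brk \<xi>))) = f \<xi>" for n \<xi>
    unfolding fn f by (simp_all add: algebra_simps)
  ultimately show ?thesis by (simp only:)
qed

text \<open>The step function jumps exactly at breaking time \<open>t\<close>, so the hypothesis is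
  the continuity condition of \<open>breaking_L1\<close>.\<close>

lemma V_L1:
  assumes "AE \<xi> in lborel. q \<xi> < 0 \<longrightarrow> L.brk \<xi> \<noteq> t"
  shows "(\<lambda>n. \<integral>\<xi>. \<bar>Ln.V\<^sub>\<xi> n t \<xi> - L.V\<^sub>\<xi> t \<xi>\<bar> \<partial>lborel) \<longlonglongrightarrow> 0"
proof (rule breaking_L1_affine[where \<omega> = "\<lambda>c. of_bool (c \<le> t)" and B = 1 and c = 1])
  show "(\<lambda>c. of_bool (c \<le> t) :: real) \<in> borel_measurable borel" unfolding of_bool_def by measurable
  show "AE \<xi> in lborel. q \<xi> < 0 \<longrightarrow> isCont (\<lambda>c. of_bool (c \<le> t) :: real) (L.brk \<xi>)"
    using assms
  proof eventually_elim
    case (elim \<xi>)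
    have "isCont (\<lambda>c. of_bool (c \<le> t) :: real) c" if "c \<noteq> t" for c
    proof (cases "c < t")
      case True
      have "\<forall>\<^sub>F x in nhds c. x \<in> {..<t}" by (rule eventually_nhds_in_open) (use True in auto)
      then have ev: "\<forall>\<^sub>F x in nhds c. (of_bool (x \<le> t) :: real) = 1" by eventually_elim auto
      show ?thesis by (subst isCont_cong[OF ev]) simp
    next
      case False
      have "\<forall>\<^sub>F x in nhds c. x \<in> {t<..}" by (rule eventually_nhds_in_open) (use False that in auto)
      then have ev: "\<forall>\<^sub>F x in nhds c. (of_bool (x \<le> t) :: real) = 0" by eventually_elim auto
      show ?thesis by (subst isCont_cong[OF ev]) simp
    qed
    then show ?case using elim by auto
  qed
qed (auto simp: Ln.V\<^sub>\<xi>_def L.V\<^sub>\<xi>_def Ln.\<phi>\<^sub>0_def L.\<phi>\<^sub>0_def of_bool_def)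

lemma \<phi>\<^sub>1_L1: "0 \<le> t \<Longrightarrow> (\<lambda>n. \<integral>\<xi>. \<bar>hn n \<xi> * Ln.\<phi>\<^sub>1 n t \<xi> - h \<xi> * L.\<phi>\<^sub>1 t \<xi>\<bar> \<partial>lborel) \<longlonglongrightarrow> 0"
  by (rule breaking_L1_affine[where \<omega> = "\<lambda>c. max 0 (t - c)" and B = t and c = t])
     (auto simp: Ln.\<phi>\<^sub>1_def L.\<phi>\<^sub>1_def intro!: AE_I2 continuous_intros)

lemma \<phi>\<^sub>2_L1: "0 \<le> t \<Longrightarrow> (\<lambda>n. \<integral>\<xi>. \<bar>hn n \<xi> * Ln.\<phi>\<^sub>2 n t \<xi> - h \<xi> * L.\<phi>\<^sub>2 t \<xi>\<bar> \<partial>lborel) \<longlonglongrightarrow> 0"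
  by (rule breaking_L1_affine[where \<omega> = "\<lambda>c. (max 0 (t - c))\<^sup>2 / 2" and B = "t\<^sup>2 / 2" and c = "t\<^sup>2 / 2"])
     (auto simp: Ln.\<phi>\<^sub>2_def L.\<phi>\<^sub>2_def intro!: AE_I2 continuous_intros power_mono)

lemma stab_L1: "(\<lambda>n. \<integral>\<xi>. \<bar>Ln.stab n \<xi> - L.stab \<xi>\<bar> \<partial>lborel) \<longlonglongrightarrow> 0"
  by (rule breaking_L1_affine[where \<omega> = "\<lambda>c. 1" and B = 1 and c = 1])
     (auto simp: Ln.stab_def L.stab_def)

definition \<delta>U :: "real \<Rightarrow> nat \<Rightarrow> real" where
  "\<delta>U t n = \<epsilon> n + (LBINT \<xi>. \<bar>hn n \<xi> * Ln.\<phi>\<^sub>1 n t \<xi> - h \<xi> * L.\<phi>\<^sub>1 t \<xi>\<bar>)"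
definition \<delta>y :: "real \<Rightarrow> nat \<Rightarrow> real" where
  "\<delta>y t n = \<epsilon> n + t * \<epsilon> n + (LBINT \<xi>. \<bar>hn n \<xi> * Ln.\<phi>\<^sub>2 n t \<xi> - h \<xi> * L.\<phi>\<^sub>2 t \<xi>\<bar>)"

lemma \<delta>U_tendsto: "0 \<le> t \<Longrightarrow> \<delta>U t \<longlonglongrightarrow> 0"
  unfolding \<delta>U_def[abs_def] using tendsto_add[OF \<epsilon> \<phi>\<^sub>1_L1] by simp

lemma \<delta>y_tendsto: "0 \<le> t \<Longrightarrow> \<delta>y t \<longlonglongrightarrow> 0"
  unfolding \<delta>y_def[abs_def]
  using tendsto_add[OF tendsto_add[OF \<epsilon> tendsto_mult_right_zero[OF \<epsilon>, of t]] \<phi>\<^sub>2_L1] by simp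

lemma Ut_close:
  assumes t: "0 \<le> t"
  shows "\<bar>Ln.Ut n t \<xi> - L.Ut t \<xi>\<bar> \<le> \<delta>U t n"
  using half_quarter_integral_diff[OF Ln.integrable_h\<phi>(2)[OF t, of n] L.integrable_h\<phi>(2)[OF t], of \<xi>] U_close[of n \<xi>]
  unfolding Ln.Ut_def L.Ut_def \<delta>U_def by linarith

lemma yt_close:
  assumes t: "0 \<le> t"
  shows "\<bar>Ln.yt n t \<xi> - L.yt t \<xi>\<bar> \<le> \<delta>y t n"
proof -
  have "\<bar>t * Us n \<xi> - t * U \<xi>\<bar> \<le> t * \<epsilon> n"
    using mult_left_mono[OF U_close[of n \<xi>] t] t by (simp add: abs_mult flip: right_diff_distrib)
  then show ?thesis
    using half_quarter_integral_diff[OF Ln.integrable_h\<phi>(3)[OF t, of n] L.integrable_h\<phi>(3)[OF t], of \<xi>] y_close[of n \<xi>]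
    unfolding Ln.yt_def L.yt_def \<delta>y_def by linarith
qed

definition \<delta>u :: "real \<Rightarrow> nat \<Rightarrow> real" where
  "\<delta>u t n = \<delta>U t n + sqrt (\<delta>y t n * (LBINT \<xi>. h \<xi>))"

lemma \<delta>u_tendsto: assumes t: "0 \<le> t" shows "\<delta>u t \<longlonglongrightarrow> 0"
proof -
  have "(\<lambda>n. \<delta>U t n + sqrt (\<delta>y t n * (LBINT \<xi>. h \<xi>))) \<longlonglongrightarrow> 0 + sqrt (0 * (LBINT \<xi>. h \<xi>))"
    by (intro tendsto_intros \<delta>U_tendsto \<delta>y_tendsto t)
  then show ?thesis by (simp add: \<delta>u_def[abs_def])
qed

text \<open>Follow \<open>x\<close> back along the approximate characteristic to a particle. At that
  particle the two velocities are compared by \<open>Ut_close\<close>, and the limit velocity is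
  then moved from the limit position of the particle to \<open>x\<close> by the Hoelder
  bound.\<close>

lemma ue_close:
  assumes t: "0 \<le> t"
  shows "\<bar>Ln.ue n t x - L.ue t x\<bar> \<le> \<delta>u t n"
proof -
  let ?\<xi> = "Ln.yinv n t x"
  let ?M = "LBINT \<xi>. h \<xi>"
  have M: "0 \<le> ?M" using L.h_nonneg by simp
  have x: "\<bar>L.yt t ?\<xi> - x\<bar> \<le> \<delta>y t n"
    using yt_close[OF t, of n ?\<xi>] Ln.yt_yinv[OF t, of n x] by (simp add: abs_minus_commute)
  have "\<bar>L.ue t (L.yt t ?\<xi>) - L.ue t x\<bar> \<le> sqrt (\<bar>L.yt t ?\<xi> - x\<bar> * ?M)"
    by (rule primitive_Hoelder[OF L.primitive_ue[OF t] L.ue\<^sub>x_square[OF t]])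
  also have "\<dots> \<le> sqrt (\<delta>y t n * ?M)" using x M by (intro real_sqrt_le_mono mult_right_mono)
  finally have "\<bar>L.Ut t ?\<xi> - L.ue t x\<bar> \<le> sqrt (\<delta>y t n * ?M)" by (simp add: L.ue_yt[OF t])
  moreover have "\<bar>Ln.ue n t x - L.Ut t ?\<xi>\<bar> \<le> \<delta>U t n"
    using Ut_close[OF t, of n ?\<xi>] by (simp add: Ln.ue_def)
  ultimately show ?thesis unfolding \<delta>u_def by linarith
qed

end

section \<open>Primitives of finite measures, atoms and the layer-cake formula\<close>

lemma tendsto_lprim_at_top:
  assumes "finite_borel_measure \<mu>"
  shows "(lprim \<mu> \<longlongrightarrow> measure \<mu> UNIV) at_top"
proof -
  interpret finite_borel_measure \<mu> by fact
  note [simp] = finite_borel_measureD(2,3)[OF assms]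
  have c: "(cdf \<mu> \<longlongrightarrow> measure \<mu> UNIV) at_top" using cdf_lim_at_top by simp
  have "filterlim (\<lambda>x::real. - 1 + x) at_top at_top"
    by (rule filterlim_tendsto_add_at_top[OF tendsto_const filterlim_ident])
  from filterlim_compose[OF c this] have c': "((\<lambda>x. cdf \<mu> (x - 1)) \<longlongrightarrow> measure \<mu> UNIV) at_top"
    by simp
  show "(lprim \<mu> \<longlongrightarrow> measure \<mu> UNIV) at_top"
  proof (rule tendsto_sandwich[OF _ _ c' c]; intro always_eventually allI)
    show "cdf \<mu> (x - 1) \<le> lprim \<mu> x" "lprim \<mu> x \<le> cdf \<mu> x" for x
      unfolding cdf_def lprim_def by (intro finite_measure_mono; auto)+
  qed
qed

lemma lprim_Lim: "finite_borel_measure \<mu> \<Longrightarrow> Lim at_top (lprim \<mu>) = measure \<mu> UNIV"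
  by (rule tendsto_Lim) (simp_all add: tendsto_lprim_at_top)

lemma isCont_lprim_imp_null:
  assumes \<mu>: "finite_borel_measure \<mu>" and c: "isCont (lprim \<mu>) x"
  shows "measure \<mu> {x} = 0"
proof -
  interpret finite_borel_measure \<mu> by fact
  note [simp] = finite_borel_measureD(2,3)[OF \<mu>]
  have "(lprim \<mu> \<longlongrightarrow> lprim \<mu> x) (at_right x)"
    using c by (simp add: isCont_def filterlim_at_split)
  then have l: "((\<lambda>z. lprim \<mu> z - lprim \<mu> x) \<longlongrightarrow> 0) (at_right x)"
    using tendsto_diff[OF _ tendsto_const, of "lprim \<mu>" "lprim \<mu> x" _ "lprim \<mu> x"] by simp
  have "\<forall>\<^sub>F z in at_right x. x < z" by (auto simp: eventually_at_filter)
  then have "\<forall>\<^sub>F z in at_right x. measure \<mu> {x} \<le> lprim \<mu> z - lprim \<mu> x"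
  proof eventually_elim
    case (elim z)
    have "measure \<mu> {x} \<le> measure \<mu> {x..<z}" by (rule finite_measure_mono) (use elim in auto)
    then show ?case using emeasure_Ico_lprim(3)[OF \<mu>, of x z] elim by simp
  qed
  then have "measure \<mu> {x} \<le> 0" by (rule tendsto_lowerbound[OF l]) simp
  then show ?thesis using measure_nonneg[of \<mu> "{x}"] by linarith
qed

text \<open>With Fubini this exchanges the distance of two monotone functions for the distance of
  their generalised inverses.\<close>

lemma nn_integral_indicator_diff:
  fixes a b :: real
  shows "(\<integral>\<^sup>+x. ennreal \<bar>of_bool (a < x) - of_bool (b < x)\<bar> \<partial>lborel) = ennreal \<bar>a - b\<bar>"
proof -
  have "(\<integral>\<^sup>+x. ennreal \<bar>of_bool (a < x) - of_bool (b < x)\<bar> \<partial>lborel) = (\<integral>\<^sup>+x. indicator {min a b<..max a b} x \<partial>lborel)"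
    by (intro nn_integral_cong) (auto simp: indicator_def of_bool_def min_def max_def)
  also have "\<dots> = ennreal \<bar>a - b\<bar>" by (cases "a \<le> b") (auto simp: min_def max_def)
  finally show ?thesis .
qed

context lagrangian_data
begin

lemma H_diff_bound:
  "ennreal \<bar>H a - H b\<bar> \<le> (\<integral>\<^sup>+\<xi>. ennreal (h \<xi>) * ennreal \<bar>of_bool (\<xi> < a) - of_bool (\<xi> < b)\<bar> \<partial>lborel)"
proof -
  have i: "integrable lborel (\<lambda>\<xi>. indicat_real {..c} \<xi> * h \<xi>)" for c
    by (rule integrable_indicator_h) simp
  have "H a - H b = (LBINT \<xi>. indicat_real {..a} \<xi> * h \<xi> - indicat_real {..b} \<xi> * h \<xi>)"
    using i by (simp add: H_def H_eq set_lebesgue_integral_def)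
  then have "\<bar>H a - H b\<bar> \<le> (LBINT \<xi>. \<bar>indicat_real {..a} \<xi> * h \<xi> - indicat_real {..b} \<xi> * h \<xi>\<bar>)"
    using integral_abs_bound[of lborel "\<lambda>\<xi>. indicat_real {..a} \<xi> * h \<xi> - indicat_real {..b} \<xi> * h \<xi>"] by simp
  then have "ennreal \<bar>H a - H b\<bar> \<le> ennreal (LBINT \<xi>. \<bar>indicat_real {..a} \<xi> * h \<xi> - indicat_real {..b} \<xi> * h \<xi>\<bar>)"
    by (rule ennreal_leI)
  also have "\<dots> = (\<integral>\<^sup>+\<xi>. ennreal \<bar>indicat_real {..a} \<xi> * h \<xi> - indicat_real {..b} \<xi> * h \<xi>\<bar> \<partial>lborel)"
    by (rule nn_integral_eq_integral[symmetric]) (use i in auto)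
  also have "\<dots> = (\<integral>\<^sup>+\<xi>. ennreal (h \<xi>) * ennreal \<bar>of_bool (\<xi> < a) - of_bool (\<xi> < b)\<bar> \<partial>lborel)"
  proof (rule nn_integral_cong_AE)
    show "AE \<xi> in lborel. ennreal \<bar>indicat_real {..a} \<xi> * h \<xi> - indicat_real {..b} \<xi> * h \<xi>\<bar>
        = ennreal (h \<xi>) * ennreal \<bar>of_bool (\<xi> < a) - of_bool (\<xi> < b)\<bar>"
      using AE_lborel_singleton[of a] AE_lborel_singleton[of b]
      by eventually_elim (auto simp: indicator_def of_bool_def h_nonneg)
  qed
  finally show ?thesis .
qed

lemma H_measurable [measurable]: "H \<in> borel_measurable borel"
  by (rule borel_measurable_continuous_onI[OF primitive_continuous[OF primitive_H]])

lemma nn_integral_h: "(\<integral>\<^sup>+\<xi>. ennreal (h \<xi>) \<partial>lborel) = ennreal (LBINT \<xi>. h \<xi>)"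
  by (rule nn_integral_eq_integral) (use h_integrable h_nonneg in auto)

lemma stab_props: "integrable lborel stab" "0 \<le> stab \<xi>" "stab \<in> borel_measurable borel"
proof -
  show m[measurable]: "stab \<in> borel_measurable borel" unfolding stab_def of_bool_def by measurable
  have "integrable lborel (\<lambda>\<xi>. h \<xi> * (1 - \<alpha> * of_bool (q \<xi> < 0)))"
    by (rule integrable_h_mult[where B = 1]) (use \<alpha> in \<open>auto simp: of_bool_def\<close>)
  then show "integrable lborel stab" by (simp add: stab_def[abs_def])
  show "0 \<le> stab \<xi>" using h_nonneg[of \<xi>] \<alpha> by (auto simp: stab_def of_bool_def)
qed

lemma finite_mu: "0 \<le> t \<Longrightarrow> finite_borel_measure (mu t)"
  and finite_nu: "0 \<le> t \<Longrightarrow> finite_borel_measure (nu t)"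
  and finite_stab: "0 \<le> t \<Longrightarrow> finite_borel_measure (push_density (yt t) stab)"
  unfolding mu_def nu_def
  by (rule push_density_integral(1); use yt_measurable integrable_h\<phi>(1) V\<^sub>\<xi>_bounds h_integrable h_nonneg stab_props in auto)+

text \<open>The energy of the particles with \<open>q < 0\<close> is pushed forward by
  \<open>brk\<close> to a finite measure, which has at most countably many atoms. Since
  \<open>h\<close> is positive where \<open>q < 0\<close>, a time without atom is the breaking time
  of almost no particle.\<close>

lemma countable_breaking_times: "countable {t. \<not> (AE \<xi> in lborel. q \<xi> < 0 \<longrightarrow> brk \<xi> \<noteq> t)}"
proof -
  let ?w = "\<lambda>\<xi>. h \<xi> * of_bool (q \<xi> < 0)"
  let ?M = "push_density brk ?w"
  have wm[measurable]: "?w \<in> borel_measurable borel" unfolding of_bool_def by measurable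
  have w: "integrable lborel ?w"
    by (rule integrable_h_mult[where B = 1]) (auto simp: of_bool_def)
  have w0: "0 \<le> ?w \<xi>" for \<xi> using h_nonneg by simp
  note P = push_density_integral[OF brk_measurable w w0]
  have "{t. \<not> (AE \<xi> in lborel. q \<xi> < 0 \<longrightarrow> brk \<xi> \<noteq> t)} \<subseteq> {t. measure ?M {t} \<noteq> 0}"
  proof (intro subsetI CollectI notI)
    fix t assume t: "t \<in> {t. \<not> (AE \<xi> in lborel. q \<xi> < 0 \<longrightarrow> brk \<xi> \<noteq> t)}" and z: "measure ?M {t} = 0"
    have i: "integrable lborel (\<lambda>\<xi>. ?w \<xi> * indicator {t} (brk \<xi>))"
      by (rule Bochner_Integration.integrable_bound[OF w]) (auto simp: indicator_def)
    have "(LBINT \<xi>. ?w \<xi> * indicator {t} (brk \<xi>)) = 0" using z P(3)[of "{t}"] by simp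
    then have "AE \<xi> in lborel. ?w \<xi> * indicator {t} (brk \<xi>) = 0"
      by (subst (asm) integral_nonneg_eq_0_iff_AE[OF i]) (use w0 in auto)
    then have "AE \<xi> in lborel. q \<xi> < 0 \<longrightarrow> brk \<xi> \<noteq> t"
      by eventually_elim (use q_neg_pos(2) in \<open>fastforce simp: indicator_def\<close>)
    then show False using t by simp
  qed
  then show ?thesis
    by (rule countable_subset) (rule finite_measure.countable_support[OF finite_borel_measureD(1)[OF P(1)]])
qed

end

section \<open>Convergence of the Eulerian quantities\<close>

context lagrangian_convergence
begin

text \<open>Uniform convergence of \<open>ue\<close> gives convergence of the integrals of
  \<open>ue\<^sub>x\<close> over intervals; together with the common energy bound this is weak
  convergence.\<close>

lemma ue\<^sub>x_weak:
  assumes t: "0 \<le> t" and \<phi>: "\<phi> \<in> borel_measurable borel" "integrable lborel (\<lambda>x. (\<phi> x)\<^sup>2)"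
  shows "(\<lambda>n. \<integral>x. Ln.ue\<^sub>x n t x * \<phi> x \<partial>lborel) \<longlonglongrightarrow> (LBINT x. L.ue\<^sub>x t x * \<phi> x)"
proof -
  note m = Ln.ue\<^sub>x_measurable[OF t] L.ue\<^sub>x_measurable[OF t]
  have lim: "(\<lambda>n. Ln.ue n t x) \<longlonglongrightarrow> L.ue t x" for x
    by (rule LIM_zero_cancel, rule Lim_null_comparison[OF _ \<delta>u_tendsto[OF t]]) (simp add: ue_close[OF t])
  have "(\<lambda>n. \<integral>x. (Ln.ue\<^sub>x n t x - L.ue\<^sub>x t x) * \<phi> x \<partial>lborel) \<longlonglongrightarrow> 0"
  proof (rule weak_to_limit[where B = "LBINT \<xi>. h \<xi>", OF m Ln.ue\<^sub>x_square(1)[OF t] L.ue\<^sub>x_square(1)[OF t] _ L.ue\<^sub>x_square(2)[OF t] _ \<phi>])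
    show "(LBINT x. (Ln.ue\<^sub>x n t x)\<^sup>2) \<le> (LBINT \<xi>. h \<xi>)" for n
      using Ln.ue\<^sub>x_square(2)[OF t, of n] by (simp add: mass)
    show "(\<lambda>n. LBINT x:{a..b}. Ln.ue\<^sub>x n t x - L.ue\<^sub>x t x) \<longlonglongrightarrow> 0" if "a \<le> b" for a b
      by (rule primitive_interval_tendsto[OF Ln.primitive_ue[OF t] L.primitive_ue[OF t] lim that])
  qed
  moreover have "(LBINT x. (Ln.ue\<^sub>x n t x - L.ue\<^sub>x t x) * \<phi> x)
      = (LBINT x. Ln.ue\<^sub>x n t x * \<phi> x) - (LBINT x. L.ue\<^sub>x t x * \<phi> x)" for n
    unfolding left_diff_distrib
    by (rule Bochner_Integration.integral_diff;
        rule integrable_mult_L2; use m \<phi> Ln.ue\<^sub>x_square(1)[OF t] L.ue\<^sub>x_square(1)[OF t] in simp)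
  ultimately show ?thesis by (simp add: LIM_zero_iff)
qed

text \<open>The alternative \<open>w \<xi> = 0\<close> in the last hypothesis admits discontinuous
  \<phi>, such as indicators of half lines, provided that no mass sits on the discontinuity.\<close>

lemma push_tendsto:
  fixes \<phi> w :: "real \<Rightarrow> real" and wn :: "nat \<Rightarrow> real \<Rightarrow> real"
  assumes t: "0 \<le> t" and \<phi>[measurable]: "\<phi> \<in> borel_measurable borel" and C: "\<And>x. \<bar>\<phi> x\<bar> \<le> C"
    and w: "\<And>n. integrable lborel (wn n)" "integrable lborel w" "\<And>\<xi>. 0 \<le> w \<xi>"
    and L1: "(\<lambda>n. \<integral>\<xi>. \<bar>wn n \<xi> - w \<xi>\<bar> \<partial>lborel) \<longlonglongrightarrow> 0"
    and ae: "AE \<xi> in lborel. w \<xi> = 0 \<or> (\<lambda>n. \<phi> (Ln.yt n t \<xi>)) \<longlonglongrightarrow> \<phi> (L.yt t \<xi>)"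
  shows "(\<lambda>n. \<integral>\<xi>. wn n \<xi> * \<phi> (Ln.yt n t \<xi>) \<partial>lborel) \<longlonglongrightarrow> (LBINT \<xi>. w \<xi> * \<phi> (L.yt t \<xi>))"
proof -
  note [measurable] = Ln.yt_measurable[OF t] L.yt_measurable[OF t] 
  have [measurable]: "wn n \<in> borel_measurable borel" "w \<in> borel_measurable borel" for n using w(1)[of n] w(2) by auto
  have C0: "0 \<le> C" using C[of 0] by linarith
  have ib: "integrable lborel (\<lambda>\<xi>. f \<xi> * g \<xi>)"
    if f: "integrable lborel f" and [measurable]: "g \<in> borel_measurable borel" and B: "\<And>\<xi>. \<bar>g \<xi>\<bar> \<le> B" for f g :: "real \<Rightarrow> real" and B
  proof (rule Bochner_Integration.integrable_bound)
    show "integrable lborel (\<lambda>\<xi>. B * \<bar>f \<xi>\<bar>)" using f by simp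
    show "(\<lambda>\<xi>. f \<xi> * g \<xi>) \<in> borel_measurable lborel" using f by simp
    show "AE \<xi> in lborel. norm (f \<xi> * g \<xi>) \<le> norm (B * \<bar>f \<xi>\<bar>)"
    proof (intro AE_I2)
      fix \<xi>
      have "\<bar>f \<xi>\<bar> * \<bar>g \<xi>\<bar> \<le> \<bar>f \<xi>\<bar> * \<bar>B\<bar>" using B[of \<xi>] by (intro mult_left_mono) auto
      then show "norm (f \<xi> * g \<xi>) \<le> norm (B * \<bar>f \<xi>\<bar>)" by (simp add: abs_mult mult.commute)
    qed
  qed
  define D where "D = (\<lambda>n \<xi>. w \<xi> * \<bar>\<phi> (Ln.yt n t \<xi>) - \<phi> (L.yt t \<xi>)\<bar>)"
  have D2: "\<bar>\<bar>\<phi> (Ln.yt n t \<xi>) - \<phi> (L.yt t \<xi>)\<bar>\<bar> \<le> 2 * C" for n \<xi>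
    using C[of "Ln.yt n t \<xi>"] C[of "L.yt t \<xi>"] by linarith
  have Di: "integrable lborel (D n)" for n
    unfolding D_def by (rule ib[OF w(2) _ D2]) measurable
  have "(\<lambda>n. \<integral>\<xi>. D n \<xi> \<partial>lborel) \<longlonglongrightarrow> (\<integral>\<xi>. 0 \<partial>(lborel :: real measure))"
  proof (rule integral_dominated_convergence[where w = "\<lambda>\<xi>. w \<xi> * (2 * C)"])
    show "AE \<xi> in lborel. (\<lambda>n. D n \<xi>) \<longlonglongrightarrow> 0"
      using ae
    proof eventually_elim
      case (elim \<xi>)
      show ?case
      proof (cases "w \<xi> = 0")
        case False
        then have "(\<lambda>n. D n \<xi>) \<longlonglongrightarrow> w \<xi> * \<bar>\<phi> (L.yt t \<xi>) - \<phi> (L.yt t \<xi>)\<bar>"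
          unfolding D_def using elim by (intro tendsto_intros) auto
        then show ?thesis by simp
      qed (simp add: D_def)
    qed
    show "AE \<xi> in lborel. norm (D n \<xi>) \<le> w \<xi> * (2 * C)" for n
    proof (intro AE_I2)
      fix \<xi>
      have "w \<xi> * \<bar>\<phi> (Ln.yt n t \<xi>) - \<phi> (L.yt t \<xi>)\<bar> \<le> w \<xi> * (2 * C)"
        using D2[of n \<xi>] w(3) by (intro mult_left_mono) auto
      then show "norm (D n \<xi>) \<le> w \<xi> * (2 * C)" using w(3) by (simp add: D_def abs_mult)
    qed
  qed (use w(2) Di in auto)
  then have D0: "(\<lambda>n. \<integral>\<xi>. D n \<xi> \<partial>lborel) \<longlonglongrightarrow> 0" by simp
  have i1: "integrable lborel (\<lambda>\<xi>. wn n \<xi> * \<phi> (Ln.yt n t \<xi>))" for n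
    by (rule ib[OF w(1), where B = C]) (use C in auto)
  have i2: "integrable lborel (\<lambda>\<xi>. w \<xi> * \<phi> (L.yt t \<xi>))"
    by (rule ib[OF w(2), where B = C]) (use C in auto)
  show ?thesis
  proof (rule tendsto_L1_imp_tendsto_integral[OF i1 i2], rule Lim_null_comparison)
    show "(\<lambda>n. C * (LBINT \<xi>. \<bar>wn n \<xi> - w \<xi>\<bar>) + (LBINT \<xi>. D n \<xi>)) \<longlonglongrightarrow> 0"
      using tendsto_add[OF tendsto_mult_right_zero[OF L1, of C] D0] by simp
    show "\<forall>\<^sub>F n in sequentially. norm (LBINT \<xi>. \<bar>wn n \<xi> * \<phi> (Ln.yt n t \<xi>) - w \<xi> * \<phi> (L.yt t \<xi>)\<bar>)
        \<le> C * (LBINT \<xi>. \<bar>wn n \<xi> - w \<xi>\<bar>) + (LBINT \<xi>. D n \<xi>)"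
    proof (intro always_eventually allI)
      fix n
      have id: "integrable lborel (\<lambda>\<xi>. \<bar>wn n \<xi> - w \<xi>\<bar>)" using w by simp
      have "(LBINT \<xi>. \<bar>wn n \<xi> * \<phi> (Ln.yt n t \<xi>) - w \<xi> * \<phi> (L.yt t \<xi>)\<bar>) \<le> (LBINT \<xi>. C * \<bar>wn n \<xi> - w \<xi>\<bar> + D n \<xi>)"
      proof (rule integral_mono)
        show "integrable lborel (\<lambda>\<xi>. \<bar>wn n \<xi> * \<phi> (Ln.yt n t \<xi>) - w \<xi> * \<phi> (L.yt t \<xi>)\<bar>)" using i1 i2 by simp
        show "integrable lborel (\<lambda>\<xi>. C * \<bar>wn n \<xi> - w \<xi>\<bar> + D n \<xi>)" using id Di by simp
        fix \<xi>
        have e: "wn n \<xi> * \<phi> (Ln.yt n t \<xi>) - w \<xi> * \<phi> (L.yt t \<xi>)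
          = (wn n \<xi> - w \<xi>) * \<phi> (Ln.yt n t \<xi>) + w \<xi> * (\<phi> (Ln.yt n t \<xi>) - \<phi> (L.yt t \<xi>))" by (simp add: algebra_simps)
        have "\<bar>(wn n \<xi> - w \<xi>) * \<phi> (Ln.yt n t \<xi>)\<bar> \<le> C * \<bar>wn n \<xi> - w \<xi>\<bar>"
          using mult_left_mono[OF C[of "Ln.yt n t \<xi>"], of "\<bar>wn n \<xi> - w \<xi>\<bar>"] by (simp add: abs_mult mult.commute)
        moreover have "\<bar>w \<xi> * (\<phi> (Ln.yt n t \<xi>) - \<phi> (L.yt t \<xi>))\<bar> = D n \<xi>"
          using w(3) by (simp add: abs_mult D_def)
        ultimately show "\<bar>wn n \<xi> * \<phi> (Ln.yt n t \<xi>) - w \<xi> * \<phi> (L.yt t \<xi>)\<bar> \<le> C * \<bar>wn n \<xi> - w \<xi>\<bar> + D n \<xi>"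
          unfolding e using abs_triangle_ineq[of "(wn n \<xi> - w \<xi>) * \<phi> (Ln.yt n t \<xi>)" "w \<xi> * (\<phi> (Ln.yt n t \<xi>) - \<phi> (L.yt t \<xi>))"] by linarith
      qed
      also have "\<dots> = C * (LBINT \<xi>. \<bar>wn n \<xi> - w \<xi>\<bar>) + (LBINT \<xi>. D n \<xi>)" using id Di by simp
      finally show "norm (LBINT \<xi>. \<bar>wn n \<xi> * \<phi> (Ln.yt n t \<xi>) - w \<xi> * \<phi> (L.yt t \<xi>)\<bar>)
        \<le> C * (LBINT \<xi>. \<bar>wn n \<xi> - w \<xi>\<bar>) + (LBINT \<xi>. D n \<xi>)" by simp
    qed
  qed
qed

lemma yt_lim: "0 \<le> t \<Longrightarrow> (\<lambda>n. Ln.yt n t \<xi>) \<longlonglongrightarrow> L.yt t \<xi>"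
  by (rule LIM_zero_cancel, rule Lim_null_comparison[OF _ \<delta>y_tendsto]) (simp_all add: yt_close)

lemma push_weak:
  fixes \<phi> w :: "real \<Rightarrow> real" and wn :: "nat \<Rightarrow> real \<Rightarrow> real"
  assumes t: "0 \<le> t" and \<phi>: "continuous_on UNIV \<phi>" "bounded (range \<phi>)"
    and w: "\<And>n. integrable lborel (wn n)" "\<And>n \<xi>. 0 \<le> wn n \<xi>" "integrable lborel w" "\<And>\<xi>. 0 \<le> w \<xi>"
    and L1: "(\<lambda>n. \<integral>\<xi>. \<bar>wn n \<xi> - w \<xi>\<bar> \<partial>lborel) \<longlonglongrightarrow> 0"
  shows "(\<lambda>n. \<integral>x. \<phi> x \<partial>push_density (Ln.yt n t) (wn n)) \<longlonglongrightarrow> (\<integral>x. \<phi> x \<partial>push_density (L.yt t) w)"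
proof -
  have m: "\<phi> \<in> borel_measurable borel" by (rule borel_measurable_continuous_onI[OF \<phi>(1)])
  obtain C where "\<forall>z\<in>range \<phi>. norm z \<le> C" using \<phi>(2) unfolding bounded_iff by blast
  then have C: "\<bar>\<phi> x\<bar> \<le> C" for x by simp
  have "(\<lambda>n. \<integral>\<xi>. wn n \<xi> * \<phi> (Ln.yt n t \<xi>) \<partial>lborel) \<longlonglongrightarrow> (LBINT \<xi>. w \<xi> * \<phi> (L.yt t \<xi>))"
  proof (rule push_tendsto[OF t m C w(1) w(3) w(4) L1], intro AE_I2 disjI2)
    fix \<xi>
    have "isCont \<phi> (L.yt t \<xi>)" using \<phi>(1) by (simp add: continuous_on_eq_continuous_at)
    then show "(\<lambda>n. \<phi> (Ln.yt n t \<xi>)) \<longlonglongrightarrow> \<phi> (L.yt t \<xi>)"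
      by (rule isCont_tendsto_compose[OF _ yt_lim[OF t]])
  qed
  moreover have "(\<integral>x. \<phi> x \<partial>push_density (Ln.yt n t) (wn n)) = (LBINT \<xi>. wn n \<xi> * \<phi> (Ln.yt n t \<xi>))" for n
    by (rule push_density_integral(2)[OF Ln.yt_measurable[OF t] w(1,2) m])
  moreover have "(\<integral>x. \<phi> x \<partial>push_density (L.yt t) w) = (LBINT \<xi>. w \<xi> * \<phi> (L.yt t \<xi>))"
    by (rule push_density_integral(2)[OF L.yt_measurable[OF t] w(3,4) m])
  ultimately show ?thesis by (simp only:)
qed

text \<open>At a continuity point the limit measure has no atom, so almost no particle with energy
  is located at \<open>x\<close> and the indicator of the half line converges along the others. For
  the total mass the set is \<open>UNIV\<close> and the condition on indicators is trivial; no mass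
  escapes because \<open>V\<^sub>\<xi>\<close> converges in \<open>L\<^sup>1\<close>.\<close>

lemma lprim_mu_tendsto:
  assumes t: "0 \<le> t" and good: "AE \<xi> in lborel. q \<xi> < 0 \<longrightarrow> L.brk \<xi> \<noteq> t"
  shows "isCont (lprim (L.mu t)) x \<Longrightarrow> (\<lambda>n. lprim (Ln.mu n t) x) \<longlonglongrightarrow> lprim (L.mu t) x"
    and "(\<lambda>n. Lim at_top (lprim (Ln.mu n t))) \<longlonglongrightarrow> Lim at_top (lprim (L.mu t))"
proof -
  have Pn: "measure (Ln.mu n t) A = (LBINT \<xi>. Ln.V\<^sub>\<xi> n t \<xi> * indicator A (Ln.yt n t \<xi>))" if "A \<in> sets borel" for n A
    unfolding Ln.mu_def
    by (rule push_density_integral(3)[OF Ln.yt_measurable[OF t] Ln.integrable_h\<phi>(1) Ln.V\<^sub>\<xi>_bounds(1) that])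
  have P: "measure (L.mu t) A = (LBINT \<xi>. L.V\<^sub>\<xi> t \<xi> * indicator A (L.yt t \<xi>))" if "A \<in> sets borel" for A
    unfolding L.mu_def
    by (rule push_density_integral(3)[OF L.yt_measurable[OF t] L.integrable_h\<phi>(1) L.V\<^sub>\<xi>_bounds(1) that])
  have *: "(\<lambda>n. measure (Ln.mu n t) A) \<longlonglongrightarrow> measure (L.mu t) A"
    if A: "A \<in> sets borel"
      and ae: "AE \<xi> in lborel. L.V\<^sub>\<xi> t \<xi> = 0 \<or> (\<lambda>n. indicat_real A (Ln.yt n t \<xi>)) \<longlonglongrightarrow> indicat_real A (L.yt t \<xi>)" for A
    unfolding Pn[OF A] P[OF A]
    by (rule push_tendsto[OF t _ _ Ln.integrable_h\<phi>(1) L.integrable_h\<phi>(1) L.V\<^sub>\<xi>_bounds(1) V_L1[OF good] ae, where C = 1])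
       (use A in \<open>auto simp: indicator_def\<close>)
  show "(\<lambda>n. Lim at_top (lprim (Ln.mu n t))) \<longlonglongrightarrow> Lim at_top (lprim (L.mu t))"
    unfolding lprim_Lim[OF Ln.finite_mu[OF t]] lprim_Lim[OF L.finite_mu[OF t]] by (rule *) auto
  assume c: "isCont (lprim (L.mu t)) x"
  have "measure (L.mu t) {x} = 0" by (rule isCont_lprim_imp_null[OF L.finite_mu[OF t] c])
  then have z: "(LBINT \<xi>. L.V\<^sub>\<xi> t \<xi> * indicator {x} (L.yt t \<xi>)) = 0" using P[of "{x}"] by simp
  note [measurable] = L.yt_measurable[OF t]
  have i: "integrable lborel (\<lambda>\<xi>. L.V\<^sub>\<xi> t \<xi> * indicator {x} (L.yt t \<xi>))"
    by (rule Bochner_Integration.integrable_bound[OF L.integrable_h\<phi>(1)]) (auto simp: indicator_def)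
  have ae: "AE \<xi> in lborel. L.V\<^sub>\<xi> t \<xi> * indicator {x} (L.yt t \<xi>) = 0"
    using z by (subst (asm) integral_nonneg_eq_0_iff_AE[OF i]) (auto simp: L.V\<^sub>\<xi>_bounds)
  have "(\<lambda>n. measure (Ln.mu n t) {..<x}) \<longlonglongrightarrow> measure (L.mu t) {..<x}"
  proof (rule *)
    show "AE \<xi> in lborel. L.V\<^sub>\<xi> t \<xi> = 0 \<or> (\<lambda>n. indicat_real {..<x} (Ln.yt n t \<xi>)) \<longlonglongrightarrow> indicat_real {..<x} (L.yt t \<xi>)"
      using ae
    proof eventually_elim
      case (elim \<xi>)
      show ?case
      proof (cases "L.yt t \<xi> = x")
        case True
        then show ?thesis using elim by simp
      next
        case False
        have "\<forall>\<^sub>F n in sequentially. indicat_real {..<x} (Ln.yt n t \<xi>) = indicat_real {..<x} (L.yt t \<xi>)"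
        proof (cases "L.yt t \<xi> < x")
          case True
          from order_tendstoD(2)[OF yt_lim[OF t] this] show ?thesis
            by eventually_elim (use True in simp)
        next
          case ge: False
          then have "x < L.yt t \<xi>" using False by simp
          from order_tendstoD(1)[OF yt_lim[OF t] this] show ?thesis
            by eventually_elim (use ge in simp)
        qed
        then show ?thesis by (intro disjI2 tendsto_eventually)
      qed
    qed
  qed simp
  then show "(\<lambda>n. lprim (Ln.mu n t) x) \<longlonglongrightarrow> lprim (L.mu t) x" by (simp add: lprim_def)
qed

text \<open>Both primitives are \<open>H\<close> after an inverse characteristic; the mixed term,
  limit \<open>H\<close> after the approximate inverse, is inserted. The first difference is pulled
  back to particles, where it is \<open>yn - y\<close> times a bounded Jacobian. The second is
  turned by Fubini into an \<open>h\<close>-weighted distance of the characteristics, which are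
  uniformly close.\<close>

lemma nu_L1:
  assumes t: "0 \<le> t"
  shows "(\<lambda>n. \<integral>\<^sup>+x. ennreal \<bar>lprim (Ln.nu n t) x - lprim (L.nu t) x\<bar> \<partial>lborel) \<longlonglongrightarrow> 0"
proof -
  let ?M = "LBINT \<xi>. h \<xi>" and ?C = "1 + t + t\<^sup>2"
  have M: "0 \<le> ?M" using L.h_nonneg by simp
  have C: "0 \<le> ?C" using t by simp
  have \<epsilon>0: "0 \<le> \<epsilon> n" for n using y_close[of n 0] by linarith
  have \<delta>0: "0 \<le> \<delta>y t n" for n using yt_close[OF t, of n 0] by linarith
  note [measurable] = Ln.yinv_measurable[OF t] L.yinv_measurable[OF t] Ln.yt_measurable[OF t] L.yt_measurable[OF t]
  have bound: "(\<integral>\<^sup>+x. ennreal \<bar>lprim (Ln.nu n t) x - lprim (L.nu t) x\<bar> \<partial>lborel) \<le> ennreal (?C * \<epsilon> n + ?M * \<delta>y t n)" for n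
  proof -
    have "(\<integral>\<^sup>+x. ennreal \<bar>lprim (Ln.nu n t) x - lprim (L.nu t) x\<bar> \<partial>lborel)
      \<le> (\<integral>\<^sup>+x. ennreal \<bar>Ln.H n (Ln.yinv n t x) - L.H (Ln.yinv n t x)\<bar> + ennreal \<bar>L.H (Ln.yinv n t x) - L.H (L.yinv t x)\<bar> \<partial>lborel)"
      unfolding Ln.lprim_nu[OF t] L.lprim_nu[OF t]
      by (intro nn_integral_mono) (simp flip: ennreal_plus)
    also have "\<dots> = (\<integral>\<^sup>+x. ennreal \<bar>Ln.H n (Ln.yinv n t x) - L.H (Ln.yinv n t x)\<bar> \<partial>lborel)
        + (\<integral>\<^sup>+x. ennreal \<bar>L.H (Ln.yinv n t x) - L.H (L.yinv t x)\<bar> \<partial>lborel)"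
      by (rule nn_integral_add) auto
    also have "(\<integral>\<^sup>+x. ennreal \<bar>Ln.H n (Ln.yinv n t x) - L.H (Ln.yinv n t x)\<bar> \<partial>lborel) \<le> ennreal (?C * \<epsilon> n)"
    proof -
      have "(\<integral>\<^sup>+x. ennreal \<bar>Ln.H n (Ln.yinv n t x) - L.H (Ln.yinv n t x)\<bar> \<partial>lborel)
         = (\<integral>\<^sup>+\<xi>. ennreal (Ln.y\<^sub>\<xi> n t \<xi>) * ennreal \<bar>Ln.H n \<xi> - L.H \<xi>\<bar> \<partial>lborel)"
        by (rule Ln.nn_integral_yinv[OF t]) auto
      also have "\<dots> \<le> (\<integral>\<^sup>+\<xi>. ennreal ?C * ennreal \<bar>yn n \<xi> - y \<xi>\<bar> \<partial>lborel)"
        by (intro nn_integral_mono mult_mono ennreal_leI Ln.y\<^sub>\<xi>_le t) (auto simp: Ln.H_def L.H_def abs_minus_commute)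
      also have "\<dots> = ennreal ?C * (\<integral>\<^sup>+\<xi>. ennreal \<bar>yn n \<xi> - y \<xi>\<bar> \<partial>lborel)"
      proof (rule nn_integral_cmult)
        have "yn n \<in> borel_measurable borel" "y \<in> borel_measurable borel"
          by (rule borel_measurable_continuous_onI[OF primitive_continuous], rule Ln.primitive_y L.primitive_y)+
        then show "(\<lambda>\<xi>. ennreal \<bar>yn n \<xi> - y \<xi>\<bar>) \<in> borel_measurable lborel" by simp
      qed
      also have "\<dots> \<le> ennreal ?C * ennreal (\<epsilon> n)" by (intro mult_left_mono y_L1) simp
      also have "\<dots> = ennreal (?C * \<epsilon> n)" using C \<epsilon>0 by (simp only: ennreal_mult)
      finally show ?thesis .
    qed
    also have "(\<integral>\<^sup>+x. ennreal \<bar>L.H (Ln.yinv n t x) - L.H (L.yinv t x)\<bar> \<partial>lborel) \<le> ennreal (?M * \<delta>y t n)"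
    proof -
      let ?k = "\<lambda>x \<xi>. ennreal (h \<xi>) * ennreal \<bar>of_bool (Ln.yt n t \<xi> < x) - of_bool (L.yt t \<xi> < x)\<bar>"
      have "(\<integral>\<^sup>+x. ennreal \<bar>L.H (Ln.yinv n t x) - L.H (L.yinv t x)\<bar> \<partial>lborel) \<le> (\<integral>\<^sup>+x. \<integral>\<^sup>+\<xi>. ?k x \<xi> \<partial>lborel \<partial>lborel)"
        by (intro nn_integral_mono) (simp add: Ln.less_yinv[OF t, symmetric] L.less_yinv[OF t, symmetric] L.H_diff_bound)
      also have "\<dots> = (\<integral>\<^sup>+\<xi>. \<integral>\<^sup>+x. ?k x \<xi> \<partial>lborel \<partial>lborel)"
        by (rule lborel_pair.Fubini') (unfold of_bool_def split_beta', measurable)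
      also have "\<dots> = (\<integral>\<^sup>+\<xi>. ennreal (h \<xi>) * ennreal \<bar>Ln.yt n t \<xi> - L.yt t \<xi>\<bar> \<partial>lborel)"
      proof (rule nn_integral_cong)
        fix \<xi>
        have "(\<integral>\<^sup>+x. ?k x \<xi> \<partial>lborel) = ennreal (h \<xi>) * (\<integral>\<^sup>+x. ennreal \<bar>of_bool (Ln.yt n t \<xi> < x) - of_bool (L.yt t \<xi> < x)\<bar> \<partial>lborel)"
          by (rule nn_integral_cmult) (unfold of_bool_def, measurable)
        then show "(\<integral>\<^sup>+x. ?k x \<xi> \<partial>lborel) = ennreal (h \<xi>) * ennreal \<bar>Ln.yt n t \<xi> - L.yt t \<xi>\<bar>"
          by (simp only: nn_integral_indicator_diff)
      qed
      also have "\<dots> \<le> (\<integral>\<^sup>+\<xi>. ennreal (h \<xi>) * ennreal (\<delta>y t n) \<partial>lborel)"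
        by (intro nn_integral_mono mult_left_mono ennreal_leI yt_close t) simp
      also have "\<dots> = (\<integral>\<^sup>+\<xi>. ennreal (h \<xi>) \<partial>lborel) * ennreal (\<delta>y t n)"
        by (rule nn_integral_multc) simp
      also have "\<dots> = ennreal (?M * \<delta>y t n)" using M \<delta>0 by (simp only: L.nn_integral_h ennreal_mult)
      finally show ?thesis .
    qed
    finally show ?thesis
      using C M \<epsilon>0[of n] \<delta>0[of n] by (simp add: add_mono ennreal_plus[symmetric] del: ennreal_plus)
  qed
  have "(\<lambda>n. ?C * \<epsilon> n + ?M * \<delta>y t n) \<longlonglongrightarrow> ?C * 0 + ?M * 0"
    by (intro tendsto_intros \<epsilon> \<delta>y_tendsto t)
  then have lim: "(\<lambda>n. ennreal (?C * \<epsilon> n + ?M * \<delta>y t n)) \<longlonglongrightarrow> 0"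
    unfolding ennreal_0[symmetric] by (intro tendsto_ennrealI) simp
  show ?thesis
  proof (rule tendsto_sandwich[OF _ _ tendsto_const lim]; intro always_eventually allI)
    show "0 \<le> (\<integral>\<^sup>+x. ennreal \<bar>lprim (Ln.nu n t) x - lprim (L.nu t) x\<bar> \<partial>lborel)" for n by simp
  qed (rule bound)
qed

end

section \<open>The projection\<close>

text \<open>Induction on the number of cells between \<open>a\<close> and \<open>b\<close>; the
  common node of neighbouring cells is the splitting point.\<close>

lemma primitive_glue:
  fixes f g :: "real \<Rightarrow> real"
  assumes d: "0 < d" and g: "locally_integrable g"
    and loc: "\<And>i a b. of_int i * d \<le> a \<Longrightarrow> a \<le> b \<Longrightarrow> b \<le> (of_int i + 1) * d \<Longrightarrow>
      f b - f a = (LBINT x:{a..b}. g x)"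
  shows "primitive f g"
proof -
  have gm: "g \<in> borel_measurable borel" by (rule locally_integrable_measurable[OF g])
  have *: "f b - f a = (LBINT x:{a..b}. g x)"
    if "of_int i * d \<le> a" "a \<le> (of_int i + 1) * d" "a \<le> b" "b \<le> (of_int i + 1 + real n) * d" for i a b n
    using that
  proof (induction n arbitrary: i a)
    case 0
    then show ?case using loc[of i a b] by simp
  next
    case (Suc n)
    show ?case
    proof (cases "b \<le> (of_int i + 1) * d")
      case True
      then show ?thesis using loc[of i a b] Suc.prems by simp
    next
      case False
      define c where "c = (of_int i + 1) * d"
      have c: "a \<le> c" "c \<le> b" using Suc.prems False by (auto simp: c_def)
      have 1: "f c - f a = (LBINT x:{a..c}. g x)"
        using loc[of i a c] Suc.prems by (simp add: c_def)
      have 2: "f b - f c = (LBINT x:{c..b}. g x)"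
        by (rule Suc.IH[of "i + 1" c]) (use Suc.prems c d in \<open>auto simp: c_def algebra_simps\<close>)
      have "set_integrable lborel {a..b} g" using g unfolding locally_integrable_def by blast
      from set_integral_Icc_split[OF this gm c] 1 2 show ?thesis by simp
    qed
  qed
  show ?thesis unfolding primitive_def
  proof (intro conjI g allI impI)
    fix a b :: real assume ab: "a \<le> b"
    define i where "i = \<lfloor>a / d\<rfloor>"
    have i: "of_int i \<le> a / d" "a / d < of_int i + 1" unfolding i_def by linarith+
    obtain n :: nat where "b / d \<le> real n + of_int i + 1"
      using real_arch_simple[of "b / d - of_int i - 1"] by (auto simp: algebra_simps)
    then have "b \<le> (of_int i + 1 + real n) * d" using d by (simp add: divide_simps algebra_simps)
    moreover have "of_int i * d \<le> a" "a \<le> (of_int i + 1) * d"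
      using i d by (simp_all add: divide_simps split: if_splits)
    ultimately show "f b - f a = (LBINT x:{a..b}. g x)" using *[of i a b n] ab by simp
  qed
qed

text \<open>The index \<open>\<lceil>x / d\<rceil> - 1\<close> counts cells that are open on the
  left and closed on the right, like the cells of the projection.\<close>

lemma primitive_piecewise_affine:
  fixes f :: "real \<Rightarrow> real" and c :: "int \<Rightarrow> real"
  assumes d: "0 < d"
    and aff: "\<And>i x. of_int i * d \<le> x \<Longrightarrow> x \<le> (of_int i + 1) * d \<Longrightarrow> f x = f (of_int i * d) + c i * (x - of_int i * d)"
  shows "primitive f (\<lambda>x. c (\<lceil>x / d\<rceil> - 1))"
proof (rule primitive_glue[OF d])
  let ?g = "\<lambda>x. c (\<lceil>x / d\<rceil> - 1)"
  have m: "?g \<in> borel_measurable borel"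
  proof -
    have "(\<lambda>x::real. \<lceil>x / d\<rceil>) \<in> measurable borel (count_space UNIV)" by measurable
    from measurable_compose[OF this, of "\<lambda>k. c (k - 1)" borel] show ?thesis by simp
  qed
  show "locally_integrable ?g"
    unfolding locally_integrable_def
  proof (intro allI)
    fix a b :: real
    define S where "S = (\<lambda>k. c (k - 1)) ` {\<lceil>a / d\<rceil>..\<lceil>b / d\<rceil>}"
    show "set_integrable lborel {a..b} ?g"
    proof (rule set_integrable_mono_real[where f = "\<lambda>_. \<Sum>s\<in>S. \<bar>s\<bar>"])
      show "set_integrable lborel {a..b} (\<lambda>_. \<Sum>s\<in>S. \<bar>s\<bar>)"
        using locally_integrable_const unfolding locally_integrable_def by blast
      fix x assume x: "x \<in> {a..b}"
      have "\<lceil>a / d\<rceil> \<le> \<lceil>x / d\<rceil>" "\<lceil>x / d\<rceil> \<le> \<lceil>b / d\<rceil>"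
        using x d by (auto intro!: ceiling_mono divide_right_mono)
      then have "?g x \<in> S" unfolding S_def by auto
      moreover have "finite S" by (simp add: S_def)
      ultimately show "\<bar>?g x\<bar> \<le> (\<Sum>s\<in>S. \<bar>s\<bar>)" by (intro member_le_sum) auto
    qed (use m in auto)
  qed
  fix i a b assume ab: "of_int i * d \<le> a" "a \<le> b" "b \<le> (of_int i + 1) * d"
  have "(LBINT x:{a..b}. ?g x) = (LBINT x:{a<..b}. ?g x)"
    by (rule set_integral_Ioc[OF m, symmetric])
  also have "\<dots> = (LBINT x:{a<..b}. c i)"
  proof (rule set_lebesgue_integral_cong)
    have "\<lceil>x / d\<rceil> = i + 1" if "a < x" "x \<le> b" for x
    proof (rule ceiling_unique)
      show "of_int (i + 1) - 1 < x / d" "x / d \<le> of_int (i + 1)"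
        using that ab d by (auto simp: divide_simps algebra_simps)
    qed
    then show "\<forall>x. x \<in> {a<..b} \<longrightarrow> ?g x = c i" by auto
  qed simp
  also have "\<dots> = c i * (b - a)" using ab by (simp add: set_integral_const mult.commute)
  also have "\<dots> = f b - f a"
    using aff[of i a] aff[of i b] ab by (simp add: algebra_simps)
  finally show "f b - f a = (LBINT x:{a..b}. ?g x)" by simp
qed

lemma cell_index_bounds:
  assumes "0 < d"
  shows "of_int (2 * cell_index d x) * d < x" "x \<le> of_int (2 * cell_index d x + 2) * d"
proof -
  have "of_int (cell_index d x) < x / (2 * d)" "x / (2 * d) \<le> of_int (cell_index d x) + 1"
    unfolding cell_index_def by linarith+
  then show "of_int (2 * cell_index d x) * d < x" "x \<le> of_int (2 * cell_index d x + 2) * d"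
    using assms by (simp_all add: divide_simps algebra_simps split: if_splits)
qed

lemma cell_index_eq:
  assumes d: "0 < d" and "of_int (2 * j) * d < x" "x \<le> of_int (2 * j + 2) * d"
  shows "cell_index d x = j"
proof -
  have "\<lceil>x / (2 * d)\<rceil> = j + 1"
    by (rule ceiling_unique) (use assms in \<open>simp_all add: divide_simps algebra_simps split: if_splits\<close>)
  then show ?thesis by (simp add: cell_index_def)
qed

text \<open>The slope of the projected function on the half cell \<open>(i d, (i + 1) d]\<close>.\<close>

definition half_slope :: "(int \<Rightarrow> bool) \<Rightarrow> real \<Rightarrow> (real \<Rightarrow> real) \<Rightarrow> (real \<Rightarrow> real) \<Rightarrow> int \<Rightarrow> real" where
  "half_slope up d u F i = cell_slope d u (i div 2)
     + (if even i then - 1 else 1) * (cell_sign up (i div 2) * cell_q d u F (i div 2))"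

text \<open>The even node \<open>2 * j\<close> is the right end of cell \<open>j - 1\<close>, so the
  second branch of the projection is evaluated there. For the energy the root must square back to
  the radicand, hence the hypothesis.\<close>

lemma proj_node:
  assumes d: "0 < d"
  shows "proj_u up d u F (of_int (2 * j) * d) = u (of_int (2 * j) * d)"
    and "(cell_slope d u (j - 1))\<^sup>2 \<le> cell_slope d F (j - 1) \<Longrightarrow>
      proj_Fac up d u F (of_int (2 * j) * d) = F (of_int (2 * j) * d)"
proof -
  have i: "cell_index d (of_int (2 * j) * d) = j - 1"
    by (rule cell_index_eq[OF d]) (use d in auto)
  have n: "\<not> of_int (2 * j) * d \<le> of_int (2 * (j - 1) + 1) * d" using d by simp
  have e: "2 * (j - 1) + 2 = 2 * j" by simp
  show "proj_u up d u F (of_int (2 * j) * d) = u (of_int (2 * j) * d)"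
    unfolding proj_u_def i Let_def using n by (simp only: e if_False) simp
  assume le: "(cell_slope d u (j - 1))\<^sup>2 \<le> cell_slope d F (j - 1)"
  define D where "D = cell_slope d u (j - 1)"
  define q where "q = cell_q d u F (j - 1)"
  define s where "s = cell_sign up (j - 1)"
  have s: "s\<^sup>2 = 1" by (simp add: s_def cell_sign_def)
  have q: "q\<^sup>2 = cell_slope d F (j - 1) - D\<^sup>2" using le by (simp add: q_def cell_q_def D_def)
  have sl: "cell_slope d F (j - 1) * (2 * d) = F (of_int (2 * j) * d) - F (of_int (2 * (j - 1)) * d)"
    using d unfolding cell_slope_def e by simp
  have "(D + s * q)\<^sup>2 = D\<^sup>2 + 2 * s * q * D + s\<^sup>2 * q\<^sup>2" by (simp add: power2_eq_square algebra_simps)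
  then have sq: "(D + s * q)\<^sup>2 = cell_slope d F (j - 1) + 2 * s * q * D" by (simp add: s q)
  have "of_int (2 * j) * d - of_int (2 * (j - 1) + 1) * d = d" by (simp add: algebra_simps)
  then have "proj_Fac up d u F (of_int (2 * j) * d)
    = (F (of_int (2 * j) * d) + F (of_int (2 * (j - 1)) * d)) / 2 - s * 2 * q * D * d + (D + s * q)\<^sup>2 * d"
    unfolding proj_Fac_def i Let_def using n
    by (simp only: e if_False D_def[symmetric] q_def[symmetric] s_def[symmetric])
  also have "\<dots> = (F (of_int (2 * j) * d) + F (of_int (2 * (j - 1)) * d)) / 2 + (cell_slope d F (j - 1) * (2 * d)) / 2"
    unfolding sq by (simp add: algebra_simps)
  also have "\<dots> = F (of_int (2 * j) * d)" unfolding sl by (simp add: field_simps)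
  finally show "proj_Fac up d u F (of_int (2 * j) * d) = F (of_int (2 * j) * d)" .
qed

text \<open>Says in particular that the two branches fit together at the odd node. This rests on
  \<open>q\<^sup>2 + D\<^sup>2\<close> being the mean energy of the cell, so that the squared slopes
  are that mean minus or plus \<open>2 * s * q * D\<close>.\<close>

lemma proj_affine:
  assumes d: "0 < d" and le: "\<And>j. (cell_slope d u j)\<^sup>2 \<le> cell_slope d F j"
    and x: "of_int i * d \<le> x" "x \<le> (of_int i + 1) * d"
  shows "proj_u up d u F x = proj_u up d u F (of_int i * d) + half_slope up d u F i * (x - of_int i * d)" (is ?U)
    and "proj_Fac up d u F x = proj_Fac up d u F (of_int i * d) + (half_slope up d u F i)\<^sup>2 * (x - of_int i * d)" (is ?F)
proof -
  have "?U \<and> ?F"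
  proof (cases "x = of_int i * d")
    case False
    then have x0: "of_int i * d < x" using x by simp
    define j where "j = i div 2"
    define D where "D = cell_slope d u j"
    define q where "q = cell_q d u F j"
    define s where "s = cell_sign up j"
    have sl: "D * (2 * d) = u (of_int (2 * j + 2) * d) - u (of_int (2 * j) * d)"
      using d by (simp add: D_def cell_slope_def)
    have slF: "cell_slope d F j * (2 * d) = F (of_int (2 * j + 2) * d) - F (of_int (2 * j) * d)"
      using d by (simp add: cell_slope_def)
    have s2: "s\<^sup>2 = 1" by (simp add: s_def cell_sign_def)
    have q2: "q\<^sup>2 = cell_slope d F j - D\<^sup>2" using le[of j] by (simp add: q_def cell_q_def D_def)
    have sq: "(D - s * q)\<^sup>2 = cell_slope d F j - 2 * s * q * D"
    proof -
      have "(D - s * q)\<^sup>2 = D\<^sup>2 - 2 * s * q * D + s\<^sup>2 * q\<^sup>2" by (simp add: power2_eq_square algebra_simps)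
      then show ?thesis by (simp add: s2 q2)
    qed
    show ?thesis
    proof (cases "even i")
      case True
      then have i: "i = 2 * j" by (simp add: j_def)
      have ci: "cell_index d x = j"
        by (rule cell_index_eq[OF d]) (use x0 x d in \<open>auto simp: i algebra_simps\<close>)
      have le1: "x \<le> of_int (2 * j + 1) * d" using x by (simp add: i)
      have hs: "half_slope up d u F i = D - s * q"
        using True by (simp add: half_slope_def j_def D_def q_def s_def)
      show ?thesis
        unfolding hs unfolding i proj_node(1)[OF d] proj_node(2)[OF d le]
        unfolding proj_u_def proj_Fac_def ci Let_def using le1
        by (simp only: if_True D_def[symmetric] q_def[symmetric] s_def[symmetric])
    next
      case False
      then have i: "i = 2 * j + 1" by (simp add: j_def)
      have ci: "cell_index d x = j"
        by (rule cell_index_eq[OF d]) (use x0 x d in \<open>auto simp: i algebra_simps\<close>)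
      have n1: "\<not> x \<le> of_int (2 * j + 1) * d" using x0 by (simp add: i)
      \<comment> \<open>The odd node is the right end of the first half cell, so its value comes
        from the first branch.\<close>
      have c1: "cell_index d (of_int (2 * j + 1) * d) = j"
        by (rule cell_index_eq[OF d]) (use d in auto)
      have hs: "half_slope up d u F i = D + s * q"
        using False by (simp add: half_slope_def j_def D_def q_def s_def)
      have "of_int (2 * j + 1) * d - of_int (2 * j) * d = d" by (simp add: algebra_simps)
      then have pu: "proj_u up d u F (of_int (2 * j + 1) * d) = u (of_int (2 * j) * d) + (D - s * q) * d"
        and pF: "proj_Fac up d u F (of_int (2 * j + 1) * d) = F (of_int (2 * j) * d) + (D - s * q)\<^sup>2 * d"
        unfolding proj_u_def proj_Fac_def c1 Let_def
        by (simp_all only: if_True order_refl D_def[symmetric] q_def[symmetric] s_def[symmetric])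
      have xu: "proj_u up d u F x = u (of_int (2 * j + 2) * d) + (D + s * q) * (x - of_int (2 * j + 2) * d)"
        and xF: "proj_Fac up d u F x = (F (of_int (2 * j + 2) * d) + F (of_int (2 * j) * d)) / 2
            - s * 2 * q * D * d + (D + s * q)\<^sup>2 * (x - of_int (2 * j + 1) * d)"
        unfolding proj_u_def proj_Fac_def ci Let_def using n1
        by (simp_all only: if_False D_def[symmetric] q_def[symmetric] s_def[symmetric])
      have 1: ?U
      proof -
        have "x - of_int (2 * j + 2) * d = (x - of_int (2 * j + 1) * d) - d" by (simp add: algebra_simps)
        then have "proj_u up d u F x = u (of_int (2 * j + 2) * d) + (D + s * q) * ((x - of_int (2 * j + 1) * d) - d)"
          by (simp only: xu)
        also have "\<dots> = (u (of_int (2 * j + 2) * d) - D * (2 * d)) + (D - s * q) * d + (D + s * q) * (x - of_int (2 * j + 1) * d)"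
          by (simp add: algebra_simps)
        also have "u (of_int (2 * j + 2) * d) - D * (2 * d) = u (of_int (2 * j) * d)" unfolding sl by simp
        finally show ?thesis unfolding hs unfolding i pu .
      qed
      have 2: ?F
      proof -
        have "(F (of_int (2 * j + 2) * d) + F (of_int (2 * j) * d)) / 2
           = F (of_int (2 * j) * d) + (cell_slope d F j * (2 * d)) / 2"
          unfolding slF by (simp add: field_simps)
        then have "(F (of_int (2 * j + 2) * d) + F (of_int (2 * j) * d)) / 2 - s * 2 * q * D * d
           = F (of_int (2 * j) * d) + (D - s * q)\<^sup>2 * d"
          unfolding sq by (simp add: algebra_simps)
        then show ?thesis unfolding hs xF unfolding i pF by simp
      qed
      show ?thesis using 1 2 by simp
    qed
  qed simp
  then show ?U ?F by auto
qed

context eulerian_data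
begin

definition \<mu>a :: "real measure" where "\<mu>a = density lborel (\<lambda>x. ennreal ((v x)\<^sup>2))"

lemma sets_\<mu>a [simp, measurable_cong]: "sets \<mu>a = sets borel" by (simp add: \<mu>a_def)

lemma finite_\<mu>a: "finite_borel_measure \<mu>a"
proof (rule finite_borel_measureI)
  have "emeasure \<mu>a UNIV = (\<integral>\<^sup>+x. ennreal ((v x)\<^sup>2) \<partial>lborel)"
    unfolding \<mu>a_def by (subst emeasure_density) auto
  also have "\<dots> = ennreal (LBINT x. (v x)\<^sup>2)" by (rule nn_integral_eq_integral[OF v2]) simp
  finally show "emeasure \<mu>a UNIV < \<infinity>" by simp
qed simp

lemma lprim_\<mu>: "lprim \<mu> x = lprim \<mu>a x + lprim \<mu>s x"
proof -
  interpret a: finite_measure \<mu>a by (rule finite_borel_measureD(1)[OF finite_\<mu>a])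
  interpret s: finite_measure \<mu>s by (rule finite_borel_measureD(1)[OF fin(2)])
  have "ennreal (lprim \<mu> x) = ennreal (lprim \<mu>a x + lprim \<mu>s x)"
    using dec[of "{..<x}"]
    by (simp add: lprim_def \<mu>a_def[symmetric] \<mu>.emeasure_eq_measure a.emeasure_eq_measure s.emeasure_eq_measure)
  then show ?thesis by (subst (asm) ennreal_inj) (auto simp: lprim_def)
qed

lemma primitive_\<mu>a: "primitive (lprim \<mu>a) (\<lambda>x. (v x)\<^sup>2)"
  unfolding primitive_def
proof (intro conjI allI impI)
  show "locally_integrable (\<lambda>x. (v x)\<^sup>2)" by (rule integrable_imp_locally_integrable[OF v2])
  fix a b :: real assume ab: "a \<le> b"
  have i: "integrable lborel (\<lambda>x. indicat_real {a..b} x * (v x)\<^sup>2)"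
    using integrable_mult_indicator[OF _ v2, of "{a..b}"] by simp
  have "ennreal (lprim \<mu>a b - lprim \<mu>a a) = (\<integral>\<^sup>+x. ennreal ((v x)\<^sup>2) * indicator {a..<b} x \<partial>lborel)"
    unfolding emeasure_Ico_lprim(1)[OF finite_\<mu>a ab, symmetric] by (simp add: \<mu>a_def emeasure_density)
  also have "\<dots> = (\<integral>\<^sup>+x. ennreal (indicat_real {a..b} x * (v x)\<^sup>2) \<partial>lborel)"
  proof (rule nn_integral_cong_AE)
    show "AE x in lborel. ennreal ((v x)\<^sup>2) * indicator {a..<b} x = ennreal (indicat_real {a..b} x * (v x)\<^sup>2)"
      using AE_lborel_singleton[of b] by eventually_elim (auto simp: indicator_def)
  qed
  also have "\<dots> = ennreal (LBINT x:{a..b}. (v x)\<^sup>2)"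
    unfolding set_lebesgue_integral_def by (subst nn_integral_eq_integral[OF i]) auto
  finally have "ennreal (lprim \<mu>a b - lprim \<mu>a a) = ennreal (LBINT x:{a..b}. (v x)\<^sup>2)" .
  moreover have "0 \<le> (LBINT x:{a..b}. (v x)\<^sup>2)"
    unfolding set_lebesgue_integral_def by (rule Bochner_Integration.integral_nonneg) simp
  moreover have "0 \<le> lprim \<mu>a b - lprim \<mu>a a" using emeasure_Ico_lprim(2)[OF finite_\<mu>a ab] by simp
  ultimately show "lprim \<mu>a b - lprim \<mu>a a = (LBINT x:{a..b}. (v x)\<^sup>2)" by simp
qed

lemma radicand_nonneg:
  assumes d: "0 < d"
  shows "(cell_slope d u j)\<^sup>2 \<le> cell_slope d (lprim \<mu>a) j"
proof -
  have ab: "of_int (2 * j) * d \<le> of_int (2 * j + 2) * d" using d by simp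
  have w: "of_int (2 * j + 2) * d - of_int (2 * j) * d = 2 * d" by (simp add: algebra_simps)
  have "(u (of_int (2 * j + 2) * d) - u (of_int (2 * j) * d))\<^sup>2
     \<le> 2 * d * (lprim \<mu>a (of_int (2 * j + 2) * d) - lprim \<mu>a (of_int (2 * j) * d))"
    using set_integral_square_bound[OF primitive_u v2 ab] primitiveD(3)[OF primitive_\<mu>a ab] by (simp only: w)
  then have "(u (of_int (2 * j + 2) * d) - u (of_int (2 * j) * d))\<^sup>2 / (2 * d)\<^sup>2
     \<le> 2 * d * (lprim \<mu>a (of_int (2 * j + 2) * d) - lprim \<mu>a (of_int (2 * j) * d)) / (2 * d)\<^sup>2"
    by (rule divide_right_mono) simp
  moreover have "2 * d * X / (2 * d)\<^sup>2 = X / (2 * d)" for X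
    using d by (simp add: power2_eq_square)
  ultimately show ?thesis unfolding cell_slope_def power_divide by (simp only:)
qed

end

section \<open>Comparing Lagrangian data of two states that agree at the nodes\<close>

lemma tendsto_lprim_at_bot:
  assumes "finite_borel_measure \<mu>"
  shows "(lprim \<mu> \<longlongrightarrow> 0) at_bot"
proof -
  interpret finite_borel_measure \<mu> by fact
  note [simp] = finite_borel_measureD(2,3)[OF assms]
  show ?thesis
  proof (rule tendsto_sandwich[OF _ _ tendsto_const cdf_lim_at_bot]; intro always_eventually allI)
    show "0 \<le> lprim \<mu> x" for x by (simp add: lprim_def)
    show "lprim \<mu> x \<le> cdf \<mu> x" for x unfolding cdf_def lprim_def by (intro finite_measure_mono; auto)
  qed
qed

lemma nodes_at_top: "0 < d \<Longrightarrow> filterlim (\<lambda>n::nat. of_int (2 * int n) * d :: real) at_top sequentially"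
proof -
  assume d: "0 < d"
  have "filterlim (\<lambda>n::nat. (2 * d) * real n) at_top sequentially"
    by (rule filterlim_tendsto_pos_mult_at_top[OF tendsto_const _ filterlim_real_sequentially]) (use d in simp)
  then show ?thesis by (simp add: mult.commute mult.left_commute)
qed

lemma nodes_at_bot: "0 < d \<Longrightarrow> filterlim (\<lambda>n::nat. of_int (2 * (- int n)) * d :: real) at_bot sequentially"
proof -
  assume d: "0 < d"
  have "filterlim (\<lambda>n::nat. - (of_int (2 * int n) * d) :: real) at_bot sequentially"
    by (rule filterlim_uminus_at_bot_at_top[THEN filterlim_compose, OF nodes_at_top[OF d]])
  then show ?thesis by simp
qed

text \<open>By Fubini: each point of \<mu> is counted by the \<open>x\<close> in an interval of
  length \<open>2 * d\<close>.\<close>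

lemma nn_integral_shift_measure:
  assumes \<mu>: "finite_borel_measure \<mu>" and d: "0 < d"
  shows "(\<integral>\<^sup>+x. emeasure \<mu> {x - d..<x + d} \<partial>lborel) = ennreal (2 * d * measure \<mu> UNIV)"
proof -
  interpret finite_measure \<mu> by (rule finite_borel_measureD(1)[OF \<mu>])
  note [simp] = finite_borel_measureD(2,3)[OF \<mu>]
  have [measurable_cong]: "sets \<mu> = sets borel" by simp
  interpret P: pair_sigma_finite lborel \<mu> ..
  let ?k = "\<lambda>x z. (if x - d \<le> z \<and> z < x + d then 1 else 0 :: ennreal)"
  have "(\<integral>\<^sup>+x. emeasure \<mu> {x - d..<x + d} \<partial>lborel) = (\<integral>\<^sup>+x. \<integral>\<^sup>+z. ?k x z \<partial>\<mu> \<partial>lborel)"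
  proof (rule nn_integral_cong)
    fix x
    have "(\<integral>\<^sup>+z. ?k x z \<partial>\<mu>) = (\<integral>\<^sup>+z. indicator {x - d..<x + d} z \<partial>\<mu>)"
      by (intro nn_integral_cong) (auto simp: indicator_def)
    then show "emeasure \<mu> {x - d..<x + d} = (\<integral>\<^sup>+z. ?k x z \<partial>\<mu>)" by simp
  qed
  also have "\<dots> = (\<integral>\<^sup>+z. \<integral>\<^sup>+x. ?k x z \<partial>lborel \<partial>\<mu>)"
    by (rule P.Fubini'[symmetric]) (unfold split_beta', measurable)
  also have "\<dots> = (\<integral>\<^sup>+z. ennreal (2 * d) \<partial>\<mu>)"
  proof (rule nn_integral_cong)
    fix z
    have "(\<integral>\<^sup>+x. ?k x z \<partial>lborel) = (\<integral>\<^sup>+x. indicator {z - d<..z + d} x \<partial>lborel)"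
      by (intro nn_integral_cong) (auto simp: indicator_def)
    also have "\<dots> = ennreal (2 * d)" using d by (simp add: algebra_simps)
    finally show "(\<integral>\<^sup>+x. ?k x z \<partial>lborel) = ennreal (2 * d)" .
  qed
  also have "\<dots> = ennreal (2 * d * measure \<mu> UNIV)"
    using d by (simp add: emeasure_eq_measure ennreal_mult)
  finally show ?thesis .
qed

text \<open>Both primitives are monotone and agree at the ends of the cell of \<open>x\<close>, so
  they differ by at most the mass of that cell, which lies within \<open>2 * d\<close> of
  \<open>x\<close>.\<close>

lemma eulerian_data_lprim_close:
  assumes E: "eulerian_data u v \<mu> \<mu>s K" and E': "eulerian_data u' v' \<mu>' \<mu>s' K'" and d: "0 < d"
    and node: "\<And>j. lprim \<mu>' (of_int (2 * j) * d) = lprim \<mu> (of_int (2 * j) * d)"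
  shows "\<bar>lprim \<mu>' x - lprim \<mu> x\<bar> \<le> measure \<mu> {x - 2 * d..<x + 2 * d}"
proof -
  interpret E: eulerian_data u v \<mu> \<mu>s K by fact
  interpret E': eulerian_data u' v' \<mu>' \<mu>s' K' by fact
  define j where "j = cell_index d x"
  let ?a = "of_int (2 * j) * d" and ?b = "of_int (2 * (j + 1)) * d"
  have ab: "?a < x" "x \<le> ?b" using cell_index_bounds[OF d, of x] by (simp_all add: j_def)
  have w: "?b = ?a + 2 * d" by (simp add: algebra_simps)
  have "lprim \<mu> (x - 2 * d) \<le> lprim \<mu> ?a" "lprim \<mu> ?b \<le> lprim \<mu> (x + 2 * d)"
    using ab w by (auto intro!: E.lprim_mono)
  moreover have "lprim \<mu> ?a \<le> lprim \<mu> x" "lprim \<mu> x \<le> lprim \<mu> ?b"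
    using ab by (auto intro!: E.lprim_mono)
  moreover have "lprim \<mu>' ?a \<le> lprim \<mu>' x" "lprim \<mu>' x \<le> lprim \<mu>' ?b"
    using ab by (auto intro!: E'.lprim_mono)
  moreover have "measure \<mu> {x - 2 * d..<x + 2 * d} = lprim \<mu> (x + 2 * d) - lprim \<mu> (x - 2 * d)"
    by (rule emeasure_Ico_lprim(3)[OF E.fin(1)]) (use d in simp)
  ultimately show ?thesis using node[of j] node[of "j + 1"] by linarith
qed

text \<open>The area between two monotone graphs can be measured in either direction: the distance
  of the two \<open>y\<close> equals that of the two primitives. The latter is at most the mass near
  \<open>x\<close>, and \<open>nn_integral_shift_measure\<close> with \<open>2 * d\<close> produces
  the factor 4.\<close>

lemma eulerian_data_y_L1:
  assumes E: "eulerian_data u v \<mu> \<mu>s K" and E': "eulerian_data u' v' \<mu>' \<mu>s' K'" and d: "0 < d"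
    and node: "\<And>j. lprim \<mu>' (of_int (2 * j) * d) = lprim \<mu> (of_int (2 * j) * d)"
  shows "(\<integral>\<^sup>+\<xi>. ennreal \<bar>eulerian_data.y \<mu>' \<xi> - eulerian_data.y \<mu> \<xi>\<bar> \<partial>lborel) \<le> ennreal (4 * d * measure \<mu> UNIV)"
proof -
  interpret E: eulerian_data u v \<mu> \<mu>s K by fact
  interpret E': eulerian_data u' v' \<mu>' \<mu>s' K' by fact
  let ?k = "\<lambda>\<xi> x. ennreal \<bar>of_bool (E'.y \<xi> < x) - of_bool (E.y \<xi> < x)\<bar>"
  have "(\<integral>\<^sup>+\<xi>. ennreal \<bar>E'.y \<xi> - E.y \<xi>\<bar> \<partial>lborel) = (\<integral>\<^sup>+\<xi>. \<integral>\<^sup>+x. ?k \<xi> x \<partial>lborel \<partial>lborel)"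
    by (simp only: nn_integral_indicator_diff)
  also have "\<dots> = (\<integral>\<^sup>+x. \<integral>\<^sup>+\<xi>. ?k \<xi> x \<partial>lborel \<partial>lborel)"
    by (rule lborel_pair.Fubini'[symmetric]) (unfold of_bool_def split_beta', measurable)
  also have "\<dots> \<le> (\<integral>\<^sup>+x. emeasure \<mu> {x - 2 * d..<x + 2 * d} \<partial>lborel)"
  proof (rule nn_integral_mono)
    fix x
    define a b where "a = x + lprim \<mu>' x" and "b = x + lprim \<mu> x"
    have "(\<integral>\<^sup>+\<xi>. ?k \<xi> x \<partial>lborel) = (\<integral>\<^sup>+\<xi>. ennreal \<bar>of_bool (a < \<xi>) - of_bool (b < \<xi>)\<bar> \<partial>lborel)"
    proof (rule nn_integral_cong_AE)
      show "AE \<xi> in lborel. ?k \<xi> x = ennreal \<bar>of_bool (a < \<xi>) - of_bool (b < \<xi>)\<bar>"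
        using AE_lborel_singleton[of a] AE_lborel_singleton[of b]
      proof eventually_elim
        case (elim \<xi>)
        have "E'.y \<xi> < x \<longleftrightarrow> \<not> a < \<xi>"
          using E'.y_less[of \<xi> x] E'.y_ge[of x \<xi>] elim by (auto simp: a_def)
        moreover have "E.y \<xi> < x \<longleftrightarrow> \<not> b < \<xi>"
          using E.y_less[of \<xi> x] E.y_ge[of x \<xi>] elim by (auto simp: b_def)
        ultimately show ?case by (auto simp: of_bool_def)
      qed
    qed
    also have "\<dots> = ennreal \<bar>lprim \<mu>' x - lprim \<mu> x\<bar>"
      by (simp only: nn_integral_indicator_diff a_def b_def) simp
    also have "\<dots> \<le> ennreal (measure \<mu> {x - 2 * d..<x + 2 * d})"
      by (intro ennreal_leI eulerian_data_lprim_close[OF E E' d node])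
    finally show "(\<integral>\<^sup>+\<xi>. ?k \<xi> x \<partial>lborel) \<le> emeasure \<mu> {x - 2 * d..<x + 2 * d}"
      by (simp add: E.\<mu>.emeasure_eq_measure)
  qed
  also have "\<dots> = ennreal (4 * d * measure \<mu> UNIV)"
    using nn_integral_shift_measure[OF E.fin(1), of "2 * d"] d by simp
  finally show ?thesis .
qed

text \<open>Both values of \<open>y\<close> are trapped between the same two nodes, since the
  functions they invert agree there. The velocities agree at the left node \<open>n0\<close> and
  move away from it by at most the Hoelder bound.\<close>

lemma eulerian_data_close:
  assumes E: "eulerian_data u v \<mu> \<mu>s K" and E': "eulerian_data u' v' \<mu>' \<mu>s' K'" and d: "0 < d"
    and node: "\<And>j. lprim \<mu>' (of_int (2 * j) * d) = lprim \<mu> (of_int (2 * j) * d)"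
    and unode: "\<And>j. u' (of_int (2 * j) * d) = u (of_int (2 * j) * d)"
    and M: "(LBINT x. (v x)\<^sup>2) \<le> M" "(LBINT x. (v' x)\<^sup>2) \<le> M"
  shows "\<bar>eulerian_data.y \<mu>' \<xi> - eulerian_data.y \<mu> \<xi>\<bar> \<le> 4 * d"
    and "\<bar>u' (eulerian_data.y \<mu>' \<xi>) - u (eulerian_data.y \<mu> \<xi>)\<bar> \<le> 2 * sqrt (4 * d * M)"
proof -
  interpret E: eulerian_data u v \<mu> \<mu>s K by fact
  interpret E': eulerian_data u' v' \<mu>' \<mu>s' K' by fact
  define j where "j = cell_index d (E.y \<xi>)"
  define n0 where "n0 = of_int (2 * j) * d"
  \<comment> \<open>\<open>y \<xi>\<close> may equal the right end of its cell, where an atom could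
    spoil the comparison; the node after that lies strictly to the right of it.\<close>
  define n2 where "n2 = of_int (2 * (j + 2)) * d"
  have n2: "n2 = n0 + 4 * d" by (simp add: n0_def n2_def algebra_simps)
  have a: "n0 < E.y \<xi>" "E.y \<xi> \<le> n0 + 2 * d"
    using cell_index_bounds[OF d, of "E.y \<xi>"] by (simp_all add: j_def[symmetric] n0_def algebra_simps)
  have node0: "lprim \<mu>' n0 = lprim \<mu> n0" and node2: "lprim \<mu>' n2 = lprim \<mu> n2" and unode0: "u' n0 = u n0"
    unfolding n0_def n2_def by (rule node unode)+
  have "n0 + lprim \<mu> n0 < \<xi>"
  proof (rule ccontr)
    assume "\<not> ?thesis"
    then have "E.y \<xi> \<le> n0" by (intro E.y_le) simp
    then show False using a by simp
  qed
  then have 1: "n0 \<le> E'.y \<xi>" using E'.y_ge[of n0 \<xi>] node0 by simp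
  have "\<xi> \<le> n2 + lprim \<mu> n2"
  proof (rule ccontr)
    assume "\<not> ?thesis"
    then have "n2 \<le> E.y \<xi>" by (intro E.y_ge) simp
    then show False using a n2 d by linarith
  qed
  then have 2: "E'.y \<xi> \<le> n0 + 4 * d" using E'.y_le[of \<xi> n2] node2 n2 by simp
  show "\<bar>E'.y \<xi> - E.y \<xi>\<bar> \<le> 4 * d" using 1 2 a d by linarith
  have M0: "0 \<le> M" by (rule order_trans[OF Bochner_Integration.integral_nonneg M(1)]) simp
  have "\<bar>u' (E'.y \<xi>) - u' n0\<bar> \<le> sqrt (\<bar>E'.y \<xi> - n0\<bar> * M)"
    by (rule primitive_Hoelder[OF E'.primitive_u E'.v2 M(2)])
  also have "\<dots> \<le> sqrt (4 * d * M)"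
    using 1 2 M0 by (intro real_sqrt_le_mono mult_right_mono) auto
  finally have 3: "\<bar>u' (E'.y \<xi>) - u' n0\<bar> \<le> sqrt (4 * d * M)" .
  have "\<bar>u (E.y \<xi>) - u n0\<bar> \<le> sqrt (\<bar>E.y \<xi> - n0\<bar> * M)"
    by (rule primitive_Hoelder[OF E.primitive_u E.v2 M(1)])
  also have "\<dots> \<le> sqrt (4 * d * M)"
    using a M0 d by (intro real_sqrt_le_mono mult_right_mono) auto
  finally have "\<bar>u (E.y \<xi>) - u n0\<bar> \<le> sqrt (4 * d * M)" .
  then show "\<bar>u' (E'.y \<xi>) - u (E.y \<xi>)\<bar> \<le> 2 * sqrt (4 * d * M)"
    using 3 unode0 by linarith
qed

section \<open>The projected state as Eulerian data\<close>

context eulerian_data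
begin

definition pu :: "(int \<Rightarrow> bool) \<Rightarrow> real \<Rightarrow> real \<Rightarrow> real" where "pu up d = proj_u up d u (lprim \<mu>a)"
definition pF :: "(int \<Rightarrow> bool) \<Rightarrow> real \<Rightarrow> real \<Rightarrow> real" where "pF up d = proj_Fac up d u (lprim \<mu>a)"
definition pv :: "(int \<Rightarrow> bool) \<Rightarrow> real \<Rightarrow> real \<Rightarrow> real" where
  "pv up d x = half_slope up d u (lprim \<mu>a) (\<lceil>x / d\<rceil> - 1)"
definition p\<mu>a :: "(int \<Rightarrow> bool) \<Rightarrow> real \<Rightarrow> real measure" where
  "p\<mu>a up d = density lborel (\<lambda>x. ennreal ((pv up d x)\<^sup>2))"
text \<open>The projection collects the singular mass of each cell, closed on the left and open on
  the right, in a point mass at its left node; the primitive of the result is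
  \<open>proj_Fsing\<close>.\<close>

definition left_node :: "real \<Rightarrow> real \<Rightarrow> real" where "left_node d z = of_int (2 * \<lfloor>z / (2 * d)\<rfloor>) * d"
definition p\<mu>s :: "real \<Rightarrow> real measure" where "p\<mu>s d = distr \<mu>s borel (left_node d)"
definition p\<mu> :: "(int \<Rightarrow> bool) \<Rightarrow> real \<Rightarrow> real measure" where "p\<mu> up d = msum (p\<mu>a up d) (p\<mu>s d)"

lemma primitive_pu: "0 < d \<Longrightarrow> primitive (pu up d) (pv up d)"
  unfolding pu_def pv_def[abs_def]
  by (rule primitive_piecewise_affine) (auto intro!: proj_affine radicand_nonneg)

lemma primitive_pF: "0 < d \<Longrightarrow> primitive (pF up d) (\<lambda>x. (pv up d x)\<^sup>2)"
  unfolding pF_def pv_def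
  by (rule primitive_piecewise_affine[where c = "\<lambda>i. (half_slope up d u (lprim \<mu>a) i)\<^sup>2"]) (auto intro!: proj_affine radicand_nonneg)

lemma pu_node: "0 < d \<Longrightarrow> pu up d (of_int (2 * j) * d) = u (of_int (2 * j) * d)"
  unfolding pu_def by (rule proj_node(1))

lemma pF_node: "0 < d \<Longrightarrow> pF up d (of_int (2 * j) * d) = lprim \<mu>a (of_int (2 * j) * d)"
  unfolding pF_def by (rule proj_node(2)) (auto intro: radicand_nonneg)

lemma pF_mono: "0 < d \<Longrightarrow> a \<le> b \<Longrightarrow> pF up d a \<le> pF up d b"
proof -
  assume d: "0 < d" and ab: "a \<le> b"
  have "0 \<le> (LBINT x:{a..b}. (pv up d x)\<^sup>2)"
    unfolding set_lebesgue_integral_def by (rule Bochner_Integration.integral_nonneg) simp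
  then show ?thesis using primitiveD(3)[OF primitive_pF[OF d] ab, of up] by simp
qed

lemma emeasure_p\<mu>a_Ico:
  assumes d: "0 < d" and ab: "a \<le> b"
  shows "emeasure (p\<mu>a up d) {a..<b} = ennreal (pF up d b - pF up d a)"
proof -
  note [measurable] = primitiveD(2)[OF primitive_pu[OF d, of up]]
  have i: "integrable lborel (\<lambda>x. indicat_real {a..b} x * (pv up d x)\<^sup>2)"
    using primitiveD(4)[OF primitive_pF[OF d, of up], of a b] by (simp add: set_integrable_def)
  have "emeasure (p\<mu>a up d) {a..<b} = (\<integral>\<^sup>+x. ennreal ((pv up d x)\<^sup>2) * indicator {a..<b} x \<partial>lborel)"
    by (simp add: p\<mu>a_def emeasure_density)
  also have "\<dots> = (\<integral>\<^sup>+x. ennreal (indicat_real {a..b} x * (pv up d x)\<^sup>2) \<partial>lborel)"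
  proof (rule nn_integral_cong_AE)
    show "AE x in lborel. ennreal ((pv up d x)\<^sup>2) * indicator {a..<b} x = ennreal (indicat_real {a..b} x * (pv up d x)\<^sup>2)"
      using AE_lborel_singleton[of b] by eventually_elim (auto simp: indicator_def)
  qed
  also have "\<dots> = ennreal (LBINT x:{a..b}. (pv up d x)\<^sup>2)"
    unfolding set_lebesgue_integral_def by (subst nn_integral_eq_integral[OF i]) auto
  finally show ?thesis using primitiveD(3)[OF primitive_pF[OF d] ab, of up] by simp
qed

lemma sets_p\<mu>a [simp, measurable_cong]: "sets (p\<mu>a up d) = sets borel" by (simp add: p\<mu>a_def)

text \<open>The limit at minus infinity is taken along even nodes, where \<open>pF\<close> coincides
  with \<open>lprim \<mu>a\<close> and therefore tends to zero.\<close>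

lemma emeasure_p\<mu>a_lessThan:
  assumes d: "0 < d"
  shows "emeasure (p\<mu>a up d) {..<x} = ennreal (pF up d x)"
proof -
  let ?n = "\<lambda>n::nat. of_int (2 * (- int n)) * d"
  have "(\<lambda>n. emeasure (p\<mu>a up d) {?n n..<x}) \<longlonglongrightarrow> emeasure (p\<mu>a up d) (\<Union>n. {?n n..<x})"
  proof (rule Lim_emeasure_incseq)
    show "incseq (\<lambda>n. {?n n..<x})" using d by (auto simp: incseq_def intro: order_trans[rotated] mult_right_mono)
  qed auto
  moreover have "(\<Union>n. {?n n..<x}) = {..<x}"
  proof -
    have "\<exists>n. ?n n \<le> z" for z
      by (rule eventually_happens'[OF sequentially_bot]) (rule nodes_at_bot[OF d, unfolded filterlim_at_bot, rule_format])
    then show ?thesis by auto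
  qed
  ultimately have 1: "(\<lambda>n. emeasure (p\<mu>a up d) {?n n..<x}) \<longlonglongrightarrow> emeasure (p\<mu>a up d) {..<x}" by simp
  have "\<forall>\<^sub>F n in sequentially. ?n n \<le> x" by (rule nodes_at_bot[OF d, unfolded filterlim_at_bot, rule_format])
  then have 2: "\<forall>\<^sub>F n in sequentially. ennreal (pF up d x - lprim \<mu>a (?n n)) = emeasure (p\<mu>a up d) {?n n..<x}"
    by eventually_elim (simp only: emeasure_p\<mu>a_Ico[OF d] pF_node[OF d])
  have "(\<lambda>n. pF up d x - lprim \<mu>a (?n n)) \<longlonglongrightarrow> pF up d x - 0"
    by (intro tendsto_diff tendsto_const filterlim_compose[OF tendsto_lprim_at_bot[OF finite_\<mu>a] nodes_at_bot[OF d]])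
  then have "(\<lambda>n. ennreal (pF up d x - lprim \<mu>a (?n n))) \<longlonglongrightarrow> ennreal (pF up d x)"
    by (intro tendsto_ennrealI) simp
  then have "(\<lambda>n. emeasure (p\<mu>a up d) {?n n..<x}) \<longlonglongrightarrow> ennreal (pF up d x)"
    by (rule Lim_transform_eventually[OF _ 2])
  with 1 show ?thesis by (rule LIMSEQ_unique)
qed

lemma pF_nonneg:
  assumes d: "0 < d"
  shows "0 \<le> pF up d x"
proof -
  let ?n = "of_int (2 * cell_index d x) * d"
  have "pF up d ?n \<le> pF up d x" using cell_index_bounds[OF d, of x] by (intro pF_mono[OF d]) simp
  moreover have "0 \<le> pF up d ?n" unfolding pF_node[OF d] by (simp add: lprim_def)
  ultimately show ?thesis by simp
qed

lemma finite_p\<mu>a: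
  assumes d: "0 < d"
  shows "finite_borel_measure (p\<mu>a up d)"
proof (rule finite_borel_measureI)
  let ?n = "\<lambda>n::nat. of_int (2 * int n) * d"
  interpret a: finite_measure \<mu>a by (rule finite_borel_measureD(1)[OF finite_\<mu>a])
  have "(\<lambda>n. emeasure (p\<mu>a up d) {..<?n n}) \<longlonglongrightarrow> emeasure (p\<mu>a up d) (\<Union>n. {..<?n n})"
  proof (rule Lim_emeasure_incseq)
    show "incseq (\<lambda>n. {..<?n n})"
      unfolding incseq_def lessThan_subset_iff using d by (auto intro: mult_right_mono)
  qed auto
  moreover have "(\<Union>n. {..<?n n}) = UNIV"
  proof -
    have "\<exists>n. z < ?n n" for z
      by (rule eventually_happens'[OF sequentially_bot]) (rule nodes_at_top[OF d, unfolded filterlim_at_top_dense, rule_format])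
    then show ?thesis by auto
  qed
  ultimately have l: "(\<lambda>n. emeasure (p\<mu>a up d) {..<?n n}) \<longlonglongrightarrow> emeasure (p\<mu>a up d) UNIV" by simp
  have "emeasure (p\<mu>a up d) {..<?n n} \<le> ennreal (measure \<mu>a (space \<mu>a))" for n
    unfolding emeasure_p\<mu>a_lessThan[OF d] pF_node[OF d] lprim_def by (intro ennreal_leI a.bounded_measure)
  then have "emeasure (p\<mu>a up d) UNIV \<le> ennreal (measure \<mu>a (space \<mu>a))"
    by (intro LIMSEQ_le_const2[OF l]) blast
  then show "emeasure (p\<mu>a up d) UNIV < \<infinity>" by (simp add: le_less_trans[OF _ ennreal_less_top])
qed simp

lemma left_node_measurable [measurable]: "left_node d \<in> borel_measurable borel"
  unfolding left_node_def by measurable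

lemma finite_p\<mu>s: "finite_borel_measure (p\<mu>s d)"
  and p\<mu>s_UNIV: "emeasure (p\<mu>s d) UNIV = emeasure \<mu>s UNIV"
proof -
  show e: "emeasure (p\<mu>s d) UNIV = emeasure \<mu>s UNIV"
    by (simp add: p\<mu>s_def emeasure_distr)
  interpret s: finite_measure \<mu>s by (rule finite_borel_measureD(1)[OF fin(2)])
  show "finite_borel_measure (p\<mu>s d)"
    by (rule finite_borel_measureI) (simp add: p\<mu>s_def, simp add: e s.emeasure_eq_measure)
qed

lemma lprim_p\<mu>s:
  assumes d: "0 < d"
  shows "lprim (p\<mu>s d) x = proj_Fsing d (lprim \<mu>s) x"
proof -
  define j where "j = cell_index d x"
  have ab: "of_int (2 * j) * d < x" "x \<le> of_int (2 * j + 2) * d"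
    using cell_index_bounds[OF d, of x] by (simp_all add: j_def)
  have "left_node d z < x \<longleftrightarrow> z < of_int (2 * j + 2) * d" for z
  proof -
    have "left_node d z < x \<longleftrightarrow> \<lfloor>z / (2 * d)\<rfloor> < j + 1"
    proof
      assume "left_node d z < x"
      then have "of_int (2 * \<lfloor>z / (2 * d)\<rfloor>) * d < of_int (2 * j + 2) * d" using ab unfolding left_node_def by linarith
      then have "2 * \<lfloor>z / (2 * d)\<rfloor> < 2 * j + 2" using d by (simp only: mult_less_cancel_right_pos of_int_less_iff)
      then show "\<lfloor>z / (2 * d)\<rfloor> < j + 1" by simp
    next
      assume "\<lfloor>z / (2 * d)\<rfloor> < j + 1"
      then have "2 * \<lfloor>z / (2 * d)\<rfloor> \<le> 2 * j" by simp
      then have "(of_int (2 * \<lfloor>z / (2 * d)\<rfloor>) :: real) \<le> of_int (2 * j)" by (simp only: of_int_le_iff)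
      then have "of_int (2 * \<lfloor>z / (2 * d)\<rfloor>) * d \<le> of_int (2 * j) * d" using d by (intro mult_right_mono) auto
      then show "left_node d z < x" using ab unfolding left_node_def by linarith
    qed
    also have "\<dots> \<longleftrightarrow> z / (2 * d) < of_int (j + 1)" by (simp only: floor_less_iff)
    also have "\<dots> \<longleftrightarrow> z < of_int (2 * j + 2) * d" using d by (simp add: pos_divide_less_eq algebra_simps)
    finally show ?thesis .
  qed
  then have "left_node d -` {..<x} = {..<of_int (2 * j + 2) * d}" by auto
  then show ?thesis
    unfolding lprim_def p\<mu>s_def proj_Fsing_def j_def[symmetric]
    by (subst measure_distr) auto
qed

lemma emeasure_p\<mu>: "A \<in> sets borel \<Longrightarrow> emeasure (p\<mu> up d) A = emeasure (p\<mu>a up d) A + emeasure (p\<mu>s d) A"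
  unfolding p\<mu>_def by (rule emeasure_msum) (auto simp: p\<mu>s_def)

lemma finite_p\<mu>: "0 < d \<Longrightarrow> finite_borel_measure (p\<mu> up d)"
proof (rule finite_borel_measureI)
  assume d: "0 < d"
  show "emeasure (p\<mu> up d) UNIV < \<infinity>"
    using finite_measure.emeasure_finite[OF finite_borel_measureD(1)[OF finite_p\<mu>a[OF d, of up]], of UNIV]
      finite_measure.emeasure_finite[OF finite_borel_measureD(1)[OF finite_p\<mu>s[of d]], of UNIV]
    by (simp add: emeasure_p\<mu> less_top)
qed (simp add: p\<mu>_def)

lemma lprim_p\<mu>:
  assumes d: "0 < d"
  shows "lprim (p\<mu> up d) x = pF up d x + proj_Fsing d (lprim \<mu>s) x"
proof -
  interpret P: finite_measure "p\<mu> up d" by (rule finite_borel_measureD(1)[OF finite_p\<mu>[OF d]])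
  interpret s: finite_measure "p\<mu>s d" by (rule finite_borel_measureD(1)[OF finite_p\<mu>s])
  have s0: "0 \<le> proj_Fsing d (lprim \<mu>s) x" unfolding lprim_p\<mu>s[OF d, symmetric] by (simp add: lprim_def)
  have "ennreal (lprim (p\<mu> up d) x) = ennreal (pF up d x) + ennreal (proj_Fsing d (lprim \<mu>s) x)"
    using emeasure_p\<mu>[of "{..<x}" up d]
    by (simp add: emeasure_p\<mu>a_lessThan[OF d] P.emeasure_eq_measure s.emeasure_eq_measure lprim_def[symmetric] lprim_p\<mu>s[OF d])
  also have "\<dots> = ennreal (pF up d x + proj_Fsing d (lprim \<mu>s) x)"
    using pF_nonneg[OF d] s0 by simp
  finally show ?thesis
    by (subst (asm) ennreal_inj) (use pF_nonneg[OF d, of up x] s0 in \<open>auto simp: lprim_def\<close>)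
qed

lemma lprim_p\<mu>_node:
  assumes d: "0 < d"
  shows "lprim (p\<mu> up d) (of_int (2 * j) * d) = lprim \<mu> (of_int (2 * j) * d)"
proof -
  have "cell_index d (of_int (2 * j) * d) = j - 1" by (rule cell_index_eq[OF d]) (use d in auto)
  then have "proj_Fsing d (lprim \<mu>s) (of_int (2 * j) * d) = lprim \<mu>s (of_int (2 * j) * d)"
    by (simp add: proj_Fsing_def)
  then show ?thesis unfolding lprim_p\<mu>[OF d] pF_node[OF d] lprim_\<mu> by simp
qed

text \<open>Both primitives agree at the even nodes, which tend to infinity.\<close>

lemma p\<mu>_mass:
  assumes d: "0 < d"
  shows "measure (p\<mu> up d) UNIV = measure \<mu> UNIV"
proof (rule LIMSEQ_unique)
  show "(\<lambda>n. lprim (p\<mu> up d) (of_int (2 * int n) * d)) \<longlonglongrightarrow> measure (p\<mu> up d) UNIV"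
    by (rule filterlim_compose[OF tendsto_lprim_at_top[OF finite_p\<mu>[OF d]] nodes_at_top[OF d]])
  show "(\<lambda>n. lprim (p\<mu> up d) (of_int (2 * int n) * d)) \<longlonglongrightarrow> measure \<mu> UNIV"
    unfolding lprim_p\<mu>_node[OF d]
    by (rule filterlim_compose[OF tendsto_lprim_at_top[OF fin(1)] nodes_at_top[OF d]])
qed

lemma square_integral_le_mass: "(LBINT x. (v x)\<^sup>2) \<le> measure \<mu> UNIV"
proof -
  have "ennreal (LBINT x. (v x)\<^sup>2) = emeasure \<mu>a UNIV"
    unfolding \<mu>a_def by (subst emeasure_density) (auto simp: nn_integral_eq_integral[OF v2])
  also have "\<dots> \<le> emeasure \<mu> UNIV" using dec[of UNIV] by (simp add: \<mu>a_def)
  finally show ?thesis by (simp add: \<mu>.emeasure_eq_measure ennreal_le_iff)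
qed

text \<open>The carrier of the new singular part is the set of even nodes, null because it is
  countable.\<close>

lemma projection_data:
  assumes d: "0 < d"
  shows "eulerian_data (pu up d) (pv up d) (p\<mu> up d) (p\<mu>s d) (range (\<lambda>j::int. of_int (2 * j) * d))"
proof (rule eulerian_data.intro)
  note [measurable] = primitiveD(2)[OF primitive_pu[OF d, of up]]
  show "primitive (pu up d) (pv up d)" by (rule primitive_pu[OF d])
  have "(\<integral>\<^sup>+x. ennreal ((pv up d x)\<^sup>2) \<partial>lborel) = emeasure (p\<mu>a up d) UNIV"
    unfolding p\<mu>a_def by (subst emeasure_density) auto
  also have "\<dots> < \<infinity>"
    using finite_measure.emeasure_finite[OF finite_borel_measureD(1)[OF finite_p\<mu>a[OF d, of up]], of UNIV]
    by (simp add: less_top)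
  finally show "integrable lborel (\<lambda>x. (pv up d x)\<^sup>2)" by (intro integrableI_bounded) auto
  show "finite_borel_measure (p\<mu> up d)" "finite_borel_measure (p\<mu>s d)"
    by (rule finite_p\<mu>[OF d], rule finite_p\<mu>s)
  show n: "range (\<lambda>j::int. of_int (2 * j) * d) \<in> null_sets lborel"
    by (rule countable_imp_null_set_lborel) simp
  then have m: "- range (\<lambda>j::int. of_int (2 * j) * d) \<in> sets borel"
    by (intro borel_comp) (auto dest: null_setsD2)
  have e: "left_node d -` (- range (\<lambda>j::int. of_int (2 * j) * d)) = {}" by (auto simp: left_node_def)
  have "emeasure (p\<mu>s d) (- range (\<lambda>j::int. of_int (2 * j) * d))
      = emeasure \<mu>s (left_node d -` (- range (\<lambda>j::int. of_int (2 * j) * d)) \<inter> space \<mu>s)"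
    unfolding p\<mu>s_def by (rule emeasure_distr[OF _ m]) simp
  then show "emeasure (p\<mu>s d) (- range (\<lambda>j::int. of_int (2 * j) * d)) = 0"
    by (simp only: e Int_empty_left emeasure_empty)
  show "emeasure (p\<mu> up d) A = emeasure (density lborel (\<lambda>x. ennreal ((pv up d x)\<^sup>2))) A + emeasure (p\<mu>s d) A"
    if "A \<in> sets borel" for A
    using emeasure_p\<mu>[OF that] by (simp add: p\<mu>a_def)
qed

lemma projection_eq:
  assumes d: "0 < d" and "ac_part \<mu> = \<mu>a" "sing_part \<mu> = \<mu>s"
  shows "projection up d (u, \<mu>, \<nu>) = (pu up d, p\<mu> up d, p\<mu> up d)"
proof -
  have "measure_of_lprim (\<lambda>x. pF up d x + proj_Fsing d (lprim \<mu>s) x) = p\<mu> up d"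
    by (rule measure_of_lprim_eq[OF finite_p\<mu>[OF d]]) (auto simp: lprim_p\<mu>[OF d])
  then show ?thesis using assms by (simp add: projection_def pF_def pu_def Let_def)
qed

end

section \<open>The convergence theorem\<close>

lemma eulerian_set0_data:
  assumes \<chi>: "cutoff_pair \<chi>p \<chi>m" and D: "(u, \<mu>, \<nu>) \<in> eulerian_set0 \<alpha> \<chi>p \<chi>m"
  shows "\<nu> = \<mu>" "\<exists>K. eulerian_data u (wderiv u) \<mu> (sing_part \<mu>) K"
    "ac_part \<mu> = density lborel (\<lambda>x. ennreal ((wderiv u x)\<^sup>2))"
proof -
  show "\<nu> = \<mu>" using D by (auto simp: eulerian_set0_def)
  have E: "(u, \<mu>, \<nu>) \<in> eulerian_set \<alpha> \<chi>p \<chi>m" using D by (auto simp: eulerian_set0_def)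
  then have u: "u \<in> E2_space \<chi>p \<chi>m" and \<mu>: "finite_borel_measure \<mu>"
    and ac: "ac_part \<mu> = density lborel (\<lambda>x. ennreal ((wderiv u x)\<^sup>2))"
    unfolding eulerian_set_def by blast+
  show "ac_part \<mu> = density lborel (\<lambda>x. ennreal ((wderiv u x)\<^sup>2))" by (rule ac)
  obtain f a b g where f: "continuous_on UNIV f" "has_weak_deriv f g" and uf: "u = (\<lambda>x. f x + a * \<chi>p x + b * \<chi>m x)"
    using u unfolding E2_space_def H1_space_def by blast
  have "primitive (\<lambda>x. f x + a * \<chi>p x + b * \<chi>m x) (\<lambda>x. g x + a * deriv \<chi>p x + b * deriv \<chi>m x)"
    by (intro primitive_add primitive_cmult primitive_smooth cutoff_pair_values(1,2)[OF \<chi>]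
        has_weak_deriv_imp_primitive[OF \<chi> f(2,1)])
  then have "primitive u (\<lambda>x. g x + a * deriv \<chi>p x + b * deriv \<chi>m x)" unfolding uf .
  note pu = primitive_wderiv[OF \<chi> this]
  note [measurable] = pu(4)
  obtain A S where AS: "lebesgue_decomposition \<mu> A S" using lebesgue_decomposition_exists[OF \<mu>] by blast
  note eq = lebesgue_decomposition_parts[OF AS]
  note LD = lebesgue_decompositionD[OF AS]
  obtain K where K: "K \<in> null_sets lborel" "emeasure S (- K) = 0" using LD(4) by blast
  have "eulerian_data u (wderiv u) \<mu> (sing_part \<mu>) K"
  proof (rule eulerian_data.intro)
    show "primitive u (wderiv u)" by (rule pu(2))
    \<comment> \<open>Square integrability is read off from the finite mass of the absolutely
      continuous part, whose density it is.\<close>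
    have "(\<integral>\<^sup>+x. ennreal ((wderiv u x)\<^sup>2) \<partial>lborel) = emeasure (ac_part \<mu>) UNIV"
      unfolding ac by (subst emeasure_density) auto
    also have "\<dots> < \<infinity>"
      using finite_measure.emeasure_finite[OF finite_borel_measureD(1)[OF LD(1)], of UNIV]
      by (simp add: eq less_top)
    finally show "integrable lborel (\<lambda>x. (wderiv u x)\<^sup>2)" by (intro integrableI_bounded) auto
    show "emeasure \<mu> B = emeasure (density lborel (\<lambda>x. ennreal ((wderiv u x)\<^sup>2))) B + emeasure (sing_part \<mu>) B"
      if "B \<in> sets borel" for B
      using LD(5)[OF that] by (simp add: eq flip: ac)
  qed (use \<mu> LD K in \<open>simp_all add: eq\<close>)
  then show "\<exists>K. eulerian_data u (wderiv u) \<mu> (sing_part \<mu>) K" by blast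
qed

lemma esssup_diff_le:
  fixes f g :: "real \<Rightarrow> real"
  assumes [measurable]: "f \<in> borel_measurable borel" "g \<in> borel_measurable borel" and "\<And>x. \<bar>f x - g x\<bar> \<le> c"
  shows "esssup lborel (\<lambda>x. ennreal \<bar>f x - g x\<bar>) \<le> ennreal c"
  by (rule esssup_I) (use assms(3) in \<open>auto intro!: AE_I2 ennreal_leI\<close>)

locale eulerian_flow = eulerian_data u v \<mu> \<mu>s K for u v \<mu> \<mu>s K +
  fixes \<alpha> :: real and \<chi>p \<chi>m :: "real \<Rightarrow> real"
  assumes \<alpha>: "0 \<le> \<alpha>" "\<alpha> \<le> 1" and \<chi>: "cutoff_pair \<chi>p \<chi>m"
begin

sublocale L: lagrangian_data \<alpha> y "\<lambda>\<xi>. u (y \<xi>)" "\<lambda>\<xi>. p (y \<xi>)" "\<lambda>\<xi>. q (y \<xi>)" "\<lambda>\<xi>. h (y \<xi>)"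
  by (rule lagrangian_data[OF \<alpha>])

lemma S_eq: "0 \<le> t \<Longrightarrow> S_flow \<alpha> t (L_map (u, \<mu>, \<mu>)) = (L.yt t, L.Ut t, L.Vt t, L.H)"
proof -
  assume t: "0 \<le> t"
  have "H = L.H" by (simp add: H_def[abs_def] L.H_def[abs_def])
  then show ?thesis using L.S_flow_eq[OF \<chi> t] L_map_eq[OF \<chi>] by simp
qed

lemma T_eq: "0 \<le> t \<Longrightarrow> T_flow \<alpha> t (u, \<mu>, \<mu>) = (L.ue t, L.mu t, L.nu t)"
  using L.M_map_eq[OF \<chi>] S_eq by (simp add: T_flow_def)

lemma stab_measure_eq:
  "0 \<le> t \<Longrightarrow> push_density (fst (S_flow \<alpha> t (L_map (u, \<mu>, \<mu>)))) (stab_fun \<alpha> (S_flow \<alpha> t (L_map (u, \<mu>, \<mu>))))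
    = push_density (L.yt t) L.stab"
  using L.push_stab_fun[OF \<chi>] S_eq by simp

lemma wderiv_ue:
  assumes t: "0 \<le> t"
  shows "weakly_differentiable (L.ue t)" "wderiv (L.ue t) \<in> L2_space"
    "AE x in lborel. wderiv (L.ue t) x = L.ue\<^sub>x t x"
proof -
  note w = primitive_wderiv[OF \<chi> L.primitive_ue[OF t]]
  show "weakly_differentiable (L.ue t)" by (rule w(1))
  show ae: "AE x in lborel. wderiv (L.ue t) x = L.ue\<^sub>x t x" by (rule w(3))
  note [measurable] = w(4) L.ue\<^sub>x_measurable[OF t]
  have "integrable lborel (\<lambda>x. (wderiv (L.ue t) x)\<^sup>2) \<longleftrightarrow> integrable lborel (\<lambda>x. (L.ue\<^sub>x t x)\<^sup>2)"
    by (rule integrable_cong_AE) (use ae in auto)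
  then show "wderiv (L.ue t) \<in> L2_space"
    using L.ue\<^sub>x_square(1)[OF t] w(4) by (simp add: L2_space_def)
qed

lemma wderiv_integral:
  assumes t: "0 \<le> t" and "\<phi> \<in> borel_measurable borel"
  shows "(LBINT x. wderiv (L.ue t) x * \<phi> x) = (LBINT x. L.ue\<^sub>x t x * \<phi> x)"
proof (rule integral_cong_AE)
  note [measurable] = primitive_wderiv(4)[OF \<chi> L.primitive_ue[OF t]] L.ue\<^sub>x_measurable[OF t] assms(2)
  show "(\<lambda>x. wderiv (L.ue t) x * \<phi> x) \<in> borel_measurable lborel" "(\<lambda>x. L.ue\<^sub>x t x * \<phi> x) \<in> borel_measurable lborel"
    by measurable
  show "AE x in lborel. wderiv (L.ue t) x * \<phi> x = L.ue\<^sub>x t x * \<phi> x"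
    using wderiv_ue(3)[OF t] by eventually_elim simp
qed

lemma projection_flow:
  "0 < d \<Longrightarrow> eulerian_flow (pu up d) (pv up d) (p\<mu> up d) (p\<mu>s d) (range (\<lambda>j::int. of_int (2 * j) * d)) \<alpha> \<chi>p \<chi>m"
  using projection_data \<alpha> \<chi> by (simp add: eulerian_flow_def eulerian_flow_axioms_def)

abbreviation "proj up d \<equiv> (pu up d, p\<mu> up d, p\<mu> up d)"

text \<open>Stated for every positive null sequence and every choice of signs \<open>up\<close>,
  which may change with the step size: the estimates use only nodal values, masses and the energy
  bound, and these do not depend on the signs.\<close>

lemma projection_convergence:
  fixes dn :: "nat \<Rightarrow> real" and up :: "real \<Rightarrow> int \<Rightarrow> bool" and \<psi> :: "real \<Rightarrow> real"
  assumes d: "\<And>n. 0 < dn n" and d0: "dn \<longlonglongrightarrow> 0" and t: "0 \<le> t"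
  shows "conv_Linf (\<lambda>n. fst (T_flow \<alpha> t (proj (up (dn n)) (dn n)))) (fst (T_flow \<alpha> t (u, \<mu>, \<mu>))) sequentially"
    and "\<phi> \<in> L2_space \<Longrightarrow> (\<lambda>n. \<integral>x. wderiv (fst (T_flow \<alpha> t (proj (up (dn n)) (dn n)))) x * \<phi> x \<partial>lborel)
      \<longlonglongrightarrow> (LBINT x. wderiv (fst (T_flow \<alpha> t (u, \<mu>, \<mu>))) x * \<phi> x)"
    and "conv_L1 (\<lambda>n. lprim (snd (snd (T_flow \<alpha> t (proj (up (dn n)) (dn n)))))) (lprim (snd (snd (T_flow \<alpha> t (u, \<mu>, \<mu>))))) sequentially"
    and "continuous_on UNIV \<psi> \<Longrightarrow> bounded (range \<psi>) \<Longrightarrow>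
      (\<lambda>n. \<integral>x. \<psi> x \<partial>snd (snd (T_flow \<alpha> t (proj (up (dn n)) (dn n))))) \<longlonglongrightarrow> (\<integral>x. \<psi> x \<partial>snd (snd (T_flow \<alpha> t (u, \<mu>, \<mu>))))"
    and "continuous_on UNIV \<psi> \<Longrightarrow> bounded (range \<psi>) \<Longrightarrow>
      (\<lambda>n. \<integral>x. \<psi> x \<partial>push_density (fst (S_flow \<alpha> t (L_map (proj (up (dn n)) (dn n)))))
         (stab_fun \<alpha> (S_flow \<alpha> t (L_map (proj (up (dn n)) (dn n))))))
      \<longlonglongrightarrow> (\<integral>x. \<psi> x \<partial>push_density (fst (S_flow \<alpha> t (L_map (u, \<mu>, \<mu>)))) (stab_fun \<alpha> (S_flow \<alpha> t (L_map (u, \<mu>, \<mu>)))))"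
    and "AE \<xi> in lborel. q (y \<xi>) < 0 \<longrightarrow> L.brk \<xi> \<noteq> t \<Longrightarrow> isCont (lprim (fst (snd (T_flow \<alpha> t (u, \<mu>, \<mu>))))) x \<Longrightarrow>
      (\<lambda>n. lprim (fst (snd (T_flow \<alpha> t (proj (up (dn n)) (dn n))))) x) \<longlonglongrightarrow> lprim (fst (snd (T_flow \<alpha> t (u, \<mu>, \<mu>)))) x"
    and "AE \<xi> in lborel. q (y \<xi>) < 0 \<longrightarrow> L.brk \<xi> \<noteq> t \<Longrightarrow>
      (\<lambda>n. Lim at_top (lprim (fst (snd (T_flow \<alpha> t (proj (up (dn n)) (dn n)))))))
      \<longlonglongrightarrow> Lim at_top (lprim (fst (snd (T_flow \<alpha> t (u, \<mu>, \<mu>)))))"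
proof -
  interpret P: eulerian_flow "pu (up (dn n)) (dn n)" "pv (up (dn n)) (dn n)" "p\<mu> (up (dn n)) (dn n)" "p\<mu>s (dn n)"
    "range (\<lambda>j::int. of_int (2 * j) * dn n)" \<alpha> \<chi>p \<chi>m for n
    by (rule projection_flow[OF d])
  let ?M = "measure \<mu> UNIV"
  \<comment> \<open>The sum of the three error bounds, so that a single sequence serves
    \<open>y_close\<close>, \<open>U_close\<close> and \<open>y_L1\<close>.\<close>
  define \<epsilon> where "\<epsilon> n = 4 * dn n + 2 * sqrt (4 * dn n * ?M) + 4 * dn n * ?M" for n
  have nonneg: "0 \<le> dn n" "0 \<le> sqrt (4 * dn n * ?M)" "0 \<le> 4 * dn n * ?M" for n
    using d[of n] by simp_all
  have M: "(LBINT x. (v x)\<^sup>2) \<le> ?M" "(LBINT x. (pv (up (dn n)) (dn n) x)\<^sup>2) \<le> ?M" for n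
    using square_integral_le_mass P.square_integral_le_mass[of n] p\<mu>_mass[OF d, of "up (dn n)" n] by simp_all
  note E = eulerian_data_axioms and E' = P.eulerian_data_axioms
  note close = eulerian_data_close[OF E E' d lprim_p\<mu>_node[OF d] pu_node[OF d] M]
  interpret C: lagrangian_convergence \<alpha> y "\<lambda>\<xi>. u (y \<xi>)" "\<lambda>\<xi>. p (y \<xi>)" "\<lambda>\<xi>. q (y \<xi>)" "\<lambda>\<xi>. h (y \<xi>)"
    "\<lambda>n. P.y n" "\<lambda>n \<xi>. pu (up (dn n)) (dn n) (P.y n \<xi>)" "\<lambda>n \<xi>. P.p n (P.y n \<xi>)" "\<lambda>n \<xi>. P.q n (P.y n \<xi>)" "\<lambda>n \<xi>. P.h n (P.y n \<xi>)" \<epsilon>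
  proof (rule lagrangian_convergence.intro[OF L.lagrangian_data_axioms], rule lagrangian_convergence_axioms.intro)
    show "lagrangian_data \<alpha> (P.y n) (\<lambda>\<xi>. pu (up (dn n)) (dn n) (P.y n \<xi>)) (\<lambda>\<xi>. P.p n (P.y n \<xi>)) (\<lambda>\<xi>. P.q n (P.y n \<xi>)) (\<lambda>\<xi>. P.h n (P.y n \<xi>))" for n
      by (rule P.lagrangian_data[OF \<alpha>])
    have "(\<lambda>n. 4 * dn n + 2 * sqrt (4 * dn n * ?M) + 4 * dn n * ?M) \<longlonglongrightarrow> 4 * 0 + 2 * sqrt (4 * 0 * ?M) + 4 * 0 * ?M"
      by (intro tendsto_intros d0)
    then show "\<epsilon> \<longlonglongrightarrow> 0" by (simp add: \<epsilon>_def[abs_def])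
    show "\<bar>P.y n \<xi> - y \<xi>\<bar> \<le> \<epsilon> n" for n \<xi>
      using close(1)[of n \<xi>] nonneg[of n] unfolding \<epsilon>_def by linarith
    show "\<bar>pu (up (dn n)) (dn n) (P.y n \<xi>) - u (y \<xi>)\<bar> \<le> \<epsilon> n" for n \<xi>
      using close(2)[of n \<xi>] nonneg[of n] unfolding \<epsilon>_def by linarith
    show "(LBINT \<xi>. P.h n (P.y n \<xi>)) = (LBINT \<xi>. h (y \<xi>))" for n
      unfolding P.integral_h_y integral_h_y by (rule p\<mu>_mass[OF d])
    show "emeasure lborel {\<xi>. P.p n (P.y n \<xi>) = 0} = emeasure lborel {\<xi>. p (y \<xi>) = 0}" for n
      unfolding P.emeasure_p_zero emeasure_p_zero by (rule p\<mu>s_UNIV)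
    show "(\<integral>\<^sup>+\<xi>. ennreal \<bar>P.y n \<xi> - y \<xi>\<bar> \<partial>lborel) \<le> ennreal (\<epsilon> n)" for n
    proof -
      have "(\<integral>\<^sup>+\<xi>. ennreal \<bar>P.y n \<xi> - y \<xi>\<bar> \<partial>lborel) \<le> ennreal (4 * dn n * ?M)"
        by (rule eulerian_data_y_L1[OF E E' d lprim_p\<mu>_node[OF d]])
      also have "\<dots> \<le> ennreal (\<epsilon> n)" using nonneg[of n] unfolding \<epsilon>_def by (intro ennreal_leI) linarith
      finally show ?thesis .
    qed
  qed
  note T = T_eq[OF t] P.T_eq[OF t]
  show "conv_Linf (\<lambda>n. fst (T_flow \<alpha> t (proj (up (dn n)) (dn n)))) (fst (T_flow \<alpha> t (u, \<mu>, \<mu>))) sequentially"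
    unfolding T fst_conv conv_Linf_def
  proof (rule tendsto_sandwich[OF _ _ tendsto_const])
    have "(\<lambda>n. ennreal (C.\<delta>u t n)) \<longlonglongrightarrow> ennreal 0" by (rule tendsto_ennrealI[OF C.\<delta>u_tendsto[OF t]])
    then show "(\<lambda>n. ennreal (C.\<delta>u t n)) \<longlonglongrightarrow> 0" by simp
    show "\<forall>\<^sub>F n in sequentially. esssup lborel (\<lambda>x. ennreal \<bar>P.L.ue n t x - L.ue t x\<bar>) \<le> ennreal (C.\<delta>u t n)"
      by (intro always_eventually allI esssup_diff_le C.ue_close t
          borel_measurable_continuous_onI primitive_continuous[OF P.L.primitive_ue] primitive_continuous[OF L.primitive_ue])
  qed simp
  show "(\<lambda>n. \<integral>x. wderiv (fst (T_flow \<alpha> t (proj (up (dn n)) (dn n)))) x * \<phi> x \<partial>lborel)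
      \<longlonglongrightarrow> (LBINT x. wderiv (fst (T_flow \<alpha> t (u, \<mu>, \<mu>))) x * \<phi> x)" if "\<phi> \<in> L2_space"
  proof -
    have \<phi>: "\<phi> \<in> borel_measurable borel" "integrable lborel (\<lambda>x. (\<phi> x)\<^sup>2)" using that by (auto simp: L2_space_def)
    show ?thesis unfolding T fst_conv wderiv_integral[OF t \<phi>(1)] P.wderiv_integral[OF t \<phi>(1)]
      by (rule C.ue\<^sub>x_weak[OF t \<phi>])
  qed
  show "conv_L1 (\<lambda>n. lprim (snd (snd (T_flow \<alpha> t (proj (up (dn n)) (dn n)))))) (lprim (snd (snd (T_flow \<alpha> t (u, \<mu>, \<mu>))))) sequentially"
    unfolding T snd_conv conv_L1_def by (rule C.nu_L1[OF t])
  show "(\<lambda>n. \<integral>x. \<psi> x \<partial>snd (snd (T_flow \<alpha> t (proj (up (dn n)) (dn n))))) \<longlonglongrightarrow> (\<integral>x. \<psi> x \<partial>snd (snd (T_flow \<alpha> t (u, \<mu>, \<mu>))))"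
    if "continuous_on UNIV \<psi>" "bounded (range \<psi>)"
    unfolding T snd_conv L.nu_def P.L.nu_def
    by (rule C.push_weak[where wn = "\<lambda>n \<xi>. P.h n (P.y n \<xi>)" and w = "\<lambda>\<xi>. h (y \<xi>)", OF t that P.L.h_integrable P.L.h_nonneg L.h_integrable L.h_nonneg C.h_L1])
  show "(\<lambda>n. \<integral>x. \<psi> x \<partial>push_density (fst (S_flow \<alpha> t (L_map (proj (up (dn n)) (dn n)))))
         (stab_fun \<alpha> (S_flow \<alpha> t (L_map (proj (up (dn n)) (dn n))))))
      \<longlonglongrightarrow> (\<integral>x. \<psi> x \<partial>push_density (fst (S_flow \<alpha> t (L_map (u, \<mu>, \<mu>)))) (stab_fun \<alpha> (S_flow \<alpha> t (L_map (u, \<mu>, \<mu>)))))"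
    if "continuous_on UNIV \<psi>" "bounded (range \<psi>)"
    unfolding stab_measure_eq[OF t] P.stab_measure_eq[OF t]
    by (rule C.push_weak[where wn = "\<lambda>n. P.L.stab n" and w = L.stab, OF t that P.L.stab_props(1,2) L.stab_props(1,2) C.stab_L1])
  show "(\<lambda>n. lprim (fst (snd (T_flow \<alpha> t (proj (up (dn n)) (dn n))))) x) \<longlonglongrightarrow> lprim (fst (snd (T_flow \<alpha> t (u, \<mu>, \<mu>)))) x"
    if "AE \<xi> in lborel. q (y \<xi>) < 0 \<longrightarrow> L.brk \<xi> \<noteq> t" "isCont (lprim (fst (snd (T_flow \<alpha> t (u, \<mu>, \<mu>))))) x"
    using C.lprim_mu_tendsto(1)[OF t that(1), of x] that(2) unfolding T snd_conv fst_conv by blast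
  show "(\<lambda>n. Lim at_top (lprim (fst (snd (T_flow \<alpha> t (proj (up (dn n)) (dn n)))))))
      \<longlonglongrightarrow> Lim at_top (lprim (fst (snd (T_flow \<alpha> t (u, \<mu>, \<mu>)))))"
    if "AE \<xi> in lborel. q (y \<xi>) < 0 \<longrightarrow> L.brk \<xi> \<noteq> t"
    using C.lprim_mu_tendsto(2)[OF t that] unfolding T snd_conv fst_conv .
qed

end

text \<open>Reduces the continuous limit in the step size to sequences, to which dominated
  convergence and subsequences apply.\<close>

lemma tendsto_at_right_0_sequentially:
  fixes f :: "real \<Rightarrow> 'a :: topological_space"
  assumes "\<And>dn. (\<And>n. 0 < dn n) \<Longrightarrow> dn \<longlonglongrightarrow> 0 \<Longrightarrow> (\<lambda>n. f (dn n)) \<longlonglongrightarrow> l"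
  shows "(f \<longlongrightarrow> l) (at_right 0)"
  unfolding tendsto_at_iff_sequentially comp_def using assms by auto

theorem theorem4p12:
  fixes \<alpha> :: real
    and \<chi>p \<chi>m :: "real \<Rightarrow> real"
    and u0 :: "real \<Rightarrow> real" and \<mu>0 \<nu>0 :: "real measure"
    and up :: "real \<Rightarrow> int \<Rightarrow> bool"
    and u :: "real \<Rightarrow> real \<Rightarrow> real" and \<mu> \<nu> :: "real \<Rightarrow> real measure"
    and ud :: "real \<Rightarrow> real \<Rightarrow> real \<Rightarrow> real" and \<mu>d \<nu>d :: "real \<Rightarrow> real \<Rightarrow> real measure"
    and F G :: "real \<Rightarrow> real \<Rightarrow> real" and Fd Gd :: "real \<Rightarrow> real \<Rightarrow> real \<Rightarrow> real"
    and X :: "real \<Rightarrow> lagrangian" and Xd :: "real \<Rightarrow> real \<Rightarrow> lagrangian"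
  assumes "0 \<le> \<alpha>" and "\<alpha> \<le> 1"
    and "cutoff_pair \<chi>p \<chi>m"
    and "(u0, \<mu>0, \<nu>0) \<in> eulerian_set0 \<alpha> \<chi>p \<chi>m"
    and "\<And>t. 0 \<le> t \<Longrightarrow> (u t, \<mu> t, \<nu> t) = T_flow \<alpha> t (u0, \<mu>0, \<nu>0)"
    and "\<And>d t. 0 < d \<Longrightarrow> 0 \<le> t \<Longrightarrow>
          (ud d t, \<mu>d d t, \<nu>d d t) = T_flow \<alpha> t (projection (up d) d (u0, \<mu>0, \<nu>0))"
    and "\<And>t x. F t x = measure (\<mu> t) {..<x}"
    and "\<And>t x. G t x = measure (\<nu> t) {..<x}"
    and "\<And>d t x. Fd d t x = measure (\<mu>d d t) {..<x}"
    and "\<And>d t x. Gd d t x = measure (\<nu>d d t) {..<x}"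
    and "\<And>t. 0 \<le> t \<Longrightarrow> X t = S_flow \<alpha> t (L_map (u0, \<mu>0, \<nu>0))"
    and "\<And>d t. 0 < d \<Longrightarrow> 0 \<le> t \<Longrightarrow>
          Xd d t = S_flow \<alpha> t (L_map (projection (up d) d (u0, \<mu>0, \<nu>0)))"
  shows "(\<forall>t \<ge> 0.
            conv_Linf (\<lambda>d. ud d t) (u t) (at_right 0) \<and>
            weakly_differentiable (u t) \<and> (\<forall>d > 0. weakly_differentiable (ud d t)) \<and>
            weak_conv_L2 (\<lambda>d. wderiv (ud d t)) (wderiv (u t)) (at_right 0) \<and>
            conv_L1 (\<lambda>d. Gd d t) (G t) (at_right 0) \<and>
            weak_conv_measure (\<lambda>d. \<nu>d d t) (\<nu> t) (at_right 0) \<and>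
            weak_conv_measure
              (\<lambda>d. push_density (fst (Xd d t)) (stab_fun \<alpha> (Xd d t)))
              (push_density (fst (X t)) (stab_fun \<alpha> (X t))) (at_right 0))
       \<and> (\<exists>dm :: nat \<Rightarrow> real. (\<forall>m. 0 < dm m) \<and> dm \<longlonglongrightarrow> 0 \<and>
            (\<exists>N \<in> null_sets lebesgue. N \<subseteq> {0..} \<and>
              (\<forall>t \<in> {0..} - N.
                 (\<forall>x. isCont (F t) x \<longrightarrow> (\<lambda>m. Fd (dm m) t x) \<longlonglongrightarrow> F t x) \<and>
                 (\<lambda>m. Lim at_top (Fd (dm m) t)) \<longlonglongrightarrow> Lim at_top (F t))))"
proof -
  note \<chi> = assms(3)
  have \<nu>0: "\<nu>0 = \<mu>0" by (rule eulerian_set0_data(1)[OF \<chi> assms(4)])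
  obtain K where K: "eulerian_data u0 (wderiv u0) \<mu>0 (sing_part \<mu>0) K"
    using eulerian_set0_data(2)[OF \<chi> assms(4)] by blast
  interpret E: eulerian_flow u0 "wderiv u0" \<mu>0 "sing_part \<mu>0" K \<alpha> \<chi>p \<chi>m
    using K assms(1,2) \<chi> by (simp add: eulerian_flow_def eulerian_flow_axioms_def)
  have pr: "projection (up d) d (u0, \<mu>0, \<nu>0) = E.proj (up d) d" if "0 < d" for d
    by (rule E.projection_eq[OF that]) (use eulerian_set0_data(3)[OF \<chi> assms(4)] in \<open>simp_all add: E.\<mu>a_def\<close>)
  have T: "u t = fst (T_flow \<alpha> t (u0, \<mu>0, \<mu>0))" "\<mu> t = fst (snd (T_flow \<alpha> t (u0, \<mu>0, \<mu>0)))"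
    "\<nu> t = snd (snd (T_flow \<alpha> t (u0, \<mu>0, \<mu>0)))" if "0 \<le> t" for t
    using assms(5)[OF that] unfolding \<nu>0 by (metis fst_conv snd_conv)+
  have Td: "ud d t = fst (T_flow \<alpha> t (E.proj (up d) d))" "\<mu>d d t = fst (snd (T_flow \<alpha> t (E.proj (up d) d)))"
    "\<nu>d d t = snd (snd (T_flow \<alpha> t (E.proj (up d) d)))" if "0 < d" "0 \<le> t" for d t
    using assms(6)[OF that] unfolding pr[OF that(1)] by (metis fst_conv snd_conv)+
  have FG: "F t = lprim (\<mu> t)" "G t = lprim (\<nu> t)" "Fd d t = lprim (\<mu>d d t)" "Gd d t = lprim (\<nu>d d t)" for d t
    by (auto simp: fun_eq_iff lprim_def assms(7-10))
  have X: "X t = S_flow \<alpha> t (L_map (u0, \<mu>0, \<mu>0))" if "0 \<le> t" for t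
    using assms(11)[OF that] unfolding \<nu>0 .
  have Xd: "Xd d t = S_flow \<alpha> t (L_map (E.proj (up d) d))" if "0 < d" "0 \<le> t" for d t
    using assms(12)[OF that] unfolding pr[OF that(1)] .
  have ev: "\<forall>\<^sub>F d in at_right (0::real). Q d" if "\<And>d. 0 < d \<Longrightarrow> Q d" for Q
    using that by (auto simp: eventually_at_filter)
  show ?thesis
  proof (intro conjI allI impI)
    fix t :: real assume t: "0 \<le> t"
    show "weakly_differentiable (u t)"
      unfolding T[OF t] E.T_eq[OF t] fst_conv by (rule E.wderiv_ue(1)[OF t])
    {
      \<comment> \<open>Regularity for each single step size, which the weak modes of convergence
        demand besides the limits.\<close>
      fix d :: real assume d: "0 < d"
      interpret P: eulerian_flow "E.pu (up d) d" "E.pv (up d) d" "E.p\<mu> (up d) d" "E.p\<mu>s d"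
        "range (\<lambda>j::int. of_int (2 * j) * d)" \<alpha> \<chi>p \<chi>m by (rule E.projection_flow[OF d])
      have "weakly_differentiable (ud d t)" "wderiv (ud d t) \<in> L2_space" "finite_borel_measure (\<nu>d d t)"
        "finite_borel_measure (push_density (fst (Xd d t)) (stab_fun \<alpha> (Xd d t)))"
        unfolding Td[OF d t] P.T_eq[OF t] fst_conv snd_conv Xd[OF d t] P.stab_measure_eq[OF t]
        by (rule P.wderiv_ue[OF t] P.L.finite_nu[OF t] P.L.finite_stab[OF t])+
    } note reg = this
    then show "weakly_differentiable (ud d t)" if "0 < d" for d using that by blast
    show "conv_Linf (\<lambda>d. ud d t) (u t) (at_right 0)"
      unfolding conv_Linf_def
    proof (rule tendsto_at_right_0_sequentially)
      fix dn :: "nat \<Rightarrow> real" assume dn: "\<And>n. 0 < dn n" "dn \<longlonglongrightarrow> 0"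
      show "(\<lambda>n. esssup lborel (\<lambda>x. ennreal \<bar>ud (dn n) t x - u t x\<bar>)) \<longlonglongrightarrow> 0"
        using E.projection_convergence(1)[OF dn t, of up] unfolding conv_Linf_def Td[OF dn(1) t] T[OF t] .
    qed
    show "weak_conv_L2 (\<lambda>d. wderiv (ud d t)) (wderiv (u t)) (at_right 0)"
      unfolding weak_conv_L2_def
    proof (intro conjI ballI)
      show "\<forall>\<^sub>F d in at_right 0. wderiv (ud d t) \<in> L2_space" by (rule ev) (rule reg(2))
      show "wderiv (u t) \<in> L2_space" unfolding T[OF t] E.T_eq[OF t] fst_conv by (rule E.wderiv_ue(2)[OF t])
      fix \<phi> assume \<phi>: "\<phi> \<in> L2_space"
      show "((\<lambda>d. \<integral>x. wderiv (ud d t) x * \<phi> x \<partial>lborel) \<longlongrightarrow> (LBINT x. wderiv (u t) x * \<phi> x)) (at_right 0)"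
      proof (rule tendsto_at_right_0_sequentially)
        fix dn :: "nat \<Rightarrow> real" assume dn: "\<And>n. 0 < dn n" "dn \<longlonglongrightarrow> 0"
        show "(\<lambda>n. \<integral>x. wderiv (ud (dn n) t) x * \<phi> x \<partial>lborel) \<longlonglongrightarrow> (LBINT x. wderiv (u t) x * \<phi> x)"
          unfolding Td[OF dn(1) t] T[OF t] by (rule E.projection_convergence(2)[OF dn t \<phi>])
      qed
    qed
    show "conv_L1 (\<lambda>d. Gd d t) (G t) (at_right 0)"
      unfolding conv_L1_def FG
    proof (rule tendsto_at_right_0_sequentially)
      fix dn :: "nat \<Rightarrow> real" assume dn: "\<And>n. 0 < dn n" "dn \<longlonglongrightarrow> 0"
      show "(\<lambda>n. \<integral>\<^sup>+x. ennreal \<bar>lprim (\<nu>d (dn n) t) x - lprim (\<nu> t) x\<bar> \<partial>lborel) \<longlonglongrightarrow> 0"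
        using E.projection_convergence(3)[OF dn t, of up] unfolding conv_L1_def Td[OF dn(1) t] T[OF t] .
    qed
    show "weak_conv_measure (\<lambda>d. \<nu>d d t) (\<nu> t) (at_right 0)"
      unfolding weak_conv_measure_def
    proof (intro conjI allI impI)
      show "\<forall>\<^sub>F d in at_right 0. finite_borel_measure (\<nu>d d t)" by (rule ev) (rule reg(3))
      show "finite_borel_measure (\<nu> t)" unfolding T[OF t] E.T_eq[OF t] snd_conv by (rule E.L.finite_nu[OF t])
      fix \<psi> :: "real \<Rightarrow> real" assume \<psi>: "continuous_on UNIV \<psi> \<and> bounded (range \<psi>)"
      show "((\<lambda>d. \<integral>x. \<psi> x \<partial>\<nu>d d t) \<longlongrightarrow> (\<integral>x. \<psi> x \<partial>\<nu> t)) (at_right 0)"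
      proof (rule tendsto_at_right_0_sequentially)
        fix dn :: "nat \<Rightarrow> real" assume dn: "\<And>n. 0 < dn n" "dn \<longlonglongrightarrow> 0"
        show "(\<lambda>n. \<integral>x. \<psi> x \<partial>\<nu>d (dn n) t) \<longlonglongrightarrow> (\<integral>x. \<psi> x \<partial>\<nu> t)"
          unfolding Td[OF dn(1) t] T[OF t] by (rule E.projection_convergence(4)[OF dn t]) (use \<psi> in auto)
      qed
    qed
    show "weak_conv_measure (\<lambda>d. push_density (fst (Xd d t)) (stab_fun \<alpha> (Xd d t)))
        (push_density (fst (X t)) (stab_fun \<alpha> (X t))) (at_right 0)"
      unfolding weak_conv_measure_def
    proof (intro conjI allI impI)
      show "\<forall>\<^sub>F d in at_right 0. finite_borel_measure (push_density (fst (Xd d t)) (stab_fun \<alpha> (Xd d t)))"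
        by (rule ev) (rule reg(4))
      show "finite_borel_measure (push_density (fst (X t)) (stab_fun \<alpha> (X t)))"
        unfolding X[OF t] E.stab_measure_eq[OF t] by (rule E.L.finite_stab[OF t])
      fix \<psi> :: "real \<Rightarrow> real" assume \<psi>: "continuous_on UNIV \<psi> \<and> bounded (range \<psi>)"
      show "((\<lambda>d. \<integral>x. \<psi> x \<partial>push_density (fst (Xd d t)) (stab_fun \<alpha> (Xd d t)))
          \<longlongrightarrow> (\<integral>x. \<psi> x \<partial>push_density (fst (X t)) (stab_fun \<alpha> (X t)))) (at_right 0)"
      proof (rule tendsto_at_right_0_sequentially)
        fix dn :: "nat \<Rightarrow> real" assume dn: "\<And>n. 0 < dn n" "dn \<longlonglongrightarrow> 0"
        show "(\<lambda>n. \<integral>x. \<psi> x \<partial>push_density (fst (Xd (dn n) t)) (stab_fun \<alpha> (Xd (dn n) t)))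
          \<longlonglongrightarrow> (\<integral>x. \<psi> x \<partial>push_density (fst (X t)) (stab_fun \<alpha> (X t)))"
          unfolding Xd[OF dn(1) t] X[OF t] by (rule E.projection_convergence(5)[OF dn t]) (use \<psi> in auto)
      qed
    qed
  next
    \<comment> \<open>Any positive null sequence would serve; the exceptional set depends only on
      the limit solution.\<close>
    define dm :: "nat \<Rightarrow> real" where "dm = (\<lambda>m. 1 / real (Suc m))"
    define N where "N = {0..} \<inter> {t. \<not> (AE \<xi> in lborel. E.q (E.y \<xi>) < 0 \<longrightarrow> E.L.brk \<xi> \<noteq> t)}"
    have dm: "\<And>m. 0 < dm m" "dm \<longlonglongrightarrow> 0"
      unfolding dm_def using LIMSEQ_inverse_real_of_nat by (auto simp: inverse_eq_divide)
    have "countable N" unfolding N_def by (rule countable_Int2[OF E.L.countable_breaking_times])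
    then have N: "N \<in> null_sets lebesgue"
      by (intro null_sets_completionI countable_imp_null_set_lborel)
    have "(\<forall>x. isCont (F t) x \<longrightarrow> (\<lambda>m. Fd (dm m) t x) \<longlonglongrightarrow> F t x) \<and>
        (\<lambda>m. Lim at_top (Fd (dm m) t)) \<longlonglongrightarrow> Lim at_top (F t)" if t': "t \<in> {0..} - N" for t
    proof -
      have t: "0 \<le> t" and good: "AE \<xi> in lborel. E.q (E.y \<xi>) < 0 \<longrightarrow> E.L.brk \<xi> \<noteq> t"
        using t' by (auto simp: N_def)
      show ?thesis unfolding FG Td[OF dm(1) t] T[OF t]
        using E.projection_convergence(6,7)[OF dm t good] by blast
    qed
    then show "\<exists>dm :: nat \<Rightarrow> real. (\<forall>m. 0 < dm m) \<and> dm \<longlonglongrightarrow> 0 \<and>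
            (\<exists>N \<in> null_sets lebesgue. N \<subseteq> {0..} \<and>
              (\<forall>t \<in> {0..} - N.
                 (\<forall>x. isCont (F t) x \<longrightarrow> (\<lambda>m. Fd (dm m) t x) \<longlonglongrightarrow> F t x) \<and>
                 (\<lambda>m. Lim at_top (Fd (dm m) t)) \<longlonglongrightarrow> Lim at_top (F t)))"
      using dm N by (intro exI[of _ dm] conjI bexI[of _ N]) (auto simp: N_def)
  qed
qed

end
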